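(* Let $\nu=(\nu_1,\dots,\nu_{m(\nu)})$ be a finite tuple of positive integers with $|\nu|=\nu_1+\dots+\nu_{m(\nu)}$ even, let $x_1,\dots,x_{|\nu|}\in V$ be vertices (not necessarily distinct), and let $F:\mathbb{R}^V\to\mathbb{R}$ be bounded measurable. Let $U=(U(x,y))_{\{x,y\}\in E}$ be a connection on $\mathcal G$ with values in $\mathbb U_{\beta,n}$, and let $\Phi$ be the $E_{\beta,n}$-valued Gaussian free field twisted by $U$. (1) If $\beta\in\{1,2\}$ and $A(k,\sigma(k))$, $1\le k\le|\nu|$, are deterministic $n\times n$ complex matrices, then $$\Big\langle \Big(\prod_{l=1}^{m(\nu)}\operatorname{Tr}\big(\Pi_{\nu,l}(\Phi,A)\big)\Big)F(\operatorname{Tr}(\Phi^2)/2)\Big\rangle^U_{\beta,n}=\int_{\gamma_1,\dots,\gamma_{|\nu|/2}}\Big\langle F\big(\operatorname{Tr}(\Phi^2)/2+L(\gamma_1)+\dots+L(\gamma_{|\nu|/2})\big)\Big\rangle^U_{\beta,n}\,\mu_{\nu,\beta,n,A,U}^{x_1,\dots,x_{|\nu|}}(d\gamma_1,\dots,d\gamma_{|\nu|/2}).$$ (2) If $\beta=4$ and $\widetilde A(k,\sigma(k))$, $1\le k\le|\nu|$, are deterministic $n\times n$ quaternionic matrices, then $$\Big\langle \Big(\prod_{l=1}^{m(\nu)}\operatorname{Re}\big(\operatorname{Tr}\big(\Pi_{\nu,l}(\Phi,\widetilde A)\big)\big)\Big)F(\operatorname{Tr}(\Phi^2)/2)\Big\rangle^U_{4,n}=\int_{\gamma_1,\dots,\gamma_{|\nu|/2}}\Big\langle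 F\big(\operatorname{Tr}(\Phi^2)/2+L(\gamma_1)+\dots+L(\gamma_{|\nu|/2})\big)\Big\rangle^U_{4,n}\,\mu_{\nu,4,n,\widetilde A,U}^{x_1,\dots,x_{|\nu|}}(d\gamma_1,\dots,d\gamma_{|\nu|/2}).$$
   Context: **Network and path measures.** $\mathcal G=(V,E)$ is a finite undirected connected graph without multiple edges or self-loops, with conductances $C(x,y)=C(y,x)>0$ for $\{x,y\}\in E$ and a killing measure $\kappa:V\to[0,\infty)$, not identically zero. $(X_t)$ is the Markov jump process on $V$ jumping from $x$ to a neighbour $y$ at rate $C(x,y)$ and killed at $x$ at rate $\kappa(x)$; $\zeta$ is the killing time; $p_t(x,y)=\mathbb P(X_t=y,t<\zeta\mid X_0=x)$. $\mathbb P_t^{x,y}$ is the bridge law, i.e. the law of $(X_s)_{0\le s\le t}$ started at $x$ and conditioned on $X_t=y$, $t<\zeta$. Set $\mu^{x,y}(d\gamma)=\int_0^\infty \mathbb P_t^{x,y}(d\gamma)\,p_t(x,y)\,dt$, a finite measure on paths from $x$ to $y$ of finite lifetime. For a path $\gamma$ of lifetime $T(\gamma)$, $L(\gamma)\in\mathbb R^V$ is its occupation field, $L(\gamma)(x)=\int_0^{T(\gamma)}\mathbf 1_{\{\gamma(t)=x\}}dt$. For a partition in pairs $\mathbf p=\{\{a_1,b_1\},\dots,\{a_r,b_r\}\}$ of $\{1,\dots,2r\}$, with the convention $a_i<b_i$ (the ordering of the pairs is fixed arbitrarily and is immaterial), $\mu_{\mathbf p}^{x_1,\dots,x_{2r}}(d\gamma_1,\dots,d\gamma_r)=\prod_{i=1}^r\mu^{x_{a_i},x_{b_i}}(d\gamma_i)$.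 **Connection and holonomy.** $n\ge2$ is an integer. $\mathbb U_{\beta,n}$ is $O(n)$ for $\beta=1$, $U(n)$ for $\beta=2$, and the group $U(n,\mathbb H)$ of quaternionic $n\times n$ matrices with $UU^*=I_n$ for $\beta=4$, where ${}^*$ is the (real, complex or quaternionic) adjoint, $(M^* )_{ij}=\overline{M_{ji}}$. A connection is a family $U(x,y)\in\mathbb U_{\beta,n}$, for every oriented edge, with $U(y,x)=U(x,y)^*=U(x,y)^{-1}$. The holonomy along a nearest-neighbour path with successive vertices $y_1,\dots,y_j$ (the discrete skeleton of a continuous-time path) is $\mathsf{hol}^U(\gamma)=U(y_1,y_2)U(y_2,y_3)\cdots U(y_{j-1},y_j)$ ($I_n$ if there is no jump). **Twisted matrix-valued field.** $E_{\beta,n}$ is the real vector space of $n\times n$ real symmetric ($\beta=1$), complex Hermitian ($\beta=2$), quaternionic Hermitian ($\beta=4$) matrices, with real inner product $(M,M')\mapsto\operatorname{Re}(\operatorname{Tr}(MM'))$. $\operatorname{Tr}(M)=\sum_iM_{ii}$, $\operatorname{Re}$ is the real part (of a quaternion if $\beta=4$), ${}^{\mathsf T}$ is the transpose. The field $\Phi:V\to E_{\beta,n}$ under $\langle\cdot\rangle^U_{\beta,n}$ has density proportional to $$\exp\Big(-\tfrac12\sum_{x\in V}\kappa(x)\operatorname{Tr}(M(x)^2)-\tfrac12\sum_{\{x,y\}\in E}C(x,y)\operatorname{Tr}((M(y)-U(y,x)M(x)U(x,y))^2)\Big)$$ with respect to Lebesgue measure on $(E_{\beta,n})^V$; $\langle\cdot\rangle^U_{\beta,n}$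 also denotes expectation. $\operatorname{Tr}(\Phi^2)$ is the field $x\mapsto\operatorname{Tr}(\Phi(x)^2)$. **Ribbon pairings and trails.** Given $\nu$, there are $m(\nu)$ vertices; the $l$-th carries $\nu_l$ ribbon half-edges labelled $\nu_1+\dots+\nu_{l-1}+1,\dots,\nu_1+\dots+\nu_l$ in this (clockwise) cyclic order. Let $\sigma$ be the permutation of $\{1,\dots,|\nu|\}$ sending each label to the next one in the cyclic order around its vertex (so $\sigma(k)=k$ if the vertex has one half-edge). A ribbon pairing $\rho\in\mathcal R_\nu$ is a partition in pairs $\mathbf p_\nu(\rho)$ of $\{1,\dots,|\nu|\}$ together with a choice, for each pair, of "straight" or "twisted". Each half-edge $k$ has two sides $(k,+)$ and $(k,-)$. At vertices, the side $(k,+)$ is joined to $(\sigma(k),-)$ for every $k$. For a straight pair $\{k,k'\}$, $(k,+)$ is glued to $(k',-)$ and $(k,-)$ to $(k',+)$; for a twisted pair, $(k,+)$ is glued to $(k',+)$ and $(k,-)$ to $(k',-)$. The sides form disjoint cycles (boundary cycles), alternating vertex-joins and gluings; $f_\nu(\rho)$ is their number, and $\chi_\nu(\rho)=m(\nu)-|\nu|/2+f_\nu(\rho)$. Traversing a boundary cycle in either direction from any starting point gives a cyclic sequence of labels and symbols: a vertex-join traversed from $(k,+)$ to $(\sigma(k),-)$ is recorded as $k\rightarrow\sigma(k)$; traversed from $(\sigma(k),-)$ to $(k,+)$ it is recorded as $\sigma(k)\leftarrow k$; a gluing traversed from $k$ to $k'$ is recorded as $k\doteq k'$. This sequence, up to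 cyclic permutation and reversal of direction (reversal exchanges $\rightarrow$ and $\leftarrow$), is the trail of the cycle; $\mathcal T_\nu(\rho)$ is the set of the $f_\nu(\rho)$ trails of $\rho$. If $\rho$ has only straight edges, each boundary cycle can be traversed in the direction in which only $\rightarrow$ and $\doteq$ occur; the resulting sequence up to cyclic permutation only is an oriented trail, and $\overrightarrow{\mathcal T}_\nu(\rho)$ is the set of the $f_\nu(\rho)$ oriented trails. The weights are $$w_{\nu,1}(\rho)=2^{-|\nu|/2},\quad w_{\nu,2}(\rho)=\mathbf 1_{\{\rho\text{ has only straight edges}\}},\quad w_{\nu,4}(\rho)=(-2)^{\chi_\nu(\rho)}2^{-2m(\nu)+|\nu|/2}.$$ **Products and measures.** With $s_l=\nu_1+\dots+\nu_l$ ($s_0=0$), $$\Pi_{\nu,l}(\Phi,A)=\Phi(x_{s_{l-1}+1})A(s_{l-1}+1,s_{l-1}+2)\Phi(x_{s_{l-1}+2})\cdots A(s_l-1,s_l)\Phi(x_{s_l})A(s_l,s_{l-1}+1)$$ (equal to $\Phi(x_{s_l})A(s_l,s_l)$ if $\nu_l=1$), and similarly $\Pi_{\nu,l}(\Phi,\widetilde A)$. Fix $\rho$ with $\mathbf p_\nu(\rho)=\{\{a_i,b_i\}\}_i$, $a_i<b_i$, and paths $\gamma_i$ from $x_{a_i}$ to $x_{b_i}$. For a trail $\mathtt t\in\mathcal T_\nu(\rho)$, $\Pi_{\mathtt t}(U,A)(\gamma_1,\dots,\gamma_{|\nu|/2})$ is the product, in the cyclic order of the trail, of the factors: $A(k,k')$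 for each $k\rightarrow k'$; $A(k',k)^{\mathsf T}$ for each $k\leftarrow k'$; $\mathsf{hol}^U(\gamma_i)$ for each $k\doteq k'$ with $k<k'$, $\{k,k'\}=\{a_i,b_i\}$; $\mathsf{hol}^U(\gamma_i)^*$ for each $k\doteq k'$ with $k>k'$, $\{k,k'\}=\{a_i,b_i\}$. For an oriented trail, $\Pi_{\overrightarrow{\mathtt t}}(U,A)$ is defined by the same rules (only $\rightarrow$ and $\doteq$ occur). $\widetilde\Pi_{\mathtt t}(U,\widetilde A)$ is defined by the same rules with $\widetilde A(k,k')$ for $k\rightarrow k'$ and the quaternionic adjoint $\widetilde A(k',k)^*$ for $k\leftarrow k'$. Then $$\mu_{\nu,1,n,A,U}^{x_1,\dots,x_{|\nu|}}=\sum_{\rho\in\mathcal R_\nu}w_{\nu,1}(\rho)\Big(\prod_{\mathtt t\in\mathcal T_\nu(\rho)}\operatorname{Tr}(\Pi_{\mathtt t}(U,A)(\gamma_1,\dots,\gamma_{|\nu|/2}))\Big)\mu_{\mathbf p_\nu(\rho)}^{x_1,\dots,x_{|\nu|}}(d\gamma_1,\dots,d\gamma_{|\nu|/2}),$$ $$\mu_{\nu,2,n,A,U}^{x_1,\dots,x_{|\nu|}}=\sum_{\rho\in\mathcal R_\nu}w_{\nu,2}(\rho)\Big(\prod_{\overrightarrow{\mathtt t}\in\overrightarrow{\mathcal T}_\nu(\rho)}\operatorname{Tr}(\Pi_{\overrightarrow{\mathtt t}}(U,A)(\gamma_1,\dots,\gamma_{|\nu|/2}))\Big)\mu_{\mathbf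 p_\nu(\rho)}^{x_1,\dots,x_{|\nu|}}(d\gamma_1,\dots,d\gamma_{|\nu|/2})$$ (only $\rho$ with all edges straight contribute), and $$\mu_{\nu,4,n,\widetilde A,U}^{x_1,\dots,x_{|\nu|}}=\sum_{\rho\in\mathcal R_\nu}w_{\nu,4}(\rho)\Big(\prod_{\mathtt t\in\mathcal T_\nu(\rho)}\operatorname{Re}(\operatorname{Tr}(\widetilde\Pi_{\mathtt t}(U,\widetilde A)(\gamma_1,\dots,\gamma_{|\nu|/2})))\Big)\mu_{\mathbf p_\nu(\rho)}^{x_1,\dots,x_{|\nu|}}(d\gamma_1,\dots,d\gamma_{|\nu|/2}).$$ On the right-hand sides of the identities, the field and the paths are taken under the product of $\langle\cdot\rangle^U_{\beta,n}$ with the path measure. *)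

theory Defs
  imports "HOL-Probability.Probability"
begin

section \<open>Real, complex and quaternionic scalars\<close>

text \<open>
  The scalar types of the three cases are \<^typ>\<open>real\<close> (\<open>\<beta> = 1\<close>), \<^typ>\<open>complex\<close> (\<open>\<beta> = 2\<close>) and the
  quaternions defined below (\<open>\<beta> = 4\<close>). They are instances of one class, so that adjoints,
  connections, holonomies and the twisted Gaussian field are defined only once.
\<close>

class star_scalar = real_algebra_1 + euclidean_space +
  fixes star :: "'a \<Rightarrow> 'a"
  assumes star_add: "star (a + b) = star a + star b"
    and star_mult: "star (a * b) = star b * star a"
    and star_scaleR: "star (r *\<^sub>R a) = r *\<^sub>R star a"
    and star_star [simp]: "star (star a) = a"
    and inner_star: "inner a b = inner (a * star b) 1"

instantiation real :: star_scalar
begin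
definition star_real :: "real \<Rightarrow> real" where "star_real a = a"
instance by standard (auto simp: star_real_def)
end

instantiation complex :: star_scalar
begin
definition star_complex :: "complex \<Rightarrow> complex" where "star_complex a = cnj a"
instance by standard (auto simp: star_complex_def inner_complex_def)
end

datatype quat = Quat (qre: real) (qi: real) (qj: real) (qk: real)

lemma quat_eq_iff: "a = b \<longleftrightarrow> qre a = qre b \<and> qi a = qi b \<and> qj a = qj b \<and> qk a = qk b"
  by (cases a; cases b) auto

instantiation quat :: real_algebra_1
begin

definition zero_quat :: quat where "0 = Quat 0 0 0 0"
definition one_quat :: quat where "1 = Quat 1 0 0 0"
definition plus_quat :: "quat \<Rightarrow> quat \<Rightarrow> quat" where
  "a + b = Quat (qre a + qre b) (qi a + qi b) (qj a + qj b) (qk a + qk b)"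
definition minus_quat :: "quat \<Rightarrow> quat \<Rightarrow> quat" where
  "a - b = Quat (qre a - qre b) (qi a - qi b) (qj a - qj b) (qk a - qk b)"
definition uminus_quat :: "quat \<Rightarrow> quat" where
  "- a = Quat (- qre a) (- qi a) (- qj a) (- qk a)"
definition scaleR_quat :: "real \<Rightarrow> quat \<Rightarrow> quat" where
  "r *\<^sub>R a = Quat (r * qre a) (r * qi a) (r * qj a) (r * qk a)"
definition times_quat :: "quat \<Rightarrow> quat \<Rightarrow> quat" where
  "a * b = Quat
     (qre a * qre b - qi a * qi b - qj a * qj b - qk a * qk b)
     (qre a * qi b + qi a * qre b + qj a * qk b - qk a * qj b)
     (qre a * qj b - qi a * qk b + qj a * qre b + qk a * qi b)
     (qre a * qk b + qi a * qj b - qj a * qi b + qk a * qre b)"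

instance
  by standard
    (simp_all add: quat_eq_iff zero_quat_def one_quat_def plus_quat_def minus_quat_def
      uminus_quat_def scaleR_quat_def times_quat_def algebra_simps)

end

instantiation quat :: real_inner
begin

definition inner_quat :: "quat \<Rightarrow> quat \<Rightarrow> real" where
  "inner a b = qre a * qre b + qi a * qi b + qj a * qj b + qk a * qk b"
definition "norm (a :: quat) = sqrt (inner a a)"
definition "sgn (a :: quat) = a /\<^sub>R norm a"
definition "dist (a :: quat) b = norm (a - b)"
definition
  "(uniformity :: (quat \<times> quat) filter) = (INF e\<in>{0 <..}. principal {(x, y). dist x y < e})"
definition
  "open (S :: quat set) \<longleftrightarrow> (\<forall>x\<in>S. eventually (\<lambda>(x', y). x' = x \<longrightarrow> y \<in> S) uniformity)"

instance
proof
  fix a b c :: quat and r :: real and S :: "quat set"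
  show "dist a b = norm (a - b)" by (rule dist_quat_def)
  show "sgn a = a /\<^sub>R norm a" by (rule sgn_quat_def)
  show "(uniformity :: (quat \<times> quat) filter) = (INF e\<in>{0 <..}. principal {(x, y). dist x y < e})"
    by (rule uniformity_quat_def)
  show "open S \<longleftrightarrow> (\<forall>x\<in>S. eventually (\<lambda>(x', y). x' = x \<longrightarrow> y \<in> S) uniformity)"
    by (rule open_quat_def)
  show "inner a b = inner b a" by (simp add: inner_quat_def mult.commute)
  show "inner (a + b) c = inner a c + inner b c"
    by (simp add: inner_quat_def plus_quat_def algebra_simps)
  show "inner (r *\<^sub>R a) b = r * inner a b"
    by (simp add: inner_quat_def scaleR_quat_def algebra_simps)
  show "0 \<le> inner a a" by (simp add: inner_quat_def)
  show "inner a a = 0 \<longleftrightarrow> a = 0"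
    by (simp add: inner_quat_def quat_eq_iff zero_quat_def add_nonneg_eq_0_iff)
  show "norm a = sqrt (inner a a)" by (simp add: norm_quat_def)
qed

end

instantiation quat :: euclidean_space
begin

definition Basis_quat :: "quat set" where
  "Basis = {Quat 1 0 0 0, Quat 0 1 0 0, Quat 0 0 1 0, Quat 0 0 0 1}"

instance
proof
  fix u v a :: quat
  show "(Basis :: quat set) \<noteq> {}" "finite (Basis :: quat set)"
    by (simp_all add: Basis_quat_def)
  show "inner u v = (if u = v then 1 else 0)" if "u \<in> Basis" "v \<in> Basis"
    using that unfolding Basis_quat_def by (elim insertE emptyE) (simp_all add: inner_quat_def)
  show "(\<forall>u\<in>Basis. inner a u = 0) \<longleftrightarrow> a = 0"
    by (cases a) (simp add: Basis_quat_def inner_quat_def zero_quat_def)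
qed

end

instantiation quat :: star_scalar
begin

definition star_quat :: "quat \<Rightarrow> quat" where
  "star a = Quat (qre a) (- qi a) (- qj a) (- qk a)"

instance
  by standard
    (auto simp: star_quat_def quat_eq_iff plus_quat_def times_quat_def scaleR_quat_def
      inner_quat_def one_quat_def algebra_simps)

end

definition re :: "'a::star_scalar \<Rightarrow> real" where
  "re a = inner a 1"

lemma re_real [simp]: "re (a::real) = a"
  and re_complex [simp]: "re (z::complex) = Re z"
  and re_quat [simp]: "re (q::quat) = qre q"
  by (simp_all add: re_def inner_complex_def inner_quat_def one_quat_def)


section \<open>Matrices\<close>

definition adj :: "('a::star_scalar)^'n^'n \<Rightarrow> 'a^'n^'n" where
  "adj M = (\<chi> i j. star (M $ j $ i))"

definition cmat :: "real^'n^'n \<Rightarrow> complex^'n^'n" where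
  "cmat M = (\<chi> i j. complex_of_real (M $ i $ j))"

definition mat_prod :: "('a::semiring_1^'n^'n) list \<Rightarrow> 'a^'n^'n" where
  "mat_prod Ms = foldr (**) Ms (mat 1)"

lemma subspace_adj: "subspace {M :: 'a::star_scalar^'n^'n. adj M = M}"
proof -
  have c0: "star (0::'a) = 0"
    using star_scaleR[of 0 "0::'a"] by simp
  show ?thesis
    by (auto simp: subspace_def adj_def vec_eq_iff star_add star_scaleR c0)
qed

lemma star_one [simp]: "star (1::'a::star_scalar) = 1"
  by (metis star_star star_mult mult_1 mult.right_neutral)

text \<open>
  The space \<open>E\<^bsub>\<beta>,n\<^esub>\<close> of Hermitian matrices, as a Euclidean space in its own right with
  inner product \<open>Re (Tr (M M'))\<close>; in particular \<^const>\<open>lborel\<close> on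
  \<open>('a, 'n) herm ^ 'v\<close> is Lebesgue measure on \<open>(E\<^bsub>\<beta>,n\<^esub>)\<^sup>V\<close>.
\<close>

typedef (overloaded) ('a::star_scalar, 'n::finite) herm = "{M :: 'a^'n^'n. adj M = M}"
  morphisms mat_of Herm
  using subspace_0[OF subspace_adj] by blast

setup_lifting type_definition_herm

lemma inner_mat_eq: "adj N = N \<Longrightarrow> inner M N = re (trace (M ** N))"
  for M N :: "'a::star_scalar^'n^'n"
proof -
  assume N: "adj N = N"
  have "star (N $ i $ k) = N $ k $ i" for i k
    using arg_cong[OF N, of "\<lambda>M. M $ k $ i"] by (simp add: adj_def)
  then have "inner (M $ i $ k) (N $ i $ k) = inner (M $ i $ k * N $ k $ i) 1" for i k
    by (subst inner_star) simp
  then show ?thesis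
    by (simp only: inner_vec_def trace_def matrix_matrix_mult_def re_def inner_sum_left
        vec_lambda_beta)
qed

instantiation herm :: (star_scalar, finite) real_vector
begin

lift_definition zero_herm :: "('a, 'b) herm" is 0
  using subspace_0[OF subspace_adj] by auto
lift_definition plus_herm :: "('a, 'b) herm \<Rightarrow> ('a, 'b) herm \<Rightarrow> ('a, 'b) herm" is "(+)"
  using subspace_add[OF subspace_adj] by auto
lift_definition minus_herm :: "('a, 'b) herm \<Rightarrow> ('a, 'b) herm \<Rightarrow> ('a, 'b) herm" is "(-)"
  using subspace_diff[OF subspace_adj] by auto
lift_definition uminus_herm :: "('a, 'b) herm \<Rightarrow> ('a, 'b) herm" is uminus
  using subspace_neg[OF subspace_adj] by auto
lift_definition scaleR_herm :: "real \<Rightarrow> ('a, 'b) herm \<Rightarrow> ('a, 'b) herm" is scaleR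
  using subspace_scale[OF subspace_adj] by auto

instance
proof
  fix a b c :: "('a, 'b) herm" and r s :: real
  show "a + b + c = a + (b + c)" by transfer (simp add: add.assoc)
  show "a + b = b + a" by transfer (simp add: add.commute)
  show "0 + a = a" by transfer simp
  show "- a + a = 0" by transfer simp
  show "a - b = a + - b" by transfer simp
  show "r *\<^sub>R (a + b) = r *\<^sub>R a + r *\<^sub>R b" by transfer (simp add: scaleR_add_right)
  show "(r + s) *\<^sub>R a = r *\<^sub>R a + s *\<^sub>R a" by transfer (simp add: scaleR_add_left)
  show "r *\<^sub>R s *\<^sub>R a = (r * s) *\<^sub>R a" by transfer simp
  show "1 *\<^sub>R a = a" by transfer simp
qed

end

instantiation herm :: (star_scalar, finite) real_inner
begin

definition inner_herm :: "('a, 'b) herm \<Rightarrow> ('a, 'b) herm \<Rightarrow> real" where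
  "inner M M' = re (trace (mat_of M ** mat_of M'))"
definition "norm (M :: ('a, 'b) herm) = sqrt (inner M M)"
definition "sgn (M :: ('a, 'b) herm) = M /\<^sub>R norm M"
definition "dist (M :: ('a, 'b) herm) M' = norm (M - M')"
definition
  "(uniformity :: (('a, 'b) herm \<times> ('a, 'b) herm) filter) = (INF e\<in>{0 <..}. principal {(x, y). dist x y < e})"
definition
  "open (S :: ('a, 'b) herm set) \<longleftrightarrow> (\<forall>x\<in>S. eventually (\<lambda>(x', y). x' = x \<longrightarrow> y \<in> S) uniformity)"

lemma inner_herm_eq: "inner M M' = inner (mat_of M) (mat_of M')"
  for M M' :: "('a::star_scalar, 'b::finite) herm"
  using mat_of[of M'] by (simp add: inner_herm_def inner_mat_eq)

instance
proof
  fix a b c :: "('a, 'b) herm" and r :: real and S :: "('a, 'b) herm set"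
  show "dist a b = norm (a - b)" by (rule dist_herm_def)
  show "sgn a = a /\<^sub>R norm a" by (rule sgn_herm_def)
  show "(uniformity :: (('a, 'b) herm \<times> ('a, 'b) herm) filter)
      = (INF e\<in>{0 <..}. principal {(x, y). dist x y < e})"
    by (rule uniformity_herm_def)
  show "open S \<longleftrightarrow> (\<forall>x\<in>S. eventually (\<lambda>(x', y). x' = x \<longrightarrow> y \<in> S) uniformity)"
    by (rule open_herm_def)
  show "inner a b = inner b a" by (simp add: inner_herm_eq inner_commute)
  show "inner (a + b) c = inner a c + inner b c"
    by (simp add: inner_herm_eq plus_herm.rep_eq inner_add_left)
  show "inner (r *\<^sub>R a) b = r * inner a b" by (simp add: inner_herm_eq scaleR_herm.rep_eq)
  show "0 \<le> inner a a" by (simp add: inner_herm_eq)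
  show "inner a a = 0 \<longleftrightarrow> a = 0" by (simp add: inner_herm_eq zero_herm.rep_eq flip: mat_of_inject)
  show "norm a = sqrt (inner a a)" by (simp add: norm_herm_def)
qed

end

text \<open>
  Any orthonormal basis will do: \<^const>\<open>lborel\<close> does not depend on it.
\<close>

definition is_orthonormal_basis :: "('a::real_inner) set \<Rightarrow> bool" where
  "is_orthonormal_basis B \<longleftrightarrow> B \<noteq> {} \<and> finite B \<and>
     (\<forall>u\<in>B. \<forall>v\<in>B. inner u v = (if u = v then 1 else 0)) \<and>
     (\<forall>x. (\<forall>u\<in>B. inner x u = 0) \<longleftrightarrow> x = 0)"

lemma herm_orthonormal_basis_exists:
  "\<exists>B :: ('a::star_scalar, 'b::finite) herm set. is_orthonormal_basis B"
proof -
  let ?S = "{M :: 'a^'b^'b. adj M = M}"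
  obtain B where B: "B \<subseteq> ?S" "pairwise orthogonal B" "\<And>x. x \<in> B \<Longrightarrow> norm x = 1"
    "independent B" "card B = dim ?S" "span B = ?S"
    using orthonormal_basis_subspace[OF subspace_adj] by blast
  have fin: "finite B"
    using B(4) independent_imp_finite by blast
  have rep: "mat_of (Herm M) = M" if "M \<in> B" for M
    using that B(1) Herm_inverse by blast
  have "mat (1::'a) \<in> ?S"
    using subspace_0[OF subspace_adj[where ?'a = 'a and ?'n = 'b]]
    by (auto simp: adj_def mat_def vec_eq_iff)
  moreover have "mat (1::'a) \<noteq> (0 :: 'a^'b^'b)"
    by (auto simp: mat_def vec_eq_iff)
  ultimately have ne: "B \<noteq> {}"
    using B(6) by auto
  have "inner u v = (if u = v then 1 else 0)" if "u \<in> Herm ` B" "v \<in> Herm ` B" for u v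
  proof -
    have uv: "mat_of u \<in> B" "mat_of v \<in> B"
      using that rep by auto
    show ?thesis
    proof (cases "u = v")
      case True
      then show ?thesis
        using B(3)[OF uv(1)] by (simp add: inner_herm_eq norm_eq_1)
    next
      case False
      then have "mat_of u \<noteq> mat_of v"
        by (simp add: mat_of_inject)
      then show ?thesis
        using pairwiseD[OF B(2) uv] False by (simp add: inner_herm_eq orthogonal_def)
    qed
  qed
  moreover have "(\<forall>u\<in>Herm ` B. inner x u = 0) \<longleftrightarrow> x = 0" for x :: "('a, 'b) herm"
  proof
    assume "\<forall>u\<in>Herm ` B. inner x u = 0"
    then have "\<forall>M\<in>B. orthogonal (mat_of x) M"
      by (simp add: inner_herm_eq rep orthogonal_def)
    moreover have "mat_of x \<in> span B"
      using B(6) mat_of by auto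
    ultimately have "orthogonal (mat_of x) (mat_of x)"
      using orthogonal_to_span by blast
    then show "x = 0"
      by (simp add: orthogonal_def zero_herm.rep_eq flip: mat_of_inject)
  qed simp
  ultimately have "is_orthonormal_basis (Herm ` B)"
    unfolding is_orthonormal_basis_def using fin ne by blast
  then show ?thesis ..
qed

instantiation herm :: (star_scalar, finite) euclidean_space
begin

definition
  "(Basis :: ('a, 'b) herm set) = (SOME B. is_orthonormal_basis B)"

instance
proof -
  have "is_orthonormal_basis (Basis :: ('a, 'b) herm set)"
    unfolding Basis_herm_def by (rule someI_ex[OF herm_orthonormal_basis_exists])
  then show "OFCLASS(('a, 'b) herm, euclidean_space_class)"
    by intro_classes (auto simp: is_orthonormal_basis_def)
qed

end


section \<open>The network and its Markov jump process\<close>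

text \<open>
  The vertex set \<open>V\<close> is the finite type \<open>'v\<close>. The values of \<open>C\<close> matter only on edges.
\<close>

definition network :: "'v::finite set set \<Rightarrow> ('v \<Rightarrow> 'v \<Rightarrow> real) \<Rightarrow> ('v \<Rightarrow> real) \<Rightarrow> bool" where
  "network E C \<kappa> \<longleftrightarrow>
     (\<forall>e\<in>E. card e = 2) \<and>
     (\<forall>x y. (x, y) \<in> {(a, b). {a, b} \<in> E}\<^sup>*) \<and>
     (\<forall>x y. {x, y} \<in> E \<longrightarrow> C x y = C y x \<and> 0 < C x y) \<and>
     (\<forall>x. 0 \<le> \<kappa> x) \<and> (\<exists>x. \<kappa> x \<noteq> 0)"

definition jump_rate :: "'v::finite set set \<Rightarrow> ('v \<Rightarrow> 'v \<Rightarrow> real) \<Rightarrow> 'v \<Rightarrow> 'v \<Rightarrow> real" where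
  "jump_rate E C x y = (if {x, y} \<in> E then C x y else 0)"

definition exit_rate ::
  "'v::finite set set \<Rightarrow> ('v \<Rightarrow> 'v \<Rightarrow> real) \<Rightarrow> ('v \<Rightarrow> real) \<Rightarrow> 'v \<Rightarrow> real" where
  "exit_rate E C \<kappa> x = \<kappa> x + (\<Sum>y\<in>UNIV. jump_rate E C x y)"

text \<open>
  The process is realised by its jump chain and holding times; the state \<^const>\<open>None\<close> stands
  for ``killed''. The randomness \<open>(\<xi>, e)\<close> consists of independent variables: \<open>\<xi> (m, v)\<close> is the
  state entered when the \<open>m\<close>-th jump (counted from 0) takes place from \<open>v\<close>, and \<open>e m\<close> is a
  standard exponential variable which, divided by the exit rate, is the time spent in the
  \<open>m\<close>-th state.
\<close>

definition jump_pmf ::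
  "'v::finite set set \<Rightarrow> ('v \<Rightarrow> 'v \<Rightarrow> real) \<Rightarrow> ('v \<Rightarrow> real) \<Rightarrow> 'v \<Rightarrow> 'v option pmf" where
  "jump_pmf E C \<kappa> v = embed_pmf (\<lambda>z. case z of
       None \<Rightarrow> \<kappa> v / exit_rate E C \<kappa> v
     | Some w \<Rightarrow> jump_rate E C v w / exit_rate E C \<kappa> v)"

type_synonym 'v noise = "(nat \<times> 'v \<Rightarrow> 'v option) \<times> (nat \<Rightarrow> real)"

definition noise ::
  "'v::finite set set \<Rightarrow> ('v \<Rightarrow> 'v \<Rightarrow> real) \<Rightarrow> ('v \<Rightarrow> real) \<Rightarrow> 'v noise measure" where
  "noise E C \<kappa> =
     (\<Pi>\<^sub>M i\<in>UNIV. measure_pmf (jump_pmf E C \<kappa> (snd i))) \<Otimes>\<^sub>M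
     (\<Pi>\<^sub>M m\<in>UNIV. density lborel (\<lambda>t. ennreal (exponential_density 1 t)))"

primrec jump_chain :: "'v \<Rightarrow> 'v noise \<Rightarrow> nat \<Rightarrow> 'v option" where
  "jump_chain x \<omega> 0 = Some x"
| "jump_chain x \<omega> (Suc m) =
     (case jump_chain x \<omega> m of None \<Rightarrow> None | Some v \<Rightarrow> fst \<omega> (m, v))"

definition holding_time ::
  "'v::finite set set \<Rightarrow> ('v \<Rightarrow> 'v \<Rightarrow> real) \<Rightarrow> ('v \<Rightarrow> real) \<Rightarrow> 'v \<Rightarrow> 'v noise \<Rightarrow> nat \<Rightarrow> real" where
  "holding_time E C \<kappa> x \<omega> m =
     (case jump_chain x \<omega> m of None \<Rightarrow> snd \<omega> m | Some v \<Rightarrow> snd \<omega> m / exit_rate E C \<kappa> v)"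

definition jump_time ::
  "'v::finite set set \<Rightarrow> ('v \<Rightarrow> 'v \<Rightarrow> real) \<Rightarrow> ('v \<Rightarrow> real) \<Rightarrow> 'v \<Rightarrow> 'v noise \<Rightarrow> nat \<Rightarrow> real" where
  "jump_time E C \<kappa> x \<omega> m = (\<Sum>i<m. holding_time E C \<kappa> x \<omega> i)"

definition jump_count ::
  "'v::finite set set \<Rightarrow> ('v \<Rightarrow> 'v \<Rightarrow> real) \<Rightarrow> ('v \<Rightarrow> real) \<Rightarrow> 'v \<Rightarrow> real \<Rightarrow> 'v noise \<Rightarrow> nat" where
  "jump_count E C \<kappa> x t \<omega> = (LEAST m. t < jump_time E C \<kappa> x \<omega> (Suc m))"

text \<open>
  The state \<open>X\<^sub>t\<close> of the process started at \<open>x\<close>. As \<^const>\<open>None\<close> is absorbing, the event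
  \<open>X\<^sub>t = y, t < \<zeta>\<close> is \<open>jump_process E C \<kappa> x t \<omega> = Some y\<close>.
\<close>

definition jump_process ::
  "'v::finite set set \<Rightarrow> ('v \<Rightarrow> 'v \<Rightarrow> real) \<Rightarrow> ('v \<Rightarrow> real) \<Rightarrow> 'v \<Rightarrow> real \<Rightarrow> 'v noise \<Rightarrow> 'v option" where
  "jump_process E C \<kappa> x t \<omega> = jump_chain x \<omega> (jump_count E C \<kappa> x t \<omega>)"

definition transition ::
  "'v::finite set set \<Rightarrow> ('v \<Rightarrow> 'v \<Rightarrow> real) \<Rightarrow> ('v \<Rightarrow> real) \<Rightarrow> real \<Rightarrow> 'v \<Rightarrow> 'v \<Rightarrow> real" where
  "transition E C \<kappa> t x y =
     measure (noise E C \<kappa>) {\<omega> \<in> space (noise E C \<kappa>). jump_process E C \<kappa> x t \<omega> = Some y}"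


section \<open>Paths and the path measures\<close>

text \<open>
  A right-continuous path with finitely many jumps and finite lifetime is given by the list of
  its successive vertices together with the times spent there. The \<open>\<sigma>\<close>-algebra is the one
  generated by the length of the list and its entries; on paths with positive holding times
  and distinct consecutive vertices it is the one generated by the lifetime and the
  evaluations \<open>\<gamma>(t)\<close>.
\<close>

type_synonym 'v path = "('v \<times> real) list"

definition path_space :: "'v path measure" where
  "path_space = vimage_algebra UNIV
     (\<lambda>\<gamma>. (length \<gamma>, \<lambda>i. if i < length \<gamma> then \<gamma> ! i else undefined))
     (count_space UNIV \<Otimes>\<^sub>M (\<Pi>\<^sub>M i\<in>UNIV. count_space UNIV \<Otimes>\<^sub>M borel))"

definition lifetime :: "'v path \<Rightarrow> real" where
  "lifetime \<gamma> = sum_list (map snd \<gamma>)"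

fun path_at :: "'v path \<Rightarrow> real \<Rightarrow> 'v" where
  "path_at [] t = undefined"
| "path_at ((y, \<tau>) # \<gamma>) t = (if t < \<tau> \<or> \<gamma> = [] then y else path_at \<gamma> (t - \<tau>))"

definition occupation :: "'v::finite path \<Rightarrow> real^'v" where
  "occupation \<gamma> = (\<chi> x. LINT t:{0..lifetime \<gamma>}|lborel. of_bool (path_at \<gamma> t = x))"

text \<open>
  The path \<open>(X\<^sub>s)\<^bsub>0\<le>s\<le>t\<^esub>\<close>; only used on the event that the process is alive at time \<open>t\<close>.
\<close>

definition path_until ::
  "'v::finite set set \<Rightarrow> ('v \<Rightarrow> 'v \<Rightarrow> real) \<Rightarrow> ('v \<Rightarrow> real) \<Rightarrow> 'v \<Rightarrow> real \<Rightarrow> 'v noise \<Rightarrow> 'v path" where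
  "path_until E C \<kappa> x t \<omega> =
     (let N = jump_count E C \<kappa> x t \<omega> in
       map (\<lambda>i. (the (jump_chain x \<omega> i), holding_time E C \<kappa> x \<omega> i)) [0..<N]
       @ [(the (jump_chain x \<omega> N), t - jump_time E C \<kappa> x \<omega> N)])"

definition bridge ::
  "'v::finite set set \<Rightarrow> ('v \<Rightarrow> 'v \<Rightarrow> real) \<Rightarrow> ('v \<Rightarrow> real) \<Rightarrow> real \<Rightarrow> 'v \<Rightarrow> 'v \<Rightarrow> 'v path measure" where
  "bridge E C \<kappa> t x y =
     distr
       (uniform_measure (noise E C \<kappa>)
         {\<omega> \<in> space (noise E C \<kappa>). jump_process E C \<kappa> x t \<omega> = Some y})
       path_space (path_until E C \<kappa> x t)"

text \<open>
  \<open>\<mu>\<^bsup>x,y\<^esup>\<close>: the mixture of the bridge laws over \<open>t \<in> (0,\<infinity>)\<close> with weight \<open>p\<^sub>t(x,y) dt\<close>.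
\<close>

definition path_measure ::
  "'v::finite set set \<Rightarrow> ('v \<Rightarrow> 'v \<Rightarrow> real) \<Rightarrow> ('v \<Rightarrow> real) \<Rightarrow> 'v \<Rightarrow> 'v \<Rightarrow> 'v path measure" where
  "path_measure E C \<kappa> x y =
     Giry_Monad.bind
       (density (restrict_space lborel {0<..}) (\<lambda>t. ennreal (transition E C \<kappa> t x y)))
       (\<lambda>t. bridge E C \<kappa> t x y)"


section \<open>Connections, holonomy and the twisted Gaussian free field\<close>

definition connection ::
  "'v::finite set set \<Rightarrow> ('v \<Rightarrow> 'v \<Rightarrow> 'a::star_scalar^'n^'n) \<Rightarrow> bool" where
  "connection E U \<longleftrightarrow>
     (\<forall>x y. {x, y} \<in> E \<longrightarrow>
       U x y ** adj (U x y) = mat 1 \<and> adj (U x y) ** U x y = mat 1 \<and> U y x = adj (U x y))"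

definition hol :: "('v \<Rightarrow> 'v \<Rightarrow> 'a::star_scalar^'n^'n) \<Rightarrow> 'v path \<Rightarrow> 'a^'n^'n" where
  "hol U \<gamma> = (let ys = map fst \<gamma> in
     mat_prod (map (\<lambda>i. U (ys ! i) (ys ! Suc i)) [0..<length ys - 1]))"

text \<open>
  The exponent of the density is \<open>- gff_action\<close>. The sum over unordered edges is written as half
  the sum over ordered pairs: the summand is symmetric for a connection \<open>U\<close>. The traces are
  real as the matrices are Hermitian, so \<^const>\<open>re\<close> only changes the type.
\<close>

definition gff_action ::
  "'v::finite set set \<Rightarrow> ('v \<Rightarrow> 'v \<Rightarrow> real) \<Rightarrow> ('v \<Rightarrow> real) \<Rightarrow>
   ('v \<Rightarrow> 'v \<Rightarrow> 'a::star_scalar^'n^'n) \<Rightarrow> ('a, 'n::finite) herm^'v \<Rightarrow> real" where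
  "gff_action E C \<kappa> U \<Phi> =
     1/2 * (\<Sum>x\<in>UNIV. \<kappa> x * re (trace (mat_of (\<Phi> $ x) ** mat_of (\<Phi> $ x))))
   + 1/2 * (1/2 * (\<Sum>(x, y) | {x, y} \<in> E.
       let D = mat_of (\<Phi> $ y) - U y x ** mat_of (\<Phi> $ x) ** U x y
       in C x y * re (trace (D ** D))))"

definition gff ::
  "'v::finite set set \<Rightarrow> ('v \<Rightarrow> 'v \<Rightarrow> real) \<Rightarrow> ('v \<Rightarrow> real) \<Rightarrow>
   ('v \<Rightarrow> 'v \<Rightarrow> 'a::star_scalar^'n^'n) \<Rightarrow> (('a, 'n::finite) herm^'v) measure" where
  "gff E C \<kappa> U = density lborel (\<lambda>\<Phi>. ennreal
     (exp (- gff_action E C \<kappa> U \<Phi>) / (LINT \<Psi>|lborel. exp (- gff_action E C \<kappa> U \<Psi>))))"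

definition half_tr_sq :: "('a::star_scalar, 'n::finite) herm^'v \<Rightarrow> real^'v" where
  "half_tr_sq \<Phi> = (\<chi> x. re (trace (mat_of (\<Phi> $ x) ** mat_of (\<Phi> $ x))) / 2)"


section \<open>Ribbon pairings and trails\<close>

definition psum :: "nat list \<Rightarrow> nat \<Rightarrow> nat" where
  "psum \<nu> l = sum_list (take l \<nu>)"

text \<open>
  The permutation \<open>\<sigma>\<close>: the last half-edge \<open>s\<^sub>l\<close> of the \<open>l\<close>-th vertex is followed by the first one,
  \<open>s\<^bsub>l-1\<^esub> + 1\<close>.
\<close>

definition next_label :: "nat list \<Rightarrow> nat \<Rightarrow> nat" where
  "next_label \<nu> k =
     (if \<exists>l\<in>{1..length \<nu>}. k = psum \<nu> l
      then psum \<nu> ((THE l. l \<in> {1..length \<nu>} \<and> k = psum \<nu> l) - 1) + 1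
      else k + 1)"

text \<open>
  A ribbon pairing is a pair \<open>(p, tw)\<close> of a partition \<open>p\<close> in pairs and the set \<open>tw \<subseteq> p\<close> of its
  twisted pairs.
\<close>

type_synonym ribbon = "nat set set \<times> nat set set"

definition pair_partitions :: "nat \<Rightarrow> nat set set set" where
  "pair_partitions N = {p. partition_on {1..N} p \<and> (\<forall>e\<in>p. card e = 2)}"

definition ribbon_pairings :: "nat list \<Rightarrow> ribbon set" where
  "ribbon_pairings \<nu> = {(p, tw). p \<in> pair_partitions (sum_list \<nu>) \<and> tw \<subseteq> p}"

text \<open>
  The side \<open>(k,+)\<close> is \<open>(k, True)\<close>, and \<open>(k,-)\<close> is \<open>(k, False)\<close>.
\<close>

type_synonym side = "nat \<times> bool"

definition joined :: "nat list \<Rightarrow> side \<Rightarrow> side \<Rightarrow> bool" where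
  "joined \<nu> s s' \<longleftrightarrow>
     (\<exists>k\<in>{1..sum_list \<nu>}. {s, s'} = {(k, True), (next_label \<nu> k, False)})"

definition glued :: "ribbon \<Rightarrow> side \<Rightarrow> side \<Rightarrow> bool" where
  "glued \<rho> s s' \<longleftrightarrow>
     fst s \<noteq> fst s' \<and> {fst s, fst s'} \<in> fst \<rho> \<and>
     (if {fst s, fst s'} \<in> snd \<rho> then snd s' = snd s else snd s' \<noteq> snd s)"

text \<open>
  One full turn around a boundary cycle, as the list of sides met, starting with a vertex-join
  (so that the steps from even positions are joins and those from odd positions are gluings).
\<close>

definition traversal :: "nat list \<Rightarrow> ribbon \<Rightarrow> side list \<Rightarrow> bool" where
  "traversal \<nu> \<rho> ss \<longleftrightarrow>
     ss \<noteq> [] \<and> even (length ss) \<and> distinct ss \<and>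
     (\<forall>i<length ss.
        let s = ss ! i; s' = ss ! (Suc i mod length ss)
        in if even i then joined \<nu> s s' else glued \<rho> s s')"

definition boundary_cycles :: "nat list \<Rightarrow> ribbon \<Rightarrow> side set set" where
  "boundary_cycles \<nu> \<rho> = {set ss | ss. traversal \<nu> \<rho> ss}"

definition euler_char :: "nat list \<Rightarrow> ribbon \<Rightarrow> int" where
  "euler_char \<nu> \<rho> =
     int (length \<nu>) - int (sum_list \<nu> div 2) + int (card (boundary_cycles \<nu> \<rho>))"

text \<open>
  \<open>Fwd k k'\<close> is \<open>k \<rightarrow> k'\<close>, \<open>Bwd k k'\<close> is \<open>k \<leftarrow> k'\<close> and \<open>Glue k k'\<close> is \<open>k \<doteq> k'\<close>.
\<close>

datatype trail_step = Fwd nat nat | Bwd nat nat | Glue nat nat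

primrec flip_step :: "trail_step \<Rightarrow> trail_step" where
  "flip_step (Fwd k k') = Bwd k' k"
| "flip_step (Bwd k k') = Fwd k' k"
| "flip_step (Glue k k') = Glue k' k"

definition trail_word :: "side list \<Rightarrow> trail_step list" where
  "trail_word ss = map (\<lambda>i.
     let s = ss ! i; s' = ss ! (Suc i mod length ss)
     in if odd i then Glue (fst s) (fst s')
        else if snd s then Fwd (fst s) (fst s')
        else Bwd (fst s) (fst s')) [0..<length ss]"

definition cyclic_class :: "trail_step list \<Rightarrow> trail_step list set" where
  "cyclic_class w = {rotate i w | i. True}"

definition trails :: "nat list \<Rightarrow> ribbon \<Rightarrow> trail_step list set set" where
  "trails \<nu> \<rho> =
     {cyclic_class w \<union> cyclic_class (rev (map flip_step w)) | w.
        \<exists>ss. traversal \<nu> \<rho> ss \<and> w = trail_word ss}"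

definition oriented_trails :: "nat list \<Rightarrow> ribbon \<Rightarrow> trail_step list set set" where
  "oriented_trails \<nu> \<rho> =
     {cyclic_class w | w.
        (\<exists>ss. traversal \<nu> \<rho> ss \<and> w = trail_word ss) \<and> (\<forall>k k'. Bwd k k' \<notin> set w)}"

definition weight1 :: "nat list \<Rightarrow> ribbon \<Rightarrow> real" where
  "weight1 \<nu> \<rho> = 1 / 2 ^ (sum_list \<nu> div 2)"

definition weight2 :: "nat list \<Rightarrow> ribbon \<Rightarrow> real" where
  "weight2 \<nu> \<rho> = (if snd \<rho> = {} then 1 else 0)"

definition weight4 :: "nat list \<Rightarrow> ribbon \<Rightarrow> real" where
  "weight4 \<nu> \<rho> =
     (-2) powi euler_char \<nu> \<rho> * 2 powi (- 2 * int (length \<nu>) + int (sum_list \<nu> div 2))"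


section \<open>Products along vertices and trails\<close>

text \<open>
  \<open>\<Pi>\<^bsub>\<nu>,l\<^esub>(\<Phi>,A)\<close>, for \<open>1 \<le> l \<le> length \<nu>\<close>; the points \<open>x\<^sub>k\<close> are \<open>xs k\<close>.
\<close>

definition vertex_product ::
  "nat list \<Rightarrow> (nat \<Rightarrow> 'v) \<Rightarrow> ('v \<Rightarrow> 'b::semiring_1^'n^'n) \<Rightarrow>
   (nat \<Rightarrow> nat \<Rightarrow> 'b^'n^'n) \<Rightarrow> nat \<Rightarrow> 'b^'n^'n" where
  "vertex_product \<nu> xs \<Phi> A l =
     mat_prod (map (\<lambda>k. \<Phi> (xs k) ** A k (next_label \<nu> k)) [psum \<nu> (l - 1) + 1..<psum \<nu> l + 1])"

text \<open>
  The arbitrary fixed ordering of the pairs; paths are indexed by \<open>0, \<dots>, r - 1\<close> accordingly.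
\<close>

definition pair_list :: "nat set set \<Rightarrow> nat set list" where
  "pair_list p = (SOME es. distinct es \<and> set es = p)"

definition pair_index :: "nat set set \<Rightarrow> nat set \<Rightarrow> nat" where
  "pair_index p e = (THE i. i < length (pair_list p) \<and> pair_list p ! i = e)"

definition pairing_measure ::
  "'v::finite set set \<Rightarrow> ('v \<Rightarrow> 'v \<Rightarrow> real) \<Rightarrow> ('v \<Rightarrow> real) \<Rightarrow> (nat \<Rightarrow> 'v) \<Rightarrow>
   nat set set \<Rightarrow> (nat \<Rightarrow> 'v path) measure" where
  "pairing_measure E C \<kappa> xs p =
     (\<Pi>\<^sub>M i\<in>{..<card p}.
        path_measure E C \<kappa> (xs (Min (pair_list p ! i))) (xs (Max (pair_list p ! i))))"

text \<open>
  The product along a trail \<open>t\<close>, computed from any of its words \<open>w\<close>; only its trace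
  (\<open>\<beta> = 1, 2\<close>) or the real part of its trace (\<open>\<beta> = 4\<close>) is used, which does not depend on \<open>w\<close>.
  The argument \<open>tr\<close> is the transpose (\<open>\<beta> = 1\<close>) or the quaternionic adjoint (\<open>\<beta> = 4\<close>), and \<open>h\<close> is
  the holonomy.
\<close>

primrec step_factor ::
  "('b::star_scalar^'n^'n \<Rightarrow> 'b^'n^'n) \<Rightarrow> ('v path \<Rightarrow> 'b^'n^'n) \<Rightarrow>
   (nat \<Rightarrow> nat \<Rightarrow> 'b^'n^'n) \<Rightarrow> nat set set \<Rightarrow> (nat \<Rightarrow> 'v path) \<Rightarrow> trail_step \<Rightarrow> 'b^'n^'n" where
  "step_factor tr h A p \<gamma> (Fwd k k') = A k k'"
| "step_factor tr h A p \<gamma> (Bwd k k') = tr (A k' k)"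
| "step_factor tr h A p \<gamma> (Glue k k') =
     (let H = h (\<gamma> (pair_index p {k, k'})) in if k < k' then H else adj H)"

definition trail_product ::
  "('b::star_scalar^'n^'n \<Rightarrow> 'b^'n^'n) \<Rightarrow> ('v path \<Rightarrow> 'b^'n^'n) \<Rightarrow>
   (nat \<Rightarrow> nat \<Rightarrow> 'b^'n^'n) \<Rightarrow> nat set set \<Rightarrow> (nat \<Rightarrow> 'v path) \<Rightarrow>
   trail_step list set \<Rightarrow> 'b^'n^'n" where
  "trail_product tr h A p \<gamma> t =
     mat_prod (map (step_factor tr h A p \<gamma>) (SOME w. w \<in> t))"

text \<open>
  The integrals of \<open>f\<close>, a function of the \<open>|\<nu>|/2\<close> paths, against the complex measures
  \<open>\<mu>\<^bsub>\<nu>,1,n,A,U\<^esub>\<close> and \<open>\<mu>\<^bsub>\<nu>,2,n,A,U\<^esub>\<close> and the signed measure \<open>\<mu>\<^bsub>\<nu>,4,n,A,U\<^esub>\<close>. These measures are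
  linear combinations of finite measures with bounded densities.
\<close>

definition ribbon_integral1 ::
  "'v::finite set set \<Rightarrow> ('v \<Rightarrow> 'v \<Rightarrow> real) \<Rightarrow> ('v \<Rightarrow> real) \<Rightarrow> nat list \<Rightarrow> (nat \<Rightarrow> 'v) \<Rightarrow>
   (nat \<Rightarrow> nat \<Rightarrow> complex^'n^'n) \<Rightarrow> ('v \<Rightarrow> 'v \<Rightarrow> real^'n^'n) \<Rightarrow>
   ((nat \<Rightarrow> 'v path) \<Rightarrow> real) \<Rightarrow> complex" where
  "ribbon_integral1 E C \<kappa> \<nu> xs A U f =
     (\<Sum>\<rho>\<in>ribbon_pairings \<nu>. complex_of_real (weight1 \<nu> \<rho>) *
        (LINT \<gamma>|pairing_measure E C \<kappa> xs (fst \<rho>).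
           complex_of_real (f \<gamma>) *
           (\<Prod>t\<in>trails \<nu> \<rho>.
              trace (trail_product transpose (\<lambda>g. cmat (hol U g)) A (fst \<rho>) \<gamma> t))))"

definition ribbon_integral2 ::
  "'v::finite set set \<Rightarrow> ('v \<Rightarrow> 'v \<Rightarrow> real) \<Rightarrow> ('v \<Rightarrow> real) \<Rightarrow> nat list \<Rightarrow> (nat \<Rightarrow> 'v) \<Rightarrow>
   (nat \<Rightarrow> nat \<Rightarrow> complex^'n^'n) \<Rightarrow> ('v \<Rightarrow> 'v \<Rightarrow> complex^'n^'n) \<Rightarrow>
   ((nat \<Rightarrow> 'v path) \<Rightarrow> real) \<Rightarrow> complex" where
  "ribbon_integral2 E C \<kappa> \<nu> xs A U f =
     (\<Sum>\<rho>\<in>ribbon_pairings \<nu>. complex_of_real (weight2 \<nu> \<rho>) *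
        (LINT \<gamma>|pairing_measure E C \<kappa> xs (fst \<rho>).
           complex_of_real (f \<gamma>) *
           (\<Prod>t\<in>oriented_trails \<nu> \<rho>.
              trace (trail_product transpose (hol U) A (fst \<rho>) \<gamma> t))))"

definition ribbon_integral4 ::
  "'v::finite set set \<Rightarrow> ('v \<Rightarrow> 'v \<Rightarrow> real) \<Rightarrow> ('v \<Rightarrow> real) \<Rightarrow> nat list \<Rightarrow> (nat \<Rightarrow> 'v) \<Rightarrow>
   (nat \<Rightarrow> nat \<Rightarrow> quat^'n^'n) \<Rightarrow> ('v \<Rightarrow> 'v \<Rightarrow> quat^'n^'n) \<Rightarrow>
   ((nat \<Rightarrow> 'v path) \<Rightarrow> real) \<Rightarrow> real" where
  "ribbon_integral4 E C \<kappa> \<nu> xs A U f =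
     (\<Sum>\<rho>\<in>ribbon_pairings \<nu>. weight4 \<nu> \<rho> *
        (LINT \<gamma>|pairing_measure E C \<kappa> xs (fst \<rho>).
           f \<gamma> *
           (\<Prod>t\<in>trails \<nu> \<rho>.
              qre (trace (trail_product adj (hol U) A (fst \<rho>) \<gamma> t)))))"

end

theory Submission
  imports Defs
begin

text \<open>
  Bounded measurable functionals of a nonnegative field are determined by their behaviour on
  \<open>u \<mapsto> exp (- V \<bullet> u)\<close>. For such a functional the weight changes the Gaussian form into the one with
  killing measure \<open>\<kappa> + V\<close>, and Wick's formula leaves pairings of twisted Green functions, which by
  the Feynman--Kac formula are integrals of holonomies against the path measures.

  It remains to contract the matrices for fixed paths. Ribbons are glued one at a time: averaging
  over a Gaussian Hermitian matrix replaces two untwisted loops at a pair of half-edges by the sum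
  of the straight and the twisted ribbon, whatever the current boundary pattern is. The value of a
  pattern is the product over its boundary cycles of \<open>Tr\<close> (\<open>\<beta> = 1, 2\<close>) or \<open>- 2 Re Tr\<close> (\<open>\<beta> = 4\<close>); the
  factors \<open>- 2\<close> make the quaternionic contraction have the same shape, with weight \<open>- 1\<close>, and
  produce the Euler characteristic in the weight.
\<close>

section \<open>Gluing values\<close>

text \<open>The value of a gluing pattern is defined by eliminating one gluing at a time, not as a
  product over cycles. This makes a contraction local: once all other gluings have been performed,
  the two loops to be contracted see only four sides, and these can be joined in just three ways.
  The price is that the elimination must not depend on the order of the gluings, which is the
  combinatorial core. Partial elimination replaces joins by words in holonomies and vertex matrices,
  so the induction has to allow arbitrary labels. They are taken in a semigroup with an
  anti-involution and an invariant trace, without a unit. The absence of a unit makes room for the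
  unitary case, where a matrix must not meet a reversed one: once each label records its direction
  of reading, a twisted ribbon is an absorbing element of trace 0, and the three cases share one
  argument. Holonomies act on field values by conjugation, so contracting two of them produces
  \<open>h e (adj h)\<close> instead of \<open>e\<close>; this is how a path enters a boundary
  word.\<close>

locale gluing =
 fixes mul :: "'m => 'm => 'm" (infixl "\<odot>" 70)
  and st :: "'m => 'm"
  and z :: "'m => 'c::comm_ring_1"
 assumes mul_assoc: "(a \<odot> b) \<odot> c = a \<odot> (b \<odot> c)"
  and st_mul: "st (a \<odot> b) = st b \<odot> st a"
  and st_st [simp]: "st (st a) = a"
  and z_comm: "z (a \<odot> b) = z (b \<odot> a)"
  and z_st [simp]: "z (st a) = z a"
begin

text \<open>\<open>B s\<close> is the word read along the join from \<open>s\<close> to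
  \<open>J s\<close>, and \<open>H\<close> the word read across the gluing from \<open>a\<close> to
  \<open>b\<close>. A gluing across an existing join closes a cycle and contributes its trace; any
  other gluing replaces two joins by a single one from \<open>J a\<close> to \<open>J b\<close>,
  running through \<open>a\<close> and \<open>b\<close>. At eliminated sides \<open>J\<close> and
  \<open>B\<close> keep stale values.\<close>

fun gluing_value :: "('s \<times> 's \<times> 'm) list => ('s => 's) => ('s => 'm) => 'c" where
 "gluing_value [] J B = 1"
| "gluing_value ((a, b, H) # gs) J B =
  (if J a = b then z (H \<odot> B b) * gluing_value gs J B
   else gluing_value gs (J(J a := J b, J b := J a))
      (B(J a := B (J a) \<odot> H \<odot> B b, J b := B (J b) \<odot> st H \<odot> B a)))"

definition joining :: "'s set => ('s => 's) => ('s => 'm) => bool" where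
 "joining S J B \<longleftrightarrow> (\<forall>s\<in>S. J s \<in> S \<and> J s ~= s \<and> J (J s) = s \<and> B (J s) = st (B s))"

fun glue_sides :: "('s \<times> 's \<times> 'm) list => 's list" where
 "glue_sides [] = []"
| "glue_sides ((a, b, H) # gs) = a # b # glue_sides gs"

lemma glue_sides_append [simp]: "glue_sides (xs @ ys) = glue_sides xs @ glue_sides ys"
 by (induction xs rule: glue_sides.induct) auto

definition glues :: "'s set => ('s \<times> 's \<times> 'm) list => bool" where
 "glues S gs \<longleftrightarrow> distinct (glue_sides gs) \<and> set (glue_sides gs) = S"

lemma glues_Cons: "glues S ((a, b, H) # gs) \<longleftrightarrow> a \<in> S \<and> b \<in> S \<and> a ~= b \<and> glues (S - {a, b}) gs"
 by (auto simp: glues_def)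

lemma joining_remove: "joining S J B ==> J a = b ==> a \<in> S ==> joining (S - {a, b}) J B"
 unfolding joining_def by (metis Diff_iff insert_iff empty_iff)

lemma joining_reconnect:
 assumes "joining S J B" "J a ~= b" "a \<in> S" "b \<in> S" "a ~= b"
 shows "joining (S - {a, b}) (J(J a := J b, J b := J a))
     (B(J a := B (J a) \<odot> H \<odot> B b, J b := B (J b) \<odot> st H \<odot> B a))"
proof -
 have J: "\<And>s. s \<in> S ==> J s \<in> S \<and> J s ~= s \<and> J (J s) = s \<and> B (J s) = st (B s)"
  using assms(1) by (auto simp: joining_def)
 have ne: "J a ~= J b"
  using J assms by metis
 have b: "J b ~= a" using J assms by metis
 show ?thesis
  unfolding joining_def
 proof
  fix s assume s: "s \<in> S - {a, b}"
  consider "s = J a" | "s = J b" | "s ~= J a" "s ~= J b" by blast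
  thus "(J(J a := J b, J b := J a)) s \<in> S - {a, b} \<and> (J(J a := J b, J b := J a)) s ~= s \<and>
   (J(J a := J b, J b := J a)) ((J(J a := J b, J b := J a)) s) = s \<and>
   (B(J a := B (J a) \<odot> H \<odot> B b, J b := B (J b) \<odot> st H \<odot> B a)) ((J(J a := J b, J b := J a)) s) =
    st ((B(J a := B (J a) \<odot> H \<odot> B b, J b := B (J b) \<odot> st H \<odot> B a)) s)"
  proof cases
   case 1
   thus ?thesis using J[of a] J[of b] assms ne b s by (auto simp: st_mul mul_assoc)
  next
   case 2
   thus ?thesis using J[of a] J[of b] assms ne b s by (auto simp: st_mul mul_assoc)
  next
   case 3
   hence "J s ~= a" "J s ~= b" "J s ~= J a" "J s ~= J b" using J s assms by (metis DiffD1 insertCI DiffD2)+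
   thus ?thesis using 3 J[of s] s by auto
  qed
 qed
qed

section \<open>Independence of the order and orientation of the gluings\<close>

lemma gluing_value_cong:
 assumes "joining S J B" "glues S gs" "\<And>s. s \<in> S ==> J s = J' s" "\<And>s. s \<in> S ==> B s = B' s"
 shows "gluing_value gs J B = gluing_value gs J' B'"
 using assms
proof (induction gs arbitrary: S J B J' B')
 case Nil
 thus ?case by simp
next
 case (Cons g gs)
 obtain a b H where g: "g = (a, b, H)" by (cases g)
 have ab: "a \<in> S" "b \<in> S" "a ~= b" "glues (S - {a, b}) gs"
  using Cons.prems(2) by (auto simp: g glues_Cons)
 have eq: "J' a = J a" "J' b = J b" "B' a = B a" "B' b = B b" "B' (J a) = B (J a)" "B' (J b) = B (J b)"
  using Cons.prems(1,3,4) ab by (auto simp: joining_def)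
 show ?case
 proof (cases "J a = b")
  case True
  have "gluing_value gs J B = gluing_value gs J' B'"
   by (rule Cons.IH[OF joining_remove[OF Cons.prems(1) True ab(1)] ab(4)]) (use Cons.prems in auto)
  thus ?thesis using True by (simp add: g eq)
 next
  case False
  show ?thesis
   unfolding g gluing_value.simps eq using False apply simp
   by (rule Cons.IH[OF joining_reconnect[OF Cons.prems(1) False ab(1,2,3)] ab(4)]) (use Cons.prems in auto)
 qed
qed

text \<open>If \<open>J a = b\<close>, the same cycle is read backwards, which \<open>z\<close> does
  not see; otherwise both orientations reconnect \<open>J a\<close> to \<open>J b\<close> with the
  same two labels, assigned in the other order.\<close>

lemma gluing_value_flip:
 assumes "joining S J B" "a \<in> S" "b \<in> S" "a ~= b"
 shows "gluing_value ((b, a, st H) # gs) J B = gluing_value ((a, b, H) # gs) J B"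
proof -
 have J: "\<And>s. s \<in> S ==> J s \<in> S \<and> J s ~= s \<and> J (J s) = s \<and> B (J s) = st (B s)"
  using assms(1) by (auto simp: joining_def)
 show ?thesis
 proof (cases "J a = b")
  case True
  hence b: "J b = a" using J assms(2) by auto
  have "B a = st (B b)" using J[of b] b assms by auto
  hence "z (st H \<odot> B a) = z (H \<odot> B b)"
   using st_mul[of "B b" H] z_st[of "B b \<odot> H"] z_comm by simp
  thus ?thesis using True b by simp
 next
  case False
  hence "J b ~= a" "J a ~= J b" using J assms by metis+
  thus ?thesis using False by (simp add: fun_upd_twist)
 qed
qed

text \<open>Both orders leave the same joins on the surviving sides and produce the same traces. If
  the four sides form one cycle, the first elimination reconnects and the second closes it, and the
  two traces differ by a cyclic shift or a reversal. If a single join links the two gluings,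
  associativity matches the composed words. Otherwise the gluings do not interfere.\<close>

lemma gluing_value_swap:
 assumes "joining S J B" "glues S ((a, b, H) # (c, d, K) # gs)"
 shows "gluing_value ((a, b, H) # (c, d, K) # gs) J B = gluing_value ((c, d, K) # (a, b, H) # gs) J B"
proof -
 have J: "\<And>s. s \<in> S ==> J s \<in> S \<and> J s ~= s \<and> J (J s) = s \<and> B (J s) = st (B s)"
  using assms(1) by (auto simp: joining_def)
 have S: "a \<in> S" "b \<in> S" "c \<in> S" "d \<in> S" and gs: "glues (S - {a, b} - {c, d}) gs"
  and d: "a ~= b" "a ~= c" "a ~= d" "b ~= c" "b ~= d" "c ~= d"
  using assms(2) by (auto simp: glues_Cons)
 have JJ: "J (J a) = a" "J (J b) = b" "J (J c) = c" "J (J d) = d" using J S by auto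
 have inj: "J x = J y \<longleftrightarrow> x = y" if "x \<in> S" "y \<in> S" for x y using J that by metis
 note Jne = J[OF S(1)] J[OF S(2)] J[OF S(3)] J[OF S(4)]
 show ?thesis
 proof (cases "J a = b")
  case True
  hence Jb: "J b = a" using JJ by auto
  show ?thesis
  proof (cases "J c = d")
   case True
   thus ?thesis using \<open>J a = b\<close> by (simp add: algebra_simps)
  next
   case False
   hence "J c ~= a" "J c ~= b" "J d ~= a" "J d ~= b" using JJ d True Jb by metis+
   thus ?thesis using True Jb False d by auto
  qed
 next
  case ab: False
  hence ba: "J b ~= a" using JJ by auto
  show ?thesis
  proof (cases "J c = d")
   case True
   hence Jd: "J d = c" using JJ by auto
   have "J a ~= c" "J a ~= d" "J b ~= c" "J b ~= d" using JJ d True Jd by metis+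
   thus ?thesis using True Jd ab d by auto
  next
   case cd: False
   hence dc: "J d ~= c" using JJ by auto
   consider "J a = c" "J b = d" | "J a = d" "J b = c" | "\<not> (J a = c \<and> J b = d)" "\<not> (J a = d \<and> J b = c)"
    by blast
   thus ?thesis
   proof cases
    case 1
    hence Jcd: "J c = a" "J d = b" using JJ by auto
    have jS: "joining (S - {a, b} - {c, d}) J B"
    proof -
     have "S - {a, b} - {c, d} = S - {a, c} - {b, d}" by auto
     thus ?thesis
      using joining_remove[OF joining_remove[OF assms(1) 1(1) S(1)] 1(2)] S d by auto
    qed
    \<comment> \<open>The two closing words are reversals of each other up to a cyclic
      shift.\<close>
    have "z (K \<odot> (B d \<odot> st H \<odot> B a)) = z (H \<odot> (B b \<odot> st K \<odot> B c))"
    proof -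
     have "B b = st (B d)" "B c = st (B a)" using J[OF S(4)] J[OF S(1)] 1 Jcd by auto
     hence "H \<odot> (B b \<odot> st K \<odot> B c) = st (B a \<odot> (K \<odot> (B d \<odot> st H)))"
      by (simp add: st_mul mul_assoc)
     hence "z (H \<odot> (B b \<odot> st K \<odot> B c)) = z (B a \<odot> (K \<odot> (B d \<odot> st H)))" by simp
     also have "\<dots> = z (K \<odot> (B d \<odot> st H \<odot> B a))" by (subst z_comm) (simp add: mul_assoc)
     finally show ?thesis by simp
    qed
    \<comment> \<open>The updates concern eliminated sides only.\<close>
    moreover have "gluing_value gs (J(c := d, d := c)) (B(c := X, d := Y)) = gluing_value gs J B"
     "gluing_value gs (J(a := b, b := a)) (B(a := X, b := Y)) = gluing_value gs J B" for X Y
     by (rule gluing_value_cong[OF jS gs, symmetric]; auto)+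
    ultimately show ?thesis using 1 Jcd d by simp
   next
    case 2
    hence Jcd: "J c = b" "J d = a" using JJ by auto
    have jS: "joining (S - {a, b} - {c, d}) J B"
    proof -
     have "S - {a, b} - {c, d} = S - {a, d} - {b, c}" by auto
     thus ?thesis
      using joining_remove[OF joining_remove[OF assms(1) 2(1) S(1)] 2(2)] S d by auto
    qed
    have "z (K \<odot> (B d \<odot> H \<odot> B b)) = z (H \<odot> (B b \<odot> K \<odot> B d))"
     using z_comm[of "K \<odot> B d" "H \<odot> B b"] by (simp add: mul_assoc)
    moreover have "gluing_value gs (J(d := c, c := d)) (B(d := X, c := Y)) = gluing_value gs J B"
     "gluing_value gs (J(b := a, a := b)) (B(b := X, a := Y)) = gluing_value gs J B" for X Y
     by (rule gluing_value_cong[OF jS gs, symmetric]; auto)+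
    ultimately show ?thesis using 2 Jcd d by simp
   next
    case 3
    let ?J1 = "J(J a := J b, J b := J a)" and ?B1 = "B(J a := B (J a) \<odot> H \<odot> B b, J b := B (J b) \<odot> st H \<odot> B a)"
    let ?J2 = "J(J c := J d, J d := J c)" and ?B2 = "B(J c := B (J c) \<odot> K \<odot> B d, J d := B (J d) \<odot> st K \<odot> B c)"
    \<comment> \<open>With both double connections excluded, the second gluing does not close a
      cycle in either order.\<close>
    have n1: "?J1 c ~= d" using 3 cd JJ by auto
    have n2: "?J2 a ~= b" using 3 ab JJ by (metis fun_upd_apply)
    have j1: "joining (S - {a, b} - {c, d}) (?J1(?J1 c := ?J1 d, ?J1 d := ?J1 c))
      (?B1(?J1 c := ?B1 (?J1 c) \<odot> K \<odot> ?B1 d, ?J1 d := ?B1 (?J1 d) \<odot> st K \<odot> ?B1 c))"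
    proof (rule joining_reconnect[OF joining_reconnect[OF assms(1) ab S(1,2) d(1)] n1])
     show "c \<in> S - {a, b}" "d \<in> S - {a, b}" "c ~= d" using S d by auto
    qed
    have l: "gluing_value ((a, b, H) # (c, d, K) # gs) J B = gluing_value gs (?J1(?J1 c := ?J1 d, ?J1 d := ?J1 c))
      (?B1(?J1 c := ?B1 (?J1 c) \<odot> K \<odot> ?B1 d, ?J1 d := ?B1 (?J1 d) \<odot> st K \<odot> ?B1 c))"
     using ab n1 by simp
    have r: "gluing_value ((c, d, K) # (a, b, H) # gs) J B = gluing_value gs (?J2(?J2 a := ?J2 b, ?J2 b := ?J2 a))
      (?B2(?J2 a := ?B2 (?J2 a) \<odot> H \<odot> ?B2 b, ?J2 b := ?B2 (?J2 b) \<odot> st H \<odot> ?B2 a))"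
     using cd n2 by simp
    consider "J a = c" "J b ~= d" | "J a = d" "J b ~= c" | "J b = c" "J a ~= d" | "J b = d" "J a ~= c"
     | "J a ~= c" "J a ~= d" "J b ~= c" "J b ~= d" using 3 by blast
    thus ?thesis
    proof cases
     case 1
     hence "J c = a" "J d ~= a" "J d ~= b" "J d ~= J b" "J b ~= a" using JJ d inj S ba by metis+
     with 1 show ?thesis unfolding l r
      by (intro gluing_value_cong[OF j1 gs]) (use JJ d ab ba cd dc in \<open>auto simp: mul_assoc st_mul\<close>)
    next
     case 2
     hence "J d = a" "J c ~= a" "J c ~= b" "J c ~= J b" "J b ~= a" using JJ d inj S ba by metis+
     with 2 show ?thesis unfolding l r
      by (intro gluing_value_cong[OF j1 gs]) (use JJ d ab ba cd dc in \<open>auto simp: mul_assoc st_mul\<close>)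
    next
     case 3
     hence "J c = b" "J d ~= a" "J d ~= b" "J d ~= J a" using JJ d inj S ba by metis+
     with 3 show ?thesis unfolding l r
      by (intro gluing_value_cong[OF j1 gs]) (use JJ d ab ba cd dc in \<open>auto simp: mul_assoc st_mul\<close>)
    next
     case 4
     hence "J d = b" "J c ~= a" "J c ~= b" "J c ~= J a" using JJ d inj S ba by metis+
     with 4 show ?thesis unfolding l r
      by (intro gluing_value_cong[OF j1 gs]) (use JJ d ab ba cd dc in \<open>auto simp: mul_assoc st_mul\<close>)
    next
     case 5
     hence "J c ~= a" "J c ~= b" "J d ~= a" "J d ~= b" "J a ~= J c" "J a ~= J d" "J b ~= J c" "J b ~= J d"
      using JJ d inj S by metis+
     with 5 show ?thesis unfolding l r
      by (intro gluing_value_cong[OF j1 gs]) (use JJ d ab ba cd dc in \<open>auto simp: mul_assoc st_mul\<close>)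
    qed
   qed
  qed
 qed
qed

end

section \<open>Sums over labellings and over sets of twisted pairs\<close>

lemma sum_PiE_insert:
 assumes "k \<notin> L"
 shows "(\<Sum>b\<in>PiE (insert k L) (%_. I). f b) = (\<Sum>i\<in>I. \<Sum>b\<in>PiE L (%_. I). f (b(k := i)))"
proof -
 have "(\<Sum>b\<in>PiE (insert k L) (%_. I). f b)
   = (\<Sum>y\<in>I \<times> PiE L (%_. I). f ((%(y, g). g(k := y)) y))"
  unfolding PiE_insert_eq
  by (rule sum.reindex_cong[OF inj_combinator[OF assms] refl]) auto
 thus ?thesis by (simp add: sum.cartesian_product case_prod_beta)
qed

lemma sum_Pow_insert:
 assumes "finite A" "p \<notin> A"
 shows "(\<Sum>t\<in>Pow (insert p A). f t) = (\<Sum>t\<in>Pow A. f t) + (\<Sum>t\<in>Pow A. f (insert p t))"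
proof -
 have "(\<Sum>t\<in>Pow (insert p A). f t) = (\<Sum>t\<in>Pow A. f t) + (\<Sum>t\<in>insert p ` Pow A. f t)"
  unfolding Pow_insert using assms by (intro sum.union_disjoint) auto
 also have "(\<Sum>t\<in>insert p ` Pow A. f t) = (\<Sum>t\<in>Pow A. f (insert p t))"
  using assms(2) by (subst sum.reindex) (auto simp: inj_on_def)
 finally show ?thesis .
qed

context gluing begin

text \<open>The factor and the new pattern are the same for all tails \<open>gs\<close>. Hence
  identities among values of tails, including linear ones, pass to the full list without asking
  whether a cycle closes.\<close>

lemma gluing_value_step:
 assumes "joining S J B" "a \<in> S" "b \<in> S" "a ~= b"
 shows "\<exists>k J' B'. joining (S - {a, b}) J' B' \<and>
  (\<forall>gs. gluing_value ((a, b, H) # gs) J B = k * gluing_value gs J' B')"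
proof (cases "J a = b")
 case True
 show ?thesis
  by (intro exI[of _ "z (H \<odot> B b)"] exI[of _ J] exI[of _ B] conjI allI joining_remove[OF assms(1) True assms(2)])
   (simp add: True)
next
 case False
 show ?thesis
  by (intro exI[of _ "1"] exI[of _ "J(J a := J b, J b := J a)"]
     exI[of _ "B(J a := B (J a) \<odot> H \<odot> B b, J b := B (J b) \<odot> st H \<odot> B a)"] conjI allI
     joining_reconnect[OF assms(1) False assms(2-4)])
   (simp add: False)
qed

lemma gluing_value_move:
 assumes "joining S J B" "glues S (xs @ g # ys)"
 shows "gluing_value (xs @ g # ys) J B = gluing_value (g # xs @ ys) J B"
 using assms
proof (induction xs arbitrary: S J B)
 case Nil
 thus ?case by simp
next
 case (Cons x xs)
 obtain a b H c d K where x: "x = (a, b, H)" and g: "g = (c, d, K)"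
  by (metis prod_cases3)
 have ab: "a \<in> S" "b \<in> S" "a ~= b" "glues (S - {a, b}) (xs @ g # ys)"
  using Cons.prems(2) by (auto simp: x glues_Cons)
 obtain k J' B' where J': "joining (S - {a, b}) J' B'"
  and *: "\<And>gs. gluing_value ((a, b, H) # gs) J B = k * gluing_value gs J' B'"
  using gluing_value_step[OF Cons.prems(1) ab(1-3)] by metis
 have "gluing_value ((x # xs) @ g # ys) J B = gluing_value (x # g # xs @ ys) J B"
  using Cons.IH[OF J' ab(4)] by (simp only: x * append_Cons)
 also have "\<dots> = gluing_value (g # x # xs @ ys) J B"
  unfolding x g
  by (rule gluing_value_swap[OF Cons.prems(1)])
   (use Cons.prems(2) in \<open>auto simp: x g glues_def\<close>)
 finally show ?case by simp
qed

lemma mset_glue_sides: "mset (glue_sides gs) = (\<Sum>(a, b, H)\<in>#mset gs. {#a, b#})"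
 by (induction gs rule: glue_sides.induct) auto

lemma glues_perm: "mset xs = mset ys ==> glues S xs \<longleftrightarrow> glues S ys"
 unfolding glues_def using mset_glue_sides[of xs] mset_glue_sides[of ys]
 by (metis mset_eq_imp_distinct_iff mset_eq_setD)

lemma gluing_value_perm:
 assumes "joining S J B" "glues S xs" "mset xs = mset ys"
 shows "gluing_value xs J B = gluing_value ys J B"
 using assms
proof (induction xs arbitrary: S J B ys)
 case Nil
 thus ?case by simp
next
 case (Cons x xs)
 obtain a b H where x: "x = (a, b, H)" by (metis prod_cases3)
 have ab: "a \<in> S" "b \<in> S" "a ~= b" "glues (S - {a, b}) xs"
  using Cons.prems(2) by (auto simp: x glues_Cons)
 obtain k J' B' where J': "joining (S - {a, b}) J' B'"
  and *: "\<And>gs. gluing_value ((a, b, H) # gs) J B = k * gluing_value gs J' B'"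
  using gluing_value_step[OF Cons.prems(1) ab(1-3)] by metis
 have "x \<in> set ys" using Cons.prems(3) by (metis list.set_intros(1) mset_eq_setD)
 then obtain us vs where ys: "ys = us @ x # vs" by (meson split_list)
 have "gluing_value ys J B = gluing_value (x # us @ vs) J B"
  using gluing_value_move[OF Cons.prems(1)] glues_perm[OF Cons.prems(3)] Cons.prems(2) ys by blast
 moreover have "gluing_value xs J' B' = gluing_value (us @ vs) J' B'"
  by (rule Cons.IH[OF J' ab(4)]) (use Cons.prems(3) ys in auto)
 ultimately show ?case by (simp only: x *)
qed

text \<open>One glued surface has many listings; the involution \<open>g\<close> and the labels
  \<open>H\<close> record what is glued and how, regardless of order and orientation.\<close>

definition compatible :: "('s => 's) => ('s => 'm) => ('s \<times> 's \<times> 'm) list => bool" where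
 "compatible g H gs \<longleftrightarrow>
  (\<forall>(a, b, X)\<in>set gs. b = g a \<and> X = H a \<and> g b = a \<and> H b = st X)"

lemma compatible_subset: "compatible g H ys ==> set xs \<subseteq> set ys ==> compatible g H xs"
 unfolding compatible_def by (rule ballI, drule (1) subsetD, drule (1) bspec)

lemma glues_split: "a \<in> set (glue_sides gs) ==>
 \<exists>us vs b X. gs = us @ (a, b, X) # vs \<or> gs = us @ (b, a, X) # vs"
proof (induction gs rule: glue_sides.induct)
 case (2 c d K gs)
 show ?case
 proof (cases "a = c \<or> a = d")
  case True
  thus ?thesis by (metis append_Nil)
 next
  case False
  with 2 obtain us vs b X where "gs = us @ (a, b, X) # vs \<or> gs = us @ (b, a, X) # vs" by auto
  thus ?thesis by (metis append_Cons)
 qed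
qed simp

text \<open>Each gluing of the first list occurs in the second up to orientation; there it is moved
  to the front, flipped if necessary, and eliminated from both lists.\<close>

lemma gluing_value_compatible:
 assumes "joining S J B" "glues S xs" "glues S ys" "compatible g H xs" "compatible g H ys"
 shows "gluing_value xs J B = gluing_value ys J B"
 using assms
proof (induction xs arbitrary: S J B ys)
 case Nil
 hence "glue_sides ys = []" by (auto simp: glues_def)
 hence "ys = []" by (cases ys rule: glue_sides.cases) auto
 thus ?case by simp
next
 case (Cons x xs)
 obtain a b X where x: "x = (a, b, X)" by (metis prod_cases3)
 have ab: "a \<in> S" "b \<in> S" "a ~= b" "glues (S - {a, b}) xs"
  using Cons.prems(2) by (auto simp: x glues_Cons)
 have X: "b = g a" "X = H a" "g b = a" "H b = st X"
  using Cons.prems(4) by (auto simp: x compatible_def)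
 obtain k J' B' where J': "joining (S - {a, b}) J' B'"
  and *: "\<And>gs. gluing_value ((a, b, X) # gs) J B = k * gluing_value gs J' B'"
  using gluing_value_step[OF Cons.prems(1) ab(1-3)] by metis
 have "a \<in> set (glue_sides ys)" using Cons.prems(3) ab by (auto simp: glues_def)
 then obtain us vs c Y where "ys = us @ (a, c, Y) # vs \<or> ys = us @ (c, a, Y) # vs"
  using glues_split by meson
 hence ys: "ys = us @ (a, b, X) # vs \<or> ys = us @ (b, a, st X) # vs"
  using Cons.prems(5) X by (fastforce simp: compatible_def)
 have comp: "compatible g H (us @ vs)" "compatible g H xs"
 proof -
  have "set (us @ vs) \<subseteq> set ys" using ys by auto
  thus "compatible g H (us @ vs)" by (rule compatible_subset[OF Cons.prems(5)])
  show "compatible g H xs" by (rule compatible_subset[OF Cons.prems(4)]) auto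
 qed
 have "glues (S - {a, b}) (us @ vs)"
 proof -
  have "glues S ((a, b, X) # us @ vs) \<or> glues S ((b, a, st X) # us @ vs)"
   using ys Cons.prems(3) glues_perm[of "us @ (a, b, X) # vs" "(a, b, X) # us @ vs"]
    glues_perm[of "us @ (b, a, st X) # vs" "(b, a, st X) # us @ vs"] by auto
  thus ?thesis by (auto simp: glues_Cons insert_commute)
 qed
 hence "gluing_value xs J' B' = gluing_value (us @ vs) J' B'"
  by (rule Cons.IH[OF J' ab(4) _ comp(2,1)])
 hence "gluing_value (x # xs) J B = gluing_value ((a, b, X) # us @ vs) J B"
  by (simp only: x *)
 also have "\<dots> = gluing_value ys J B"
  using ys
 proof
  assume "ys = us @ (a, b, X) # vs"
  thus ?thesis using gluing_value_move[OF Cons.prems(1)] Cons.prems(3) by metis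
 next
  assume y: "ys = us @ (b, a, st X) # vs"
  have "gluing_value ((a, b, X) # us @ vs) J B = gluing_value ((b, a, st X) # us @ vs) J B"
   by (rule gluing_value_flip[symmetric, OF Cons.prems(1) ab(1-3)])
  thus ?thesis using gluing_value_move[OF Cons.prems(1)] Cons.prems(3) y by metis
 qed
 finally show ?case .
qed

text \<open>The three identities are the three ways of joining four sides: the two loops lie on
  different cycles, or on one cycle with parallel readings, or on one cycle with opposite readings.
  The right-hand side is always the straight gluing plus the twisted one. \<open>h\<close>,
  \<open>h'\<close> label the two borders of a straight ribbon and \<open>t\<close>,
  \<open>t'\<close> those of a twisted one.\<close>

definition contraction_rule ::
 "'i set => ('i => 'm) => 'c => ('i => 'i => 'c) => 'm => 'm => 'm => 'm => bool" where
 "contraction_rule I X c \<kappa> h h' t t' \<longleftrightarrow> (\<forall>P Q.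
  (\<Sum>i\<in>I. \<Sum>j\<in>I. \<kappa> i j * (z (X i \<odot> P) * z (X j \<odot> Q)))
   = c * (z (h' \<odot> P \<odot> h \<odot> Q) + z (t' \<odot> Q \<odot> st t \<odot> st P)) \<and>
  (\<Sum>i\<in>I. \<Sum>j\<in>I. \<kappa> i j * z (X j \<odot> Q \<odot> X i \<odot> P))
   = c * (z (h \<odot> Q) * z (h' \<odot> P) + z (t' \<odot> Q \<odot> t \<odot> st P)) \<and>
  (\<Sum>i\<in>I. \<Sum>j\<in>I. \<kappa> i j * z (X j \<odot> P \<odot> st (X i) \<odot> Q))
   = c * (z (h' \<odot> st P \<odot> st h \<odot> Q) + z (st t \<odot> Q) * z (t' \<odot> P)))"

text \<open>With four sides \<open>J a\<close> can only be \<open>b\<close>, \<open>d\<close> or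
  \<open>c\<close>, and these cases select the three identities of the rule.\<close>

lemma contraction_four_sides:
 assumes J: "joining {a, b, c, d} J B" and dist: "a ~= b" "a ~= c" "a ~= d" "b ~= c" "b ~= d" "c ~= d"
  and rule: "contraction_rule I X w \<kappa> h h' t t'"
 shows "(\<Sum>i\<in>I. \<Sum>j\<in>I. \<kappa> i j * gluing_value [(a, b, X i), (c, d, X j)] J B)
   = w * (gluing_value [(a, d, h), (c, b, h')] J B + gluing_value [(a, c, t), (b, d, t')] J B)"
proof -
 have JJ: "J a ~= a" "J b ~= b" "J c ~= c" "J d ~= d"
  "J (J a) = a" "J (J b) = b" "J (J c) = c" "J (J d) = d"
  "B (J a) = st (B a)" "B (J b) = st (B b)" "B (J c) = st (B c)" "B (J d) = st (B d)"
  "J a \<in> {a, b, c, d}" "J b \<in> {a, b, c, d}" "J c \<in> {a, b, c, d}" "J d \<in> {a, b, c, d}"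
  using J by (auto simp: joining_def)
 note sums = rule[unfolded contraction_rule_def, rule_format]
 consider "J a = b" | "J a = d" | "J a = c" using JJ by auto
 thus ?thesis
 proof cases
  case 1
  have v: "J b = a" using JJ 1 by simp
  moreover have "J c ~= a" "J c ~= b" "J d ~= a" "J d ~= b" using JJ 1 v dist by metis+
  ultimately have v: "J b = a" "J c = d" "J d = c" using JJ by auto
  have B: "B a = st (B b)" "B c = st (B d)" using JJ v by metis+
  show ?thesis
   using sums[of "B b" "B d"] dist by (simp add: 1 v B mul_assoc)
 next
  case 2
  hence v: "J b = c" "J c = b" "J d = a" using JJ dist by (metis insertE singletonD)+
  hence B: "B a = st (B d)" "B c = st (B b)" using JJ 2 by metis+
  show ?thesis
   using sums[where P="B b" and Q="B d"] dist by (simp add: 2 v B mul_assoc)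
 next
  case 3
  hence v: "J b = d" "J c = a" "J d = b" using JJ dist by (metis insertE singletonD)+
  hence B: "B d = st (B b)" "B a = st (B c)" using JJ 3 by metis+
  have "z (st t \<odot> st (B c)) = z (t \<odot> B c)"
   using z_st[of "t \<odot> B c"] z_comm by (simp add: st_mul del: z_st)
  thus ?thesis
   using sums[of "st (B b)" "st (B c)"] dist by (simp add: 3 v B mul_assoc st_mul)
 qed
qed

text \<open>Each gluing in front contributes only a scalar and a new pattern; once all of them are
  performed, exactly the four sides of the two loops are left.\<close>

lemma contraction_after:
 assumes "joining S J B" "glues S (gs @ [(a, b, H), (c, d, K)])"
  and rule: "contraction_rule I X w \<kappa> h h' t t'"
 shows "(\<Sum>i\<in>I. \<Sum>j\<in>I. \<kappa> i j * gluing_value (gs @ [(a, b, X i), (c, d, X j)]) J B)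
   = w * (gluing_value (gs @ [(a, d, h), (c, b, h')]) J B
      + gluing_value (gs @ [(a, c, t), (b, d, t')]) J B)"
 using assms(1,2)
proof (induction gs arbitrary: S J B)
 case Nil
 hence "S = {a, b, c, d}" "distinct [a, b, c, d]" by (auto simp: glues_def)
 thus ?case using contraction_four_sides[OF _ _ _ _ _ _ _ rule, of a b c d J B] Nil(1) by simp
next
 case (Cons x xs)
 obtain a' b' H' where x: "x = (a', b', H')" by (metis prod_cases3)
 have ab: "a' \<in> S" "b' \<in> S" "a' ~= b'" "glues (S - {a', b'}) (xs @ [(a, b, H), (c, d, K)])"
  using Cons.prems(2) by (auto simp: x glues_Cons)
 obtain k J' B' where J': "joining (S - {a', b'}) J' B'"
  and *: "\<And>gs. gluing_value ((a', b', H') # gs) J B = k * gluing_value gs J' B'"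
  using gluing_value_step[OF Cons.prems(1) ab(1-3)] by metis
 have "(\<Sum>i\<in>I. \<Sum>j\<in>I. \<kappa> i j * (k * gluing_value (xs @ [(a, b, X i), (c, d, X j)]) J' B'))
  = k * (\<Sum>i\<in>I. \<Sum>j\<in>I. \<kappa> i j * gluing_value (xs @ [(a, b, X i), (c, d, X j)]) J' B')"
  by (simp add: sum_distrib_left algebra_simps)
 thus ?case
  unfolding x append_Cons * Cons.IH[OF J' ab(4)] by (simp add: algebra_simps)
qed

text \<open>Gluing the two sides of a half-edge to each other cuts the ribbon off and inserts
  \<open>X k\<close> into the boundary of the vertex. This encodes a field value at \<open>k\<close>
  before the contraction.\<close>

definition self_glues :: "('k => 'm) => ('k \<times> 'k) list => (('k \<times> bool) \<times> ('k \<times> bool) \<times> 'm) list" where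
 "self_glues X ps = concat (map (%(k, k').
  [((k, False), (k, True), X k), ((k', False), (k', True), X k')]) ps)"

definition ribbon_glues ::
 "('k \<times> 'k => 'm \<times> 'm) => ('k \<times> 'k => 'm \<times> 'm) => ('k \<times> 'k) set => ('k \<times> 'k) list =>
  (('k \<times> bool) \<times> ('k \<times> bool) \<times> 'm) list" where
 "ribbon_glues h t tw ps = concat (map (%(k, k').
  if (k, k') \<in> tw
  then [((k, False), (k', False), fst (t (k, k'))), ((k, True), (k', True), snd (t (k, k')))]
  else [((k, False), (k', True), fst (h (k, k'))), ((k', False), (k, True), snd (h (k, k')))]) ps)"

lemma mset_glue_sides_ribbon:
 "mset (glue_sides (ribbon_glues h t tw ps)) = mset (glue_sides (self_glues X ps))"
 by (induction ps) (auto simp: ribbon_glues_def self_glues_def)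

lemma glues_ribbon_iff:
 "glues S (xs @ ribbon_glues h t tw ps @ ys) \<longleftrightarrow> glues S (xs @ self_glues X ps @ ys)"
proof -
 have "mset (glue_sides (xs @ ribbon_glues h t tw ps @ ys)) = mset (glue_sides (xs @ self_glues X ps @ ys))"
  using mset_glue_sides_ribbon[of h t tw ps X] by simp
 thus ?thesis unfolding glues_def by (metis mset_eq_imp_distinct_iff mset_eq_setD)
qed

lemma ribbon_glues_insert:
 "p \<notin> set ps ==> ribbon_glues h t (insert p tw) ps = ribbon_glues h t tw ps"
 unfolding ribbon_glues_def by (intro arg_cong[where f=concat] map_cong) (auto split: prod.split)

lemma self_glues_cong:
 "(\<And>k k'. (k, k') \<in> set ps ==> X k = Y k \<and> X k' = Y k') ==> self_glues X ps = self_glues Y ps"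
 unfolding self_glues_def by (intro arg_cong[where f=concat] map_cong) (auto split: prod.split)

text \<open>Since the contraction rule applies in every pattern, each pair contributes a factor
  \<open>w\<close> and an independent choice between straight and twisted; the choices make up the
  sum over \<open>Pow\<close>.\<close>

theorem gluing_contraction:
 assumes "joining S J B" "glues S (gs @ self_glues Y ps)"
  and "\<And>p. p \<in> set ps ==> contraction_rule I X w (\<kappa> p) (fst (h p)) (snd (h p)) (fst (t p)) (snd (t p))"
 shows "(\<Sum>b\<in>PiE (fst ` set ps \<union> snd ` set ps) (%_. I).
      (\<Prod>p\<in>set ps. \<kappa> p (b (fst p)) (b (snd p))) * gluing_value (gs @ self_glues (%k. X (b k)) ps) J B)
   = w ^ length ps * (\<Sum>tw\<in>Pow (set ps). gluing_value (gs @ ribbon_glues h t tw ps) J B)"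
 using assms
proof (induction ps arbitrary: gs)
 case Nil
 thus ?case by (simp add: self_glues_def ribbon_glues_def)
next
 case (Cons p ps)
 obtain k k' where p: "p = (k, k')" by (cases p)
 let ?L = "fst ` set ps \<union> snd ` set ps"
 let ?two = "%x y. [((k, False), (k, True), x), ((k', False), (k', True), y)]"
 have sides: "set (glue_sides (self_glues Y ps)) = ?L \<times> UNIV"
  by (induction ps) (auto simp: self_glues_def UNIV_bool)
 have dist: "distinct (glue_sides (?two (Y k) (Y k') @ self_glues Y ps))"
  using Cons.prems(2) by (auto simp: glues_def self_glues_def p)
 hence "k ~= k'" "(k, False) \<notin> ?L \<times> UNIV" "(k', False) \<notin> ?L \<times> UNIV"
  unfolding sides[symmetric] by auto
 hence new: "k ~= k'" "k \<notin> ?L" "k' \<notin> ?L" by auto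
 moreover from new(2) have "(k, k') \<notin> set ps" by force
 ultimately have new: "k ~= k'" "k \<notin> ?L" "k' \<notin> ?L" "(k, k') \<notin> set ps" by blast+
 have L: "fst ` set (p # ps) \<union> snd ` set (p # ps) = insert k (insert k' ?L)" by (auto simp: p)
 have G: "glues S ((gs @ ?two x y) @ self_glues Y' ps)" for x y Y'
 proof -
  have "glue_sides ((gs @ ?two x y) @ self_glues Y' ps) = glue_sides (gs @ self_glues Y (p # ps))"
   using arg_cong[of _ _ "%x. x"] by (simp add: self_glues_def p, induction ps) auto
  thus ?thesis using Cons.prems(2) by (simp add: glues_def)
 qed
 have Gr: "glues S ((gs @ ?two x y) @ ribbon_glues h t tw ps)" for x y tw
  using G[of x y Y] glues_ribbon_iff[of S "gs @ ?two x y" h t tw ps "[]" Y] by simp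
 have IH: "(\<Sum>b\<in>PiE ?L (%_. I). (\<Prod>p\<in>set ps. \<kappa> p (b (fst p)) (b (snd p))) *
    gluing_value ((gs @ ?two x y) @ self_glues (%k. X (b k)) ps) J B)
   = w ^ length ps * (\<Sum>tw\<in>Pow (set ps). gluing_value ((gs @ ?two x y) @ ribbon_glues h t tw ps) J B)" for x y
  by (rule Cons.IH[OF assms(1) G Cons.prems(3)]) simp
 let ?f = "%b. (\<Prod>p\<in>set (p # ps). \<kappa> p (b (fst p)) (b (snd p))) * gluing_value (gs @ self_glues (%k. X (b k)) (p # ps)) J B"
 have "(\<Sum>b\<in>PiE (insert k (insert k' ?L)) (%_. I). ?f b)
   = (\<Sum>i\<in>I. \<Sum>b\<in>PiE (insert k' ?L) (%_. I). ?f (b(k := i)))"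
  by (rule sum_PiE_insert) (use new in blast)
 also have "\<dots> = (\<Sum>i\<in>I. \<Sum>j\<in>I. \<Sum>b\<in>PiE ?L (%_. I). ?f (b(k' := j, k := i)))"
  by (rule sum.cong[OF refl], rule sum_PiE_insert) (use new in blast)
 also have "\<dots> = (\<Sum>i\<in>I. \<Sum>j\<in>I. \<Sum>b\<in>PiE ?L (%_. I). \<kappa> p i j * ((\<Prod>p\<in>set ps. \<kappa> p (b (fst p)) (b (snd p))) *
    gluing_value ((gs @ ?two (X i) (X j)) @ self_glues (%k. X (b k)) ps) J B))"
 proof (intro sum.cong refl)
  fix i j b
  have "(\<Prod>p\<in>set ps. \<kappa> p ((b(k' := j, k := i)) (fst p)) ((b(k' := j, k := i)) (snd p)))
    = (\<Prod>p\<in>set ps. \<kappa> p (b (fst p)) (b (snd p)))"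
  proof (intro prod.cong refl)
   fix q assume "q \<in> set ps"
   hence "fst q \<in> ?L" "snd q \<in> ?L" by auto
   hence "fst q ~= k" "fst q ~= k'" "snd q ~= k" "snd q ~= k'" using new by blast+
   thus "\<kappa> q ((b(k' := j, k := i)) (fst q)) ((b(k' := j, k := i)) (snd q)) = \<kappa> q (b (fst q)) (b (snd q))"
    by simp
  qed
  moreover have "self_glues (%k''. X ((b(k' := j, k := i)) k'')) (p # ps)
    = ?two (X i) (X j) @ self_glues (%k. X (b k)) ps"
  proof -
   have "self_glues (%k''. X ((b(k' := j, k := i)) k'')) ps = self_glues (%k. X (b k)) ps"
   proof (rule self_glues_cong)
    fix q q' assume "(q, q') \<in> set ps"
    hence "q \<in> ?L" "q' \<in> ?L" by force+
    hence "q ~= k" "q ~= k'" "q' ~= k" "q' ~= k'" using new by blast+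
    thus "X ((b(k' := j, k := i)) q) = X (b q) \<and> X ((b(k' := j, k := i)) q') = X (b q')" by simp
   qed
   thus ?thesis using new by (simp add: self_glues_def p)
  qed
  moreover have "p \<notin> set ps" "fst p = k" "snd p = k'" using new p by auto
  ultimately show "?f (b(k' := j, k := i))
   = \<kappa> p i j * ((\<Prod>p\<in>set ps. \<kappa> p (b (fst p)) (b (snd p))) *
    gluing_value ((gs @ ?two (X i) (X j)) @ self_glues (%k. X (b k)) ps) J B)"
   using new(1) by (simp add: mult.assoc)
 qed
 also have "\<dots> = (\<Sum>i\<in>I. \<Sum>j\<in>I. \<kappa> p i j * (w ^ length ps *
   (\<Sum>tw\<in>Pow (set ps). gluing_value ((gs @ ?two (X i) (X j)) @ ribbon_glues h t tw ps) J B)))"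
  by (simp only: sum_distrib_left[symmetric] IH)
 \<comment> \<open>The two loops of \<open>p\<close> are moved behind the ribbons already formed,
   the position in which \<open>contraction_after\<close> contracts them.\<close>
 also have "\<dots> = w ^ length ps * (\<Sum>tw\<in>Pow (set ps). \<Sum>i\<in>I. \<Sum>j\<in>I. \<kappa> p i j *
   gluing_value ((gs @ ribbon_glues h t tw ps) @ ?two (X i) (X j)) J B)"
 proof -
  have "gluing_value ((gs @ ?two x y) @ ribbon_glues h t tw ps) J B
    = gluing_value ((gs @ ribbon_glues h t tw ps) @ ?two x y) J B" for x y tw
   by (rule gluing_value_perm[OF assms(1) Gr]) simp
  hence "(\<Sum>i\<in>I. \<Sum>j\<in>I. \<kappa> p i j * (w ^ length ps *
   (\<Sum>tw\<in>Pow (set ps). gluing_value ((gs @ ?two (X i) (X j)) @ ribbon_glues h t tw ps) J B)))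
   = (\<Sum>i\<in>I. \<Sum>j\<in>I. \<Sum>tw\<in>Pow (set ps). w ^ length ps * (\<kappa> p i j *
     gluing_value ((gs @ ribbon_glues h t tw ps) @ ?two (X i) (X j)) J B))"
   by (simp add: sum_distrib_left algebra_simps)
  also have "\<dots> = (\<Sum>i\<in>I. \<Sum>tw\<in>Pow (set ps). \<Sum>j\<in>I. w ^ length ps * (\<kappa> p i j *
     gluing_value ((gs @ ribbon_glues h t tw ps) @ ?two (X i) (X j)) J B))"
   by (intro sum.cong refl sum.swap)
  also have "\<dots> = (\<Sum>tw\<in>Pow (set ps). \<Sum>i\<in>I. \<Sum>j\<in>I. w ^ length ps * (\<kappa> p i j *
     gluing_value ((gs @ ribbon_glues h t tw ps) @ ?two (X i) (X j)) J B))"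
   by (rule sum.swap)
  finally show ?thesis by (simp only: sum_distrib_left)
 qed
 also have "\<dots> = w ^ length ps * (\<Sum>tw\<in>Pow (set ps). w *
   (gluing_value (gs @ ribbon_glues h t tw (p # ps)) J B
   + gluing_value (gs @ ribbon_glues h t (insert p tw) (p # ps)) J B))"
 proof (intro arg_cong2[where f="(*)"] sum.cong refl)
  fix tw assume tw: "tw \<in> Pow (set ps)"
  have G2: "glues S ((gs @ ribbon_glues h t tw ps) @ ?two (X i) (X j))" for i j
   using Gr[of "X i" "X j" tw] by (subst glues_perm) auto
  let ?s = "[((k, False), (k', True), fst (h p)), ((k', False), (k, True), snd (h p))]"
  let ?t = "[((k, False), (k', False), fst (t p)), ((k, True), (k', True), snd (t p))]"
  have "p \<notin> tw" using tw new p by auto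
  have r: "ribbon_glues h t tw (p # ps) = ?s @ ribbon_glues h t tw ps"
   "ribbon_glues h t (insert p tw) (p # ps) = ?t @ ribbon_glues h t tw ps"
   using \<open>p \<notin> tw\<close> ribbon_glues_insert[of p ps h t tw] new p by (auto simp: ribbon_glues_def)
  have "glues S (gs @ x @ ribbon_glues h t tw ps)" if "x = ?s \<or> x = ?t" for x
  proof -
   have "mset (glue_sides (gs @ x @ ribbon_glues h t tw ps))
     = mset (glue_sides ((gs @ ?two (Y k) (Y k')) @ ribbon_glues h t tw ps))" using that by auto
   thus ?thesis
    using Gr[of "Y k" "Y k'" tw] unfolding glues_def by (metis mset_eq_imp_distinct_iff mset_eq_setD)
  qed
  hence mv: "gluing_value (gs @ x @ ribbon_glues h t tw ps) J B = gluing_value ((gs @ ribbon_glues h t tw ps) @ x) J B"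
   if "x = ?s \<or> x = ?t" for x
   using that by (intro gluing_value_perm[OF assms(1)]) auto
  show "(\<Sum>i\<in>I. \<Sum>j\<in>I. \<kappa> p i j * gluing_value ((gs @ ribbon_glues h t tw ps) @ ?two (X i) (X j)) J B)
   = w * (gluing_value (gs @ ribbon_glues h t tw (p # ps)) J B
    + gluing_value (gs @ ribbon_glues h t (insert p tw) (p # ps)) J B)"
   unfolding r mv[OF disjI1[OF refl]] mv[OF disjI2[OF refl]]
   by (rule contraction_after[OF assms(1) G2 Cons.prems(3)]) simp
 qed
 also have "\<dots> = w ^ length (p # ps) * (\<Sum>tw\<in>Pow (set (p # ps)). gluing_value (gs @ ribbon_glues h t tw (p # ps)) J B)"
  using new p sum_Pow_insert[of "set ps" p "%tw. gluing_value (gs @ ribbon_glues h t tw (p # ps)) J B"]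
  by (simp add: sum_distrib_left[symmetric] sum.distrib algebra_simps)
 finally show ?case unfolding L .
qed

section \<open>Gluing along a single boundary cycle\<close>

primrec chain_glues :: "('s => 's) => ('s => 'm) => 's => 's => 's list => ('s \<times> 's \<times> 'm) list" where
 "chain_glues J H s t [] = [(t, s, H t)]"
| "chain_glues J H s t (v # r) = (t, v, H t) # chain_glues J H s (J v) r"

primrec chain_word :: "('s => 's) => ('s => 'm) => ('s => 'm) => 'm => 's => 's list => 'm" where
 "chain_word J B H x t [] = x \<odot> H t"
| "chain_word J B H x t (v # r) = chain_word J B H (x \<odot> H t \<odot> B v) (J v) r"

text \<open>The join that starts at \<open>s\<close> grows along the cycle: \<open>s\<close> stays
  fixed, \<open>t\<close> is the current end, and each gluing from \<open>t\<close> to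
  \<open>v\<close>, followed by the join that leaves \<open>v\<close>, is appended to the word at
  \<open>s\<close> until the last gluing closes it. \<open>J1\<close> and \<open>B1\<close> describe
  the current joins, which agree with the original ones at the sides still ahead.\<close>

lemma gluing_value_chain:
 assumes "joining S J1 B1" "J1 s = t" "glues S (chain_glues J H s t r @ gs)"
  and "\<And>v. v \<in> set r ==> J1 v = J v \<and> B1 v = B v"
 shows "gluing_value (chain_glues J H s t r @ gs) J1 B1
   = z (chain_word J B H (B1 s) t r) * gluing_value gs J1 B1"
 using assms
proof (induction r arbitrary: S J1 B1 t)
 case Nil
 have "s \<in> S" using Nil(3) by (auto simp: glues_def)
 hence "J1 t = s" using Nil(1,2) by (auto simp: joining_def)
 thus ?case by (simp add: z_comm)
next
 case (Cons v r)
 have gl: "t \<in> S" "v \<in> S" "t ~= v" "glues (S - {t, v}) (chain_glues J H s (J v) r @ gs)"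
  using Cons.prems(3) by (auto simp: glues_Cons)
 have ins: "s \<in> set (glue_sides (chain_glues J H s t' r))" for t' by (induction r arbitrary: t') auto
 have inr: "set r \<subseteq> set (glue_sides (chain_glues J H s t' r))" for t' by (induction r arbitrary: t') auto
 have int: "t' \<in> set (glue_sides (chain_glues J H s t' r))" for t' by (cases r) auto
 have inJr: "J ` set r \<subseteq> set (glue_sides (chain_glues J H s t' r))" for t'
 proof (induction r arbitrary: t')
  case (Cons a r)
  have "J a \<in> set (glue_sides (chain_glues J H s (J a) r))" by (cases r) auto
  with Cons show ?case by auto
 qed simp
 have dist: "s ~= t" "s ~= v" "s \<notin> set r" "J v \<notin> set r" "J v ~= s" "v \<notin> set r"
 proof -
  have d: "distinct (glue_sides (chain_glues J H s (J v) r))" "s ~= t" "s ~= v" "v \<notin> set r"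
   using Cons.prems(3) ins[of "J v"] inr[of "J v"] by (auto simp: glues_def)
  have "distinct (glue_sides (chain_glues J H s t' r)) ==> s \<notin> set r \<and> t' \<notin> set r \<and> t' ~= s" for t'
  proof (induction r arbitrary: t')
   case (Cons a r)
   have "s \<in> set (glue_sides (chain_glues J H s (J a) r))" "set r \<subseteq> set (glue_sides (chain_glues J H s (J a) r))"
    by (induction r arbitrary: a) auto
   with Cons show ?case by auto
  qed simp
  with d show "s ~= t" "s ~= v" "s \<notin> set r" "J v \<notin> set r" "J v ~= s" "v \<notin> set r" by auto
 qed
 have sS: "s \<in> S" using gl(4) ins[of "J v"] by (auto simp: glues_def)
 have J1t: "J1 t = s" using Cons.prems(1,2) sS by (auto simp: joining_def)
 have Jv: "J1 v = J v" "B1 v = B v" using Cons.prems(4) by auto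
 let ?J = "J1(J1 t := J1 v, J1 v := J1 t)" and ?B = "B1(J1 t := B1 (J1 t) \<odot> H t \<odot> B1 v, J1 v := B1 (J1 v) \<odot> st (H t) \<odot> B1 t)"
 have jn: "joining (S - {t, v}) ?J ?B"
  by (rule joining_reconnect[OF Cons.prems(1)]) (use gl J1t dist in auto)
 have "gluing_value (chain_glues J H s t (v # r) @ gs) J1 B1
   = gluing_value (chain_glues J H s (J v) r @ gs) ?J ?B"
  using J1t dist by auto
 also have "\<dots> = z (chain_word J B H (?B s) (J v) r) * gluing_value gs ?J ?B"
 proof (rule Cons.IH[OF jn _ gl(4)])
  show "?J s = J v" using J1t Jv dist by auto
  show "?J v' = J v' \<and> ?B v' = B v'" if "v' \<in> set r" for v'
   using that Cons.prems(4)[of v'] J1t Jv dist by auto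
 qed
 also have "?B s = B1 s \<odot> H t \<odot> B v" using J1t Jv dist by auto
 also have "gluing_value gs ?J ?B = gluing_value gs J1 B1"
 proof -
  let ?S = "set (glue_sides gs)"
  have g: "glues ?S gs" using gl(4) by (auto simp: glues_def)
  have nin: "s \<notin> ?S" "J v \<notin> ?S" "v \<notin> ?S" "t \<notin> ?S" "set r \<inter> ?S = {}" "J ` set r \<inter> ?S = {}"
   using Cons.prems(3) ins[of "J v"] int[of "J v"] inr[of "J v"] inJr[of "J v"] by (auto simp: glues_def)
  have S: "S = {t, v} \<union> set (glue_sides (chain_glues J H s (J v) r)) \<union> ?S"
   using Cons.prems(3) by (auto simp: glues_def)
  have sub: "set (glue_sides (chain_glues J H s t' r)) \<subseteq> {s, t'} \<union> set r \<union> J ` set r" for t'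
   by (induction r arbitrary: t') auto
  \<comment> \<open>The joins permute the sides of this cycle, hence also the remaining ones, so the
    tail is a pattern of its own.\<close>
  have cl: "J1 x \<in> ?S" if "x \<in> ?S" for x
  proof -
   have x: "x \<in> S" "J1 x \<in> S" "J1 (J1 x) = x" using that S Cons.prems(1) by (auto simp: joining_def)
   have a: "J1 y ~= x" if "y \<in> {s, t, v, J v} \<union> set r \<union> J ` set r" for y
   proof -
    have "J1 y \<in> {s, t, v, J v} \<union> set r \<union> J ` set r"
    proof -
     have "y = s \<or> y = t \<or> y = v \<or> y = J v \<or> y \<in> set r \<or> (\<exists>u\<in>set r. y = J u)"
      using that by auto
     then consider "y = s" | "y = t" | "y = v" | "y = J v" | "y \<in> set r" | u where "u \<in> set r" "y = J u"
      by blast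
     thus ?thesis
     proof cases
      case 4
      have "J1 (J1 v) = v" using Cons.prems(1) gl(2) by (auto simp: joining_def)
      thus ?thesis using 4 Jv by auto
     next
      case 5
      thus ?thesis using Cons.prems(4)[of y] by auto
     next
      case 6
      have "u \<in> S" using 6 inr[of "J v"] S by auto
      hence "J1 (J1 u) = u" using Cons.prems(1) by (auto simp: joining_def)
      thus ?thesis using 6 Cons.prems(4)[of u] by auto
     qed (use Cons.prems(2) J1t Jv in auto)
    qed
    thus ?thesis using nin \<open>x \<in> ?S\<close> by auto
   qed
   have "J1 x \<notin> {s, t, v, J v} \<union> set r \<union> J ` set r" using a[of "J1 x"] x(3) by auto
   thus ?thesis using x(2) S sub[of "J v"] by auto
  qed
  have jS: "joining ?S J1 B1" using Cons.prems(1) cl S by (auto simp: joining_def)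
  show ?thesis
   by (rule gluing_value_cong[OF jS g, symmetric]) (use nin J1t Jv in auto)
 qed
 finally show ?case by simp
qed

end

section \<open>Boundary cycles\<close>

text \<open>Joins and gluings are two fixed-point-free involutions, and the boundary cycles are the
  orbits of the group that they generate.\<close>

locale two_involutions =
 fixes S :: "'s set" and J g :: "'s => 's"
 assumes fin: "finite S"
  and J: "\<And>s. s \<in> S ==> J s \<in> S \<and> J s ~= s \<and> J (J s) = s"
  and g: "\<And>s. s \<in> S ==> g s \<in> S \<and> g s ~= s \<and> g (g s) = s"
begin

definition alternating :: "'s list => bool" where
 "alternating ss \<longleftrightarrow> ss ~= [] \<and> even (length ss) \<and> distinct ss \<and> set ss \<subseteq> S \<and>
  (\<forall>i<length ss. ss ! (Suc i mod length ss) = (if even i then J else g) (ss ! i))"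

lemma alternating_next: "alternating ss ==> i < length ss ==>
 ss ! (Suc i mod length ss) = (if even i then J else g) (ss ! i)"
 by (simp add: alternating_def)

text \<open>Each entry is determined by the one before and the parity of the position, so lists with
  the same head agree as long as both last. The shorter one cannot end first: its return to the head
  would be a repetition within the longer one.\<close>

lemma alternating_unique:
 assumes a: "alternating ss" and b: "alternating ss'" and hd: "hd ss = hd ss'"
 shows "ss = ss'"
proof -
 have ne: "ss ~= []" "ss' ~= []" using a b by (auto simp: alternating_def)
 have eq: "i < length xs ==> i < length ys ==> xs ! i = ys ! i"
  if xs: "alternating xs" and ys: "alternating ys" and h: "hd xs = hd ys" for xs ys i
 proof (induction i)
  case 0
  thus ?case using h by (simp add: hd_conv_nth)
 next
  case (Suc i)
  thus ?case using alternating_next[OF xs, of i] alternating_next[OF ys, of i] by simp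
 qed
 have len: "length ys \<le> length xs"
  if xs: "alternating xs" and ys: "alternating ys" and h: "hd xs = hd ys" for xs ys
 proof (rule ccontr)
  assume "\<not> length ys \<le> length xs"
  hence l: "length xs < length ys" by simp
  have ne: "xs ~= []" using xs by (simp add: alternating_def)
  let ?m = "length xs - 1"
  have m: "?m < length xs" "Suc ?m = length xs" using ne by (auto simp: Suc_diff_1)
  have "ys ! length xs = xs ! 0"
   using alternating_next[OF xs m(1)] alternating_next[OF ys, of ?m] eq[OF xs ys h, of ?m] m l by simp
  also have "\<dots> = ys ! 0" using eq[OF xs ys h, of 0] ne l by (cases ys) simp_all
  finally show False
   using l ne ys nth_eq_iff_index_eq[of ys "length xs" 0] by (auto simp: alternating_def)
 qed
 have "length ss = length ss'" using len[OF a b hd] len[OF b a hd[symmetric]] by simp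
 thus ?thesis using eq[OF a b hd] by (intro nth_equalityI) auto
qed

lemma alternating_rotate:
 assumes a: "alternating ss" and k: "even k"
 shows "alternating (rotate k ss)"
proof -
 let ?n = "length ss"
 have n: "0 < ?n" "even ?n" using a by (auto simp: alternating_def)
 have "rotate k ss ! (Suc i mod ?n) = (if even i then J else g) (rotate k ss ! i)" if i: "i < ?n" for i
 proof -
  have "rotate k ss ! (Suc i mod ?n) = ss ! ((k + Suc i mod ?n) mod ?n)"
   using n by (simp add: nth_rotate)
  also have "(k + Suc i mod ?n) mod ?n = Suc ((k + i) mod ?n) mod ?n"
   by (simp add: mod_simps)
  also have "ss ! \<dots> = (if even ((k + i) mod ?n) then J else g) (ss ! ((k + i) mod ?n))"
   using n by (intro alternating_next[OF a]) simp
  also have "even ((k + i) mod ?n) \<longleftrightarrow> even i" using n k by (simp add: even_mod_2_iff dvd_mod_iff)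
  finally show ?thesis using i by (simp add: nth_rotate)
 qed
 thus ?thesis using a by (simp add: alternating_def)
qed

text \<open>The step at position \<open>i\<close> of the reversal is the step at position
  \<open>length ss - 2 - i\<close> taken backwards. As the length is even, both positions have the
  same parity, and an involution undoes itself.\<close>

lemma alternating_rev:
 assumes a: "alternating ss"
 shows "alternating (rev ss)"
proof -
 let ?n = "length ss"
 have n: "0 < ?n" "even ?n" and sub: "set ss \<subseteq> S" using a by (auto simp: alternating_def)
 have "rev ss ! (Suc i mod ?n) = (if even i then J else g) (rev ss ! i)" if i: "i < ?n" for i
 proof (cases "Suc i = ?n")
  case True
  have "ss ! 0 = g (ss ! (?n - 1))"
   using alternating_next[OF a, of "?n - 1"] n True by (auto simp: Suc_diff_1)
  moreover have "ss ! (?n - 1) \<in> S" using sub n nth_mem[of "?n - 1" ss] by auto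
  ultimately have "g (ss ! 0) = ss ! (?n - 1)" using g by simp
  moreover have "odd i" using True n by (metis even_Suc)
  ultimately show ?thesis using True n i by (simp add: rev_nth)
 next
  case False
  let ?j = "?n - 2 - i"
  have j: "?j < ?n" "Suc ?j = ?n - 1 - i" "Suc ?j < ?n" using i False n by auto
  have "ss ! (?n - 1 - i) = (if even ?j then J else g) (ss ! ?j)"
   using alternating_next[OF a j(1)] j by simp
  moreover have "even ?j \<longleftrightarrow> even i"
  proof -
   have "?j + i + 2 = ?n" using i False by simp
   hence "even (?j + i + 2)" using n(2) by simp
   thus ?thesis by simp
  qed
  moreover have "ss ! ?j \<in> S" using sub j nth_mem[of ?j ss] by auto
  ultimately have b: "ss ! ?j = (if even i then J else g) (ss ! (?n - 1 - i))"
   using g J by (cases "even i") simp_all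
  have "rev ss ! (Suc i mod ?n) = ss ! ?j" using i False by (simp add: rev_nth)
  also have "\<dots> = (if even i then J else g) (rev ss ! i)" unfolding b using i by (simp add: rev_nth)
  finally show ?thesis .
 qed
 thus ?thesis using a by (simp add: alternating_def)
qed

text \<open>If the new head sits at an even position of \<open>ss\<close>, the step after it is a
  join and a rotation suffices. At an odd position its join leads backwards, so the list has to be
  reversed.\<close>

lemma alternating_same_cycle:
 assumes a: "alternating ss" and b: "alternating ss'" and hd: "hd ss' \<in> set ss"
 shows "\<exists>k. even k \<and> (ss' = rotate k ss \<or> ss' = rotate k (rev ss))"
proof -
 have ne: "ss ~= []" and ev: "even (length ss)" using a by (auto simp: alternating_def)
 obtain i where i: "i < length ss" "ss ! i = hd ss'" using hd by (auto simp: in_set_conv_nth)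
 show ?thesis
 proof (cases "even i")
  case True
  have "hd (rotate i ss) = hd ss'" using i ne by (simp add: hd_rotate_conv_nth)
  hence "ss' = rotate i ss" using alternating_unique[OF alternating_rotate[OF a True] b] by simp
  thus ?thesis using True by blast
 next
  case False
  let ?j = "length ss - 1 - i"
  have j: "even ?j" "?j < length ss" using False ev i by auto
  have "hd (rotate ?j (rev ss)) = hd ss'" using i ne j by (simp add: hd_rotate_conv_nth rev_nth)
  hence "ss' = rotate ?j (rev ss)"
   using alternating_unique[OF alternating_rotate[OF alternating_rev[OF a] j(1)] b] by simp
  thus ?thesis using j by blast
 qed
qed

text \<open>The step after \<open>s\<close> in \<open>ss\<close> uses one of the involutions; in the
  reversed list \<open>s\<close> has a position of the other parity, and the step after it uses the
  other one.\<close>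

lemma alternating_closed:
 assumes a: "alternating ss" and s: "s \<in> set ss"
 shows "J s \<in> set ss" "g s \<in> set ss"
proof -
 have n: "0 < length ss" and sub: "set ss \<subseteq> S" using a by (auto simp: alternating_def)
 obtain i where i: "i < length ss" "ss ! i = s" using s by (auto simp: in_set_conv_nth)
 obtain ss' j where b: "alternating ss'" "set ss' = set ss" "j < length ss'" "ss' ! j = s" "even j ~= even i"
 proof (rule that[of "rev ss" "length ss - 1 - i"])
  show "alternating (rev ss)" by (rule alternating_rev[OF a])
  show "even (length ss - 1 - i) ~= even i" using a i by (auto simp: alternating_def)
 qed (use i in \<open>auto simp: rev_nth\<close>)
 have "ss ! (Suc i mod length ss) \<in> set ss" using n by (intro nth_mem) simp
 moreover have "ss' ! (Suc j mod length ss') \<in> set ss" unfolding b(2)[symmetric] using b(3) by (intro nth_mem mod_less_divisor) linarith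
 ultimately show "J s \<in> set ss" "g s \<in> set ss"
  using alternating_next[OF a i(1)] alternating_next[OF b(1,3)] i b by (auto split: if_splits)
qed

text \<open>A longest chain of alternate joins and gluings closes up.\<close>

lemma alternating_exists:
 assumes s0: "s0 \<in> S"
 shows "\<exists>ss. alternating ss"
proof -
 let ?full = "%us. concat (map (%v. [v, J v]) us)"
 let ?chain = "%us. us ~= [] \<and> set us \<subseteq> S \<and> distinct (?full us) \<and> (\<forall>i. Suc i < length us \<longrightarrow> us ! Suc i = g (J (us ! i)))"
 have set_full: "set (?full us) = set us \<union> J ` set us" for us by auto
 have len_full: "length (?full us) = 2 * length us" for us by (induction us) auto
 have c0: "?chain [s0]" using s0 J[OF s0] by simp metis
 have cb: "length us \<le> card S" if "?chain us" for us
 proof -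
  have "distinct (?full us) ==> distinct us" by (induction us) auto
  hence "distinct us" using that by simp
  thus ?thesis using that fin by (metis card_mono distinct_card)
 qed
 have "\<exists>us. ?chain us \<and> (\<forall>vs. ?chain vs \<longrightarrow> length vs \<le> length us)"
  by (rule ex_has_greatest_nat[of ?chain "[s0]" length "Suc (card S)"], rule c0,
    intro allI impI, rule le_imp_less_Suc, rule cb)
 then obtain us where both: "?chain us \<and> (\<forall>vs. ?chain vs \<longrightarrow> length vs \<le> length us)" ..
 have us: "?chain us" by (rule conjunct1[OF both])
 have max: "\<forall>vs. ?chain vs \<longrightarrow> length vs \<le> length us" by (rule conjunct2[OF both])
 let ?n = "length us"
 have n: "0 < ?n" and sub: "set us \<subseteq> S" and dist: "distinct (?full us)"
  and step: "\<And>i. Suc i < ?n ==> us ! Suc i = g (J (us ! i))" using us by auto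
 have inS: "us ! i \<in> S" if "i < ?n" for i using that sub nth_mem by blast
 have full_nth: "?full us ! (2 * i) = us ! i" "?full us ! (Suc (2 * i)) = J (us ! i)" if "i < ?n" for i
  using that by (induction us arbitrary: i) (auto simp: nth_Cons split: nat.split)
 have no_cross: "us ! i ~= J (us ! j)" if "i < ?n" "j < ?n" for i j
  using nth_eq_iff_index_eq[OF dist, of "2 * i" "Suc (2 * j)"] full_nth[OF that(1)] full_nth[OF that(2)] that
  by (simp add: len_full) presburger
 have inj: "us ! i = us ! j \<longleftrightarrow> i = j" if "i < ?n" "j < ?n" for i j
  using nth_eq_iff_index_eq[OF dist, of "2 * i" "2 * j"] full_nth[OF that(1)] full_nth[OF that(2)] that
  by (simp add: len_full)
 let ?l = "us ! (?n - 1)"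
 let ?t = "g (J ?l)"
 have l: "?l \<in> S" "J ?l \<in> S" "?t \<in> S" using inS[of "?n - 1"] n J g by auto
 \<comment> \<open>Otherwise \<open>?t\<close> could be appended: its join partner would be new as
   well, because the listed sides are closed under \<open>J\<close>.\<close>
 have "?t \<in> set (?full us)"
 proof (rule ccontr)
  assume t: "?t \<notin> set (?full us)"
  have "J ?t \<notin> set (?full us)"
  proof
   assume "J ?t \<in> set (?full us)"
   hence "J (J ?t) \<in> set (?full us)" using sub J unfolding set_full by auto
   thus False using t J l by simp
  qed
  moreover have "(us @ [?t]) ! Suc i = g (J ((us @ [?t]) ! i))" if i: "Suc i < length (us @ [?t])" for i
  proof (cases "Suc i = ?n")
   case True
   hence "i = ?n - 1" "i < ?n" by auto
   thus ?thesis using True by (simp add: nth_append)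
  next
   case False
   hence "Suc i < ?n" using i by simp
   thus ?thesis using step[of i] by (simp add: nth_append)
  qed
  moreover have "distinct (?full (us @ [?t]))"
   using dist t calculation(1) J[OF l(3), THEN conjunct2, THEN conjunct1, symmetric] by simp
  ultimately have "?chain (us @ [?t])" using sub l by simp
  hence "length (us @ [?t]) \<le> length us" by (rule max[rule_format])
  thus False by simp
 qed
 then obtain i where i: "i < ?n" "?t = us ! i \<or> ?t = J (us ! i)"
  unfolding set_full by (auto simp: in_set_conv_nth)
 \<comment> \<open>A return to a later entry would force the last entry to equal an earlier one. A
   return to some \<open>J (us ! i)\<close> would either put the join partner of the last entry
   among the entries or be a fixed point of \<open>g\<close>.\<close>
 have close: "?t = us ! 0"
  using i(2)
 proof
  assume t: "?t = us ! i"
  show ?thesis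
  proof (cases i)
   case (Suc k)
   hence "g (J (us ! k)) = g (J ?l)" using t step[of k] i by simp
   hence "us ! k = ?l" using g J inS[of k] l i Suc by (metis Suc_lessD)
   hence "k = ?n - 1" using inj[of k "?n - 1"] i Suc n by simp
   thus ?thesis using i Suc by simp
  qed (use t in simp)
 next
  assume t: "?t = J (us ! i)"
  show ?thesis
  proof (cases "Suc i < ?n")
   case True
   have "us ! Suc i = g ?t" using step[OF True] t by simp
   also have "\<dots> = J ?l" using g l by simp
   finally have "us ! Suc i = J ?l" .
   moreover have "?n - 1 < ?n" using n by simp
   ultimately show ?thesis using no_cross[of "Suc i" "?n - 1"] True by simp
  next
   case False
   hence "i = ?n - 1" using i by simp
   thus ?thesis using t g[OF l(2)] by simp
  qed
 qed
 have "?full us ! (Suc i mod length (?full us)) = (if even i then J else g) (?full us ! i)"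
  if i: "i < length (?full us)" for i
 proof (cases "even i")
  case True
  then obtain k where k: "i = 2 * k" by (elim evenE)
  thus ?thesis using i full_nth[of k] by (simp add: len_full)
 next
  case False
  then obtain k where k: "i = Suc (2 * k)" by (elim oddE) simp
  hence kn: "k < ?n" using i by (simp add: len_full)
  show ?thesis
  proof (cases "Suc k < ?n")
   case True
   have "Suc i mod (2 * ?n) = 2 * Suc k" using k True by simp
   thus ?thesis
    using full_nth(1)[OF True] full_nth(2)[OF kn] step[OF True] k by (simp add: len_full)
  next
   case False
   hence "k = ?n - 1" using kn by simp
   moreover have "Suc i mod (2 * ?n) = 0"
   proof -
    have "Suc i = 2 * ?n" using k n \<open>k = ?n - 1\<close> by arith
    thus ?thesis by simp
   qed
   ultimately show ?thesis
    using full_nth(1)[OF n] full_nth(2)[OF kn] close k by (simp add: len_full)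
  qed
 qed
 moreover have "set (?full us) \<subseteq> S" unfolding set_full using sub J by auto
 ultimately have "alternating (?full us)"
  using n dist len_full[of us] by (simp add: alternating_def)
 thus ?thesis ..
qed

lemma alternating_pairs:
 assumes a: "alternating ss"
 shows "\<exists>us. ss = concat (map (%v. [v, J v]) us) \<and> us ~= []"
proof -
 have "\<exists>us. xs = concat (map (%v. [v, J v]) us)"
  if "even (length xs)" "\<forall>i<length xs. even i \<longrightarrow> xs ! Suc i = J (xs ! i)" for xs
  using that
 proof (induction xs rule: induct_list012)
  case (3 x y zs)
  have "y = J x" using 3(4) by (auto dest: spec[of _ 0])
  moreover have "\<exists>us. zs = concat (map (%v. [v, J v]) us)"
  proof (rule 3(1))
   show "\<forall>i<length zs. even i \<longrightarrow> zs ! Suc i = J (zs ! i)"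
   proof (intro allI impI)
    fix i assume "i < length zs" "even i"
    thus "zs ! Suc i = J (zs ! i)" using 3(4)[rule_format, of "Suc (Suc i)"] by simp
   qed
  qed (use 3(3) in simp)
  ultimately obtain us where "x # y # zs = concat (map (%v. [v, J v]) (x # us))" by auto
  thus ?case ..
 qed (auto intro: exI[of _ "[]"])
 moreover have "ss ! Suc i = J (ss ! i)" if "i < length ss" "even i" for i
 proof -
  have "Suc i < length ss" using that a by (metis Suc_lessI alternating_def even_Suc)
  thus ?thesis using alternating_next[OF a that(1)] that by simp
 qed
 ultimately have "\<exists>us. ss = concat (map (%v. [v, J v]) us)" using a by (simp add: alternating_def)
 then obtain us where "ss = concat (map (%v. [v, J v]) us)" ..
 thus ?thesis using a by (auto simp: alternating_def)
qed

end

text \<open>The complement of a cycle is closed under both involutions, so cycles can be split off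
  by induction on the number of sides.\<close>

lemma alternating_partition:
 assumes "two_involutions S J g"
 shows "\<exists>css. (\<forall>ss\<in>set css. two_involutions.alternating S J g ss) \<and> distinct (concat css) \<and> set (concat css) = S"
 using assms
proof (induction "card S" arbitrary: S rule: less_induct)
 case less
 interpret two_involutions S J g by (rule less.prems)
 show ?case
 proof (cases "S = {}")
  case True
  thus ?thesis by (intro exI[of _ "[]"]) simp
 next
  case False
  then obtain ss where ss: "alternating ss" using alternating_exists by blast
  let ?R = "S - set ss"
  have sub: "set ss \<subseteq> S" "ss ~= []" using ss by (auto simp: alternating_def)
  have cl: "J s \<in> ?R" "g s \<in> ?R" if "s \<in> ?R" for s
   using that J[of s] g[of s] alternating_closed[OF ss, of "J s"] alternating_closed[OF ss, of "g s"] by auto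
  have R: "two_involutions ?R J g"
   by unfold_locales (use fin J g cl in auto)
  have "hd ss \<in> set ss" using sub by simp
  hence "?R \<subset> S" using sub by blast
  hence "card ?R < card S" using fin by (intro psubset_card_mono)
  from less.hyps[OF this R] obtain css where css:
   "\<And>xs. xs \<in> set css ==> two_involutions.alternating ?R J g xs" "distinct (concat css)" "set (concat css) = ?R"
   by blast
  have "alternating xs" if "xs \<in> set css" for xs
   using css(1)[OF that] unfolding two_involutions.alternating_def[OF R] alternating_def by auto
  thus ?thesis
  proof (intro exI[of _ "ss # css"] conjI)
   show "distinct (concat (ss # css))" using ss css by (auto simp: alternating_def)
  qed (use ss css sub in auto)
 qed
qed

section \<open>Cyclic words, trails and their reversal\<close>

lemma cyclic_class_rotate: "cyclic_class (rotate k w) = cyclic_class w"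
proof -
 have "\<exists>j. rotate i w = rotate (j + k) w" for i
 proof (cases "w = []")
  case False
  \<comment> \<open>Rotation by \<open>length w * k\<close> is the identity, so
    \<open>length w * k - k\<close> is a natural number whose rotation inverts that by
    \<open>k\<close>.\<close>
  have "rotate (i + (length w * k - k) + k) w = rotate i w"
  proof -
   have "k \<le> length w * k" using False by (cases w) auto
   hence "i + (length w * k - k) + k = i + length w * k"
    by (simp only: add.assoc le_add_diff_inverse2)
   thus ?thesis by (metis mod_mult_self2 rotate_conv_mod)
  qed
  thus ?thesis by metis
 qed simp
 thus ?thesis by (fastforce simp: cyclic_class_def rotate_rotate)
qed

lemma flip_step_involution [simp]: "flip_step (flip_step s) = s"
 by (cases s) auto

lemma cyclic_class_rev_rotate: "cyclic_class (rev (map f (rotate k w))) = cyclic_class (rev (map f w))"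
proof -
 have "rev (map f (rotate k w)) = rotate (length w - k mod length w) (rev (map f w))"
 proof (cases "w = []")
  case False
  have "rotate (length w - k mod length w) (rev (map f w)) = rev (rotate (length w - (length w - k mod length w) mod length w) (map f w))"
   by (simp add: rotate_rev)
  also have "rotate (length w - (length w - k mod length w) mod length w) (map f w) = rotate k (map f w)"
  proof (cases "k mod length w = 0")
   case True
   hence "rotate k (map f w) = map f w" by (metis length_map rotate_id)
   thus ?thesis using True by simp
  next
   case 2: False
   have "(length w - k mod length w) mod length w = length w - k mod length w" using 2 False by simp
   moreover have "length w - (length w - k mod length w) = k mod length w" using False by (simp add: less_imp_le)
   ultimately show ?thesis by (metis length_map rotate_conv_mod)
  qed
  finally show ?thesis by (simp add: rotate_map)
 qed simp
 thus ?thesis by (simp add: cyclic_class_rotate)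
qed

definition trail_class :: "trail_step list => trail_step list set" where
 "trail_class w = cyclic_class w \<union> cyclic_class (rev (map flip_step w))"

lemma trail_class_rotate: "trail_class (rotate k w) = trail_class w"
 by (simp add: trail_class_def cyclic_class_rotate cyclic_class_rev_rotate)

lemma trail_class_rev: "trail_class (rev (map flip_step w)) = trail_class w"
 by (auto simp: trail_class_def rev_map[symmetric] comp_def)

lemma length_trail_word [simp]: "length (trail_word ss) = length ss"
 by (simp add: trail_word_def)

lemma nth_trail_word:
 "i < length ss ==> trail_word ss ! i =
  (if odd i then Glue (fst (ss ! i)) (fst (ss ! (Suc i mod length ss)))
  else if snd (ss ! i) then Fwd (fst (ss ! i)) (fst (ss ! (Suc i mod length ss)))
  else Bwd (fst (ss ! i)) (fst (ss ! (Suc i mod length ss))))"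
 by (simp add: trail_word_def Let_def)

lemma trail_word_rotate:
 assumes "even (length ss)" "even k"
 shows "trail_word (rotate k ss) = rotate k (trail_word ss)"
proof (rule nth_equalityI)
 fix i assume "i < length (trail_word (rotate k ss))"
 hence i: "i < length ss" by simp
 hence n: "0 < length ss" by auto
 have e: "even ((k + i) mod length ss) \<longleftrightarrow> even i" using assms by (simp add: even_mod_2_iff dvd_mod_iff)
 have s: "(k + Suc i mod length ss) mod length ss = Suc ((k + i) mod length ss) mod length ss"
  by (simp add: mod_simps)
 show "trail_word (rotate k ss) ! i = rotate k (trail_word ss) ! i"
  using i n by (simp add: nth_trail_word nth_rotate e s)
qed simp

text \<open>The word of a traversal starts with a join, while its reversal starts with the last
  gluing; hence the rotation by one. The hypothesis on signs says that a join links sides of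
  opposite sign, so that reading it backwards exchanges \<open>Fwd\<close> and
  \<open>Bwd\<close>.\<close>

lemma trail_word_rev:
 assumes ev: "even (length ss)"
  and flip: "\<And>i. i < length ss ==> even i ==> snd (ss ! Suc i) ~= snd (ss ! i)"
 shows "trail_word (rev ss) = rotate 1 (rev (map flip_step (trail_word ss)))"
proof (rule nth_equalityI)
 fix i assume "i < length (trail_word (rev ss))"
 hence i: "i < length ss" by simp
 let ?n = "length ss"
 show "trail_word (rev ss) ! i = rotate 1 (rev (map flip_step (trail_word ss))) ! i"
 proof (cases "Suc i = ?n")
  case True
  hence "odd i" "?n - 1 = i" "odd (?n - 1)" using ev by (metis even_Suc, simp, metis diff_Suc_1 even_Suc)
  moreover have "0 < ?n" using i by linarith
  ultimately show ?thesis using True i by (simp add: nth_trail_word nth_rotate1 rev_nth)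
 next
  case False
  let ?j = "?n - Suc (Suc i)"
  have j: "Suc ?j = ?n - Suc i" "Suc ?j < ?n" using i False by auto
  have e: "even ?j \<longleftrightarrow> even i"
  proof -
   have "?j + i + 2 = ?n" using i False by simp
   hence "even (?j + i + 2)" using ev by simp
   thus ?thesis by simp
  qed
  have m: "Suc i mod ?n = Suc i" "Suc ?j mod ?n = ?n - Suc i" using i False j by auto
  have f: "even i ==> snd (ss ! (?n - Suc i)) ~= snd (ss ! ?j)" using flip[of ?j] e j by simp
  show ?thesis using i False j m e f by (auto simp: nth_trail_word nth_rotate1 rev_nth)
 qed
qed simp

text \<open>The half-edge whose positive side takes part in a join. The labels along a word are
  invariant under rotation and reversal, and those of distinct boundary cycles are disjoint, which
  is how their trails are told apart.\<close>

definition step_labels :: "trail_step => nat set" where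
 "step_labels s = (case s of Fwd k k' => {k} | Bwd k k' => {k'} | Glue k k' => {})"

lemma step_labels_flip [simp]: "step_labels (flip_step s) = step_labels s"
 by (cases s) (auto simp: step_labels_def)

lemma labels_cyclic_class: "w' \<in> cyclic_class w ==> \<Union>(step_labels ` set w') = \<Union>(step_labels ` set w)"
 by (auto simp: cyclic_class_def)

lemma labels_trail_class: "w' \<in> trail_class w ==> \<Union>(step_labels ` set w') = \<Union>(step_labels ` set w)"
proof -
 have eq: "\<Union>(step_labels ` set (rev (map flip_step w))) = \<Union>(step_labels ` set w)"
  by (simp add: image_image)
 assume "w' \<in> trail_class w"
 then consider "w' \<in> cyclic_class w" | "w' \<in> cyclic_class (rev (map flip_step w))"
  by (auto simp: trail_class_def)
 thus ?thesis
 proof cases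
  case 1
  thus ?thesis by (rule labels_cyclic_class)
 next
  case 2
  show ?thesis using labels_cyclic_class[OF 2] eq by (rule trans)
 qed
qed

lemma mem_cyclic_class [simp]: "w \<in> cyclic_class w"
 unfolding cyclic_class_def by (rule CollectI, rule exI[of _ 0]) simp

lemma mem_trail_class [simp]: "w \<in> trail_class w"
 by (simp add: trail_class_def)

section \<open>Products along boundary cycles\<close>

context gluing begin

text \<open>The semigroup has no unit to start from, so the fold starts at the head of the
  list.\<close>

definition list_mul :: "'m list => 'm" where
 "list_mul xs = foldl (\<odot>) (hd xs) (tl xs)"

lemma foldl_mul: "foldl (\<odot>) (x \<odot> y) zs = x \<odot> foldl (\<odot>) y zs"
 by (induction zs arbitrary: y) (simp_all add: mul_assoc)

lemma list_mul_append: "xs ~= [] ==> ys ~= [] ==> list_mul (xs @ ys) = list_mul xs \<odot> list_mul ys"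
 by (cases xs; cases ys) (simp_all add: list_mul_def foldl_mul)

lemma z_list_mul_rotate: "z (list_mul (rotate k xs)) = z (list_mul xs)"
proof (cases "k mod length xs = 0 \<or> xs = []")
 case True
 thus ?thesis by (auto simp: rotate_drop_take)
next
 case False
 hence "drop (k mod length xs) xs ~= []" "take (k mod length xs) xs ~= []"
  by (auto simp: not_le)
 thus ?thesis
  using list_mul_append[of "drop (k mod length xs) xs" "take (k mod length xs) xs"]
   list_mul_append[of "take (k mod length xs) xs" "drop (k mod length xs) xs"] z_comm
  by (simp add: rotate_drop_take)
qed

lemma list_mul_rev: "xs ~= [] ==> list_mul (rev (map st xs)) = st (list_mul xs)"
proof (induction xs)
 case (Cons x xs)
 show ?case
 proof (cases "xs = []")
  case True
  thus ?thesis by (simp add: list_mul_def)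
 next
  case False
  have "list_mul (x # xs) = x \<odot> list_mul xs"
   using list_mul_append[of "[x]" xs] False by (simp add: list_mul_def)
  moreover have "list_mul (rev (map st (x # xs))) = list_mul (rev (map st xs)) \<odot> st x"
   using list_mul_append[of "rev (map st xs)" "[st x]"] False by (simp add: list_mul_def)
  ultimately show ?thesis using Cons.IH[OF False] by (simp add: st_mul)
 qed
qed simp

definition cycle_word :: "('s => 'm) => ('s => 'm) => 's list => 'm" where
 "cycle_word B H ss = list_mul (map (%i. if even i then B (ss ! i) else H (ss ! i)) [0..<length ss])"

lemma cycle_word_pairs:
 "cycle_word B H (concat (map (%v. [v, J v]) us)) = list_mul (concat (map (%v. [B v, H (J v)]) us))"
proof -
 have "map (%i. if even i then B (ss ! i) else H (ss ! i)) [0..<length ss] = concat (map (%v. [B v, H (J v)]) us)"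
  if "ss = concat (map (%v. [v, J v]) us)" for ss
  using that
 proof (induction us arbitrary: ss)
  case (Cons u us)
  define r where "r = concat (map (%v. [v, J v]) us)"
  have "[0..<length ss] = 0 # 1 # map (%i. i + 2) [0..<length r]"
  proof -
   have "length ss = Suc (Suc (length r))" using Cons.prems by (simp add: r_def)
   thus ?thesis by (intro nth_equalityI) (auto simp: nth_Cons simp del: upt_Suc split: nat.split)
  qed
  moreover have ss: "ss = u # J u # r" using Cons.prems by (simp add: r_def)
  ultimately show ?case unfolding ss using Cons.IH[OF r_def] by (simp add: comp_def del: upt_Suc cong: if_cong)
 qed simp
 thus ?thesis by (simp add: cycle_word_def)
qed

lemma chain_word_list_mul:
 "chain_word J B H x t r = list_mul ([x, H t] @ concat (map (%v. [B v, H (J v)]) r))"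
 by (induction r arbitrary: x t) (simp_all add: list_mul_def)

text \<open>The even positions hold the sides from which joins start; the gluings of the cycle lead
  from the join partner of one of them to the next.\<close>

definition cycle_glues :: "('s => 's) => ('s => 'm) => 's list => ('s \<times> 's \<times> 'm) list" where
 "cycle_glues J H ss = chain_glues J H (hd ss) (J (hd ss)) (tl (map (%i. ss ! (2 * i)) [0..<length ss div 2]))"

lemma mset_chain_glues:
 "mset (glue_sides (chain_glues J H s t r)) = mset (s # t # concat (map (%v. [v, J v]) r))"
 by (induction r arbitrary: t) auto

lemma evens_pairs: "map (%i. concat (map (%v. [v, J v]) us) ! (2 * i)) [0..<length us] = us"
proof (rule nth_equalityI)
 fix i assume "i < length (map (%i. concat (map (%v. [v, J v]) us) ! (2 * i)) [0..<length us])"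
 hence "i < length us" by simp
 hence "concat (map (%v. [v, J v]) us) ! (2 * i) = us ! i"
  by (induction us arbitrary: i) (auto simp: nth_Cons split: nat.split)
 thus "map (%i. concat (map (%v. [v, J v]) us) ! (2 * i)) [0..<length us] ! i = us ! i"
  using \<open>i < length us\<close> by simp
qed simp

lemma cycle_glues_pairs:
 assumes "ss = concat (map (%v. [v, J v]) (u # us))"
 shows "cycle_glues J H ss = chain_glues J H u (J u) us"
proof -
 have "length ss div 2 = length (u # us)"
 proof -
  have "length (concat (map (%v. [v, J v]) vs)) = 2 * length vs" for vs by (induction vs) auto
  thus ?thesis unfolding assms by simp
 qed
 thus ?thesis
  unfolding cycle_glues_def using evens_pairs[of J "u # us"] assms by simp
qed

lemma compatible_append: "compatible g H (xs @ ys) \<longleftrightarrow> compatible g H xs \<and> compatible g H ys"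
 by (simp add: compatible_def ball_Un)

lemma compatible_chain:
 assumes "\<forall>i<length r. r ! i = g ((t # map J r) ! i)" "s = g (last (t # map J r))"
  and "\<And>v. v \<in> set (s # t # r) \<union> J ` set r ==> g (g v) = v \<and> H (g v) = st (H v)"
 shows "compatible g H (chain_glues J H s t r)"
 using assms
proof (induction r arbitrary: t)
 case Nil
 thus ?case by (simp add: compatible_def)
next
 case (Cons v r)
 have v: "v = g t" using Cons.prems(1) by (auto dest: spec[of _ 0])
 have "compatible g H (chain_glues J H s (J v) r)"
 proof (rule Cons.IH)
  show "\<forall>i<length r. r ! i = g ((J v # map J r) ! i)" using Cons.prems(1) by auto
  show "s = g (last (J v # map J r))" using Cons.prems(2) by simp
  show "\<And>v'. v' \<in> set (s # J v # r) \<union> J ` set r ==> g (g v') = v' \<and> H (g v') = st (H v')"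
   using Cons.prems(3) by auto
 qed
 moreover have "g v = t" "H v = st (H t)" using v Cons.prems(3)[of t] by auto
 ultimately show ?case using v by (simp add: compatible_def)
qed

text \<open>All listings of the same gluings have the same value, so \<open>gs\<close> may be
  replaced by the list that goes around the cycles one after the other. There each cycle splits off
  its trace.\<close>

theorem gluing_value_cycles:
 assumes inv: "two_involutions S J g"
  and jn: "joining S J B" and H: "\<And>s. s \<in> S ==> H (g s) = st (H s)"
  and gs: "glues S gs" "compatible g H gs"
  and css: "\<And>ss. ss \<in> set css ==> two_involutions.alternating S J g ss"
   "distinct (concat css)" "set (concat css) = S"
 shows "gluing_value gs J B = (\<Prod>ss\<in>set css. z (cycle_word B H ss))"
proof -
 interpret two_involutions S J g by (rule inv)
 have cyc: "mset (glue_sides (cycle_glues J H ss)) = mset ss" "compatible g H (cycle_glues J H ss)"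
  "\<exists>u us. ss = concat (map (%v. [v, J v]) (u # us))" if "ss \<in> set css" for ss
 proof -
  have a: "alternating ss" by (rule css(1)[OF that])
  obtain us' where "ss = concat (map (%v. [v, J v]) us')" "us' ~= []" using alternating_pairs[OF a] by blast
  then obtain u us where us: "ss = concat (map (%v. [v, J v]) (u # us))" by (cases us') auto
  show "\<exists>u us. ss = concat (map (%v. [v, J v]) (u # us))" using us by blast
  show "mset (glue_sides (cycle_glues J H ss)) = mset ss"
   by (simp only: cycle_glues_pairs[OF us] mset_chain_glues) (simp add: us)
  have sub: "set ss \<subseteq> S" using a by (simp add: alternating_def)
  have len: "length ss = 2 * length (u # us)" unfolding us by (induction us) auto
  have full: "ss ! (2 * i) = (u # us) ! i" "ss ! (Suc (2 * i)) = J ((u # us) ! i)" if "i < length (u # us)" for i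
  proof -
   have "concat (map (%v. [v, J v]) vs) ! (2 * i) = vs ! i \<and> concat (map (%v. [v, J v]) vs) ! (Suc (2 * i)) = J (vs ! i)"
    if "i < length vs" for vs i
    using that by (induction vs arbitrary: i) (auto simp: nth_Cons split: nat.split)
   thus "ss ! (2 * i) = (u # us) ! i" "ss ! (Suc (2 * i)) = J ((u # us) ! i)" using that us by blast+
  qed
  show "compatible g H (cycle_glues J H ss)"
   unfolding cycle_glues_pairs[OF us]
  proof (rule compatible_chain)
   show "\<forall>i<length us. us ! i = g ((J u # map J us) ! i)"
   proof (intro allI impI)
    fix i assume i: "i < length us"
    have "ss ! (2 * Suc i) = g (ss ! (Suc (2 * i)))"
     using alternating_next[OF a, of "Suc (2 * i)"] len i by simp
    moreover have "(J u # map J us) ! i = J ((u # us) ! i)" using i by (cases i) auto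
    ultimately show "us ! i = g ((J u # map J us) ! i)" using full(1)[of "Suc i"] full(2)[of i] i by simp
   qed
   have "ss ! 0 = g (ss ! (Suc (2 * length us)))"
    using alternating_next[OF a, of "Suc (2 * length us)"] len by simp
   moreover have "last (J u # map J us) = J ((u # us) ! length us)"
    by (metis (no_types) last_conv_nth length_map list.simps(3,9) nth_map length_Cons diff_Suc_1 lessI)
   ultimately show "u = g (last (J u # map J us))" using full(1)[of 0] full(2)[of "length us"] by simp
   fix v assume "v \<in> set (u # J u # us) \<union> J ` set us"
   hence "v \<in> S" using sub unfolding us by auto
   thus "g (g v) = v \<and> H (g v) = st (H v)" using g H by auto
  qed
 qed
 let ?L = "%cs. concat (map (cycle_glues J H) cs)"
 have ms: "mset (glue_sides (?L cs)) = mset (concat cs)" if "set cs \<subseteq> set css" for cs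
  using that by (induction cs) (auto simp: cyc(1))
 have cp: "compatible g H (?L cs)" if "set cs \<subseteq> set css" for cs
  using that by (induction cs) (auto simp: compatible_append cyc(2), simp add: compatible_def)
 have gl: "glues S (?L css)"
  using ms[of css] css(2,3) unfolding glues_def by (metis mset_eq_imp_distinct_iff mset_eq_setD order_refl)
 have "gluing_value gs J B = gluing_value (?L css) J B"
  by (rule gluing_value_compatible[OF jn gs(1) gl gs(2) cp]) simp
 also have "\<dots> = (\<Prod>ss\<leftarrow>css. z (cycle_word B H ss))"
 proof -
  have "gluing_value (?L cs) J B = (\<Prod>ss\<leftarrow>cs. z (cycle_word B H ss))"
   if "set cs \<subseteq> set css" "distinct (concat cs)" for cs
   using that
  proof (induction cs)
   case (Cons ss cs)
   obtain u us where us: "ss = concat (map (%v. [v, J v]) (u # us))" using cyc(3)[of ss] Cons.prems by auto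
   have cl: "J s \<in> set (concat (ss # cs))" if "s \<in> set (concat (ss # cs))" for s
    using that alternating_closed(1) css(1) Cons.prems(1) by fastforce
   have sub: "set (concat (ss # cs)) \<subseteq> S" using Cons.prems(1) css(3) by auto
   let ?S = "set (concat (ss # cs))"
   have jS: "joining ?S J B" using jn sub cl unfolding joining_def by blast
   have "glues ?S (?L (ss # cs))"
    using ms[OF Cons.prems(1)] Cons.prems(2) unfolding glues_def by (metis mset_eq_imp_distinct_iff mset_eq_setD)
   hence "gluing_value (?L (ss # cs)) J B = z (chain_word J B H (B u) (J u) us) * gluing_value (?L cs) J B"
    unfolding list.map concat.simps cycle_glues_pairs[OF us]
    by (intro gluing_value_chain[OF jS refl]) auto
   also have "chain_word J B H (B u) (J u) us = cycle_word B H ss"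
    unfolding us cycle_word_pairs chain_word_list_mul by simp
   finally show ?case using Cons by simp
  qed simp
  thus ?thesis using css(2) by simp
 qed
 also have "\<dots> = (\<Prod>ss\<in>set css. z (cycle_word B H ss))"
 proof -
  have "distinct css"
  proof -
   have "ss ~= []" if "ss \<in> set css" for ss using css(1)[OF that] by (simp add: alternating_def)
   thus ?thesis using css(2) distinct_concat_iff[of css] by (metis removeAll_id)
  qed
  thus ?thesis by (simp add: prod.distinct_set_conv_list)
 qed
 finally show ?thesis .
qed

end

section \<open>Gaussian contractions of Hermitian matrices\<close>

text \<open>Together with \<open>inner_star\<close> this yields
  \<open>re (a * b) = re (b * a)\<close>, so that multiplication by \<open>star h\<close> is adjoint
  to multiplication by \<open>h\<close> on either side.\<close>

class tracial_star_scalar = star_scalar +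
 assumes inner_star_star: "inner (star a) (star b) = inner a b"

instance real :: tracial_star_scalar by standard (simp add: star_real_def)
instance complex :: tracial_star_scalar by standard (simp add: star_complex_def inner_complex_def)
instance quat :: tracial_star_scalar by standard (simp add: star_quat_def inner_quat_def)

section \<open>Adjoints and conjugation of Hermitian matrices\<close>

lemma star_zero [simp]: "star (0::'a::star_scalar) = 0"
 using star_scaleR[of 0 "0::'a"] by simp

lemma star_sum: "star (sum f A) = (\<Sum>x\<in>A. star (f x :: 'a::star_scalar))"
 by (induction A rule: infinite_finite_induct) (auto simp: star_add)

lemma adj_mult: "adj (A ** B) = adj B ** adj (A :: 'a::star_scalar^'n^'n)"
 by (simp add: adj_def matrix_matrix_mult_def vec_eq_iff star_sum star_mult)

lemma adj_adj [simp]: "adj (adj A) = (A :: 'a::star_scalar^'n^'n)"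
 by (simp add: adj_def vec_eq_iff)

lemma adj_add: "adj (A + B) = adj A + adj (B :: 'a::star_scalar^'n^'n)"
 by (simp add: adj_def vec_eq_iff star_add)

lemma adj_scaleR: "adj (r *\<^sub>R A) = r *\<^sub>R adj (A :: 'a::star_scalar^'n^'n)"
 by (simp add: adj_def vec_eq_iff star_scaleR)

lemma adj_mat_of [simp]: "adj (mat_of M) = mat_of M"
 using mat_of[of M] by simp

definition conjugate :: "'a::star_scalar^'n^'n => ('a, 'n::finite) herm => ('a, 'n) herm" where
 "conjugate h e = Herm (h ** mat_of e ** adj h)"

lemma mat_of_conjugate: "mat_of (conjugate h e) = h ** mat_of e ** adj h"
 unfolding conjugate_def by (rule Herm_inverse) (simp add: adj_mult matrix_mul_assoc)

lemma matrix_scaleR_left: "(r *\<^sub>R A) ** B = r *\<^sub>R (A ** (B :: 'a::real_algebra_1^'n^'n))"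
 by (simp add: matrix_matrix_mult_def vec_eq_iff scaleR_sum_right)

lemma matrix_scaleR_right: "A ** (r *\<^sub>R B) = r *\<^sub>R (A ** (B :: 'a::real_algebra_1^'n^'n))"
 by (simp add: matrix_matrix_mult_def vec_eq_iff scaleR_sum_right)

lemma matrix_add_left: "(A + B) ** C = A ** C + B ** (C :: 'a::semiring_1^'n^'n)"
 by (simp add: matrix_matrix_mult_def vec_eq_iff distrib_right sum.distrib)

lemma matrix_add_right: "C ** (A + B) = C ** A + C ** (B :: 'a::semiring_1^'n^'n)"
 by (simp add: matrix_matrix_mult_def vec_eq_iff distrib_left sum.distrib)

lemma linear_conjugate: "linear (conjugate h)"
 by (rule linearI)
  (simp_all add: mat_of_inject[symmetric] mat_of_conjugate plus_herm.rep_eq scaleR_herm.rep_eq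
   matrix_add_left matrix_add_right matrix_scaleR_left matrix_scaleR_right)

lemma inner_adj_left: "inner (adj A) (adj B) = inner A (B :: 'a::tracial_star_scalar^'n^'n)"
proof -
 have "inner (adj A) (adj B) = (\<Sum>i\<in>UNIV. \<Sum>j\<in>UNIV. inner (A $ j $ i) (B $ j $ i))"
  by (simp add: inner_vec_def adj_def inner_star_star)
 also have "\<dots> = inner A B" unfolding inner_vec_def by (rule sum.swap)
 finally show ?thesis .
qed

text \<open>Against Hermitian matrices \<open>A\<close> acts through its Hermitian part
  \<open>(A + adj A) / 2\<close>; Parseval's identity in \<open>herm\<close> then gives the inner
  product of the two Hermitian parts.\<close>

lemma herm_basis_sum:
 fixes A B :: "'a::tracial_star_scalar^'n::finite^'n"
 shows "(\<Sum>e\<in>Basis. inner A (mat_of e) * inner B (mat_of (e :: ('a, 'n) herm))) = (inner A B + inner A (adj B)) / 2"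
proof -
 define H where "H = (%A :: 'a^'n^'n. Herm ((1/2) *\<^sub>R (A + adj A)))"
 have H: "mat_of (H A) = (1/2) *\<^sub>R (A + adj A)" for A
  unfolding H_def by (rule Herm_inverse) (simp add: adj_add adj_scaleR add.commute)
 have i: "inner (H A) e = inner A (mat_of e)" for A and e :: "('a, 'n) herm"
  using inner_adj_left[of A "mat_of e"] by (simp add: inner_herm_eq H inner_add_left)
 have "(\<Sum>e\<in>Basis. inner A (mat_of e) * inner B (mat_of (e :: ('a, 'n) herm))) = inner (H A) (H B)"
  unfolding i[symmetric] by (rule euclidean_inner[symmetric])
 also have "\<dots> = (inner A B + inner A (adj B)) / 2"
  using inner_adj_left[of A B] inner_adj_left[of A "adj B"]
  by (simp add: inner_herm_eq H inner_add_left inner_add_right field_simps)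
 finally show ?thesis .
qed

definition unit_matrix :: "'a::zero => 'n => 'n => 'a^'n^'n" where
 "unit_matrix u i j = (\<chi> k l. if k = i \<and> l = j then u else 0)"

lemma inner_unit_matrix: "inner (unit_matrix u i j) A = inner u (A $ i $ j)"
 for A :: "'a::real_inner^'n^'n"
proof -
 have "inner (unit_matrix u i j) A = (\<Sum>k\<in>UNIV. \<Sum>l\<in>UNIV. if k = i \<and> l = j then inner u (A $ i $ j) else 0)"
  unfolding inner_vec_def unit_matrix_def by (intro sum.cong) auto
 also have "\<dots> = (\<Sum>k\<in>UNIV. if k = i then inner u (A $ i $ j) else 0)"
  by (intro sum.cong) auto
 finally show ?thesis by simp
qed

lemma adj_unit_matrix: "adj (unit_matrix u i j) = unit_matrix (star u) j i"
 by (auto simp: adj_def unit_matrix_def vec_eq_iff)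

text \<open>Entries are extracted by pairing with matrix units, and the two terms come from a matrix
  unit and from its adjoint. Keeping the bilinear \<open>f\<close> general lets one statement cover
  products of entries and products with a quaternion in between.\<close>

lemma herm_entry_contraction:
 fixes f :: "'a::tracial_star_scalar => 'a => 'b::real_vector" and i j k l :: "'n::finite"
 assumes f1: "\<And>b. linear (%a. f a b)" and f2: "\<And>a. linear (f a)"
 shows "(\<Sum>e\<in>Basis. f (mat_of (e :: ('a, 'n) herm) $ i $ j) (mat_of e $ k $ l))
  = (1/2) *\<^sub>R ((if i = k \<and> j = l then (\<Sum>u\<in>Basis. f u u) else 0)
    + (if i = l \<and> j = k then (\<Sum>u\<in>Basis. f (star u) u) else 0))"
proof -
 have er: "(\<Sum>u\<in>Basis. inner u a *\<^sub>R u) = a" for a :: 'a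
  by (rule euclidean_representation[of a, unfolded inner_commute[of a]])
 have rep: "f a b = (\<Sum>u\<in>Basis. \<Sum>v\<in>Basis. (inner u a * inner v b) *\<^sub>R f u v)" for a b
 proof -
  have "f a b = f (\<Sum>u\<in>Basis. inner u a *\<^sub>R u) b" by (simp add: er)
  also have "\<dots> = (\<Sum>u\<in>Basis. inner u a *\<^sub>R f u b)"
   by (simp add: linear_sum[OF f1] linear_scale[OF f1])
  also have "\<dots> = (\<Sum>u\<in>Basis. inner u a *\<^sub>R f u (\<Sum>v\<in>Basis. inner v b *\<^sub>R v))"
   by (simp add: er)
  also have "\<dots> = (\<Sum>u\<in>Basis. \<Sum>v\<in>Basis. (inner u a * inner v b) *\<^sub>R f u v)"
   by (simp add: linear_sum[OF f2] linear_scale[OF f2] scaleR_sum_right)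
  finally show ?thesis .
 qed
 define P Q where "P \<longleftrightarrow> i = k \<and> j = l" and "Q \<longleftrightarrow> i = l \<and> j = k"
 have c: "(\<Sum>e\<in>Basis. inner u (mat_of (e :: ('a, 'n) herm) $ i $ j) * inner v (mat_of e $ k $ l))
   = ((if P then inner u v else 0) + (if Q then inner u (star v) else 0)) / 2" for u v :: 'a
 proof -
  have "unit_matrix v k l $ i $ j = (if P then v else 0)" "unit_matrix (star v) l k $ i $ j = (if Q then star v else 0)"
   unfolding P_def Q_def unit_matrix_def vec_lambda_beta by (rule refl)+
  thus ?thesis
   using herm_basis_sum[of "unit_matrix u i j" "unit_matrix v k l"]
   unfolding inner_unit_matrix adj_unit_matrix by (cases P; cases Q; simp)
 qed
 have "(\<Sum>e\<in>Basis. f (mat_of (e :: ('a, 'n) herm) $ i $ j) (mat_of e $ k $ l))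
  = (\<Sum>e\<in>Basis. \<Sum>u\<in>Basis. \<Sum>v\<in>Basis. (inner u (mat_of (e :: ('a, 'n) herm) $ i $ j) * inner v (mat_of e $ k $ l)) *\<^sub>R f u v)"
  by (simp only: rep[symmetric])
 also have "\<dots> = (\<Sum>u\<in>Basis. \<Sum>v\<in>Basis. \<Sum>e\<in>Basis. (inner u (mat_of (e :: ('a, 'n) herm) $ i $ j) * inner v (mat_of e $ k $ l)) *\<^sub>R f u v)"
  by (subst sum.swap) (intro sum.cong refl sum.swap)
 also have "\<dots> = (\<Sum>u\<in>Basis. \<Sum>v\<in>Basis. (((if P then inner u v else 0) + (if Q then inner u (star v) else 0)) / 2) *\<^sub>R f u v)"
  unfolding scaleR_sum_left[symmetric] c ..
 also have "\<dots> = (1/2) *\<^sub>R ((if P then (\<Sum>u\<in>Basis. \<Sum>v\<in>Basis. inner u v *\<^sub>R f u v) else 0)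
    + (if Q then (\<Sum>u\<in>Basis. \<Sum>v\<in>Basis. inner u (star v) *\<^sub>R f u v) else 0))"
  by (cases P; cases Q; simp add: scaleR_sum_right sum.distrib scaleR_add_left add_divide_distrib scaleR_add_right)
 also have "(\<Sum>u\<in>Basis. \<Sum>v\<in>Basis. inner u v *\<^sub>R f u v) = (\<Sum>u\<in>Basis. f u u)"
 proof (rule sum.cong[OF refl])
  fix u :: 'a assume u: "u \<in> Basis"
  have "(\<Sum>v\<in>Basis. inner u v *\<^sub>R f u v) = (\<Sum>v\<in>Basis. if v = u then f u u else 0)"
   by (rule sum.cong) (use u in \<open>auto simp: inner_Basis\<close>)
  thus "(\<Sum>v\<in>Basis. inner u v *\<^sub>R f u v) = f u u" using u by simp
 qed
 also have "(\<Sum>u\<in>Basis. \<Sum>v\<in>Basis. inner u (star v) *\<^sub>R f u v) = (\<Sum>v\<in>Basis. f (star v) v)"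
 proof (subst sum.swap, rule sum.cong[OF refl])
  fix v :: 'a
  have "(\<Sum>u\<in>Basis. inner u (star v) *\<^sub>R f u v) = f (\<Sum>u\<in>Basis. inner u (star v) *\<^sub>R u) v"
   by (simp add: linear_sum[OF f1] linear_scale[OF f1])
  thus "(\<Sum>u\<in>Basis. inner u (star v) *\<^sub>R f u v) = f (star v) v"
   by (simp add: er)
 qed
 finally show ?thesis unfolding P_def Q_def .
qed

section \<open>Contraction of two matrices under one or two traces\<close>

lemma trace_mul_expand: "trace (A ** B) = (\<Sum>i\<in>UNIV. \<Sum>j\<in>UNIV. A $ i $ j * B $ j $ i)"
 by (simp add: trace_def matrix_matrix_mult_def)

lemma trace_mul4_expand: "trace (A ** M ** B ** N) = (\<Sum>i\<in>UNIV. \<Sum>l\<in>UNIV. \<Sum>k\<in>UNIV. \<Sum>j\<in>UNIV. A $ i $ j * M $ j $ k * B $ k $ l * N $ l $ i)"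
 by (simp add: trace_def matrix_matrix_mult_def sum_distrib_right)

lemma sum_delta2:
 fixes f :: "'n::finite => 'n => 'b::comm_monoid_add"
 shows "(\<Sum>k\<in>UNIV. \<Sum>l\<in>UNIV. if i = k \<and> j = l then f k l else 0) = f i j"
  "(\<Sum>k\<in>UNIV. \<Sum>l\<in>UNIV. if i = l \<and> j = k then f k l else 0) = f j i"
proof -
 have "(\<Sum>k\<in>UNIV. \<Sum>l\<in>UNIV. if i = k \<and> j = l then f k l else 0) = (\<Sum>k\<in>UNIV. if i = k then f k j else 0)"
  by (intro sum.cong) auto
 thus "(\<Sum>k\<in>UNIV. \<Sum>l\<in>UNIV. if i = k \<and> j = l then f k l else 0) = f i j" by simp
 have "(\<Sum>k\<in>UNIV. \<Sum>l\<in>UNIV. if i = l \<and> j = k then f k l else 0) = (\<Sum>k\<in>UNIV. if j = k then f k i else 0)"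
  by (intro sum.cong) auto
 thus "(\<Sum>k\<in>UNIV. \<Sum>l\<in>UNIV. if i = l \<and> j = k then f k l else 0) = f j i" by simp
qed

lemma sum_delta2':
 fixes f :: "'n::finite => 'n => 'b::comm_monoid_add"
 shows "(\<Sum>k\<in>UNIV. \<Sum>j\<in>UNIV. if i = k \<and> j = l then f k j else 0) = f i l"
  "(\<Sum>k\<in>UNIV. \<Sum>j\<in>UNIV. if i = l \<and> j = k then f k j else 0) = (if i = l then (\<Sum>k\<in>UNIV. f k k) else 0)"
proof -
 have "(\<Sum>k\<in>UNIV. \<Sum>j\<in>UNIV. if i = k \<and> j = l then f k j else 0) = (\<Sum>k\<in>UNIV. if i = k then f k l else 0)"
  by (intro sum.cong) auto
 thus "(\<Sum>k\<in>UNIV. \<Sum>j\<in>UNIV. if i = k \<and> j = l then f k j else 0) = f i l" by simp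
 show "(\<Sum>k\<in>UNIV. \<Sum>j\<in>UNIV. if i = l \<and> j = k then f k j else 0) = (if i = l then (\<Sum>k\<in>UNIV. f k k) else 0)"
  by (cases "i = l") simp_all
qed

lemma half_of_bool:
 "(1/2) * (of_bool P + of_bool Q) * x = (1/2) * ((if P then x else 0) + (if Q then x else (0::complex)))"
 by (cases P; cases Q; simp)

lemma sum_sum_swap_out:
 "(\<Sum>e\<in>E. \<Sum>i\<in>A. \<Sum>j\<in>B. \<Sum>k\<in>C. \<Sum>l\<in>D. f e i j k l) = (\<Sum>i\<in>A. \<Sum>j\<in>B. \<Sum>k\<in>C. \<Sum>l\<in>D. \<Sum>e\<in>E. f e i j k l)"
proof -
 have "(\<Sum>e\<in>E. \<Sum>i\<in>A. \<Sum>j\<in>B. \<Sum>k\<in>C. \<Sum>l\<in>D. f e i j k l) = (\<Sum>i\<in>A. \<Sum>e\<in>E. \<Sum>j\<in>B. \<Sum>k\<in>C. \<Sum>l\<in>D. f e i j k l)"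
  by (rule sum.swap)
 also have "\<dots> = (\<Sum>i\<in>A. \<Sum>j\<in>B. \<Sum>e\<in>E. \<Sum>k\<in>C. \<Sum>l\<in>D. f e i j k l)"
  by (intro sum.cong refl sum.swap)
 also have "\<dots> = (\<Sum>i\<in>A. \<Sum>j\<in>B. \<Sum>k\<in>C. \<Sum>e\<in>E. \<Sum>l\<in>D. f e i j k l)"
  by (intro sum.cong refl sum.swap)
 also have "\<dots> = (\<Sum>i\<in>A. \<Sum>j\<in>B. \<Sum>k\<in>C. \<Sum>l\<in>D. \<Sum>e\<in>E. f e i j k l)"
  by (intro sum.cong refl sum.swap)
 finally show ?thesis .
qed

lemma linear_mult_left: "linear (%a. a * b)" for b :: "'a::real_algebra_1"
 by (rule linearI) (simp_all add: distrib_right)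

lemma linear_mult_mult_left: "linear (%a. a * q * b)" for b :: "'a::real_algebra_1"
 by (rule linearI) (simp_all add: distrib_right)

lemma linear_mult_right: "linear (%b. a * b)" for a :: "'a::real_algebra_1"
 by (rule linearI) (simp_all add: distrib_left)

lemma real_entry:
 fixes i j k l :: "'n::finite"
 shows "(\<Sum>e\<in>Basis. complex_of_real (mat_of (e :: (real, 'n) herm) $ i $ j) * complex_of_real (mat_of e $ k $ l))
  = (1/2) * (of_bool (i = k \<and> j = l) + of_bool (i = l \<and> j = k))"
proof -
 define P Q where "P \<longleftrightarrow> i = k \<and> j = l" and "Q \<longleftrightarrow> i = l \<and> j = k"
 have h: "(\<Sum>e\<in>Basis. mat_of (e :: (real, 'n) herm) $ i $ j * (mat_of e $ k $ l))
  = (1/2) *\<^sub>R ((if i = k \<and> j = l then (\<Sum>u\<in>Basis. u * u) else 0)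
    + (if i = l \<and> j = k then (\<Sum>u\<in>Basis. star u * u) else 0))"
  by (rule herm_entry_contraction[OF linear_mult_left linear_mult_right])
 show ?thesis
  unfolding of_real_mult[symmetric] of_real_sum[symmetric] h
  unfolding P_def[symmetric] Q_def[symmetric] by (cases P; cases Q; simp add: star_real_def)
qed

text \<open>The squares of 1 and \<open>\<i>\<close> sum to 0, which removes the term behind twisted
  ribbons, while \<open>star u * u\<close> sums to 2.\<close>

lemma complex_entry:
 fixes i j k l :: "'n::finite"
 shows "(\<Sum>e\<in>Basis. (mat_of (e :: (complex, 'n) herm) $ i $ j) * (mat_of e $ k $ l)) = of_bool (i = l \<and> j = k)"
proof -
 define P Q where "P \<longleftrightarrow> i = k \<and> j = l" and "Q \<longleftrightarrow> i = l \<and> j = k"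
 have h: "(\<Sum>e\<in>Basis. mat_of (e :: (complex, 'n) herm) $ i $ j * (mat_of e $ k $ l))
  = (1/2) *\<^sub>R ((if i = k \<and> j = l then (\<Sum>u\<in>Basis. u * u) else 0)
    + (if i = l \<and> j = k then (\<Sum>u\<in>Basis. star u * u) else 0))"
  by (rule herm_entry_contraction[OF linear_mult_left linear_mult_right])
 show ?thesis
  unfolding h P_def[symmetric] Q_def[symmetric] by (cases P; cases Q; simp add: star_complex_def Basis_complex_def scaleR_conv_of_real)
qed

text \<open>Over the four units \<open>u * q * u\<close> sums to \<open>-2\<close> times
  \<open>star q\<close>, and \<open>star u * q * u\<close> to \<open>4 * qre q\<close>. Quaternions
  do not commute, so the factor between the two entries has to be carried along.\<close>

lemma quat_entry:
 fixes i j k l :: "'n::finite"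
 shows "(\<Sum>e\<in>Basis. (mat_of (e :: (quat, 'n) herm) $ i $ j) * q * (mat_of e $ k $ l))
  = (if i = l \<and> j = k then (2 * qre q) *\<^sub>R 1 else 0) - (if i = k \<and> j = l then star q else 0)"
proof -
 define P Q where "P \<longleftrightarrow> i = k \<and> j = l" and "Q \<longleftrightarrow> i = l \<and> j = k"
 have h: "(\<Sum>e\<in>Basis. mat_of (e :: (quat, 'n) herm) $ i $ j * q * (mat_of e $ k $ l))
  = (1/2) *\<^sub>R ((if i = k \<and> j = l then (\<Sum>u\<in>Basis. u * q * u) else 0)
    + (if i = l \<and> j = k then (\<Sum>u\<in>Basis. star u * q * u) else 0))"
  by (rule herm_entry_contraction[where f="%a b. a * q * b", OF linear_mult_mult_left linear_mult_right])
 have 1: "(\<Sum>u\<in>Basis. u * q * u) = (-2) *\<^sub>R star q"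
  by (simp add: Basis_quat_def quat_eq_iff times_quat_def plus_quat_def scaleR_quat_def star_quat_def zero_quat_def one_quat_def)
 have 2: "(\<Sum>u\<in>Basis. star u * q * u) = (4 * qre q) *\<^sub>R (1 :: quat)"
  by (simp add: Basis_quat_def quat_eq_iff times_quat_def plus_quat_def scaleR_quat_def star_quat_def one_quat_def zero_quat_def)
 show ?thesis
  unfolding h 1 2 P_def[symmetric] Q_def[symmetric] by (cases P; cases Q; simp add: scaleR_add_right scaleR_diff_right)
qed

lemma cmat_mult: "cmat (A ** B) = cmat A ** cmat B"
 by (simp add: cmat_def matrix_matrix_mult_def vec_eq_iff)

lemma cmat_adj: "cmat (adj A) = transpose (cmat A)"
 by (simp add: cmat_def adj_def transpose_def vec_eq_iff star_real_def)

lemma real_contraction_merge: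
 fixes M N :: "complex^'n::finite^'n"
 shows "(\<Sum>e\<in>Basis. trace (cmat (mat_of (e :: (real, 'n) herm)) ** M) * trace (cmat (mat_of e) ** N))
  = (1/2) * (trace (M ** N) + trace (M ** transpose N))"
proof -
 have "(\<Sum>e\<in>Basis. trace (cmat (mat_of (e :: (real, 'n) herm)) ** M) * trace (cmat (mat_of e) ** N))
  = (\<Sum>e\<in>Basis. \<Sum>i\<in>UNIV. \<Sum>j\<in>UNIV. \<Sum>k\<in>UNIV. \<Sum>l\<in>UNIV.
    (complex_of_real (mat_of (e :: (real, 'n) herm) $ i $ j) * complex_of_real (mat_of e $ k $ l)) * (M $ j $ i * N $ l $ k))"
  unfolding trace_mul_expand
  by (simp only: sum_distrib_right, simp only: sum_distrib_left) (simp add: cmat_def mult_ac)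
 also have "\<dots> = (\<Sum>i\<in>UNIV. \<Sum>j\<in>UNIV. \<Sum>k\<in>UNIV. \<Sum>l\<in>UNIV.
   (1/2) * (of_bool (i = k \<and> j = l) + of_bool (i = l \<and> j = k)) * (M $ j $ i * N $ l $ k))"
  unfolding sum_sum_swap_out sum_distrib_right[symmetric] real_entry ..
 also have "\<dots> = (1/2) * (\<Sum>i\<in>UNIV. \<Sum>j\<in>UNIV. (\<Sum>k\<in>UNIV. \<Sum>l\<in>UNIV. if i = k \<and> j = l then M $ j $ i * N $ l $ k else 0)
   + (\<Sum>k\<in>UNIV. \<Sum>l\<in>UNIV. if i = l \<and> j = k then M $ j $ i * N $ l $ k else 0))"
  unfolding half_of_bool by (simp only: sum_distrib_left[symmetric] sum.distrib)
 also have "\<dots> = (1/2) * (\<Sum>i\<in>UNIV. \<Sum>j\<in>UNIV. M $ j $ i * N $ j $ i + M $ j $ i * N $ i $ j)"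
  unfolding sum_delta2 ..
 also have "\<dots> = (1/2) * (trace (M ** N) + trace (M ** transpose N))"
  unfolding trace_mul_expand transpose_def sum.distrib
  by (subst (1 2) sum.swap) simp
 finally show ?thesis .
qed

lemma real_contraction_split:
 fixes M N :: "complex^'n::finite^'n"
 shows "(\<Sum>e\<in>Basis. trace (cmat (mat_of (e :: (real, 'n) herm)) ** M ** cmat (mat_of e) ** N))
  = (1/2) * (trace M * trace N + trace (transpose M ** N))"
proof -
 have "(\<Sum>e\<in>Basis. trace (cmat (mat_of (e :: (real, 'n) herm)) ** M ** cmat (mat_of e) ** N))
  = (\<Sum>e\<in>Basis. \<Sum>i\<in>UNIV. \<Sum>l\<in>UNIV. \<Sum>k\<in>UNIV. \<Sum>j\<in>UNIV.
    (complex_of_real (mat_of (e :: (real, 'n) herm) $ i $ j) * complex_of_real (mat_of e $ k $ l)) * (M $ j $ k * N $ l $ i))"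
  by (simp add: trace_mul4_expand cmat_def mult_ac)
 also have "\<dots> = (\<Sum>i\<in>UNIV. \<Sum>l\<in>UNIV. \<Sum>k\<in>UNIV. \<Sum>j\<in>UNIV.
   (1/2) * (of_bool (i = k \<and> j = l) + of_bool (i = l \<and> j = k)) * (M $ j $ k * N $ l $ i))"
  unfolding sum_sum_swap_out sum_distrib_right[symmetric] real_entry ..
 also have "\<dots> = (1/2) * (\<Sum>i\<in>UNIV. \<Sum>l\<in>UNIV. (\<Sum>k\<in>UNIV. \<Sum>j\<in>UNIV. if i = k \<and> j = l then M $ j $ k * N $ l $ i else 0)
   + (\<Sum>k\<in>UNIV. \<Sum>j\<in>UNIV. if i = l \<and> j = k then M $ j $ k * N $ l $ i else 0))"
  unfolding half_of_bool by (simp only: sum_distrib_left[symmetric] sum.distrib)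
 also have "\<dots> = (1/2) * (\<Sum>i\<in>UNIV. \<Sum>l\<in>UNIV. M $ l $ i * N $ l $ i + (if i = l then trace M * N $ l $ i else 0))"
  unfolding sum_delta2' trace_def sum_distrib_right ..
 also have "\<dots> = (1/2) * (trace M * trace N + trace (transpose M ** N))"
  by (simp add: sum.distrib trace_mul_expand transpose_def) (simp add: trace_def sum_distrib_left)
 finally show ?thesis .
qed

lemma of_bool_if: "of_bool P * x = (if P then x else (0::complex))"
 by simp

lemma complex_contraction_merge:
 fixes M N :: "complex^'n::finite^'n"
 shows "(\<Sum>e\<in>Basis. trace (mat_of (e :: (complex, 'n) herm) ** M) * trace (mat_of e ** N)) = trace (M ** N)"
proof -
 have "(\<Sum>e\<in>Basis. trace (mat_of (e :: (complex, 'n) herm) ** M) * trace (mat_of e ** N))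
  = (\<Sum>e\<in>Basis. \<Sum>i\<in>UNIV. \<Sum>j\<in>UNIV. \<Sum>k\<in>UNIV. \<Sum>l\<in>UNIV.
    (mat_of (e :: (complex, 'n) herm) $ i $ j * mat_of e $ k $ l) * (M $ j $ i * N $ l $ k))"
  unfolding trace_mul_expand
  by (simp only: sum_distrib_right, simp only: sum_distrib_left) (simp add: mult_ac)
 also have "\<dots> = (\<Sum>i\<in>UNIV. \<Sum>j\<in>UNIV. \<Sum>k\<in>UNIV. \<Sum>l\<in>UNIV. if i = l \<and> j = k then M $ j $ i * N $ l $ k else 0)"
  unfolding sum_sum_swap_out sum_distrib_right[symmetric] complex_entry of_bool_if ..
 also have "\<dots> = trace (M ** N)"
  unfolding sum_delta2 trace_mul_expand by (rule sum.swap)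
 finally show ?thesis .
qed

lemma complex_contraction_split:
 fixes M N :: "complex^'n::finite^'n"
 shows "(\<Sum>e\<in>Basis. trace (mat_of (e :: (complex, 'n) herm) ** M ** mat_of e ** N)) = trace M * trace N"
proof -
 have "(\<Sum>e\<in>Basis. trace (mat_of (e :: (complex, 'n) herm) ** M ** mat_of e ** N))
  = (\<Sum>e\<in>Basis. \<Sum>i\<in>UNIV. \<Sum>l\<in>UNIV. \<Sum>k\<in>UNIV. \<Sum>j\<in>UNIV.
    (mat_of (e :: (complex, 'n) herm) $ i $ j * mat_of e $ k $ l) * (M $ j $ k * N $ l $ i))"
  by (simp add: trace_mul4_expand mult_ac)
 also have "\<dots> = (\<Sum>i\<in>UNIV. \<Sum>l\<in>UNIV. \<Sum>k\<in>UNIV. \<Sum>j\<in>UNIV. if i = l \<and> j = k then M $ j $ k * N $ l $ i else 0)"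
  unfolding sum_sum_swap_out sum_distrib_right[symmetric] complex_entry of_bool_if ..
 also have "\<dots> = (\<Sum>i\<in>UNIV. \<Sum>l\<in>UNIV. if i = l then trace M * N $ l $ i else 0)"
  unfolding sum_delta2' trace_def sum_distrib_right ..
 also have "\<dots> = trace M * trace N"
  by simp (simp add: trace_def sum_distrib_left)
 finally show ?thesis .
qed

lemma qre_simps [simp]: "qre (a + b) = qre a + qre b" "qre (a - b) = qre a - qre b" "qre (r *\<^sub>R a) = r * qre a" "qre 0 = 0"
 by (simp_all add: plus_quat_def minus_quat_def scaleR_quat_def zero_quat_def)

lemma qre_sum: "qre (sum f A) = (\<Sum>x\<in>A. qre (f x))"
 by (induction A rule: infinite_finite_induct) auto

lemma qre_mult_commute: "qre (a * b) = qre (b * a)"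
 by (simp add: times_quat_def)

lemma qre_star [simp]: "qre (star a) = qre a"
 by (simp add: star_quat_def)

lemma qre_trace_commute: "qre (trace (A ** B)) = qre (trace (B ** A))"
proof -
 have "qre (trace (A ** B)) = (\<Sum>i\<in>UNIV. \<Sum>j\<in>UNIV. qre (B $ j $ i * A $ i $ j))"
  by (simp add: trace_mul_expand qre_sum qre_mult_commute)
 also have "\<dots> = qre (trace (B ** A))"
  unfolding trace_mul_expand qre_sum by (rule sum.swap)
 finally show ?thesis .
qed

lemma qre_trace_adj [simp]: "qre (trace (adj A)) = qre (trace A)"
 by (simp add: trace_def adj_def qre_sum)

lemma inner_quat_matrix: "inner A B = qre (trace (A ** adj B))" for A B :: "quat^'n^'n"
 by (simp add: inner_vec_def trace_mul_expand adj_def qre_sum)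
  (simp add: inner_quat_def times_quat_def star_quat_def)

text \<open>The real part of the trace of \<open>e ** M\<close> is the inner product of
  \<open>M\<close> and \<open>e\<close>, so this is Parseval's identity for Hermitian parts.\<close>

lemma quat_contraction_merge:
 fixes M N :: "quat^'n::finite^'n"
 shows "(\<Sum>e\<in>Basis. qre (trace (mat_of (e :: (quat, 'n) herm) ** M)) * qre (trace (mat_of e ** N)))
  = (qre (trace (M ** N)) + qre (trace (M ** adj N))) / 2"
proof -
 have "qre (trace (mat_of e ** M)) = inner M (mat_of e)" for e :: "(quat, 'n) herm" and M
  unfolding inner_quat_matrix adj_mat_of by (rule qre_trace_commute)
 moreover note herm_basis_sum[of M N]
 ultimately show ?thesis
  unfolding inner_quat_matrix adj_adj add.commute[of "qre (trace (M ** N))"] by simp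
qed

lemma quat_contraction_split:
 fixes M N :: "quat^'n::finite^'n"
 shows "(\<Sum>e\<in>Basis. qre (trace (mat_of (e :: (quat, 'n) herm) ** M ** mat_of e ** N)))
  = 2 * qre (trace M) * qre (trace N) - qre (trace (adj M ** N))"
proof -
 have "(\<Sum>e\<in>Basis. trace (mat_of (e :: (quat, 'n) herm) ** M ** mat_of e ** N))
  = (\<Sum>e\<in>Basis. \<Sum>i\<in>UNIV. \<Sum>l\<in>UNIV. \<Sum>k\<in>UNIV. \<Sum>j\<in>UNIV.
    (mat_of (e :: (quat, 'n) herm) $ i $ j * M $ j $ k * mat_of e $ k $ l) * N $ l $ i)"
  by (simp add: trace_mul4_expand)
 also have "\<dots> = (\<Sum>i\<in>UNIV. \<Sum>l\<in>UNIV. \<Sum>k\<in>UNIV. \<Sum>j\<in>UNIV.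
   ((if i = l \<and> j = k then (2 * qre (M $ j $ k)) *\<^sub>R 1 else 0) - (if i = k \<and> j = l then star (M $ j $ k) else 0)) * N $ l $ i)"
 proof -
  have "(\<Sum>e\<in>Basis. (mat_of (e :: (quat, 'n) herm) $ i $ j * q * mat_of e $ k $ l) * x)
   = ((if i = l \<and> j = k then (2 * qre q) *\<^sub>R 1 else 0) - (if i = k \<and> j = l then star q else 0)) * x" for i j k l q x
   by (rule trans[OF sum_distrib_right[symmetric] arg_cong[OF quat_entry, where f="%s. s * x"]])
  note e = this
  show ?thesis by (rule trans[OF sum_sum_swap_out]) (intro sum.cong refl e)
 qed
 also have "\<dots> = (\<Sum>i\<in>UNIV. \<Sum>l\<in>UNIV. \<Sum>k\<in>UNIV. \<Sum>j\<in>UNIV.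
   (if i = l \<and> j = k then (2 * qre (M $ j $ k)) *\<^sub>R N $ l $ i else 0) - (if i = k \<and> j = l then star (M $ j $ k) * N $ l $ i else 0))"
 proof -
  have "((if P then r *\<^sub>R 1 else 0) - (if Q then b else 0)) * x = (if P then r *\<^sub>R x else 0) - (if Q then b * x else 0)" for P Q r and b x :: quat
   by (cases P; cases Q; simp add: left_diff_distrib)
  thus ?thesis by (simp only:)
 qed
 also have "\<dots> = (\<Sum>i\<in>UNIV. \<Sum>l\<in>UNIV. (if i = l then (\<Sum>k\<in>UNIV. (2 * qre (M $ k $ k)) *\<^sub>R N $ l $ i) else 0) - star (M $ l $ i) * N $ l $ i)"
  unfolding sum_subtractf sum_delta2' ..
 also have "\<dots> = (2 * qre (trace M)) *\<^sub>R trace N - trace (adj M ** N)"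
  by (simp add: sum_subtractf trace_mul_expand adj_def)
   (simp add: trace_def qre_sum scaleR_sum_left scaleR_sum_right sum_distrib_left)
 finally have "qre (\<Sum>e\<in>Basis. trace (mat_of (e :: (quat, 'n) herm) ** M ** mat_of e ** N))
  = qre ((2 * qre (trace M)) *\<^sub>R trace N - trace (adj M ** N))" by simp
 thus ?thesis by (simp add: qre_sum)
qed

text \<open>Matrices read along or against the orientation of a boundary; a product mixing the two is void.\<close>

datatype 'm oriented = Along 'm | Against 'm | Clash

text \<open>Reading from the other end changes the recorded direction and leaves the matrix as it
  is; accordingly a product of two reversed labels is formed in the opposite order.\<close>

primrec oriented_star :: "'m oriented => 'm oriented" where
 "oriented_star (Along M) = Against M"
| "oriented_star (Against M) = Along M"
| "oriented_star Clash = Clash"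

fun oriented_mult :: "('b::semiring_1^'n^'n) oriented => ('b^'n^'n) oriented => ('b^'n^'n) oriented" where
 "oriented_mult (Along M) (Along N) = Along (M ** N)"
| "oriented_mult (Against M) (Against N) = Against (N ** M)"
| "oriented_mult _ _ = Clash"

primrec oriented_trace :: "('b::semiring_1^'n^'n) oriented => 'b" where
 "oriented_trace (Along M) = trace M"
| "oriented_trace (Against M) = trace M"
| "oriented_trace Clash = 0"

lemma trace_transpose: "trace (transpose A) = trace A"
 by (simp add: trace_def transpose_def)

interpretation RG: gluing "(**) :: complex^'n::finite^'n => _" transpose trace
proof
 fix a b c :: "complex^'n^'n"
 show "a ** b ** c = a ** (b ** c)" by (rule matrix_mul_assoc[symmetric])
 show "trace (a ** b) = trace (b ** a)" by (rule trace_mul_sym)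
qed (simp_all add: matrix_transpose_mul trace_transpose)

interpretation CG: gluing "oriented_mult :: (complex^'n::finite^'n) oriented => _" oriented_star oriented_trace
proof
 fix a b c :: "(complex^'n^'n) oriented"
 show "oriented_mult (oriented_mult a b) c = oriented_mult a (oriented_mult b c)"
  by (cases a; cases b; cases c; simp add: matrix_mul_assoc)
 show "oriented_star (oriented_mult a b) = oriented_mult (oriented_star b) (oriented_star a)"
  by (cases a; cases b; simp)
 show "oriented_star (oriented_star a) = a" by (cases a; simp)
 show "oriented_trace (oriented_mult a b) = oriented_trace (oriented_mult b a)"
  by (cases a; cases b; simp; rule trace_mul_sym)
 show "oriented_trace (oriented_star a) = oriented_trace a" by (cases a; simp)
qed

interpretation QG: gluing "(**) :: quat^'n::finite^'n => _" adj "%M. -2 * qre (trace M)"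
proof
 fix a b c :: "quat^'n^'n"
 show "a ** b ** c = a ** (b ** c)" by (rule matrix_mul_assoc[symmetric])
 show "-2 * qre (trace (a ** b)) = -2 * qre (trace (b ** a))" by (simp only: qre_trace_commute[of a b])
qed (simp_all add: adj_mult qre_trace_adj)

section \<open>The contraction rules for the three kinds of scalars\<close>

context gluing begin

text \<open>Summing \<open>inner e (Ad e')\<close> against \<open>X e\<close> rebuilds
  \<open>X (Ad e')\<close>, which is \<open>X e'\<close> conjugated by \<open>h\<close>. The double
  sum becomes a diagonal one with \<open>h\<close> and \<open>st h\<close> absorbed into the
  neighbouring words, and \<open>merge\<close> and \<open>split\<close> evaluate it.
  Self-adjointness of \<open>X\<close> reduces opposite readings to parallel ones.\<close>

lemma contraction_rule_selfadjoint:
 fixes X :: "'e::euclidean_space => 'm" and emb :: "real => 'c" and Ad :: "'e => 'e"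
 assumes merge: "\<And>M N. (\<Sum>e\<in>Basis. z (X e \<odot> M) * z (X e \<odot> N)) = w * (z (M \<odot> N) + z (st M \<odot> N))"
  and split: "\<And>M N. (\<Sum>e\<in>Basis. z (X e \<odot> M \<odot> X e \<odot> N)) = w * (z M * z N + z (st M \<odot> N))"
  and X: "\<And>e. st (X e) = X e" "\<And>e. X (Ad e) = h \<odot> X e \<odot> st h"
  and lin: "\<And>x M. (\<Sum>e\<in>Basis. emb (inner e x) * z (X e \<odot> M)) = z (X x \<odot> M)"
 shows "contraction_rule Basis X w (%e e'. emb (inner e (Ad e'))) h (st h) h h"
 unfolding contraction_rule_def
proof (intro allI conjI)
 fix P Q
 have lin2: "(\<Sum>e\<in>Basis. \<Sum>e'\<in>Basis. emb (inner e (Ad e')) * (c e' * z (X e \<odot> M e'))) = (\<Sum>e'\<in>Basis. c e' * z (X (Ad e') \<odot> M e'))"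
  for c M
 proof -
  have "(\<Sum>e\<in>Basis. \<Sum>e'\<in>Basis. emb (inner e (Ad e')) * (c e' * z (X e \<odot> M e')))
   = (\<Sum>e'\<in>Basis. c e' * (\<Sum>e\<in>Basis. emb (inner e (Ad e')) * z (X e \<odot> M e')))"
   by (subst sum.swap) (simp add: sum_distrib_left mult_ac)
  thus ?thesis by (simp only: lin)
 qed
 have cyc4: "z (a \<odot> b \<odot> c \<odot> d) = z (b \<odot> c \<odot> d \<odot> a)" for a b c d
  using z_comm[of a "b \<odot> c \<odot> d"] by (simp add: mul_assoc)
 have star4: "z (a \<odot> b \<odot> c \<odot> d) = z (st d \<odot> st c \<odot> st b \<odot> st a)" for a b c d
  using z_st[of "a \<odot> b \<odot> c \<odot> d"] by (simp add: st_mul mul_assoc)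
 show "(\<Sum>i\<in>Basis. \<Sum>j\<in>Basis. emb (inner i (Ad j)) * (z (X i \<odot> P) * z (X j \<odot> Q)))
   = w * (z (st h \<odot> P \<odot> h \<odot> Q) + z (h \<odot> Q \<odot> st h \<odot> st P))"
 proof -
  have "(\<Sum>i\<in>Basis. \<Sum>j\<in>Basis. emb (inner i (Ad j)) * (z (X i \<odot> P) * z (X j \<odot> Q))) = (\<Sum>e\<in>Basis. z (X e \<odot> Q) * z (X (Ad e) \<odot> P))"
   using lin2[of "%e. z (X e \<odot> Q)" "%_. P"] by (simp add: mult.commute)
  also have "\<dots> = (\<Sum>e\<in>Basis. z (X e \<odot> (st h \<odot> P \<odot> h)) * z (X e \<odot> Q))"
   using z_comm[of h] by (simp add: X mul_assoc mult.commute)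
  also have "\<dots> = w * (z (st h \<odot> P \<odot> h \<odot> Q) + z (st (st h \<odot> P \<odot> h) \<odot> Q))" by (rule merge)
  also have "z (st (st h \<odot> P \<odot> h) \<odot> Q) = z (h \<odot> Q \<odot> st h \<odot> st P)"
   using cyc4[of "st h" "st P" h Q] by (simp add: st_mul mul_assoc)
    (metis cyc4 mul_assoc)
  finally show ?thesis .
 qed
 have split': "(\<Sum>i\<in>Basis. \<Sum>j\<in>Basis. emb (inner i (Ad j)) * z (X j \<odot> A \<odot> X i \<odot> B))
  = w * (z (A \<odot> h) * z (st h \<odot> B) + z (st h \<odot> st A \<odot> st h \<odot> B))" for A B
 proof -
  have "z (X j \<odot> A \<odot> X i \<odot> B) = 1 * z (X i \<odot> (B \<odot> X j \<odot> A))" for i j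
   using cyc4[of "X j" A "X i" B] cyc4[of A "X i" B "X j"] by (simp add: mul_assoc)
  hence "(\<Sum>i\<in>Basis. \<Sum>j\<in>Basis. emb (inner i (Ad j)) * z (X j \<odot> A \<odot> X i \<odot> B)) = (\<Sum>e\<in>Basis. z (X (Ad e) \<odot> (B \<odot> X e \<odot> A)))"
   using lin2[of "%_. 1" "%e. B \<odot> X e \<odot> A"] by simp
  also have "\<dots> = (\<Sum>e\<in>Basis. z (X e \<odot> (A \<odot> h) \<odot> X e \<odot> (st h \<odot> B)))"
  proof (rule sum.cong[OF refl])
   fix e
   show "z (X (Ad e) \<odot> (B \<odot> X e \<odot> A)) = z (X e \<odot> (A \<odot> h) \<odot> X e \<odot> (st h \<odot> B))"
    using z_comm[of "h \<odot> X e \<odot> st h \<odot> B" "X e \<odot> A"] by (simp add: X mul_assoc)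
  qed
  also have "\<dots> = w * (z (A \<odot> h) * z (st h \<odot> B) + z (st (A \<odot> h) \<odot> (st h \<odot> B)))" by (rule split)
  finally show ?thesis by (simp add: st_mul mul_assoc)
 qed
 show "(\<Sum>i\<in>Basis. \<Sum>j\<in>Basis. emb (inner i (Ad j)) * z (X j \<odot> Q \<odot> X i \<odot> P))
   = w * (z (h \<odot> Q) * z (st h \<odot> P) + z (h \<odot> Q \<odot> h \<odot> st P))"
  unfolding split' using z_comm[of Q h] star4[of h Q h "st P"] cyc4[of P "st h" "st Q" "st h"] by simp
 show "(\<Sum>i\<in>Basis. \<Sum>j\<in>Basis. emb (inner i (Ad j)) * z (X j \<odot> P \<odot> st (X i) \<odot> Q))
   = w * (z (st h \<odot> st P \<odot> st h \<odot> Q) + z (st h \<odot> Q) * z (h \<odot> P))"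
  unfolding X(1) split' using z_comm[of P h] by (simp add: algebra_simps)
qed

end

lemma basis_sum_linear:
 fixes x :: "'e::euclidean_space" and f :: "'e => 'b::real_vector"
 assumes "linear f"
 shows "(\<Sum>e\<in>Basis. inner e x *\<^sub>R f e) = f x"
proof -
 have "f x = f (\<Sum>e\<in>Basis. inner e x *\<^sub>R e)"
  by (simp add: euclidean_representation[of x, unfolded inner_commute[of x]])
 thus ?thesis by (simp add: linear_sum[OF assms] linear_scale[OF assms])
qed

lemma trace_plus: "trace (A + B) = trace A + trace (B :: 'a::semiring_1^'n^'n)"
 by (simp add: trace_def sum.distrib)

lemma trace_scaleR: "trace (r *\<^sub>R A) = r *\<^sub>R trace (A :: 'a::real_algebra_1^'n^'n)"
 by (simp add: trace_def scaleR_sum_right)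

lemma cmat_scaleR: "cmat (r *\<^sub>R A) = r *\<^sub>R cmat A"
 by (simp add: cmat_def vec_eq_iff complex_eq_iff)

lemma cmat_add: "cmat (A + B) = cmat A + cmat B"
 by (simp add: cmat_def vec_eq_iff)

lemma real_contraction_rule:
 fixes h :: "real^'n::finite^'n"
 shows "RG.contraction_rule Basis (%e. cmat (mat_of e)) (1/2)
  (%e e'. complex_of_real (inner e (conjugate h e'))) (cmat h) (transpose (cmat h)) (cmat h) (cmat h)"
proof (rule RG.contraction_rule_selfadjoint)
 show "transpose (cmat (mat_of e)) = cmat (mat_of e)" for e :: "(real, 'n) herm"
  using cmat_adj[of "mat_of e"] by simp
 show "cmat (mat_of (conjugate h e)) = cmat h ** cmat (mat_of e) ** transpose (cmat h)" for e
  by (simp add: mat_of_conjugate cmat_mult cmat_adj)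
 fix M N :: "complex^'n^'n" and x :: "(real, 'n) herm"
 have "trace (M ** transpose N) = trace (transpose M ** N)"
  using trace_transpose[of "M ** transpose N"] trace_mul_sym[of N "transpose M"] by (simp add: matrix_transpose_mul)
 thus "(\<Sum>e\<in>Basis. trace (cmat (mat_of (e :: (real, 'n) herm)) ** M) * trace (cmat (mat_of e) ** N))
   = (1/2) * (trace (M ** N) + trace (transpose M ** N))"
  using real_contraction_merge[of M N] by simp
 show "(\<Sum>e\<in>Basis. trace (cmat (mat_of (e :: (real, 'n) herm)) ** M ** cmat (mat_of e) ** N))
   = (1/2) * (trace M * trace N + trace (transpose M ** N))"
  by (rule real_contraction_split)
 have "linear (%e :: (real, 'n) herm. trace (cmat (mat_of e) ** M))"
  by (rule linearI) (simp_all add: plus_herm.rep_eq scaleR_herm.rep_eq cmat_add cmat_scaleR matrix_add_left matrix_scaleR_left trace_plus trace_scaleR)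
 from basis_sum_linear[OF this, of x]
 show "(\<Sum>e\<in>Basis. complex_of_real (inner e x) * trace (cmat (mat_of e) ** M)) = trace (cmat (mat_of x) ** M)"
  by (simp add: scaleR_conv_of_real)
qed

text \<open>If values were normalised as \<open>c * qre (trace M)\<close>, merging would have weight
  \<open>c / 2\<close> on both terms, and splitting would have weights \<open>2 / c\<close> and
  \<open>-1\<close>. These agree exactly for \<open>c = -2\<close>, with common weight
  \<open>-1\<close>.\<close>

lemma quat_contraction_rule:
 fixes h :: "quat^'n::finite^'n"
 shows "QG.contraction_rule Basis mat_of (-1) (%e e'. inner e (conjugate h e')) h (adj h) h h"
proof (rule QG.contraction_rule_selfadjoint[where emb="%r. r"])
 show "adj (mat_of e) = mat_of e" for e :: "(quat, 'n) herm" by simp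
 show "mat_of (conjugate h e) = h ** mat_of e ** adj h" for e by (rule mat_of_conjugate)
 fix M N :: "quat^'n^'n" and x :: "(quat, 'n) herm"
 have s: "qre (trace (M ** adj N)) = qre (trace (adj M ** N))"
  using qre_trace_adj[of "M ** adj N"] qre_trace_commute[of N "adj M"] by (simp only: adj_mult adj_adj)
 show "(\<Sum>e\<in>Basis. (-2 * qre (trace (mat_of (e :: (quat, 'n) herm) ** M))) * (-2 * qre (trace (mat_of e ** N))))
   = -1 * (-2 * qre (trace (M ** N)) + -2 * qre (trace (adj M ** N)))"
 proof -
  have "(\<Sum>e\<in>Basis. (-2 * qre (trace (mat_of (e :: (quat, 'n) herm) ** M))) * (-2 * qre (trace (mat_of e ** N))))
   = 4 * (\<Sum>e\<in>Basis. qre (trace (mat_of (e :: (quat, 'n) herm) ** M)) * qre (trace (mat_of e ** N)))"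
   by (simp add: sum_distrib_left mult_ac)
  thus ?thesis unfolding quat_contraction_merge s by simp
 qed
 show "(\<Sum>e\<in>Basis. -2 * qre (trace (mat_of (e :: (quat, 'n) herm) ** M ** mat_of e ** N)))
   = -1 * ((-2 * qre (trace M)) * (-2 * qre (trace N)) + -2 * qre (trace (adj M ** N)))"
  unfolding sum_distrib_left[symmetric] quat_contraction_split by simp
 have "linear (%e :: (quat, 'n) herm. -2 * qre (trace (mat_of e ** M)))"
  by (rule linearI) (simp_all add: plus_herm.rep_eq scaleR_herm.rep_eq matrix_add_left matrix_scaleR_left trace_plus trace_scaleR algebra_simps)
 from basis_sum_linear[OF this, of x]
 show "(\<Sum>e\<in>Basis. inner e x * (-2 * qre (trace (mat_of e ** M)))) = -2 * qre (trace (mat_of x ** M))"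
  by simp
qed

text \<open>The field is read along, so in the first two identities both sides vanish unless
  \<open>P\<close> and \<open>Q\<close> are read along too, and then the straight gluing alone
  survives. The third identity always mixes directions and reads \<open>0 = 0\<close>.\<close>

lemma complex_contraction_rule:
 fixes h :: "complex^'n::finite^'n"
 shows "CG.contraction_rule Basis (%e. Along (mat_of e)) 1
  (%e e'. complex_of_real (inner e (conjugate h e'))) (Along h) (Along (adj h)) Clash Clash"
proof -
 have lin: "(\<Sum>e\<in>Basis. complex_of_real (inner e x) * trace (mat_of e ** M)) = trace (mat_of x ** M)"
  for M :: "complex^'n^'n" and x
 proof -
  have "linear (%e :: (complex, 'n) herm. trace (mat_of e ** M))"
   by (rule linearI) (simp_all add: plus_herm.rep_eq scaleR_herm.rep_eq matrix_add_left matrix_scaleR_left trace_plus trace_scaleR)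
  from basis_sum_linear[OF this, of x] show ?thesis by (simp add: scaleR_conv_of_real)
 qed
 have lin2: "(\<Sum>e\<in>Basis. \<Sum>e'\<in>Basis. complex_of_real (inner e (conjugate h e')) * (c e' * trace (mat_of e ** M e')))
   = (\<Sum>e'\<in>Basis. c e' * trace (h ** mat_of e' ** adj h ** M e'))" for c and M :: "(complex, 'n) herm => _"
 proof -
  have "(\<Sum>e\<in>Basis. \<Sum>e'\<in>Basis. complex_of_real (inner e (conjugate h e')) * (c e' * trace (mat_of e ** M e')))
   = (\<Sum>e'\<in>Basis. c e' * (\<Sum>e\<in>Basis. complex_of_real (inner e (conjugate h e')) * trace (mat_of e ** M e')))"
   by (subst sum.swap) (simp add: sum_distrib_left mult_ac)
  thus ?thesis by (simp only: lin mat_of_conjugate)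
 qed
 show ?thesis
  unfolding CG.contraction_rule_def
 proof (intro allI conjI)
  fix P Q :: "(complex^'n^'n) oriented"
  show "(\<Sum>i\<in>Basis. \<Sum>j\<in>Basis. complex_of_real (inner i (conjugate h j)) *
    (oriented_trace (oriented_mult (Along (mat_of i)) P) * oriented_trace (oriented_mult (Along (mat_of j)) Q)))
   = 1 * (oriented_trace (oriented_mult (oriented_mult (oriented_mult (Along (adj h)) P) (Along h)) Q)
    + oriented_trace (oriented_mult (oriented_mult (oriented_mult Clash Q) (oriented_star Clash)) (oriented_star P)))"
  proof (cases "\<exists>M N. P = Along M \<and> Q = Along N")
   case True
   then obtain M N where PQ: "P = Along M" "Q = Along N" by blast
   have "(\<Sum>i\<in>Basis. \<Sum>j\<in>Basis. complex_of_real (inner i (conjugate h j)) * (trace (mat_of i ** M) * trace (mat_of j ** N)))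
    = (\<Sum>e\<in>Basis. trace (mat_of e ** N) * trace (h ** mat_of e ** adj h ** M))"
    using lin2[of "%e. trace (mat_of e ** N)" "%_. M"] by (simp add: mult.commute)
   also have "\<dots> = (\<Sum>e\<in>Basis. trace (mat_of (e :: (complex, 'n) herm) ** (adj h ** M ** h)) * trace (mat_of e ** N))"
   proof (rule sum.cong[OF refl])
    fix e :: "(complex, 'n) herm"
    show "trace (mat_of e ** N) * trace (h ** mat_of e ** adj h ** M) = trace (mat_of e ** (adj h ** M ** h)) * trace (mat_of e ** N)"
     using trace_mul_sym[of h "mat_of e ** adj h ** M"] by (simp add: matrix_mul_assoc)
   qed
   also have "\<dots> = trace (adj h ** M ** h ** N)" by (rule complex_contraction_merge)
   finally show ?thesis by (simp add: PQ)
  next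
   case False
   thus ?thesis by (cases P; cases Q; simp)
  qed
  show "(\<Sum>i\<in>Basis. \<Sum>j\<in>Basis. complex_of_real (inner i (conjugate h j)) *
    oriented_trace (oriented_mult (oriented_mult (oriented_mult (Along (mat_of j)) Q) (Along (mat_of i))) P))
   = 1 * (oriented_trace (oriented_mult (Along h) Q) * oriented_trace (oriented_mult (Along (adj h)) P)
    + oriented_trace (oriented_mult (oriented_mult (oriented_mult Clash Q) Clash) (oriented_star P)))"
  proof (cases "\<exists>M N. P = Along M \<and> Q = Along N")
   case True
   then obtain M N where PQ: "P = Along M" "Q = Along N" by blast
   have "(\<Sum>i\<in>Basis. \<Sum>j\<in>Basis. complex_of_real (inner i (conjugate h j)) * trace (mat_of j ** N ** mat_of i ** M))
    = (\<Sum>i\<in>Basis. \<Sum>j\<in>Basis. complex_of_real (inner i (conjugate h j)) * (1 * trace (mat_of i ** (M ** mat_of j ** N))))"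
   proof (intro sum.cong refl)
    fix i j :: "(complex, 'n) herm"
    show "complex_of_real (inner i (conjugate h j)) * trace (mat_of j ** N ** mat_of i ** M)
     = complex_of_real (inner i (conjugate h j)) * (1 * trace (mat_of i ** (M ** mat_of j ** N)))"
     using trace_mul_sym[of "mat_of j ** N" "mat_of i ** M"] by (simp add: matrix_mul_assoc)
   qed
   also have "\<dots> = (\<Sum>e\<in>Basis. 1 * trace (h ** mat_of e ** adj h ** (M ** mat_of e ** N)))"
    by (rule lin2)
   also have "\<dots> = (\<Sum>e\<in>Basis. trace (mat_of (e :: (complex, 'n) herm) ** (N ** h) ** mat_of e ** (adj h ** M)))"
   proof (rule sum.cong[OF refl])
    fix e :: "(complex, 'n) herm"
    show "1 * trace (h ** mat_of e ** adj h ** (M ** mat_of e ** N)) = trace (mat_of e ** (N ** h) ** mat_of e ** (adj h ** M))"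
     using trace_mul_sym[of "h ** mat_of e ** adj h ** M" "mat_of e ** N"] by (simp add: matrix_mul_assoc)
   qed
   also have "\<dots> = trace (N ** h) * trace (adj h ** M)" by (rule complex_contraction_split)
   finally show ?thesis unfolding PQ trace_mul_sym[of N h] by simp
  next
   case False
   thus ?thesis by (cases P; cases Q; simp)
  qed
  show "(\<Sum>i\<in>Basis. \<Sum>j\<in>Basis. complex_of_real (inner i (conjugate h j)) *
    oriented_trace (oriented_mult (oriented_mult (oriented_mult (Along (mat_of j)) P) (oriented_star (Along (mat_of i)))) Q))
   = 1 * (oriented_trace (oriented_mult (oriented_mult (oriented_mult (Along (adj h)) (oriented_star P)) (oriented_star (Along h))) Q)
    + oriented_trace (oriented_mult (oriented_star Clash) Q) * oriented_trace (oriented_mult Clash P))"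
   by (cases P; cases Q; simp)
 qed
qed

section \<open>Path measures\<close>

lemma borel_measurable_vecI:
 fixes f :: "'a => real^'n::finite"
 assumes "\<And>i. (%x. f x $ i) \<in> borel_measurable M"
 shows "f \<in> borel_measurable M"
proof -
 have "(%x. f x \<bullet> b) \<in> borel_measurable M" if "b \<in> Basis" for b
  using that assms by (auto simp: Basis_vec_def inner_axis)
 thus ?thesis by (subst borel_measurable_euclidean_space) auto
qed

lemma space_path_space [simp]: "space path_space = UNIV"
 by (simp add: path_space_def)

abbreviation entries_space :: "(nat => 'v \<times> real) measure" where
 "entries_space \<equiv> \<Pi>\<^sub>M i\<in>UNIV. count_space UNIV \<Otimes>\<^sub>M borel"

text \<open>The length takes countably many values, and for a given length the entries are
  coordinates of a sequence.\<close>

lemma measurable_from_path_space: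
 fixes f :: "'v path => 'b"
 assumes "\<And>n. (%w. f (map w [0..<n])) \<in> measurable entries_space N"
 shows "f \<in> measurable path_space N"
proof -
 let ?enc = "%\<gamma>::'v path. (length \<gamma>, %i. if i < length \<gamma> then \<gamma> ! i else undefined)"
 have "?enc \<in> measurable path_space (count_space UNIV \<Otimes>\<^sub>M entries_space)"
  unfolding path_space_def
  by (rule measurable_vimage_algebra1) (auto simp: space_pair_measure space_PiM)
 moreover have "(%(n, w). f (map w [0..<n])) \<in> measurable (count_space UNIV \<Otimes>\<^sub>M entries_space) N"
  by (rule measurable_pair_measure_countable1) (use assms in auto)
 ultimately have "(%\<gamma>. (%(n, w). f (map w [0..<n])) (?enc \<gamma>)) \<in> measurable path_space N"
  by (rule measurable_compose)
 moreover have "map (%i. if i < length \<gamma> then \<gamma> ! i else undefined) [0..<length \<gamma>] = \<gamma>" for \<gamma> :: "'v path"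
  by (rule nth_equalityI) auto
 ultimately show ?thesis by simp
qed

lemma measurable_into_path_space:
 assumes "(%W. length (g W)) \<in> measurable M (count_space UNIV)"
  and "\<And>i. (%W. if i < length (g W) then g W ! i else undefined) \<in> measurable M (count_space UNIV \<Otimes>\<^sub>M borel)"
 shows "g \<in> measurable M path_space"
 unfolding path_space_def
proof (rule measurable_vimage_algebra2)
 show "(%x. (length (g x), %i. if i < length (g x) then g x ! i else undefined))
   \<in> measurable M (count_space UNIV \<Otimes>\<^sub>M entries_space)"
  using assms by (intro measurable_Pair measurable_PiM_single') (auto simp: space_pair_measure)
qed auto

lemma measurable_entry: "(%w. w i) \<in> measurable (entries_space :: (nat => 'v \<times> real) measure) (count_space UNIV \<Otimes>\<^sub>M borel)"
 by (rule measurable_component_singleton) simp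

lemma measurable_map_count_space:
 fixes g :: "'i => 'a => 'b::countable"
 assumes "\<And>i. i \<in> set is ==> g i \<in> measurable M (count_space UNIV)"
 shows "(%w. map (%i. g i w) is) \<in> measurable M (count_space UNIV)"
 using assms
proof (induction "is")
 case (Cons i "is")
 have "(%w. (%y w. y # map (%i. g i w) is) (g i w) w) \<in> measurable M (count_space UNIV)"
 proof (rule measurable_compose_countable[where g = "g i" and f = "%y w. y # map (%i. g i w) is"])
  show "g i \<in> measurable M (count_space UNIV)" using Cons.prems by simp
  fix y
  show "(%w. y # map (%i. g i w) is) \<in> measurable M (count_space UNIV)"
   by (rule measurable_compose[OF Cons.IH]) (use Cons.prems in auto)
 qed
 thus ?case by simp
qed simp

lemma measurable_vertices [measurable]:
 "map fst \<in> measurable (path_space :: 'v::finite path measure) (count_space UNIV)"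
proof (rule measurable_from_path_space)
 fix n
 note measurable_entry [measurable]
 have "(%w. map (%i. fst (w i)) [0..<n]) \<in> measurable (entries_space :: (nat => 'v \<times> real) measure) (count_space UNIV)"
  by (rule measurable_map_count_space) measurable
 thus "(%w. map fst (map w [0..<n])) \<in> measurable (entries_space :: (nat => 'v \<times> real) measure) (count_space UNIV)"
  by (simp add: comp_def)
qed

lemma measurable_path_at:
 "(%(w, t). path_at (map w is) t) \<in> measurable ((entries_space :: (nat => 'v::finite \<times> real) measure) \<Otimes>\<^sub>M borel) (count_space UNIV)"
proof (induction "is")
 case (Cons i "is")
 note [measurable] = Cons.IH measurable_entry
 have "(%x. if snd x < snd (fst x i) \<or> is = [] then fst (fst x i)
    else (%(w, t). path_at (map w is) t) (fst x, snd x - snd (fst x i)))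
   \<in> measurable ((entries_space :: (nat => 'v \<times> real) measure) \<Otimes>\<^sub>M borel) (count_space UNIV)"
  by measurable
 moreover have "path_at (map w (i # is)) t = (if t < snd (w i) \<or> is = [] then fst (w i) else path_at (map w is) (t - snd (w i)))" for w :: "nat => 'v \<times> real" and t
  by (cases "w i") simp
 ultimately show ?case by (simp add: case_prod_beta)
qed simp

lemma measurable_occupation [measurable]: "occupation \<in> borel_measurable (path_space :: 'v::finite path measure)"
proof (rule measurable_from_path_space, rule borel_measurable_vecI)
 fix n and x :: 'v
 define pa where "pa = (%(w :: nat => 'v \<times> real, t). path_at (map w [0..<n]) t)"
 define L where "L = (%w :: nat => 'v \<times> real. lifetime (map w [0..<n]))"
 have [measurable]: "pa \<in> measurable (entries_space \<Otimes>\<^sub>M lborel) (count_space UNIV)"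
  using measurable_path_at[of "[0..<n]"] unfolding pa_def
  by (subst measurable_cong_sets[OF sets_pair_measure_cong[OF refl sets_lborel] refl])
 have [measurable]: "L \<in> borel_measurable entries_space"
  using measurable_entry [measurable] by (simp add: L_def lifetime_def comp_def interv_sum_list_conv_sum_set_nat)
 have "(%p. (if 0 \<le> snd p \<and> snd p \<le> L (fst p) \<and> pa p = x then 1 else 0) :: real)
  \<in> borel_measurable (entries_space \<Otimes>\<^sub>M lborel)"
  by measurable
 hence "(%w. LINT t|lborel. (if 0 \<le> t \<and> t \<le> lifetime (map w [0..<n]) \<and> pa (w, t) = x then 1 else 0) :: real)
  \<in> borel_measurable (entries_space :: (nat => 'v \<times> real) measure)"
  by (intro lborel.borel_measurable_lebesgue_integral) (simp add: case_prod_unfold L_def)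
 moreover have "(LINT t|lborel. (if 0 \<le> t \<and> t \<le> lifetime (map w [0..<n]) \<and> pa (w, t) = x then 1 else 0) :: real)
   = occupation (map w [0..<n]) $ x" for w
  unfolding occupation_def set_lebesgue_integral_def pa_def vec_lambda_beta
  by (rule Bochner_Integration.integral_cong) (auto simp: indicator_def)
 ultimately show "(%w. occupation (map w [0..<n]) $ x) \<in> borel_measurable (entries_space :: (nat => 'v \<times> real) measure)"
  by simp
qed

lemma occupation_nonneg: "0 \<le> occupation \<gamma> $ x"
 by (auto simp: occupation_def set_lebesgue_integral_def intro!: integral_nonneg_AE)

lemma measurable_path_at_fixed [measurable]: "path_at \<gamma> \<in> measurable borel (count_space UNIV)"
proof (induction \<gamma>)
 case (Cons a \<gamma>)
 note [measurable] = Cons.IH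
 obtain y \<tau> where a: "a = (y, \<tau>)" by (cases a)
 have "(%t. if t < \<tau> \<or> \<gamma> = [] then y else path_at \<gamma> (t - \<tau>)) \<in> measurable borel (count_space UNIV)"
  by measurable
 thus ?case by (simp add: a)
qed simp

lemma lifetime_nonneg: "(\<forall>p\<in>set \<gamma>. 0 \<le> snd p) ==> 0 \<le> lifetime \<gamma>"
 by (auto simp: lifetime_def intro!: sum_list_nonneg)

lemma occupation_Nil [simp]: "occupation [] = 0"
proof -
 have "(LINT t:{0..0::real}|lborel. (f t :: real)) = 0" for f
 proof -
  have "AE t in lborel. indicator {0..0::real} t *\<^sub>R f t = 0"
   using AE_lborel_singleton[of 0] by eventually_elim (auto simp: indicator_def)
  thus ?thesis unfolding set_lebesgue_integral_def by (rule integral_eq_zero_AE)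
 qed
 thus ?thesis by (simp add: occupation_def lifetime_def vec_eq_iff)
qed

text \<open>The first sojourn contributes \<open>\<tau>\<close> at \<open>y\<close>; the remaining
  time integral is that of the tail, translated by \<open>\<tau>\<close>. Non-negative times keep
  the two pieces apart.\<close>

lemma occupation_Cons:
 assumes "0 \<le> \<tau>" "\<forall>p\<in>set \<gamma>. 0 \<le> snd p"
 shows "occupation ((y, \<tau>) # \<gamma>) = \<tau> *\<^sub>R axis y 1 + occupation \<gamma>"
proof (cases "\<gamma> = []")
 case True
 have "occupation [(y, \<tau>)] $ x = (\<tau> *\<^sub>R axis y 1) $ x" for x
  using assms by (simp add: occupation_def lifetime_def set_lebesgue_integral_def axis_def)
 thus ?thesis using True by (simp add: vec_eq_iff)
next
 case False
 have L: "0 \<le> lifetime \<gamma>" using lifetime_nonneg assms by blast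
 have lt: "lifetime ((y, \<tau>) # \<gamma>) = \<tau> + lifetime \<gamma>" by (simp add: lifetime_def)
 show ?thesis
 proof (unfold vec_eq_iff, rule allI)
  fix x
  let ?f = "%t. of_bool (path_at \<gamma> t = x) :: real"
  let ?g = "%t. of_bool (path_at ((y, \<tau>) # \<gamma>) t = x) :: real"
  have Ico: "emeasure lborel {a..<b} < \<top>" for a b :: real
   by (rule le_less_trans[OF emeasure_mono[of _ "{a..b}"]]) (auto simp: emeasure_lborel_Icc_eq)
  have meas: "set_integrable lborel {a..b} ?f" "set_integrable lborel {a..b} ?g" "set_integrable lborel {a..<b} ?g" for a b :: real
   unfolding set_integrable_def
   by (rule integrableI_bounded_set_indicator[where B=1];
     simp del: path_at.simps add: emeasure_lborel_Icc_eq Ico)+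
  have "{0..\<tau> + lifetime \<gamma>} = {0..<\<tau>} \<union> {\<tau>..\<tau> + lifetime \<gamma>}" using assms L by auto
  hence "(LINT t:{0..\<tau> + lifetime \<gamma>}|lborel. ?g t)
    = (LINT t:{0..<\<tau>}|lborel. ?g t) + (LINT t:{\<tau>..\<tau> + lifetime \<gamma>}|lborel. ?g t)"
   using meas by (subst set_integral_Un[symmetric]) auto
  also have "(LINT t:{0..<\<tau>}|lborel. ?g t) = (LINT t:{0..<\<tau>}|lborel. of_bool (y = x))"
   by (rule set_lebesgue_integral_cong) auto
  also have "\<dots> = \<tau> * of_bool (y = x)"
   using assms by (simp add: set_lebesgue_integral_def)
  also have "(LINT t:{\<tau>..\<tau> + lifetime \<gamma>}|lborel. ?g t) = (LINT t|lborel. indicator {\<tau>..\<tau> + lifetime \<gamma>} (\<tau> + 1 * t) *\<^sub>R ?g (\<tau> + 1 * t))"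
   unfolding set_lebesgue_integral_def by (subst lborel_integral_real_affine[where c=1 and t=\<tau>]) auto
  also have "\<dots> = (LINT t:{0..lifetime \<gamma>}|lborel. ?f t)"
   unfolding set_lebesgue_integral_def by (rule Bochner_Integration.integral_cong) (auto simp: False indicator_def)
  finally show "occupation ((y, \<tau>) # \<gamma>) $ x = (\<tau> *\<^sub>R axis y 1 + occupation \<gamma>) $ x"
   by (simp add: occupation_def lt axis_def)
 qed
qed

lemma inner_occupation:
 assumes "\<forall>p\<in>set \<gamma>. 0 \<le> snd p"
 shows "V \<bullet> occupation \<gamma> = (\<Sum>(y, \<tau>)\<leftarrow>\<gamma>. V $ y * \<tau>)"
 using assms
 by (induction \<gamma>) (auto simp: occupation_Cons inner_add_right inner_axis algebra_simps)

section \<open>The jump process as a function of time and noise\<close>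

lemma measurable_noise_fst [measurable]:
 "(%W. fst W i) \<in> measurable (noise E C K) (count_space UNIV)"
proof -
 have "(%\<xi>. \<xi> i) \<in> measurable (\<Pi>\<^sub>M i\<in>UNIV. measure_pmf (jump_pmf E C K (snd i))) (measure_pmf (jump_pmf E C K (snd i)))"
  by (rule measurable_component_singleton) simp
 hence "(%\<xi>. \<xi> i) \<in> measurable (\<Pi>\<^sub>M i\<in>UNIV. measure_pmf (jump_pmf E C K (snd i))) (count_space UNIV)"
  by (simp cong: measurable_cong_sets)
 thus ?thesis unfolding noise_def by measurable
qed

lemma measurable_noise_snd [measurable]:
 "(%W. snd W m) \<in> borel_measurable (noise E C K)"
proof -
 have "(%e. e m) \<in> measurable (\<Pi>\<^sub>M m\<in>UNIV. density lborel (%t. ennreal (exponential_density 1 t))) (density lborel (%t. ennreal (exponential_density 1 t)))"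
  by (rule measurable_component_singleton) simp
 hence "(%e. e m) \<in> borel_measurable (\<Pi>\<^sub>M m\<in>UNIV. density lborel (%t. ennreal (exponential_density 1 t)))"
  by (simp cong: measurable_cong_sets)
 thus ?thesis unfolding noise_def by measurable
qed

lemma measurable_jump_chain [measurable]:
 "(%W. jump_chain x W m) \<in> measurable (noise E C K) (count_space UNIV)"
proof (induction m)
 case (Suc m)
 have "(%W. (%s W. case s of None => None | Some v => fst W (m, v)) (jump_chain x W m) W)
   \<in> measurable (noise E C K) (count_space UNIV)"
 proof (rule measurable_compose_countable[OF _ Suc])
  fix s show "(%W. case s of None => None | Some v => fst W (m, v)) \<in> measurable (noise E C K) (count_space UNIV)"
   by (cases s) (simp_all add: measurable_noise_fst)
 qed
 thus ?case by simp
qed simp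

lemma measurable_holding_time [measurable]:
 "(%W. holding_time E C K x W m) \<in> borel_measurable (noise E C K)"
proof -
 have "(%W. (%s W. case s of None => snd W m | Some v => snd W m / exit_rate E C K v) (jump_chain x W m) W)
   \<in> borel_measurable (noise E C K)"
 proof (rule measurable_compose_countable[OF _ measurable_jump_chain])
  fix s show "(%W. case s of None => snd W m | Some v => snd W m / exit_rate E C K v) \<in> borel_measurable (noise E C K)"
   by (cases s) simp_all
 qed
 thus ?thesis by (simp add: holding_time_def)
qed

lemma measurable_jump_time [measurable]:
 "(%W. jump_time E C K x W m) \<in> borel_measurable (noise E C K)"
 unfolding jump_time_def by measurable

lemma measurable_jump_count [measurable]:
 "(%(t, W). jump_count E C K x t W) \<in> measurable (borel \<Otimes>\<^sub>M noise E C K) (count_space UNIV)"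
 unfolding jump_count_def case_prod_beta by measurable

lemma measurable_jump_process [measurable]:
 "(%(t, W). jump_process E C K x t W) \<in> measurable (borel \<Otimes>\<^sub>M noise E C K) (count_space UNIV)"
proof -
 have "(%p. (%n p. jump_chain x (snd p) n) ((%(t, W). jump_count E C K x t W) p) p) \<in> measurable (borel \<Otimes>\<^sub>M noise E C K) (count_space UNIV)"
  by (rule measurable_compose_countable[OF _ measurable_jump_count]) measurable
 thus ?thesis by (simp add: jump_process_def case_prod_beta)
qed

lemma measurable_path_until [measurable]:
 "(%(t, W). path_until E C K x t W) \<in> measurable (borel \<Otimes>\<^sub>M noise E C K) path_space"
proof (rule measurable_into_path_space)
 show "(%p. length (case p of (t, W) => path_until E C K x t W)) \<in> measurable (borel \<Otimes>\<^sub>M noise E C K) (count_space UNIV)"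
  using measurable_compose[OF measurable_jump_count, of Suc "count_space UNIV"]
  by (simp add: path_until_def case_prod_beta Let_def)
 fix i
 let ?q = "%N p. if i < Suc N then (if i < N then (the (jump_chain x (snd p) i), holding_time E C K x (snd p) i)
   else (the (jump_chain x (snd p) N), fst p - jump_time E C K x (snd p) N)) else undefined"
 have "(%p. ?q ((%(t, W). jump_count E C K x t W) p) p) \<in> measurable (borel \<Otimes>\<^sub>M noise E C K) (count_space UNIV \<Otimes>\<^sub>M borel)"
 proof (rule measurable_compose_countable[OF _ measurable_jump_count])
  fix N
  have [measurable]: "(%W. the (jump_chain x W k)) \<in> measurable (noise E C K) (count_space UNIV)" for k
   by (rule measurable_compose[OF measurable_jump_chain]) simp
  show "?q N \<in> measurable (borel \<Otimes>\<^sub>M noise E C K) (count_space UNIV \<Otimes>\<^sub>M borel)"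
   by (cases "i < N"; cases "i < Suc N"; simp add: space_pair_measure)
 qed
 thus "(%p. if i < length (case p of (t, W) => path_until E C K x t W) then (case p of (t, W) => path_until E C K x t W) ! i else undefined)
  \<in> measurable (borel \<Otimes>\<^sub>M noise E C K) (count_space UNIV \<Otimes>\<^sub>M borel)"
  by (rule measurable_cong[THEN iffD1, rotated])
   (auto simp: path_until_def Let_def case_prod_beta nth_append less_Suc_eq)
qed

lemma prob_space_noise:
 fixes E :: "'v::finite set set"
 shows "prob_space (noise E C K)"
proof -
 show ?thesis
  unfolding noise_def
  by (intro prob_space_pair prob_space_PiM measure_pmf.prob_space_axioms prob_space_exponential_density) simp
qed

lemma space_noise [simp]: "space (noise E C K) = UNIV"
 by (simp add: noise_def space_pair_measure space_PiM)

lemma measurable_path_until_at [measurable]: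
 "path_until E C K x t \<in> measurable (noise E C K) path_space"
proof -
 have t: "Pair t \<in> measurable (noise E C K) (borel \<Otimes>\<^sub>M noise E C K)" by measurable
 show ?thesis using measurable_compose[OF t measurable_path_until] by simp
qed

lemma measurable_jump_process_at [measurable]:
 "jump_process E C K x t \<in> measurable (noise E C K) (count_space UNIV)"
proof -
 have t: "Pair t \<in> measurable (noise E C K) (borel \<Otimes>\<^sub>M noise E C K)" by measurable
 show ?thesis using measurable_compose[OF t measurable_jump_process] by simp
qed

lemma sets_alive_at: "{W. jump_process E C K x t W = Some y} \<in> sets (noise E C K)"
 using measurable_sets[OF measurable_jump_process_at, of "{Some y}"] by (auto simp: vimage_def)

lemma emeasure_bridge:
 assumes B: "B \<in> sets path_space"
 shows "emeasure (bridge E C K t x y) B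
  = emeasure (noise E C K) ({W. jump_process E C K x t W = Some y} \<inter> path_until E C K x t -` B)
   / emeasure (noise E C K) {W. jump_process E C K x t W = Some y}"
proof -
 let ?A = "{W. jump_process E C K x t W = Some y}"
 have m: "path_until E C K x t \<in> measurable (uniform_measure (noise E C K) ?A) path_space"
  by (simp add: uniform_measure_def measurable_path_until_at)
 have "emeasure (bridge E C K t x y) B = emeasure (uniform_measure (noise E C K) ?A) (path_until E C K x t -` B)"
  unfolding bridge_def space_noise using emeasure_distr[OF m B] by (simp add: uniform_measure_def)
 also have "\<dots> = emeasure (noise E C K) (?A \<inter> path_until E C K x t -` B) / emeasure (noise E C K) ?A"
  using measurable_sets[OF measurable_path_until_at B] sets_alive_at by (subst emeasure_uniform_measure) auto
 finally show ?thesis .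
qed

lemma ennreal_mult_divide_cancel: "a ~= 0 ==> a ~= \<top> ==> a * (b / a) = (b::ennreal)"
 by (simp add: ennreal_times_divide mult.commute[of a] ennreal_mult_divide_eq)

text \<open>The normalisation of the conditional law cancels against the transition probability; if
  that probability is 0, the indicator makes the right-hand side vanish too.\<close>

lemma bridge_nn_integral:
 assumes [measurable]: "f \<in> borel_measurable path_space"
 shows "ennreal (transition E C K t x y) * (\<integral>\<^sup>+\<gamma>. f \<gamma> \<partial>bridge E C K t x y)
  = (\<integral>\<^sup>+W. f (path_until E C K x t W) * indicator {W. jump_process E C K x t W = Some y} W \<partial>noise E C K)"
proof -
 interpret prob_space "noise E C K" by (rule prob_space_noise)
 let ?A = "{W. jump_process E C K x t W = Some y}"
 have A: "?A \<in> sets (noise E C K)" by (rule sets_alive_at)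
 have e: "ennreal (transition E C K t x y) = emeasure (noise E C K) ?A"
  by (simp add: transition_def emeasure_eq_measure)
 have "(\<integral>\<^sup>+\<gamma>. f \<gamma> \<partial>bridge E C K t x y) = (\<integral>\<^sup>+W. f (path_until E C K x t W) \<partial>uniform_measure (noise E C K) ?A)"
  unfolding bridge_def by (subst nn_integral_distr) (auto simp: uniform_measure_def)
 also have "\<dots> = (\<integral>\<^sup>+W. f (path_until E C K x t W) * indicator ?A W \<partial>noise E C K) / emeasure (noise E C K) ?A"
  by (rule nn_integral_uniform_measure[OF _ A]) measurable
 finally have b: "(\<integral>\<^sup>+\<gamma>. f \<gamma> \<partial>bridge E C K t x y)
  = (\<integral>\<^sup>+W. f (path_until E C K x t W) * indicator ?A W \<partial>noise E C K) / emeasure (noise E C K) ?A" .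
 show ?thesis
 proof (cases "emeasure (noise E C K) ?A = 0")
  case True
  hence "AE W in noise E C K. W \<notin> ?A" using A by (subst AE_iff_measurable[OF A]) auto
  hence "(\<integral>\<^sup>+W. f (path_until E C K x t W) * indicator ?A W \<partial>noise E C K) = 0"
   by (subst nn_integral_0_iff_AE) (use A in \<open>auto simp: indicator_def\<close>)
  thus ?thesis using True by (simp add: e)
 next
  case False
  thus ?thesis unfolding e b
   by (intro ennreal_mult_divide_cancel) (simp_all add: emeasure_eq_measure)
 qed
qed

lemma measurable_bridge [measurable]:
 "(%t. bridge E C K t x y) \<in> measurable borel (subprob_algebra path_space)"
proof (rule measurable_subprob_algebra)
 interpret prob_space "noise E C K" by (rule prob_space_noise)
 fix t :: real
 show "sets (bridge E C K t x y) = sets path_space" by (simp add: bridge_def)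
 show "subprob_space (bridge E C K t x y)"
 proof
  let ?A = "{W. jump_process E C K x t W = Some y}"
  have s: "space (bridge E C K t x y) = UNIV" by (simp add: bridge_def)
  have "emeasure (bridge E C K t x y) UNIV = emeasure (noise E C K) ?A / emeasure (noise E C K) ?A"
   using emeasure_bridge[of UNIV] sets.top[of path_space] by simp
  \<comment> \<open>When the conditioning event is null, the quotient is \<open>0 / 0 = 0\<close>,
    so in general the bridge is only a sub-probability.\<close>
  also have "\<dots> \<le> 1"
   by (cases "emeasure (noise E C K) ?A = 0") (simp_all add: ennreal_divide_self emeasure_eq_measure)
  finally show "emeasure (bridge E C K t x y) (space (bridge E C K t x y)) \<le> 1" unfolding s .
  show "space (bridge E C K t x y) ~= {}" unfolding s by simp
 qed
next
 interpret prob_space "noise E C K" by (rule prob_space_noise)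
 fix B :: "'a path set" assume B: "B \<in> sets path_space"
 have m1: "{p \<in> space (borel \<Otimes>\<^sub>M noise E C K). (%(t, W). jump_process E C K x t W) p = Some y} \<in> sets (borel \<Otimes>\<^sub>M noise E C K)"
  by measurable
 have m2: "(%(t, W). path_until E C K x t W) -` B \<inter> space (borel \<Otimes>\<^sub>M noise E C K) \<in> sets (borel \<Otimes>\<^sub>M noise E C K)"
  by (rule measurable_sets[OF measurable_path_until B])
 have r1: "(%t. emeasure (noise E C K) {W. jump_process E C K x t W = Some y}) \<in> borel_measurable borel"
  using measurable_emeasure_Pair[OF m1] by (simp add: space_pair_measure vimage_def)
 have "Pair t -` ({p \<in> space (borel \<Otimes>\<^sub>M noise E C K). (%(t, W). jump_process E C K x t W) p = Some y} \<inter> ((%(t, W). path_until E C K x t W) -` B \<inter> space (borel \<Otimes>\<^sub>M noise E C K)))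
  = {W. jump_process E C K x t W = Some y} \<inter> path_until E C K x t -` B" for t :: real
  by (auto simp: space_pair_measure)
 hence r2: "(%t. emeasure (noise E C K) ({W. jump_process E C K x t W = Some y} \<inter> path_until E C K x t -` B)) \<in> borel_measurable borel"
  using measurable_emeasure_Pair[OF sets.Int[OF m1 m2]] by simp
 show "(%t. emeasure (bridge E C K t x y) B) \<in> borel_measurable borel"
  unfolding emeasure_bridge[OF B] by (rule borel_measurable_divide_ennreal[OF r2 r1])
qed

lemma measurable_transition [measurable]:
 "(%t. transition E C K t x y) \<in> borel_measurable borel"
proof -
 interpret prob_space "noise E C K" by (rule prob_space_noise)
 have m1: "{p \<in> space (borel \<Otimes>\<^sub>M noise E C K). (%(t, W). jump_process E C K x t W) p = Some y} \<in> sets (borel \<Otimes>\<^sub>M noise E C K)"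
  by measurable
 have "(%t. emeasure (noise E C K) (Pair t -` {p \<in> space (borel \<Otimes>\<^sub>M noise E C K). (%(t, W). jump_process E C K x t W) p = Some y})) \<in> borel_measurable borel"
  by (rule measurable_emeasure_Pair[OF m1])
 thus ?thesis by (simp add: transition_def measure_def space_pair_measure vimage_def)
qed

lemma sets_path_measure [simp, measurable_cong]: "sets (path_measure E C K x y) = sets path_space"
 unfolding path_measure_def
 by (rule sets_bind) (auto simp: space_restrict_space bridge_def intro!: exI[of _ 1])

lemma space_path_measure [simp]: "space (path_measure E C K x y) = UNIV"
 using sets_eq_imp_space_eq[OF sets_path_measure] by simp

text \<open>Mixing the bridges with weight \<open>transition\<close> undoes the conditioning. By
  Tonelli, integration against the path measure becomes an average over the noise of a time integral
  along one trajectory.\<close>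

lemma path_measure_nn_integral:
 assumes f[measurable]: "f \<in> borel_measurable path_space"
 shows "(\<integral>\<^sup>+\<gamma>. f \<gamma> \<partial>path_measure E C K x y)
  = (\<integral>\<^sup>+W. \<integral>\<^sup>+t. f (path_until E C K x t W) * indicator {t. 0 < t \<and> jump_process E C K x t W = Some y} t \<partial>lborel \<partial>noise E C K)"
proof -
 interpret prob_space "noise E C K" by (rule prob_space_noise)
 interpret pair_sigma_finite lborel "noise E C K" by standard
 have [measurable]: "(%t. bridge E C K t x y) \<in> measurable (restrict_space lborel {0<..}) (subprob_algebra path_space)"
  by (rule measurable_restrict_space1) simp
 have "(\<integral>\<^sup>+\<gamma>. f \<gamma> \<partial>path_measure E C K x y)
   = (\<integral>\<^sup>+t. (\<integral>\<^sup>+\<gamma>. f \<gamma> \<partial>bridge E C K t x y) \<partial>density (restrict_space lborel {0<..}) (%t. ennreal (transition E C K t x y)))"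
  unfolding path_measure_def by (rule nn_integral_bind[OF f]) simp
 also have "\<dots> = (\<integral>\<^sup>+t. ennreal (transition E C K t x y) * (\<integral>\<^sup>+\<gamma>. f \<gamma> \<partial>bridge E C K t x y) \<partial>restrict_space lborel {0<..})"
 proof (rule nn_integral_density)
  show "(%t. ennreal (transition E C K t x y)) \<in> borel_measurable (restrict_space lborel {0<..})"
   by (rule measurable_restrict_space1) measurable
  show "(%t. \<integral>\<^sup>+\<gamma>. f \<gamma> \<partial>bridge E C K t x y) \<in> borel_measurable (restrict_space lborel {0<..})"
   by (rule measurable_restrict_space1) measurable
 qed
 also have "\<dots> = (\<integral>\<^sup>+t. (\<integral>\<^sup>+W. f (path_until E C K x t W) * indicator {W. jump_process E C K x t W = Some y} W \<partial>noise E C K) * indicator {0<..} t \<partial>lborel)"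
  unfolding bridge_nn_integral[OF f] by (rule nn_integral_restrict_space) simp
 also have "\<dots> = (\<integral>\<^sup>+t. (\<integral>\<^sup>+W. f ((%(t, W). path_until E C K x t W) (t, W)) * (if 0 < t \<and> (%(t, W). jump_process E C K x t W) (t, W) = Some y then 1 else 0) \<partial>noise E C K) \<partial>lborel)"
  by (rule nn_integral_cong) (auto simp: indicator_def of_bool_def)
 also have "\<dots> = (\<integral>\<^sup>+W. (\<integral>\<^sup>+t. f ((%(t, W). path_until E C K x t W) (t, W)) * (if 0 < t \<and> (%(t, W). jump_process E C K x t W) (t, W) = Some y then 1 else 0) \<partial>lborel) \<partial>noise E C K)"
  by (rule Fubini'[symmetric]) measurable
 also have "\<dots> = (\<integral>\<^sup>+W. \<integral>\<^sup>+t. f (path_until E C K x t W) * indicator {t. 0 < t \<and> jump_process E C K x t W = Some y} t \<partial>lborel \<partial>noise E C K)"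
  by (intro nn_integral_cong) (auto simp: indicator_def)
 finally show ?thesis .
qed

section \<open>Rates of the network\<close>

lemma network_killing_nonneg: "network E C \<kappa> ==> 0 \<le> \<kappa> x"
 by (simp add: network_def)

lemma network_killing_nonzero: "network E C \<kappa> ==> \<exists>x. \<kappa> x ~= 0"
 unfolding network_def by (elim conjE)

lemma network_conductance:
 assumes "network E C \<kappa>" "{x, y} \<in> E"
 shows "C x y = C y x" "0 < C x y"
 using assms unfolding network_def by (elim conjE, blast)+

lemma network_connected: "network E C \<kappa> ==> (x, y) \<in> {(a, b). {a, b} \<in> E}\<^sup>*"
 unfolding network_def by (elim conjE, erule allE, erule allE)

lemma jump_rate_nonneg: "network E C \<kappa> ==> 0 \<le> jump_rate E C x y"
 using network_conductance(2)[of E C \<kappa> x y] by (simp add: jump_rate_def less_imp_le)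

text \<open>By connectedness a vertex without edges is the only vertex, and then the killing acts
  there.\<close>

lemma exit_rate_pos:
 assumes "network E C \<kappa>"
 shows "0 < exit_rate E C \<kappa> v"
proof -
 have nn: "0 \<le> \<kappa> x" "0 \<le> jump_rate E C x y" for x y
  using assms by (simp_all add: network_killing_nonneg jump_rate_nonneg)
 obtain x where x: "\<kappa> x ~= 0" using network_killing_nonzero[OF assms] ..
 have "(v, x) \<in> {(a, b). {a, b} \<in> E}\<^sup>*" by (rule network_connected[OF assms])
 then consider "v = x" | b where "{v, b} \<in> E"
  by (cases rule: converse_rtranclE) auto
 thus ?thesis
 proof cases
  case 1
  hence "0 < \<kappa> v" using x nn(1)[of x] by simp
  thus ?thesis using sum_nonneg[of UNIV "jump_rate E C v"] nn by (simp add: exit_rate_def add_pos_nonneg)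
 next
  case 2
  hence "0 < jump_rate E C v b" using network_conductance[OF assms 2] by (simp add: jump_rate_def)
  hence "0 < (\<Sum>y\<in>UNIV. jump_rate E C v y)"
   using nn by (intro sum_pos2[of _ b]) auto
  thus ?thesis using nn(1)[of v] by (simp add: exit_rate_def)
 qed
qed

lemma pmf_jump_pmf_Some:
 assumes N: "network E C \<kappa>"
 shows "pmf (jump_pmf E C \<kappa> v) (Some w) = jump_rate E C v w / exit_rate E C \<kappa> v"
proof -
 have r: "0 < exit_rate E C \<kappa> v" by (rule exit_rate_pos[OF N])
 have nn: "0 \<le> \<kappa> v" "0 \<le> jump_rate E C v y" for y
  using network_killing_nonneg[OF N] jump_rate_nonneg[OF N] by simp_all
 let ?f = "%z. case z of None => \<kappa> v / exit_rate E C \<kappa> v | Some w => jump_rate E C v w / exit_rate E C \<kappa> v"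
 have nonneg: "0 \<le> ?f z" for z using r nn by (cases z) auto
 have "(\<Sum>z\<in>UNIV. ?f z) = ?f None + (\<Sum>w\<in>UNIV. ?f (Some w))"
  unfolding UNIV_option_conv by (subst sum.insert) (auto simp: sum.reindex)
 also have "\<dots> = exit_rate E C \<kappa> v / exit_rate E C \<kappa> v"
  by (simp add: exit_rate_def add_divide_distrib[symmetric] sum_divide_distrib[symmetric])
 finally have "(\<Sum>z\<in>UNIV. ?f z) = 1" using r by simp
 hence "(\<integral>\<^sup>+z. ennreal (?f z) \<partial>count_space UNIV) = 1"
  using nonneg by (subst nn_integral_count_space_finite) (simp_all add: sum_ennreal)
 thus ?thesis
  unfolding jump_pmf_def using nonneg by (subst pmf_embed_pmf) auto
qed

section \<open>Independent exponential holding times\<close>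

lemma (in product_prob_space) nn_integral_PiM_prod:
 assumes "finite J" "J \<subseteq> I" and f[measurable]: "\<And>i. i \<in> J ==> f i \<in> borel_measurable (M i)"
 shows "(\<integral>\<^sup>+W. (\<Prod>i\<in>J. f i (W i)) \<partial>PiM I M) = (\<Prod>i\<in>J. \<integral>\<^sup>+x. f i x \<partial>M i)"
proof -
 have m: "(%W. \<Prod>i\<in>J. f i (W i)) \<in> borel_measurable (PiM J M)"
  by measurable
 have "(\<integral>\<^sup>+W. (\<Prod>i\<in>J. f i (W i)) \<partial>PiM J M)
  = (\<integral>\<^sup>+W. (\<Prod>i\<in>J. f i (W i)) \<partial>distr (PiM I M) (PiM J M) (%x. restrict x J))"
  using distr_PiM_restrict_finite[OF assms(1,2)] by simp
 also have "\<dots> = (\<integral>\<^sup>+W. (\<Prod>i\<in>J. f i (restrict W J i)) \<partial>PiM I M)"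
  by (rule nn_integral_distr[OF measurable_restrict_subset[OF assms(2)]]) (use m in simp)
 also have "\<dots> = (\<integral>\<^sup>+W. (\<Prod>i\<in>J. f i (W i)) \<partial>PiM I M)"
  by (intro nn_integral_cong prod.cong) auto
 finally show ?thesis
  using product_nn_integral_prod[OF assms(1), of f] f by simp
qed

text \<open>The exponential law with rate \<open>a\<close> has mass 1, and its density is
  \<open>a\<close> times the integrand.\<close>

lemma nn_integral_exp_decay:
 assumes "0 < (a::real)"
 shows "(\<integral>\<^sup>+x. ennreal (exp (- a * x)) * indicator {0..} x \<partial>lborel) = ennreal (1 / a)"
proof -
 interpret prob_space "density lborel (%t. ennreal (exponential_density a t))"
  by (rule prob_space_exponential_density[OF assms])
 have "(\<integral>\<^sup>+x. ennreal (exponential_density a x) \<partial>lborel) = 1"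
  using emeasure_space_1 by (subst (asm) emeasure_density) auto
 moreover have "ennreal (exponential_density a x) = ennreal a * (ennreal (exp (- a * x)) * indicator {0..} x)" for x
  using assms by (auto simp: exponential_density_def ennreal_mult' mult.commute)
 ultimately have "ennreal a * (\<integral>\<^sup>+x. ennreal (exp (- a * x)) * indicator {0..} x \<partial>lborel) = 1"
  by (subst nn_integral_cmult[symmetric]) auto
 thus ?thesis
  using assms by (metis divide_self_if ennreal_1 ennreal_divide_times ennreal_mult_divide_cancel
   ennreal_neq_top ennreal_eq_0_iff less_le_not_le divide_ennreal zero_le_one mult.commute ennreal_mult_divide_eq)
qed

abbreviation exponential_law :: "real measure" where
 "exponential_law \<equiv> density lborel (%t. ennreal (exponential_density 1 t))"

lemma exponential_laplace:
 assumes "0 \<le> (a::real)"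
 shows "(\<integral>\<^sup>+x. ennreal (exp (- a * x)) \<partial>exponential_law) = ennreal (1 / (1 + a))"
proof -
 have "(\<integral>\<^sup>+x. ennreal (exp (- a * x)) \<partial>exponential_law)
  = (\<integral>\<^sup>+x. ennreal (exponential_density 1 x) * ennreal (exp (- a * x)) \<partial>lborel)"
  by (rule nn_integral_density) auto
 also have "\<dots> = (\<integral>\<^sup>+x. ennreal (exp (- (1 + a) * x)) * indicator {0..} x \<partial>lborel)"
  by (rule nn_integral_cong)
   (auto simp: exponential_density_def ennreal_mult'[symmetric] mult_exp_exp algebra_simps)
 also have "\<dots> = ennreal (1 / (1 + a))" by (rule nn_integral_exp_decay) (use assms in simp)
 finally show ?thesis .
qed

text \<open>This is the factor of the last vertex of a path. Integrating over the terminal time cuts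
  the last holding time at every point before its end, and Tonelli replaces the cut by the
  exponential tail \<open>exp (- r * s)\<close>.\<close>

lemma exponential_sojourn:
 assumes "0 < (r::real)" "0 \<le> a"
 shows "(\<integral>\<^sup>+e. (\<integral>\<^sup>+s. ennreal (exp (- a * s)) * indicator {0..<e / r} s \<partial>lborel) \<partial>exponential_law)
   = ennreal (1 / (r + a))"
proof -
 interpret prob_space exponential_law by (rule prob_space_exponential_density) simp
 interpret pair_sigma_finite lborel exponential_law by standard
 have d: "distributed exponential_law lborel (%x. x) (%t. ennreal (exponential_density 1 t))"
  by (auto simp: distributed_def distr_id2 intro!: measure_eqI)
 have gt: "emeasure exponential_law {e. r * s < e} = ennreal (exp (- r * s))" if "0 \<le> s" for s
  using exponential_distributedD_gt[OF d, of "r * s"] that assms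
  by (simp add: emeasure_eq_measure)
 have "(\<integral>\<^sup>+e. (\<integral>\<^sup>+s. ennreal (exp (- a * s)) * indicator {0..<e / r} s \<partial>lborel) \<partial>exponential_law)
  = (\<integral>\<^sup>+e. (\<integral>\<^sup>+s. ennreal (exp (- a * s)) * (if 0 \<le> s \<and> r * s < e then 1 else 0) \<partial>lborel) \<partial>exponential_law)"
  using assms by (intro nn_integral_cong) (auto simp: indicator_def field_simps)
 also have "\<dots> = (\<integral>\<^sup>+s. (\<integral>\<^sup>+e. ennreal (exp (- a * s)) * (if 0 \<le> s \<and> r * s < e then 1 else 0) \<partial>exponential_law) \<partial>lborel)"
  by (rule Fubini') measurable
 also have "\<dots> = (\<integral>\<^sup>+s. ennreal (exp (- (r + a) * s)) * indicator {0..} s \<partial>lborel)"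
 proof (rule nn_integral_cong)
  fix s :: real
  show "(\<integral>\<^sup>+e. ennreal (exp (- a * s)) * (if 0 \<le> s \<and> r * s < e then 1 else 0) \<partial>exponential_law)
   = ennreal (exp (- (r + a) * s)) * indicator {0..} s"
  proof (cases "0 \<le> s")
   case True
   have "(\<integral>\<^sup>+e. ennreal (exp (- a * s)) * (if 0 \<le> s \<and> r * s < e then 1 else 0) \<partial>exponential_law)
     = (\<integral>\<^sup>+e. ennreal (exp (- a * s)) * indicator {e. r * s < e} e \<partial>exponential_law)"
    using True by (intro nn_integral_cong) (auto simp: indicator_def)
   also have "\<dots> = ennreal (exp (- a * s)) * emeasure exponential_law {e. r * s < e}"
    by (rule nn_integral_cmult_indicator) auto
   finally show ?thesis
    using True gt[OF True] by (simp add: ennreal_mult'[symmetric] mult_exp_exp algebra_simps)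
  qed simp
 qed
 also have "\<dots> = ennreal (1 / (r + a))" by (rule nn_integral_exp_decay) (use assms in simp)
 finally show ?thesis .
qed

abbreviation holding_noise :: "(nat => real) measure" where
 "holding_noise \<equiv> \<Pi>\<^sub>M m\<in>UNIV. exponential_law"

lemma product_prob_space_exponential: "product_prob_space (%_. exponential_law)"
 by (intro product_prob_spaceI prob_space_exponential_density) simp

lemma AE_holding_pos: "AE e in holding_noise. \<forall>m. 0 < e m"
proof -
 have p: "prob_space exponential_law" by (rule prob_space_exponential_density) simp
 have "AE x in exponential_law. 0 < x"
  using AE_lborel_singleton[of 0]
  by (subst AE_density) (auto simp: exponential_density_def elim!: eventually_mono)
 thus ?thesis
  unfolding AE_all_countable using p by (intro allI AE_PiM_component[where P="%x. 0 < x"]) auto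
qed

text \<open>The exponential of minus the \<open>m\<close>-th partial sum has mean
  \<open>(1/2) ^ m\<close>, so its infimum over \<open>m\<close> is almost surely 0. This excludes
  explosion of the jump process.\<close>

lemma AE_holding_unbounded: "AE e in holding_noise. \<forall>K. \<exists>m. K < (\<Sum>i<m. e i)"
proof -
 interpret product_prob_space "%_. exponential_law" "UNIV :: nat set" by (rule product_prob_space_exponential)
 have [measurable]: "(%e. e i) \<in> borel_measurable holding_noise" for i
 proof -
  have "(%e. e i) \<in> measurable holding_noise exponential_law" by (rule measurable_component_singleton) simp
  thus ?thesis by (simp cong: measurable_cong_sets)
 qed
 have E: "(\<integral>\<^sup>+e. ennreal (exp (- (\<Sum>i<m. e i))) \<partial>holding_noise) = ennreal ((1/2) ^ m)" for m
 proof -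
  have "ennreal (exp (- (\<Sum>i<m. e i))) = (\<Prod>i<m. ennreal (exp (- 1 * e i)))" for e :: "nat => real"
   by (simp add: prod_ennreal exp_sum[symmetric] sum_negf)
  hence "(\<integral>\<^sup>+e. ennreal (exp (- (\<Sum>i<m. e i))) \<partial>holding_noise) = (\<Prod>i<m. \<integral>\<^sup>+x. ennreal (exp (- 1 * x)) \<partial>exponential_law)"
   using nn_integral_PiM_prod[of "{..<m}" "%_ x. ennreal (exp (- 1 * x))"] by simp
  also have "\<dots> = (\<Prod>i<m. ennreal (1 / 2))"
   using exponential_laplace[of 1] by simp
  also have "\<dots> = ennreal ((1/2) ^ m)"
   by (subst prod_ennreal) auto
  finally show ?thesis .
 qed
 have le: "(\<integral>\<^sup>+e. (INF m. ennreal (exp (- (\<Sum>i<m. e i)))) \<partial>holding_noise) \<le> ennreal ((1/2) ^ m)" for m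
  unfolding E[symmetric] by (intro nn_integral_mono INF_lower) simp
 have "(\<integral>\<^sup>+e. (INF m. ennreal (exp (- (\<Sum>i<m. e i)))) \<partial>holding_noise) \<le> 0"
 proof (rule LIMSEQ_le_const)
  show "(%m. ennreal ((1/2) ^ m)) \<longlonglongrightarrow> 0"
   unfolding ennreal_0[symmetric] by (intro tendsto_ennrealI LIMSEQ_realpow_zero) auto
 qed (use le in auto)
 hence "AE e in holding_noise. (INF m. ennreal (exp (- (\<Sum>i<m. e i)))) = 0"
  by (subst nn_integral_0_iff_AE[symmetric]) auto
 thus ?thesis
 proof eventually_elim
  case (elim e)
  show ?case
  proof (rule ccontr)
   assume "\<not> (\<forall>K. \<exists>m. K < (\<Sum>i<m. e i))"
   then obtain K where "\<And>m. (\<Sum>i<m. e i) \<le> K" by (auto simp: not_less)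
   hence "ennreal (exp (- K)) \<le> (INF m. ennreal (exp (- (\<Sum>i<m. e i))))"
    by (intro INF_greatest ennreal_leI) simp
   thus False using elim by simp
  qed
 qed
qed

section \<open>The skeleton of a path, weighted by its occupation field\<close>

lemma jump_chain_None: "jump_chain x W m = None ==> m \<le> k ==> jump_chain x W k = None"
 by (induction k) (auto simp: le_Suc_eq)

lemma jump_chain_eq_iff:
 "(\<forall>i\<le>m. jump_chain x W i = Some (vs ! i)) \<longleftrightarrow>
 vs ! 0 = x \<and> (\<forall>i<m. fst W (i, vs ! i) = Some (vs ! Suc i))"
proof (induction m)
 case (Suc m)
 have "(\<forall>i\<le>Suc m. jump_chain x W i = Some (vs ! i)) \<longleftrightarrow>
  (\<forall>i\<le>m. jump_chain x W i = Some (vs ! i)) \<and> jump_chain x W (Suc m) = Some (vs ! Suc m)"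
  by (auto simp: le_Suc_eq)
 also have "\<dots> \<longleftrightarrow> (\<forall>i\<le>m. jump_chain x W i = Some (vs ! i)) \<and> fst W (m, vs ! m) = Some (vs ! Suc m)"
  by auto
 finally show ?case unfolding Suc.IH by (auto simp: less_Suc_eq)
qed auto

lemma prod_of_bool_ennreal: "(\<Prod>i<(m::nat). of_bool (P i) :: ennreal) = of_bool (\<forall>i<m. P i)"
 by (induction m) (auto simp: less_Suc_eq)

text \<open>The weight of a skeleton when the killing measure is raised from \<open>\<kappa>\<close>
  to \<open>\<kappa> + V\<close>; summed over the skeletons that start at \<open>x\<close> it is the
  Green function of that network between \<open>x\<close> and \<open>y\<close>.\<close>

fun path_weight ::
 "'v::finite set set => ('v => 'v => real) => ('v => real) => real^'v => 'v => 'v list => real" where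
 "path_weight E C \<kappa> V y [] = 0"
| "path_weight E C \<kappa> V y [v] = of_bool (v = y) / (exit_rate E C \<kappa> v + V $ v)"
| "path_weight E C \<kappa> V y (v # w # vs) =
  jump_rate E C v w / (exit_rate E C \<kappa> v + V $ v) * path_weight E C \<kappa> V y (w # vs)"

lemma path_weight_prod:
 "path_weight E C \<kappa> V y (v # vs) =
  (\<Prod>i<length vs. jump_rate E C ((v # vs) ! i) (vs ! i) / (exit_rate E C \<kappa> ((v # vs) ! i) + V $ ((v # vs) ! i)))
  * (of_bool (last (v # vs) = y) / (exit_rate E C \<kappa> (last (v # vs)) + V $ (last (v # vs))))"
proof (induction vs arbitrary: v)
 case (Cons w vs)
 show ?case
  unfolding path_weight.simps Cons.IH length_Cons prod.lessThan_Suc_shift by simp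
qed simp

text \<open>For a given noise, prescribing the skeleton at time \<open>t\<close> confines
  \<open>t\<close> to the sojourn in the \<open>m\<close>-th state. Completed sojourns enter with
  their full holding times, the last one through an integral over the elapsed part. The hypotheses
  on the noise make the jump times strictly increasing and unbounded, so that
  \<open>jump_count\<close> is characterised by two inequalities.\<close>

lemma path_integral_pointwise:
 fixes V :: "real^'v::finite"
 assumes N: "network E C \<kappa>" and pos: "\<And>m. 0 < snd W m" and unb: "\<And>K. \<exists>m. K < (\<Sum>i<m. snd W i)"
  and m: "length vs = Suc m"
 shows "(\<integral>\<^sup>+t. ennreal (exp (- (V \<bullet> occupation (path_until E C \<kappa> x t W)))) * indicator {\<gamma>. map fst \<gamma> = vs} (path_until E C \<kappa> x t W)
    * indicator {t. 0 < t \<and> jump_process E C \<kappa> x t W = Some y} t \<partial>lborel)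
  = of_bool (vs ! 0 = x \<and> (\<forall>i<m. fst W (i, vs ! i) = Some (vs ! Suc i))) * of_bool (vs ! m = y)
   * ((\<Prod>i<m. ennreal (exp (- (V $ (vs ! i) / exit_rate E C \<kappa> (vs ! i)) * snd W i)))
   * (\<integral>\<^sup>+s. ennreal (exp (- (V $ (vs ! m)) * s)) * indicator {0..<snd W m / exit_rate E C \<kappa> (vs ! m)} s \<partial>lborel))"
proof -
 let ?r = "exit_rate E C \<kappa>" and ?T = "jump_time E C \<kappa> x W" and ?h = "holding_time E C \<kappa> x W"
 have r: "0 < ?r v" for v by (rule exit_rate_pos[OF N])
 have h: "0 < ?h i" for i
  using pos r by (auto simp: holding_time_def split: option.split)
 have T_Suc: "?T (Suc i) = ?T i + ?h i" for i by (simp add: jump_time_def)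
 have T_mono: "?T i \<le> ?T j" if "i \<le> j" for i j
  using that by (rule lift_Suc_mono_le[rotated]) (use h T_Suc in \<open>simp add: less_imp_le\<close>)
 have T0: "0 \<le> ?T i" for i using T_mono[of 0 i] by (simp add: jump_time_def)
 have T_unb: "\<exists>i. t < ?T (Suc i)" for t
 proof -
  \<comment> \<open>Every holding time is at least its exponential variable divided by
    \<open>R\<close>; the summand 1 takes care of the killed state, where the variable is not
    divided by a rate.\<close>
  define R where "R = 1 + (\<Sum>v\<in>UNIV. ?r v)"
  have R: "1 \<le> R" "?r v \<le> R" for v
   unfolding R_def using r sum_nonneg[of UNIV ?r] member_le_sum[of v UNIV ?r]
   by (auto simp: less_imp_le add_increasing)
  have hR: "snd W i / R \<le> ?h i" for i
  proof (cases "jump_chain x W i")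
   case None
   have "snd W i / R \<le> snd W i / 1" using R pos[of i] by (intro divide_left_mono) auto
   thus ?thesis using None by (simp add: holding_time_def)
  next
   case (Some v)
   have "snd W i / R \<le> snd W i / ?r v" using R r[of v] pos[of i] by (intro divide_left_mono) auto
   thus ?thesis using Some by (simp add: holding_time_def)
  qed
  obtain k where k: "t * R < (\<Sum>i<k. snd W i)" using unb by blast
  have "t < (\<Sum>i<k. snd W i) / R" using k R by (simp add: field_simps)
  also have "\<dots> \<le> ?T k" unfolding jump_time_def sum_divide_distrib by (intro sum_mono hR)
  also have "\<dots> \<le> ?T (Suc k)" by (rule T_mono) simp
  finally show ?thesis by blast
 qed
 have count: "jump_count E C \<kappa> x t W = k \<longleftrightarrow> ?T k \<le> t \<and> t < ?T (Suc k)" if "0 \<le> t" for t k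
 proof
  assume k: "jump_count E C \<kappa> x t W = k"
  have "t < ?T (Suc k)" using LeastI_ex[OF T_unb[of t]] k by (simp add: jump_count_def)
  moreover have "?T k \<le> t"
  proof (cases k)
   case 0
   thus ?thesis using that by (simp add: jump_time_def)
  next
   case (Suc j)
   hence "j < (LEAST m. t < ?T (Suc m))" using k by (simp add: jump_count_def)
   thus ?thesis using not_less_Least Suc by (metis not_less)
  qed
  ultimately show "?T k \<le> t \<and> t < ?T (Suc k)" by simp
 next
  assume k: "?T k \<le> t \<and> t < ?T (Suc k)"
  show "jump_count E C \<kappa> x t W = k"
   unfolding jump_count_def
  proof (rule Least_equality)
   show "t < ?T (Suc k)" using k by simp
   fix j assume "t < ?T (Suc j)"
   show "k \<le> j"
   proof (rule ccontr)
    assume "\<not> k \<le> j"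
    hence "?T (Suc j) \<le> ?T k" by (intro T_mono) simp
    thus False using k \<open>t < ?T (Suc j)\<close> by simp
   qed
  qed
 qed
 let ?G = "\<forall>i\<le>m. jump_chain x W i = Some (vs ! i)"
 have verts: "map fst (path_until E C \<kappa> x t W) = map (%i. the (jump_chain x W i)) [0..<Suc (jump_count E C \<kappa> x t W)]" for t
  by (simp add: path_until_def Let_def comp_def)
 have event: "(map fst (path_until E C \<kappa> x t W) = vs \<and> jump_process E C \<kappa> x t W = Some y)
  \<longleftrightarrow> ?G \<and> vs ! m = y \<and> ?T m \<le> t \<and> t < ?T (Suc m)" if "0 \<le> t" for t
 proof
  assume a: "map fst (path_until E C \<kappa> x t W) = vs \<and> jump_process E C \<kappa> x t W = Some y"
  hence "length (map (%i. the (jump_chain x W i)) [0..<Suc (jump_count E C \<kappa> x t W)]) = length vs"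
   unfolding verts by simp
  hence k: "jump_count E C \<kappa> x t W = m" using m by simp
  have "jump_chain x W i ~= None" if "i \<le> m" for i
   using jump_chain_None[OF _ that, of x W] a k by (auto simp: jump_process_def)
  moreover have "vs ! i = the (jump_chain x W i)" if "i \<le> m" for i
  proof -
   have "vs = map (%i. the (jump_chain x W i)) [0..<Suc m]" using a verts k by simp
   thus ?thesis using that by (simp add: nth_append del: upt_Suc)
  qed
  ultimately have G: ?G by auto
  thus "?G \<and> vs ! m = y \<and> ?T m \<le> t \<and> t < ?T (Suc m)"
   using a k count[OF that] by (auto simp: jump_process_def)
 next
  assume b: "?G \<and> vs ! m = y \<and> ?T m \<le> t \<and> t < ?T (Suc m)"
  hence k: "jump_count E C \<kappa> x t W = m" using count[OF that] by simp
  have "map (%i. the (jump_chain x W i)) [0..<Suc m] = vs"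
   by (rule nth_equalityI) (use b m in \<open>auto simp del: upt_Suc\<close>)
  thus "map fst (path_until E C \<kappa> x t W) = vs \<and> jump_process E C \<kappa> x t W = Some y"
   unfolding verts k using b k by (simp add: jump_process_def)
 qed
 show ?thesis
 proof (cases "?G \<and> vs ! m = y")
  case False
  have "(\<integral>\<^sup>+t. ennreal (exp (- (V \<bullet> occupation (path_until E C \<kappa> x t W)))) * indicator {\<gamma>. map fst \<gamma> = vs} (path_until E C \<kappa> x t W)
    * indicator {t. 0 < t \<and> jump_process E C \<kappa> x t W = Some y} t \<partial>lborel) = (\<integral>\<^sup>+t. 0 \<partial>(lborel :: real measure))"
  proof (rule nn_integral_cong)
   fix t
   show "ennreal (exp (- (V \<bullet> occupation (path_until E C \<kappa> x t W)))) * indicator {\<gamma>. map fst \<gamma> = vs} (path_until E C \<kappa> x t W)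
    * indicator {t. 0 < t \<and> jump_process E C \<kappa> x t W = Some y} t = 0"
    using event[of t] False by (cases "0 < t") (auto simp: indicator_def)
  qed
  thus ?thesis using False by (auto simp: jump_chain_eq_iff)
 next
  case True
  hence hi: "?h i = snd W i / ?r (vs ! i)" if "i \<le> m" for i
   using that by (simp add: holding_time_def)
  let ?c = "\<Sum>i<m. V $ (vs ! i) * (snd W i / ?r (vs ! i))"
  have occ: "V \<bullet> occupation (path_until E C \<kappa> x t W) = ?c + V $ (vs ! m) * (t - ?T m)"
   if "?T m \<le> t" "t < ?T (Suc m)" for t
  proof -
   have k: "jump_count E C \<kappa> x t W = m" using count[of t m] that T0[of m] by simp
   have p: "path_until E C \<kappa> x t W = map (%i. (vs ! i, snd W i / ?r (vs ! i))) [0..<m] @ [(vs ! m, t - ?T m)]"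
    unfolding path_until_def Let_def k using True hi by simp
   show ?thesis unfolding p using that pos r
    by (subst inner_occupation) (auto simp: comp_def interv_sum_list_conv_sum_set_nat atLeast0LessThan less_imp_le)
  qed
  have "(\<integral>\<^sup>+t. ennreal (exp (- (V \<bullet> occupation (path_until E C \<kappa> x t W)))) * indicator {\<gamma>. map fst \<gamma> = vs} (path_until E C \<kappa> x t W)
    * indicator {t. 0 < t \<and> jump_process E C \<kappa> x t W = Some y} t \<partial>lborel)
   = (\<integral>\<^sup>+t. ennreal (exp (- ?c)) * (ennreal (exp (- (V $ (vs ! m)) * (t - ?T m))) * indicator {0..<snd W m / ?r (vs ! m)} (t - ?T m)) \<partial>lborel)"
  proof (rule nn_integral_cong_AE)
   show "AE t in lborel. ennreal (exp (- (V \<bullet> occupation (path_until E C \<kappa> x t W)))) * indicator {\<gamma>. map fst \<gamma> = vs} (path_until E C \<kappa> x t W)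
    * indicator {t. 0 < t \<and> jump_process E C \<kappa> x t W = Some y} t
   = ennreal (exp (- ?c)) * (ennreal (exp (- (V $ (vs ! m)) * (t - ?T m))) * indicator {0..<snd W m / ?r (vs ! m)} (t - ?T m))"
    \<comment> \<open>The two integrands may differ at \<open>t = 0\<close>, which is excluded on
      the left only.\<close>
    using AE_lborel_singleton[of 0]
   proof eventually_elim
    case (elim t)
    show ?case
    proof (cases "?T m \<le> t \<and> t < ?T (Suc m)")
     case in_T: True
     hence "0 < t" using elim T0[of m] by simp
     moreover have "0 \<le> t - ?T m" "t - ?T m < snd W m / ?r (vs ! m)"
      using in_T hi[of m] T_Suc[of m] by auto
     ultimately show ?thesis
      using event[of t] True in_T occ[of t]
      by (simp add: indicator_def ennreal_mult'[symmetric] mult_exp_exp)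
    next
     case False
     hence "\<not> (0 \<le> t - ?T m \<and> t - ?T m < snd W m / ?r (vs ! m))"
      using hi[of m] T_Suc[of m] by auto
     thus ?thesis using event[of t] False by (auto simp: indicator_def)
    qed
   qed
  qed
  also have "\<dots> = ennreal (exp (- ?c)) * (\<integral>\<^sup>+t. (ennreal (exp (- (V $ (vs ! m)) * (t - ?T m))) * indicator {0..<snd W m / ?r (vs ! m)} (t - ?T m)) \<partial>lborel)"
   by (rule nn_integral_cmult) measurable
  also have "(\<integral>\<^sup>+t. (ennreal (exp (- (V $ (vs ! m)) * (t - ?T m))) * indicator {0..<snd W m / ?r (vs ! m)} (t - ?T m)) \<partial>lborel)
   = (\<integral>\<^sup>+s. ennreal (exp (- (V $ (vs ! m)) * s)) * indicator {0..<snd W m / ?r (vs ! m)} s \<partial>lborel)"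
   by (subst nn_integral_real_affine[where c=1 and t="?T m"]) auto
  also have "ennreal (exp (- ?c)) = (\<Prod>i<m. ennreal (exp (- (V $ (vs ! i) / ?r (vs ! i)) * snd W i)))"
   by (simp add: prod_ennreal exp_sum[symmetric] sum_negf)
  finally show ?thesis using True by (simp add: jump_chain_eq_iff)
 qed
qed

text \<open>Jumps and holding times are independent. With exit rate \<open>r\<close> and jump rate
  \<open>c\<close>, a completed sojourn gives \<open>1 / (1 + V / r)\<close>, the jump that ends it
  gives \<open>c / r\<close>, and the last sojourn gives \<open>1 / (r + V)\<close>; together these
  are the factors of \<open>path_weight\<close>.\<close>

theorem path_measure_weight:
 fixes V :: "real^'v::finite"
 assumes N: "network E C \<kappa>" and V: "\<And>v. 0 \<le> V $ v"
 shows "(\<integral>\<^sup>+\<gamma>. ennreal (exp (- (V \<bullet> occupation \<gamma>))) * indicator {\<gamma>. map fst \<gamma> = vs} \<gamma> \<partial>path_measure E C \<kappa> x y)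
  = (if vs ~= [] \<and> hd vs = x then ennreal (path_weight E C \<kappa> V y vs) else 0)"
proof -
 let ?r = "exit_rate E C \<kappa>"
 let ?f = "%\<gamma>. ennreal (exp (- (V \<bullet> occupation \<gamma>))) * indicator {\<gamma>. map fst \<gamma> = vs} \<gamma>"
 have [measurable]: "{\<gamma>. map fst \<gamma> = vs} \<in> sets path_space"
  using measurable_sets[OF measurable_vertices, of "{vs}"] by (simp add: vimage_def)
 have f[measurable]: "?f \<in> borel_measurable path_space" by measurable
 note eq = path_measure_nn_integral[OF f, of E C \<kappa> x y]
 show ?thesis
 proof (cases vs)
  case Nil
  have "?f (path_until E C \<kappa> x t W) = 0" for t W
   using Nil by (auto simp: path_until_def Let_def)
  thus ?thesis unfolding eq using Nil by simp
 next
  case (Cons v vs')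
  define m where "m = length vs'"
  have m: "length vs = Suc m" and lst: "last vs = vs ! m" using Cons by (auto simp: m_def last_conv_nth)
  have r: "0 < ?r v" for v by (rule exit_rate_pos[OF N])
  let ?h = "%W. \<integral>\<^sup>+t. ?f (path_until E C \<kappa> x t W) * indicator {t. 0 < t \<and> jump_process E C \<kappa> x t W = Some y} t \<partial>lborel"
  let ?A = "\<Pi>\<^sub>M i\<in>(UNIV :: (nat \<times> 'v) set). measure_pmf (jump_pmf E C \<kappa> (snd i))"
  let ?G = "%\<xi>. vs ! 0 = x \<and> (\<forall>i<m. \<xi> (i, vs ! i) = Some (vs ! Suc i))"
  let ?F = "%i e. if i < m then ennreal (exp (- (V $ (vs ! i) / ?r (vs ! i)) * e))
    else (\<integral>\<^sup>+s. ennreal (exp (- (V $ (vs ! m)) * s)) * indicator {0..<e / ?r (vs ! m)} s \<partial>lborel)"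
  interpret A: product_prob_space "%i. measure_pmf (jump_pmf E C \<kappa> (snd i))" "UNIV :: (nat \<times> 'v) set"
   by (intro product_prob_spaceI measure_pmf.prob_space_axioms)
  interpret B: product_prob_space "%_. exponential_law" "UNIV :: nat set" by (rule product_prob_space_exponential)
  have sf: "sigma_finite_measure holding_noise"
   by (rule prob_space_imp_sigma_finite) (rule B.prob_space_axioms)
  have Fm: "?F i \<in> borel_measurable exponential_law" for i
  proof -
   have "(%p. ennreal (exp (- (V $ (vs ! m)) * snd p)) * (if 0 \<le> snd p \<and> snd p < fst p / ?r (vs ! m) then 1 else 0))
     \<in> borel_measurable (exponential_law \<Otimes>\<^sub>M lborel)" by measurable
   hence "(%e. \<integral>\<^sup>+s. ennreal (exp (- (V $ (vs ! m)) * s)) * (if 0 \<le> s \<and> s < e / ?r (vs ! m) then 1 else 0) \<partial>lborel)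
     \<in> borel_measurable exponential_law"
    by (intro lborel.borel_measurable_nn_integral) (simp add: case_prod_unfold)
   hence "(%e. \<integral>\<^sup>+s. ennreal (exp (- (V $ (vs ! m)) * s)) * indicator {0..<e / ?r (vs ! m)} s \<partial>lborel)
     \<in> borel_measurable exponential_law"
    by (simp add: indicator_def of_bool_def)
   thus ?thesis by (cases "i < m") auto
  qed
  have Fe[measurable]: "(%e. ?F i (e i)) \<in> borel_measurable holding_noise" for i
  proof -
   have c: "(%e. e i) \<in> measurable holding_noise exponential_law" by (rule measurable_component_singleton) simp
   show ?thesis by (rule measurable_compose[OF c Fm])
  qed
  have hm: "?h \<in> borel_measurable (?A \<Otimes>\<^sub>M holding_noise)"
  proof -
   have [measurable]: "(%p. (snd p, fst p)) \<in> measurable (noise E C \<kappa> \<Otimes>\<^sub>M lborel) (borel \<Otimes>\<^sub>M noise E C \<kappa>)"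
    by measurable
   have [measurable]: "(%p. path_until E C \<kappa> x (snd p) (fst p)) \<in> measurable (noise E C \<kappa> \<Otimes>\<^sub>M lborel) path_space"
    using measurable_compose[of "%p. (snd p, fst p)" "noise E C \<kappa> \<Otimes>\<^sub>M lborel", OF _ measurable_path_until] by simp
   have [measurable]: "(%p. jump_process E C \<kappa> x (snd p) (fst p)) \<in> measurable (noise E C \<kappa> \<Otimes>\<^sub>M lborel) (count_space UNIV)"
    using measurable_compose[of "%p. (snd p, fst p)" "noise E C \<kappa> \<Otimes>\<^sub>M lborel", OF _ measurable_jump_process] by simp
   have "(%p. ?f (path_until E C \<kappa> x (snd p) (fst p)) * (if 0 < snd p \<and> jump_process E C \<kappa> x (snd p) (fst p) = Some y then 1 else 0))
    \<in> borel_measurable (noise E C \<kappa> \<Otimes>\<^sub>M lborel)" by measurable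
   hence "(%W. \<integral>\<^sup>+t. ?f (path_until E C \<kappa> x t W) * (if 0 < t \<and> jump_process E C \<kappa> x t W = Some y then 1 else 0) \<partial>lborel)
    \<in> borel_measurable (noise E C \<kappa>)"
    by (intro lborel.borel_measurable_nn_integral) (simp add: case_prod_unfold)
   thus ?thesis
    unfolding noise_def by (simp add: indicator_def of_bool_def)
  qed
  have "(\<integral>\<^sup>+\<gamma>. ?f \<gamma> \<partial>path_measure E C \<kappa> x y) = (\<integral>\<^sup>+\<xi>. \<integral>\<^sup>+e. ?h (\<xi>, e) \<partial>holding_noise \<partial>?A)"
   unfolding eq noise_def by (rule sigma_finite_measure.nn_integral_fst[OF sf hm, symmetric])
  also have "\<dots> = (\<integral>\<^sup>+\<xi>. of_bool (?G \<xi>) * of_bool (vs ! m = y) * (\<Prod>i\<le>m. \<integral>\<^sup>+e. ?F i e \<partial>exponential_law) \<partial>?A)"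
  proof (rule nn_integral_cong)
   fix \<xi> :: "nat \<times> 'v => 'v option"
   have "(\<integral>\<^sup>+e. ?h (\<xi>, e) \<partial>holding_noise)
    = (\<integral>\<^sup>+e. of_bool (?G \<xi>) * of_bool (vs ! m = y) * (\<Prod>i\<le>m. ?F i (e i)) \<partial>holding_noise)"
   proof (rule nn_integral_cong_AE, use AE_holding_pos AE_holding_unbounded in eventually_elim)
    case (elim e)
    have "(\<Prod>i\<le>m. ?F i (e i)) = (\<Prod>i<m. ?F i (e i)) * ?F m (e m)"
     by (simp add: lessThan_Suc_atMost[symmetric] del: if_split)
    also have "(\<Prod>i<m. ?F i (e i)) = (\<Prod>i<m. ennreal (exp (- (V $ (vs ! i) / ?r (vs ! i)) * e i)))"
     by (intro prod.cong) auto
    finally show ?case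
     using path_integral_pointwise[OF N _ _ m, of "(\<xi>, e)" V x y] elim by simp
   qed
   also have "\<dots> = of_bool (?G \<xi>) * of_bool (vs ! m = y) * (\<integral>\<^sup>+e. (\<Prod>i\<le>m. ?F i (e i)) \<partial>holding_noise)"
    by (rule nn_integral_cmult) (intro borel_measurable_prod_ennreal Fe)
   also have "(\<integral>\<^sup>+e. (\<Prod>i\<le>m. ?F i (e i)) \<partial>holding_noise) = (\<Prod>i\<le>m. \<integral>\<^sup>+e. ?F i e \<partial>exponential_law)"
    by (rule B.nn_integral_PiM_prod) (use Fm in auto)
   finally show "(\<integral>\<^sup>+e. ?h (\<xi>, e) \<partial>holding_noise)
    = of_bool (?G \<xi>) * of_bool (vs ! m = y) * (\<Prod>i\<le>m. \<integral>\<^sup>+e. ?F i e \<partial>exponential_law)" .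
  qed
  also have "(\<Prod>i\<le>m. \<integral>\<^sup>+e. ?F i e \<partial>exponential_law)
    = (\<Prod>i<m. ennreal (1 / (1 + V $ (vs ! i) / ?r (vs ! i)))) * ennreal (1 / (?r (vs ! m) + V $ (vs ! m)))"
  proof -
   have "(\<Prod>i\<le>m. \<integral>\<^sup>+e. ?F i e \<partial>exponential_law)
    = (\<Prod>i<m. \<integral>\<^sup>+e. ?F i e \<partial>exponential_law) * (\<integral>\<^sup>+e. ?F m e \<partial>exponential_law)"
    by (simp add: lessThan_Suc_atMost[symmetric] del: if_split)
   also have "(\<Prod>i<m. \<integral>\<^sup>+e. ?F i e \<partial>exponential_law) = (\<Prod>i<m. ennreal (1 / (1 + V $ (vs ! i) / ?r (vs ! i))))"
   proof (rule prod.cong[OF refl])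
    fix i assume "i \<in> {..<m}"
    thus "(\<integral>\<^sup>+e. ?F i e \<partial>exponential_law) = ennreal (1 / (1 + V $ (vs ! i) / ?r (vs ! i)))"
     using exponential_laplace[of "V $ (vs ! i) / ?r (vs ! i)"] V r[of "vs ! i"] by (simp add: less_imp_le)
   qed
   also have "(\<integral>\<^sup>+e. ?F m e \<partial>exponential_law) = ennreal (1 / (?r (vs ! m) + V $ (vs ! m)))"
    using exponential_sojourn[OF r V, of "vs ! m" "vs ! m"] by simp
   finally show ?thesis .
  qed
  also have "(\<integral>\<^sup>+\<xi>. of_bool (?G \<xi>) * of_bool (vs ! m = y) * c \<partial>?A)
    = of_bool (vs ! 0 = x) * of_bool (vs ! m = y) * c * (\<Prod>i<m. ennreal (jump_rate E C (vs ! i) (vs ! Suc i) / ?r (vs ! i)))" for c :: ennreal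
  proof -
   let ?J = "(%i. (i, vs ! i)) ` {..<m}"
   \<comment> \<open>The coordinates carry the number of the jump, so repeated visits to a vertex
     use independent ones.\<close>
   have inj: "inj_on (%i. (i, vs ! i)) {..<m}" by (auto simp: inj_on_def)
   let ?q = "%j. indicator {Some (vs ! Suc (fst j))} :: 'v option => ennreal"
   have "(\<integral>\<^sup>+\<xi>. (\<Prod>j\<in>?J. ?q j (\<xi> j)) \<partial>?A) = (\<Prod>j\<in>?J. \<integral>\<^sup>+z. ?q j z \<partial>measure_pmf (jump_pmf E C \<kappa> (snd j)))"
    by (rule A.nn_integral_PiM_prod) auto
   also have "\<dots> = (\<Prod>i<m. \<integral>\<^sup>+z. ?q (i, vs ! i) z \<partial>measure_pmf (jump_pmf E C \<kappa> (vs ! i)))"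
    by (subst prod.reindex[OF inj]) simp
   also have "\<dots> = (\<Prod>i<m. ennreal (jump_rate E C (vs ! i) (vs ! Suc i) / ?r (vs ! i)))"
    by (simp add: emeasure_pmf_single pmf_jump_pmf_Some[OF N])
   finally have P: "(\<integral>\<^sup>+\<xi>. (\<Prod>j\<in>?J. ?q j (\<xi> j)) \<partial>?A) = (\<Prod>i<m. ennreal (jump_rate E C (vs ! i) (vs ! Suc i) / ?r (vs ! i)))" .
   have q: "(\<Prod>j\<in>?J. ?q j (\<xi> j)) = of_bool (\<forall>i<m. \<xi> (i, vs ! i) = Some (vs ! Suc i))" for \<xi> :: "nat \<times> 'v => 'v option"
    by (subst prod.reindex[OF inj])
     (simp add: prod_of_bool_ennreal[symmetric] indicator_def)
   have "(\<integral>\<^sup>+\<xi>. of_bool (?G \<xi>) * of_bool (vs ! m = y) * c \<partial>?A)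
     = (\<integral>\<^sup>+\<xi>. (of_bool (vs ! 0 = x) * of_bool (vs ! m = y) * c) * (\<Prod>j\<in>?J. ?q j (\<xi> j)) \<partial>?A)"
    unfolding q by (intro nn_integral_cong) (auto simp: of_bool_def)
   also have "\<dots> = (of_bool (vs ! 0 = x) * of_bool (vs ! m = y) * c) * (\<integral>\<^sup>+\<xi>. (\<Prod>j\<in>?J. ?q j (\<xi> j)) \<partial>?A)"
    by (rule nn_integral_cmult) (intro borel_measurable_prod_ennreal measurable_compose[OF measurable_component_singleton], auto)
   finally show ?thesis unfolding P .
  qed
  also have "of_bool (vs ! 0 = x) * of_bool (vs ! m = y) *
    ((\<Prod>i<m. ennreal (1 / (1 + V $ (vs ! i) / ?r (vs ! i)))) * ennreal (1 / (?r (vs ! m) + V $ (vs ! m))))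
    * (\<Prod>i<m. ennreal (jump_rate E C (vs ! i) (vs ! Suc i) / ?r (vs ! i)))
   = of_bool (vs ! 0 = x) * ennreal (path_weight E C \<kappa> V y vs)"
  proof -
   have pos: "0 < ?r v + V $ v" for v using r[of v] V[of v] by simp
   have a: "(\<Prod>i<m. ennreal (1 / (1 + V $ (vs ! i) / ?r (vs ! i)))) * (\<Prod>i<m. ennreal (jump_rate E C (vs ! i) (vs ! Suc i) / ?r (vs ! i)))
    = ennreal (\<Prod>i<m. jump_rate E C (vs ! i) (vs ! Suc i) / (?r (vs ! i) + V $ (vs ! i)))"
   proof -
    have "ennreal (1 / (1 + V $ v / ?r v)) * ennreal (jump_rate E C v w / ?r v) = ennreal (jump_rate E C v w / (?r v + V $ v))" for v w
    proof -
     have "0 < 1 + V $ v / ?r v" using V[of v] r[of v] by (simp add: add_pos_nonneg less_imp_le)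
     moreover have "1 / (1 + V $ v / ?r v) * (jump_rate E C v w / ?r v) = jump_rate E C v w / (?r v + V $ v)"
      using r[of v] pos[of v] by (simp add: field_simps)
     moreover have "ennreal (1 / (1 + V $ v / ?r v)) * ennreal (jump_rate E C v w / ?r v)
      = ennreal (1 / (1 + V $ v / ?r v) * (jump_rate E C v w / ?r v))"
      using calculation(1) by (intro ennreal_mult'[symmetric]) simp
     ultimately show ?thesis by metis
    qed
    hence "(\<Prod>i<m. ennreal (1 / (1 + V $ (vs ! i) / ?r (vs ! i))) * ennreal (jump_rate E C (vs ! i) (vs ! Suc i) / ?r (vs ! i)))
      = (\<Prod>i<m. ennreal (jump_rate E C (vs ! i) (vs ! Suc i) / (?r (vs ! i) + V $ (vs ! i))))" by simp
    also have "\<dots> = ennreal (\<Prod>i<m. jump_rate E C (vs ! i) (vs ! Suc i) / (?r (vs ! i) + V $ (vs ! i)))"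
     using jump_rate_nonneg[OF N] pos by (intro prod_ennreal) (simp add: less_imp_le)
    finally show ?thesis by (simp add: prod.distrib)
   qed
   have w: "path_weight E C \<kappa> V y vs = (\<Prod>i<m. jump_rate E C (vs ! i) (vs ! Suc i) / (?r (vs ! i) + V $ (vs ! i)))
    * (of_bool (vs ! m = y) / (?r (vs ! m) + V $ (vs ! m)))"
    unfolding lst[symmetric] unfolding Cons path_weight_prod m_def by simp
   have "of_bool (vs ! m = y) * ennreal (1 / (?r (vs ! m) + V $ (vs ! m))) * ennreal (\<Prod>i<m. jump_rate E C (vs ! i) (vs ! Suc i) / (?r (vs ! i) + V $ (vs ! i)))
    = ennreal (path_weight E C \<kappa> V y vs)"
    unfolding w
    using pos[of "vs ! m"] ennreal_mult'[of "1 / (?r (vs ! m) + V $ (vs ! m))"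
      "\<Prod>i<m. jump_rate E C (vs ! i) (vs ! Suc i) / (?r (vs ! i) + V $ (vs ! i))"]
    by (cases "vs ! m = y") (auto simp: less_imp_le)
   thus ?thesis unfolding a[symmetric] by (simp add: mult_ac)
  qed
  finally show ?thesis using Cons by simp
 qed
qed

section \<open>Holonomies and the twisted Green function\<close>

lemma minimum_principle:
 fixes h :: "'v::finite => real"
 assumes N: "network E C K"
  and sup: "\<And>x. 0 \<le> exit_rate E C K x * h x - (\<Sum>y\<in>UNIV. jump_rate E C x y * h y)"
 shows "0 \<le> h x"
proof (rule ccontr)
 assume neg: "\<not> 0 \<le> h x"
 define m where "m = Min (range h)"
 have m: "m \<le> h z" for z unfolding m_def by (rule Min_le) auto
 have m0: "m < 0" using m[of x] neg by simp
 have "m \<in> range h" unfolding m_def by (rule Min_in) auto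
 then obtain x0 where x0: "h x0 = m" by auto
 \<comment> \<open>Where the negative minimum is attained, the killing term and every edge term are
   non-positive, so all of them vanish; the minimum then spreads along edges and excludes
   killing.\<close>
 have step: "K z = 0 \<and> (\<forall>y. {z, y} \<in> E \<longrightarrow> h y = m)" if z: "h z = m" for z
 proof -
  have "exit_rate E C K z * h z - (\<Sum>y\<in>UNIV. jump_rate E C z y * h y)
    = K z * m + (\<Sum>y\<in>UNIV. jump_rate E C z y * (m - h y))"
   by (simp add: exit_rate_def z algebra_simps sum_subtractf sum_distrib_left sum_distrib_right sum.distrib)
  hence ge: "0 \<le> K z * m + (\<Sum>y\<in>UNIV. jump_rate E C z y * (m - h y))" using sup[of z] by simp
  have t: "jump_rate E C z y * (m - h y) \<le> 0" for y
   using jump_rate_nonneg[OF N, of z y] m[of y] by (simp add: mult_nonneg_nonpos)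
  have k: "K z * m \<le> 0" using network_killing_nonneg[OF N, of z] m0 by (simp add: mult_nonneg_nonpos)
  have s: "(\<Sum>y\<in>UNIV. jump_rate E C z y * (m - h y)) \<le> 0" using t by (rule sum_nonpos)
  have "K z * m = 0" using ge k s by linarith
  moreover have "(\<Sum>y\<in>UNIV. - (jump_rate E C z y * (m - h y))) = 0"
   using ge k s by (simp add: sum_negf)
  hence "\<forall>y\<in>UNIV. - (jump_rate E C z y * (m - h y)) = 0"
   using t by (subst (asm) sum_nonneg_eq_0_iff) auto
  moreover have "jump_rate E C z y ~= 0" if "{z, y} \<in> E" for y
   using network_conductance(2)[OF N that] that by (simp add: jump_rate_def)
  ultimately show ?thesis using m0 by force
 qed
 have "h z = m" for z
  using network_connected[OF N, of x0 z] x0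
  by (induction rule: rtrancl_induct) (use step in auto)
 hence "K z = 0" for z using step by blast
 thus False using network_killing_nonzero[OF N] by simp
qed

text \<open>The minimum principle, applied to \<open>h\<close> and to \<open>- h\<close>, makes the
  operator injective, hence surjective in finite dimension. The solution is the expected lifetime as
  a function of the starting point, which bounds the masses of the path measures.\<close>

lemma superharmonic_exists:
 fixes E :: "'v::finite set set"
 assumes N: "network E C K"
 shows "\<exists>h. (\<forall>x. 0 \<le> h x) \<and> (\<forall>x. exit_rate E C K x * h x - (\<Sum>y\<in>UNIV. jump_rate E C x y * h y) = 1)"
proof -
 define L where "L = (%h :: real^'v. \<chi> x. exit_rate E C K x * h $ x - (\<Sum>y\<in>UNIV. jump_rate E C x y * h $ y))"
 have lin: "linear L"
  by (rule linearI) (simp_all add: L_def vec_eq_iff distrib_left sum.distrib right_diff_distrib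
    sum_distrib_left mult.left_commute)
 have "inj L"
  unfolding linear_injective_0[OF lin]
 proof (intro allI impI)
  fix h assume h: "L h = 0"
  have e: "exit_rate E C K x * h $ x - (\<Sum>y\<in>UNIV. jump_rate E C x y * h $ y) = 0" for x
   using arg_cong[OF h, of "%v. v $ x"] by (simp add: L_def)
  have "0 \<le> h $ x" for x
   by (rule minimum_principle[OF N, where h="%x. h $ x"]) (rule eq_refl[OF e[symmetric]])
  moreover have "0 \<le> - h $ x" for x
  proof (rule minimum_principle[OF N, where h="%x. - h $ x"])
   fix x
   have "exit_rate E C K x * - h $ x - (\<Sum>y\<in>UNIV. jump_rate E C x y * - h $ y)
     = - (exit_rate E C K x * h $ x - (\<Sum>y\<in>UNIV. jump_rate E C x y * h $ y))"
    by (simp add: sum_negf)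
   thus "0 \<le> exit_rate E C K x * - h $ x - (\<Sum>y\<in>UNIV. jump_rate E C x y * - h $ y)"
    unfolding e by linarith
  qed
  ultimately show "h = 0" by (simp add: vec_eq_iff eq_iff)
 qed
 hence "surj L" using linear_injective_imp_surjective[OF lin] by simp
 then obtain h where h: "L h = (\<chi> x. 1)" by (metis surjD)
 have e: "exit_rate E C K x * h $ x - (\<Sum>y\<in>UNIV. jump_rate E C x y * h $ y) = 1" for x
  using arg_cong[OF h, of "%v. v $ x"] by (simp add: L_def)
 moreover have "0 \<le> h $ x" for x
  by (rule minimum_principle[OF N, where h="%x. h $ x"]) (simp only: e zero_le_one)
 ultimately show ?thesis by blast
qed

lemma path_weight_nonneg:
 assumes N: "network E C K" and V: "\<And>v. 0 \<le> V $ v"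
 shows "0 \<le> path_weight E C K V y vs"
proof -
 have "0 < exit_rate E C K v + V $ v" for v using exit_rate_pos[OF N, of v] V[of v] by simp
 thus ?thesis
  by (induction vs rule: induct_list012) (auto simp: jump_rate_nonneg[OF N] less_imp_le)
qed

lemma sum_lists_Suc:
 "(\<Sum>ws\<in>{ws. length ws = Suc n}. f ws) = (\<Sum>z\<in>UNIV. \<Sum>ws\<in>{ws. length ws = n}. f (z # ws))"
 for f :: "'v::finite list => 'b::comm_monoid_add"
proof -
 have "{ws :: 'v list. length ws = Suc n} = (%(z, ws). z # ws) ` (UNIV \<times> {ws. length ws = n})"
  by (auto simp: length_Suc_conv image_iff)
 moreover have "inj_on (%(z, ws). z # ws) (UNIV \<times> {ws :: 'v list. length ws = n})" by (auto simp: inj_on_def)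
 ultimately have "(\<Sum>ws\<in>{ws. length ws = Suc n}. f ws) = (\<Sum>p\<in>UNIV \<times> {ws. length ws = n}. f ((%(z, ws). z # ws) p))"
  by (simp only: sum.reindex o_def)
 thus ?thesis by (simp add: sum.cartesian_product case_prod_beta)
qed

text \<open>Splitting off the first jump gives a recursion for the left-hand side; \<open>h\<close>
  satisfies the same one with 1 in place of \<open>of_bool (x = y)\<close>.\<close>

lemma path_weight_sum_bound:
 fixes h :: "'v::finite => real"
 assumes N: "network E C K" and h: "\<And>x. 0 \<le> h x"
  and h1: "\<And>x. exit_rate E C K x * h x - (\<Sum>y\<in>UNIV. jump_rate E C x y * h y) = 1"
 shows "(\<Sum>k<n. \<Sum>ws\<in>{ws. length ws = k}. path_weight E C K 0 y (x # ws)) \<le> h x"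
proof (induction n arbitrary: x)
 case 0
 thus ?case by (simp add: h)
next
 case (Suc n)
 let ?r = "exit_rate E C K x"
 have r: "0 < ?r" by (rule exit_rate_pos[OF N])
 have "(\<Sum>k<Suc n. \<Sum>ws\<in>{ws. length ws = k}. path_weight E C K 0 y (x # ws))
   = of_bool (x = y) / ?r + (\<Sum>k<n. \<Sum>z\<in>UNIV. \<Sum>ws\<in>{ws. length ws = k}. jump_rate E C x z / ?r * path_weight E C K 0 y (z # ws))"
  unfolding sum.lessThan_Suc_shift sum_lists_Suc by simp
 also have "\<dots> = of_bool (x = y) / ?r + (\<Sum>z\<in>UNIV. jump_rate E C x z / ?r * (\<Sum>k<n. \<Sum>ws\<in>{ws. length ws = k}. path_weight E C K 0 y (z # ws)))"
  by (subst sum.swap) (simp add: sum_distrib_left)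
 also have "\<dots> \<le> 1 / ?r + (\<Sum>z\<in>UNIV. jump_rate E C x z / ?r * h z)"
  using r jump_rate_nonneg[OF N] by (intro add_mono sum_mono mult_left_mono Suc.IH) (auto simp: divide_right_mono)
 also have "\<dots> = (1 + (\<Sum>z\<in>UNIV. jump_rate E C x z * h z)) / ?r"
  by (simp add: add_divide_distrib sum_divide_distrib)
 also have "\<dots> = h x" using h1[of x] r by (simp add: field_simps)
 finally show ?case .
qed

lemma sets_vertices: "{\<gamma> :: 'v::finite path. P (map fst \<gamma>)} \<in> sets path_space"
 using measurable_sets[OF measurable_vertices, of "{vs. P vs}"] by (simp add: vimage_def)

lemma emeasure_vertices:
 assumes N: "network E C K"
 shows "emeasure (path_measure E C K x y) {\<gamma>. map fst \<gamma> = vs}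
  = (if vs ~= [] \<and> hd vs = x then ennreal (path_weight E C K 0 y vs) else 0)"
proof -
 have "emeasure (path_measure E C K x y) {\<gamma>. map fst \<gamma> = vs}
   = (\<integral>\<^sup>+\<gamma>. ennreal (exp (- (0 \<bullet> occupation \<gamma>))) * indicator {\<gamma>. map fst \<gamma> = vs} \<gamma> \<partial>path_measure E C K x y)"
  using sets_vertices[of "%v. v = vs"] by simp
 also have "\<dots> = (if vs ~= [] \<and> hd vs = x then ennreal (path_weight E C K 0 y vs) else 0)"
  by (rule path_measure_weight[OF N]) simp
 finally show ?thesis .
qed

lemma emeasure_path_length:
 fixes E :: "'v::finite set set"
 assumes N: "network E C K"
 shows "emeasure (path_measure E C K x y) {\<gamma>. length \<gamma> = Suc n}
  = ennreal (\<Sum>ws\<in>{ws. length ws = n}. path_weight E C K 0 y (x # ws))"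
proof -
 have fin: "finite {vs :: 'v list. length vs = k}" for k
  using finite_lists_length_eq[of "UNIV :: 'v set" k] by simp
 have un: "{\<gamma> :: 'v path. length \<gamma> = Suc n} = (\<Union>vs\<in>{vs. length vs = Suc n}. {\<gamma>. map fst \<gamma> = vs})" by auto
 have "(\<Sum>vs\<in>{vs. length vs = Suc n}. emeasure (path_measure E C K x y) {\<gamma>. map fst \<gamma> = vs})
   = emeasure (path_measure E C K x y) (\<Union>vs\<in>{vs. length vs = Suc n}. {\<gamma>. map fst \<gamma> = vs})"
  by (rule sum_emeasure) (use sets_vertices fin in \<open>auto simp: disjoint_family_on_def\<close>)
 hence "emeasure (path_measure E C K x y) {\<gamma>. length \<gamma> = Suc n}
   = (\<Sum>vs\<in>{vs. length vs = Suc n}. emeasure (path_measure E C K x y) {\<gamma>. map fst \<gamma> = vs})"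
  unfolding un by simp
 also have "\<dots> = (\<Sum>z\<in>UNIV. \<Sum>ws\<in>{ws. length ws = n}. if z = x then ennreal (path_weight E C K 0 y (z # ws)) else 0)"
  by (simp add: sum_lists_Suc emeasure_vertices[OF N])
 also have "\<dots> = (\<Sum>z\<in>UNIV. if z = x then (\<Sum>ws\<in>{ws. length ws = n}. ennreal (path_weight E C K 0 y (x # ws))) else 0)"
  by (intro sum.cong) auto
 also have "\<dots> = (\<Sum>ws\<in>{ws. length ws = n}. ennreal (path_weight E C K 0 y (x # ws)))"
  by (simp add: sum.delta)
 finally show ?thesis using path_weight_nonneg[OF N] by (simp add: sum_ennreal)
qed

text \<open>Paths are exhausted by the sets of bounded length, whose masses are partial sums of
  \<open>path_weight\<close>, all bounded by \<open>h x\<close>.\<close>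

lemma finite_path_measure:
 fixes E :: "'v::finite set set"
 assumes N: "network E C K"
 shows "finite_measure (path_measure E C K x y)"
proof
 obtain h where h: "\<And>x. 0 \<le> h x" "\<And>x. exit_rate E C K x * h x - (\<Sum>y\<in>UNIV. jump_rate E C x y * h y) = 1"
  using superharmonic_exists[OF N] by blast
 let ?A = "%n. {\<gamma> :: 'v path. length \<gamma> \<le> n}"
 have A: "?A n \<in> sets path_space" for n using sets_vertices[of "%v. length v \<le> n"] by simp
 have "emeasure (path_measure E C K x y) (?A n) = ennreal (\<Sum>k<n. \<Sum>ws\<in>{ws. length ws = k}. path_weight E C K 0 y (x # ws))" for n
 proof (induction n)
  case 0
  have "?A 0 = {\<gamma>. map fst \<gamma> = []}" by auto
  thus ?case by (simp only: emeasure_vertices[OF N]) simp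
 next
  case (Suc n)
  have un: "?A (Suc n) = ?A n \<union> {\<gamma>. length \<gamma> = Suc n}" by auto
  have "emeasure (path_measure E C K x y) (?A (Suc n))
   = emeasure (path_measure E C K x y) (?A n) + emeasure (path_measure E C K x y) {\<gamma>. length \<gamma> = Suc n}"
   unfolding un
   by (rule plus_emeasure[symmetric]) (use A[of n] sets_vertices[of "%v. length v = Suc n"] in auto)
  thus ?case
   unfolding Suc emeasure_path_length[OF N]
   using path_weight_nonneg[OF N] by (simp add: ennreal_plus[symmetric] sum_nonneg del: ennreal_plus)
 qed
 hence le: "emeasure (path_measure E C K x y) (?A n) \<le> ennreal (h x)" for n
  using path_weight_sum_bound[OF N h] by (simp add: ennreal_leI)
 have "emeasure (path_measure E C K x y) (\<Union>n. ?A n) = (SUP n. emeasure (path_measure E C K x y) (?A n))"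
  by (rule SUP_emeasure_incseq[symmetric]) (use A in \<open>auto simp: incseq_def\<close>)
 also have "(\<Union>n. ?A n) = UNIV" by auto
 finally have "emeasure (path_measure E C K x y) UNIV \<le> ennreal (h x)" using le by (simp add: SUP_least)
 thus "emeasure (path_measure E C K x y) (space (path_measure E C K x y)) ~= \<infinity>"
  by (auto simp: top_unique)
qed

section \<open>Transport along skeletons and the Green function\<close>

definition skeleton_weight ::
 "'v::finite set set => ('v => 'v => real) => ('v => real) => real^'v => 'v => 'v => 'v list => real" where
 "skeleton_weight E C K V x y vs = (if vs ~= [] \<and> hd vs = x then path_weight E C K V y vs else 0)"

text \<open>Holonomies and transports see only the vertices of a path, so this image measure turns
  their integrals into sums over lists of vertices.\<close>

lemma skeleton_law:
 fixes V :: "real^'v::finite"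
 assumes N: "network E C K" and V: "\<And>v. 0 \<le> V $ v"
 shows "distr (density (path_measure E C K x y) (%\<gamma>. ennreal (exp (- (V \<bullet> occupation \<gamma>))))) (count_space UNIV) (map fst)
   = density (count_space UNIV) (%vs. ennreal (skeleton_weight E C K V x y vs))"
  (is "?L = ?R")
proof (rule measure_eqI_countable[where A=UNIV])
 fix vs :: "'v list"
 have "emeasure ?L {vs} = emeasure (density (path_measure E C K x y) (%\<gamma>. ennreal (exp (- (V \<bullet> occupation \<gamma>))))) {\<gamma>. map fst \<gamma> = vs}"
  by (subst emeasure_distr) (auto simp: vimage_def)
 also have "\<dots> = (\<integral>\<^sup>+\<gamma>. ennreal (exp (- (V \<bullet> occupation \<gamma>))) * indicator {\<gamma>. map fst \<gamma> = vs} \<gamma> \<partial>path_measure E C K x y)"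
  using sets_vertices[of "%v. v = vs"] by (subst emeasure_density) auto
 also have "\<dots> = ennreal (skeleton_weight E C K V x y vs)"
  using path_measure_weight[OF N V] by (simp add: skeleton_weight_def)
 also have "\<dots> = emeasure ?R {vs}"
  by (simp add: emeasure_density nn_integral_count_space_indicator[symmetric])
 finally show "emeasure ?L {vs} = emeasure ?R {vs}" .
qed auto

fun nearest_neighbour :: "'v set set => 'v list => bool" where
 "nearest_neighbour E (v # w # vs) \<longleftrightarrow> {v, w} \<in> E \<and> nearest_neighbour E (w # vs)"
| "nearest_neighbour E _ \<longleftrightarrow> True"

lemma path_weight_nearest_neighbour: "path_weight E C K V y vs ~= 0 ==> nearest_neighbour E vs"
 by (induction vs rule: induct_list012) (auto simp: jump_rate_def split: if_splits)

text \<open>A skeleton with a missing edge has weight 0. The claim is transferred from the law of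
  the skeleton at \<open>V = 0\<close>, where the density is 1.\<close>

lemma AE_nearest_neighbour:
 fixes E :: "'v::finite set set"
 assumes N: "network E C K"
 shows "AE \<gamma> in path_measure E C K x y. nearest_neighbour E (map fst \<gamma>)"
proof -
 have "AE vs in density (count_space UNIV) (%vs. ennreal (skeleton_weight E C K 0 x y vs)). nearest_neighbour E vs"
  using path_weight_nearest_neighbour[of E C K 0 y]
  by (auto simp: AE_density AE_count_space skeleton_weight_def split: if_splits)
 hence "AE vs in distr (density (path_measure E C K x y) (%\<gamma>. ennreal (exp (- (0 \<bullet> occupation \<gamma>))))) (count_space UNIV) (map fst). nearest_neighbour E vs"
  by (subst skeleton_law[OF N]) auto
 hence "AE \<gamma> in density (path_measure E C K x y) (%\<gamma>. ennreal (exp (- (0 \<bullet> occupation \<gamma>)))). nearest_neighbour E (map fst \<gamma>)"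
  by (subst (asm) AE_distr_iff) auto
 thus ?thesis by (subst (asm) AE_density) auto
qed

text \<open>\<open>T v w\<close> carries a vector from the fibre over \<open>w\<close> to the fibre
  over \<open>v\<close>, so transport brings \<open>b\<close> from the end of the path back to its
  start.\<close>

fun transport :: "('v => 'v => 'b => 'b) => 'b => 'v list => 'b" where
 "transport T b (v # w # vs) = T v w (transport T b (w # vs))"
| "transport T b _ = b"

lemma norm_transport:
 assumes "\<And>v w c. {v, w} \<in> E ==> norm (T v w c) \<le> norm c" "nearest_neighbour E vs"
 shows "norm (transport T b vs) \<le> norm b"
 using assms(2) by (induction vs rule: induct_list012) (auto intro: order_trans[OF assms(1)])

definition green ::
 "'v::finite set set => ('v => 'v => real) => ('v => real) => real^'v =>
 ('v => 'v => 'b => 'b) => 'v => 'v => 'b => 'b::euclidean_space" where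
 "green E C K V T x y b = (LINT vs|count_space UNIV. skeleton_weight E C K V x y vs *\<^sub>R transport T b vs)"

text \<open>The total weight is the mass of the path measure after multiplication by a density of at
  most 1.\<close>

lemma integrable_skeleton_weight:
 fixes V :: "real^'v::finite"
 assumes N: "network E C K" and V: "\<And>v. 0 \<le> V $ v"
 shows "integrable (count_space UNIV) (skeleton_weight E C K V x y)"
proof (rule integrableI_nonneg)
 have nn: "0 \<le> skeleton_weight E C K V x y vs" for vs
  using path_weight_nonneg[OF N V] by (simp add: skeleton_weight_def)
 thus "AE vs in count_space UNIV. 0 \<le> skeleton_weight E C K V x y vs" by simp
 have "(\<integral>\<^sup>+vs. ennreal (skeleton_weight E C K V x y vs) \<partial>count_space UNIV)
   = emeasure (density (count_space UNIV) (%vs. ennreal (skeleton_weight E C K V x y vs))) UNIV"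
  by (simp add: emeasure_density)
 also have "\<dots> = emeasure (density (path_measure E C K x y) (%\<gamma>. ennreal (exp (- (V \<bullet> occupation \<gamma>))))) UNIV"
  unfolding skeleton_law[OF N V, symmetric] by (subst emeasure_distr) auto
 also have "\<dots> \<le> (\<integral>\<^sup>+\<gamma>. 1 \<partial>path_measure E C K x y)"
 proof -
  have "0 \<le> V \<bullet> occupation \<gamma>" for \<gamma>
   unfolding inner_vec_def by (intro sum_nonneg) (simp add: V occupation_nonneg)
  hence "(\<integral>\<^sup>+\<gamma>. ennreal (exp (- (V \<bullet> occupation \<gamma>))) * indicator UNIV \<gamma> \<partial>path_measure E C K x y)
    \<le> (\<integral>\<^sup>+\<gamma>. 1 \<partial>path_measure E C K x y)"
   by (intro nn_integral_mono) (simp add: ennreal_le_1)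
  thus ?thesis
   using sets.top[of path_space] by (subst emeasure_density) auto
 qed
 also have "\<dots> < \<infinity>"
  using finite_measure.emeasure_finite[OF finite_path_measure[OF N, of x y], of UNIV] by (simp add: top.not_eq_extremum)
 finally show "(\<integral>\<^sup>+vs. ennreal (skeleton_weight E C K V x y vs) \<partial>count_space UNIV) < \<infinity>" .
qed simp

context
 fixes E :: "'v::finite set set" and C K and V :: "real^'v" and T :: "'v => 'v => 'b::euclidean_space => 'b"
 assumes N: "network E C K" and V: "\<And>v. 0 \<le> V $ v"
  and T_linear: "\<And>v w. linear (T v w)"
  and T_contraction: "\<And>v w c. {v, w} \<in> E ==> norm (T v w c) \<le> norm c"
begin

lemma integrable_transport:
 "integrable (count_space UNIV) (%vs. skeleton_weight E C K V x y vs *\<^sub>R transport T b vs)"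
proof (rule Bochner_Integration.integrable_bound[OF integrable_mult_left[OF integrable_skeleton_weight[OF N V], of _ _ "norm b"]])
 have t: "norm (transport T b vs) \<le> norm b" if "nearest_neighbour E vs" for vs
  by (rule norm_transport[OF T_contraction that])
 show "AE vs in count_space UNIV. norm (skeleton_weight E C K V x y vs *\<^sub>R transport T b vs)
   \<le> norm (skeleton_weight E C K V x y vs * norm b)"
 proof (rule AE_I2)
  fix vs
  show "norm (skeleton_weight E C K V x y vs *\<^sub>R transport T b vs) \<le> norm (skeleton_weight E C K V x y vs * norm b)"
   using t[of vs] path_weight_nearest_neighbour[of E C K V y vs]
   by (cases "path_weight E C K V y vs = 0") (auto simp: skeleton_weight_def abs_mult intro!: mult_left_mono)
 qed
qed simp

lemma path_integral_transport:
 "integrable (path_measure E C K x y) (%\<gamma>. exp (- (V \<bullet> occupation \<gamma>)) *\<^sub>R transport T b (map fst \<gamma>))"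
 "(LINT \<gamma>|path_measure E C K x y. exp (- (V \<bullet> occupation \<gamma>)) *\<^sub>R transport T b (map fst \<gamma>)) = green E C K V T x y b"
proof -
 let ?D = "density (path_measure E C K x y) (%\<gamma>. ennreal (exp (- (V \<bullet> occupation \<gamma>))))"
 have nn: "0 \<le> skeleton_weight E C K V x y vs" for vs
  using path_weight_nonneg[OF N V] by (simp add: skeleton_weight_def)
 have [measurable]: "(%\<gamma>. transport T b (map fst \<gamma>)) \<in> borel_measurable (path_measure E C K x y)"
  by (rule measurable_compose[of "map fst" _ "count_space UNIV"]) auto
 have "integrable (density (count_space UNIV) (%vs. ennreal (skeleton_weight E C K V x y vs))) (transport T b)"
  using integrable_transport[of x y b] nn by (subst integrable_density) auto
 hence "integrable ?D (%\<gamma>. transport T b (map fst \<gamma>))"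
  unfolding skeleton_law[OF N V, symmetric] by (subst (asm) integrable_distr_eq) auto
 thus "integrable (path_measure E C K x y) (%\<gamma>. exp (- (V \<bullet> occupation \<gamma>)) *\<^sub>R transport T b (map fst \<gamma>))"
  by (subst (asm) integrable_density) auto
 have "green E C K V T x y b = integral\<^sup>L (density (count_space UNIV) (%vs. ennreal (skeleton_weight E C K V x y vs))) (transport T b)"
  unfolding green_def using nn by (subst integral_density) auto
 also have "\<dots> = integral\<^sup>L ?D (%\<gamma>. transport T b (map fst \<gamma>))"
  unfolding skeleton_law[OF N V, symmetric] by (subst integral_distr) auto
 also have "\<dots> = (LINT \<gamma>|path_measure E C K x y. exp (- (V \<bullet> occupation \<gamma>)) *\<^sub>R transport T b (map fst \<gamma>))"
  by (subst integral_density) auto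
 finally show "(LINT \<gamma>|path_measure E C K x y. exp (- (V \<bullet> occupation \<gamma>)) *\<^sub>R transport T b (map fst \<gamma>)) = green E C K V T x y b" ..
qed

text \<open>Lists with a head other than \<open>x\<close> have weight 0; dropping the head
  \<open>x\<close> gives a sum over all lists, which can be split according to the first
  jump.\<close>

lemma green_tails:
 "Infinite_Set_Sum.abs_summable_on (%ws. path_weight E C K V y (x # ws) *\<^sub>R transport T b (x # ws)) UNIV"
 "green E C K V T x y b = infsetsum (%ws. path_weight E C K V y (x # ws) *\<^sub>R transport T b (x # ws)) UNIV"
proof -
 let ?f = "%vs. skeleton_weight E C K V x y vs *\<^sub>R transport T b vs"
 have "Infinite_Set_Sum.abs_summable_on ?f UNIV" using integrable_transport by (simp add: Infinite_Set_Sum.abs_summable_on_def)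
 hence "Infinite_Set_Sum.abs_summable_on ?f (range ((#) x))" by (rule Infinite_Set_Sum.abs_summable_on_subset) simp
 hence "Infinite_Set_Sum.abs_summable_on (%ws. ?f (x # ws)) UNIV"
  by (subst (asm) Infinite_Set_Sum.abs_summable_on_reindex_iff[symmetric]) auto
 thus "Infinite_Set_Sum.abs_summable_on (%ws. path_weight E C K V y (x # ws) *\<^sub>R transport T b (x # ws)) UNIV"
  by (simp add: skeleton_weight_def)
 have "green E C K V T x y b = infsetsum ?f UNIV" by (simp add: green_def infsetsum_def)
 also have "\<dots> = infsetsum ?f (range ((#) x))"
 proof (rule infsetsum_cong_neutral)
  fix vs assume "vs \<in> UNIV - range ((#) x)"
  thus "?f vs = 0" by (cases vs) (auto simp: skeleton_weight_def)
 qed auto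
 also have "\<dots> = infsetsum (%ws. ?f (x # ws)) UNIV" by (subst infsetsum_reindex) auto
 finally show "green E C K V T x y b = infsetsum (%ws. path_weight E C K V y (x # ws) *\<^sub>R transport T b (x # ws)) UNIV"
  by (simp add: skeleton_weight_def)
qed

text \<open>First-step decomposition: the empty tail is the path that stays at \<open>x\<close> and
  accounts for \<open>b\<close>; the tails that start with \<open>z\<close> reproduce the Green
  function from \<open>z\<close>, with one transport and one jump factor in front.\<close>

theorem green_equation:
 "(exit_rate E C K x + V $ x) *\<^sub>R green E C K V T x y b
  = (\<Sum>z\<in>UNIV. jump_rate E C x z *\<^sub>R T x z (green E C K V T z y b)) + of_bool (x = y) *\<^sub>R b"
proof -
 let ?p = "path_weight E C K V y" and ?R = "exit_rate E C K x + V $ x"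
 let ?f = "%ws. ?p (x # ws) *\<^sub>R transport T b (x # ws)"
 let ?g = "%z ws. ?p (z # ws) *\<^sub>R transport T b (z # ws)"
 have R: "0 < ?R" using exit_rate_pos[OF N, of x] V[of x] by simp
 have bl: "bounded_linear (T v w)" for v w using T_linear by (simp add: linear_conv_bounded_linear)
 have U: "(UNIV :: 'v list set) = {[]} \<union> (\<Union>z\<in>UNIV. range ((#) z))"
 proof (rule UNIV_eq_I)
  fix ws :: "'v list"
  show "ws \<in> {[]} \<union> (\<Union>z\<in>UNIV. range ((#) z))" by (cases ws) auto
 qed
 have s: "Infinite_Set_Sum.abs_summable_on ?f A" for A by (rule Infinite_Set_Sum.abs_summable_on_subset[OF green_tails(1)]) simp
 have UN: "infsetsum ?f (\<Union>z\<in>Z. range ((#) z)) = (\<Sum>z\<in>Z. infsetsum ?f (range ((#) z)))" if "finite Z" for Z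
  using that
 proof induction
  case (insert z Z)
  have "infsetsum ?f (range ((#) z) \<union> (\<Union>z\<in>Z. range ((#) z))) = infsetsum ?f (range ((#) z)) + infsetsum ?f (\<Union>z\<in>Z. range ((#) z))"
   by (rule infsetsum_Un_disjoint) (use s insert in auto)
  thus ?case using insert by simp
 qed simp
 have tail: "infsetsum ?f (range ((#) z)) = (jump_rate E C x z / ?R) *\<^sub>R T x z (green E C K V T z y b)" for z
 proof -
  have "infsetsum ?f (range ((#) z)) = infsetsum (%ws. ?f (z # ws)) UNIV" by (subst infsetsum_reindex) auto
  also have "\<dots> = infsetsum (%ws. (jump_rate E C x z / ?R) *\<^sub>R T x z (?g z ws)) UNIV"
   by (rule infsetsum_cong) (simp_all add: linear_scale[OF T_linear])
  also have "\<dots> = (jump_rate E C x z / ?R) *\<^sub>R T x z (infsetsum (?g z) UNIV)"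
   unfolding infsetsum_def
   using integral_bounded_linear[OF bl, of "count_space UNIV" "?g z" x z] green_tails(1)[of y z b]
   by (simp add: Infinite_Set_Sum.abs_summable_on_def)
  finally show ?thesis by (simp add: green_tails(2)[symmetric])
 qed
 have "green E C K V T x y b = infsetsum ?f ({[]} \<union> (\<Union>z\<in>UNIV. range ((#) z)))"
  unfolding green_tails(2) by (simp only: U[symmetric])
 also have "\<dots> = infsetsum ?f {[]} + infsetsum ?f (\<Union>z\<in>UNIV. range ((#) z))"
  by (rule infsetsum_Un_disjoint) (use s in auto)
 also have "infsetsum ?f {[]} = (of_bool (x = y) / ?R) *\<^sub>R b" by simp
 also have "infsetsum ?f (\<Union>z\<in>UNIV. range ((#) z)) = (\<Sum>z\<in>UNIV. (jump_rate E C x z / ?R) *\<^sub>R T x z (green E C K V T z y b))"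
  unfolding UN[OF finite] tail ..
 finally have "?R *\<^sub>R green E C K V T x y b = ?R *\<^sub>R ((of_bool (x = y) / ?R) *\<^sub>R b + (\<Sum>z\<in>UNIV. (jump_rate E C x z / ?R) *\<^sub>R T x z (green E C K V T z y b)))"
  by simp
 thus ?thesis using R by (simp add: scaleR_add_right scaleR_sum_right)
qed

end

section \<open>Wick's formula\<close>

definition perfect_matchings :: "'a set => 'a set set set" where
 "perfect_matchings S = {p. partition_on S p \<and> (\<forall>e\<in>p. card e = 2)}"

lemma finite_perfect_matchings: "finite S ==> finite (perfect_matchings S)"
 by (rule finite_subset[of _ "Pow (Pow S)"]) (auto simp: perfect_matchings_def partition_on_def)

lemma perfect_matchings_empty: "perfect_matchings {} = {{}}"
 by (auto simp: perfect_matchings_def partition_on_def)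

lemma perfect_matchings_partner:
 assumes p: "p \<in> perfect_matchings S" and a: "a \<in> S"
 shows "\<exists>k\<in>S - {a}. \<exists>q\<in>perfect_matchings (S - {k, a}). p = insert {k, a} q"
proof -
 have U: "\<Union>p = S" and D: "disjoint p" and ne: "{} \<notin> p" and c: "\<And>e. e \<in> p ==> card e = 2"
  using p by (auto simp: perfect_matchings_def partition_on_def)
 obtain e where e: "e \<in> p" "a \<in> e" using U a by auto
 then obtain k where k: "e = {k, a}" "k ~= a"
  using c[OF e(1)] by (auto simp: card_2_iff)
 have disj: "\<And>e'. e' \<in> p ==> e' ~= e ==> e' \<inter> e = {}" using D e by (auto simp: disjoint_def)
 have "\<Union>(p - {e}) = S - e" using U disj e by blast
 hence "\<Union>(p - {e}) = S - {k, a}" using k by simp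
 moreover have "disjoint (p - {e})" using D by (auto simp: disjoint_def pairwise_def)
 ultimately have "p - {e} \<in> perfect_matchings (S - {k, a})"
  using ne c by (auto simp: perfect_matchings_def partition_on_def)
 moreover have "p = insert {k, a} (p - {e})" using e k by auto
 moreover have "k \<in> S - {a}" using U e k by auto
 ultimately show ?thesis by blast
qed

lemma perfect_matchings_insert:
 assumes q: "q \<in> perfect_matchings (S - {k, a})" and "a \<in> S" "k \<in> S" "k ~= a"
 shows "insert {k, a} q \<in> perfect_matchings S" "{k, a} \<notin> q"
proof -
 have U: "\<Union>q = S - {k, a}" and D: "disjoint q" and ne: "{} \<notin> q" and c: "\<And>e. e \<in> q ==> card e = 2"
  using q by (auto simp: perfect_matchings_def partition_on_def)
 have "\<Union>(insert {k, a} q) = S" using U assms by auto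
 moreover have "disjoint (insert {k, a} q)"
  using D U by (auto simp: disjoint_def pairwise_insert disjnt_def)
 ultimately show "insert {k, a} q \<in> perfect_matchings S"
  using ne c assms by (auto simp: perfect_matchings_def partition_on_def)
 show "{k, a} \<notin> q" using U by auto
qed

text \<open>The partner \<open>k\<close> of \<open>a\<close> and the matching of the remaining
  elements determine each other's union uniquely, since no other pair contains
  \<open>a\<close>.\<close>

lemma sum_perfect_matchings:
 fixes f :: "'a set set => 'b::comm_monoid_add"
 assumes "finite S" "a \<in> S"
 shows "(\<Sum>p\<in>perfect_matchings S. f p)
  = (\<Sum>k\<in>S - {a}. \<Sum>q\<in>perfect_matchings (S - {k, a}). f (insert {k, a} q))"
proof -
 let ?I = "SIGMA k:S - {a}. perfect_matchings (S - {k, a})"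
 let ?g = "%(k, q). insert {k, a} q"
 have im: "perfect_matchings S = ?g ` ?I"
 proof
  show "perfect_matchings S \<subseteq> ?g ` ?I"
   using perfect_matchings_partner[OF _ assms(2)] by force
  show "?g ` ?I \<subseteq> perfect_matchings S"
   using perfect_matchings_insert(1) assms(2) by fastforce
 qed
 have inj: "inj_on ?g ?I"
 proof (rule inj_onI)
  fix x y assume x: "x \<in> ?I" and y: "y \<in> ?I" and xy: "?g x = ?g y"
  obtain k q k' q' where xy_eq: "x = (k, q)" "y = (k', q')" by (cases x, cases y)
  have k: "k \<in> S" "k ~= a" "q \<in> perfect_matchings (S - {k, a})"
   and k': "k' \<in> S" "k' ~= a" "q' \<in> perfect_matchings (S - {k', a})"
   and eq: "insert {k, a} q = insert {k', a} q'"
   using x y xy by (auto simp: xy_eq)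
  have no: "\<And>e. e \<in> q ==> a \<notin> e" "\<And>e. e \<in> q' ==> a \<notin> e"
   using k(3) k'(3) by (auto simp: perfect_matchings_def partition_on_def)
  have "{k, a} \<in> insert {k', a} q'" using eq by blast
  hence "{k, a} = {k', a}" using no(2)[of "{k, a}"] by auto
  hence kk: "k = k'" using k k' by (auto simp: doubleton_eq_iff)
  moreover have "{k, a} \<notin> q" "{k, a} \<notin> q'" using no(1)[of "{k, a}"] no(2)[of "{k, a}"] by auto
  ultimately have "q = q'" using eq by (simp add: insert_ident)
  thus "x = y" using kk by (simp add: xy_eq)
 qed
 have "(\<Sum>p\<in>perfect_matchings S. f p) = (\<Sum>x\<in>?I. f (?g x))"
  unfolding im by (subst sum.reindex[OF inj]) simp
 also have "\<dots> = (\<Sum>(k, q)\<in>?I. f (insert {k, a} q))"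
  by (intro sum.cong) auto
 also have "\<dots> = (\<Sum>k\<in>S - {a}. \<Sum>q\<in>perfect_matchings (S - {k, a}). f (insert {k, a} q))"
  by (rule sum.Sigma[symmetric]) (use assms in \<open>simp_all add: finite_perfect_matchings\<close>)
 finally show ?thesis .
qed

text \<open>The \<open>n\<close>-th power of \<open>s / n \<le> exp (s / n)\<close>. It serves to
  absorb a power of the norm into a Gaussian.\<close>

lemma power_le_exp: "0 \<le> s ==> s ^ n \<le> real n ^ n * exp (s::real)"
proof (cases "n = 0")
 case False
 assume s: "0 \<le> s"
 have "(s / n) ^ n \<le> exp (s / n) ^ n"
 proof (rule power_mono)
  show "s / n \<le> exp (s / n)" using exp_ge_add_one_self[of "s / n"] by linarith
 qed (use s in simp)
 also have "\<dots> = exp s" using False by (simp add: exp_of_nat_mult[symmetric])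
 finally show ?thesis using False by (simp add: power_divide field_simps)
qed simp

section \<open>Gaussian integrability and integration by parts\<close>

lemma nn_integral_gaussian_1d:
 assumes "0 < (c::real)"
 shows "(\<integral>\<^sup>+x. ennreal (exp (- c * (x * x))) \<partial>lborel) < \<infinity>"
proof -
 let ?\<sigma> = "1 / sqrt (2 * c)"
 have \<sigma>: "0 < ?\<sigma>" using assms by simp
 have "integrable lborel (normal_density 0 ?\<sigma>)" using \<sigma> by (rule integrable_normal_density)
 hence "integrable lborel (%x. sqrt (2 * pi * ?\<sigma>\<^sup>2) * normal_density 0 ?\<sigma> x)" by simp
 moreover have "sqrt (2 * pi * ?\<sigma>\<^sup>2) * normal_density 0 ?\<sigma> x = exp (- c * (x * x))" for x
 proof -
  have p: "2 * ?\<sigma>\<^sup>2 = 1 / c" using assms by (simp add: power_divide)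
  have "- (x - 0)\<^sup>2 / (2 * ?\<sigma>\<^sup>2) = - c * (x * x)"
   unfolding p by (simp add: power2_eq_square)
  moreover have "sqrt (2 * pi * ?\<sigma>\<^sup>2) ~= 0" using assms by simp
  ultimately show ?thesis unfolding normal_density_def by simp
 qed
 ultimately have "integrable lborel (%x. exp (- c * (x * x)))" by simp
 thus ?thesis by (simp add: integrable_iff_bounded)
qed

lemma integrable_gaussian:
 assumes "0 < c"
 shows "integrable lborel (%x::'a::euclidean_space. exp (- c * (x \<bullet> x)))"
proof (rule integrableI_nonneg)
 have "ennreal (exp (- c * (x \<bullet> x))) = (\<Prod>b\<in>Basis. ennreal (exp (- c * ((x \<bullet> b) * (x \<bullet> b)))))" for x :: 'a
  by (subst prod_ennreal) (auto simp: exp_sum[symmetric] euclidean_inner[of x x] sum_distrib_left)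
 hence "(\<integral>\<^sup>+x. ennreal (exp (- c * (x \<bullet> x))) \<partial>(lborel :: 'a measure))
   = (\<integral>\<^sup>+x. (\<Prod>b\<in>Basis. ennreal (exp (- c * ((x \<bullet> b) * (x \<bullet> b))))) \<partial>(lborel :: 'a measure))" by simp
 also have "\<dots> = (\<Prod>b\<in>(Basis::'a set). \<integral>\<^sup>+x. ennreal (exp (- c * (x * x))) \<partial>lborel)"
  by (rule nn_integral_lborel_prod) auto
 also have "\<dots> < \<infinity>"
  using nn_integral_gaussian_1d[OF assms] by (simp add: power_less_top_ennreal)
 finally show "(\<integral>\<^sup>+x. ennreal (exp (- c * (x \<bullet> x))) \<partial>(lborel :: 'a measure)) < \<infinity>" .
qed auto

lemma lborel_integral_translation:
 fixes f :: "'a::euclidean_space => 'b::{banach, second_countable_topology}"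
 assumes [measurable]: "f \<in> borel_measurable borel"
 shows "(LINT x|lborel. f (x + v)) = (LINT x|lborel. f x)"
proof -
 have "(LINT x|lborel. f x) = (LINT x|distr lborel borel ((+) v). f x)"
  using lborel_distr_plus[of v] by simp
 also have "\<dots> = (LINT x|lborel. f (v + x))" by (rule integral_distr) auto
 finally show ?thesis by (simp add: add.commute)
qed

lemma lborel_nn_integral_translation:
 fixes f :: "'a::euclidean_space => ennreal"
 assumes [measurable]: "f \<in> borel_measurable borel"
 shows "(\<integral>\<^sup>+x. f (x + v) \<partial>lborel) = (\<integral>\<^sup>+x. f x \<partial>lborel)"
proof -
 have "(\<integral>\<^sup>+x. f x \<partial>lborel) = (\<integral>\<^sup>+x. f x \<partial>distr lborel borel ((+) v))"
  using lborel_distr_plus[of v] by simp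
 also have "\<dots> = (\<integral>\<^sup>+x. f (v + x) \<partial>lborel)" by (rule nn_integral_distr) auto
 finally show ?thesis by (simp add: add.commute)
qed

text \<open>Integration by parts: translation invariance of Lebesgue measure, integrated along the segment from \<open>0\<close> to \<open>v\<close>.\<close>

lemma integral_directional_derivative:
 fixes f D :: "'a::euclidean_space => real"
 assumes f: "integrable lborel f" and D: "integrable lborel D" and contD: "continuous_on UNIV D"
  and der: "\<And>x s. ((%s. f (x + s *\<^sub>R v)) has_real_derivative D (x + s *\<^sub>R v)) (at s)"
 shows "(LINT x|lborel. D x) = 0"
proof -
 have [measurable]: "D \<in> borel_measurable borel" "f \<in> borel_measurable borel"
  using D f by (auto dest: borel_measurable_integrable)
 have int_tr: "integrable lborel (%x. f (x + v))"
  using f by (auto simp: integrable_iff_bounded lborel_nn_integral_translation[of "%x. ennreal \<bar>f x\<bar>"])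
 have FTC: "(LINT s|lborel. D (x + s *\<^sub>R v) * indicator {0..1} s) = f (x + v) - f x" for x
 proof -
  have "has_bochner_integral lborel (%s. D (x + s *\<^sub>R v) * indicator {0..1} s) (f (x + 1 *\<^sub>R v) - f (x + 0 *\<^sub>R v))"
  proof (rule has_bochner_integral_FTC_Icc_real)
   show "((%s. f (x + s *\<^sub>R v)) has_real_derivative D (x + s *\<^sub>R v)) (at s)" for s by (rule der)
   have "continuous_on UNIV (%s. D (x + s *\<^sub>R v))"
    by (intro continuous_on_compose2[OF contD] continuous_intros) auto
   thus "isCont (%s. D (x + s *\<^sub>R v)) s" for s by (simp add: continuous_on_eq_continuous_at)
  qed simp
  thus ?thesis by (simp add: has_bochner_integral_integral_eq)
 qed
 let ?F = "%(x, s). D (x + s *\<^sub>R v) * indicator {0..1} s"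
 have meas[measurable]: "?F \<in> borel_measurable (lborel \<Otimes>\<^sub>M lborel)" by measurable
 have int: "integrable (lborel \<Otimes>\<^sub>M lborel) ?F"
  unfolding integrable_iff_bounded
 proof (intro conjI meas)
  have "(\<integral>\<^sup>+p. ennreal (norm (?F p)) \<partial>(lborel \<Otimes>\<^sub>M lborel)) = (\<integral>\<^sup>+s. \<integral>\<^sup>+x. ennreal (norm (?F (x, s))) \<partial>lborel \<partial>lborel)"
   by (rule lborel_pair.nn_integral_snd[symmetric]) measurable
  also have "\<dots> = (\<integral>\<^sup>+s. (\<integral>\<^sup>+x. ennreal (norm (D x)) \<partial>lborel) * indicator {0..1::real} s \<partial>lborel)"
  proof (rule nn_integral_cong)
   fix s :: real
   have "(\<integral>\<^sup>+x. ennreal (norm (?F (x, s))) \<partial>lborel) = (\<integral>\<^sup>+x. ennreal (norm (D (x + s *\<^sub>R v))) * indicator {0..1} s \<partial>lborel)"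
    by (intro nn_integral_cong) (auto simp: indicator_def)
   also have "\<dots> = (\<integral>\<^sup>+x. ennreal (norm (D (x + s *\<^sub>R v))) \<partial>lborel) * indicator {0..1} s"
    by (rule nn_integral_multc) measurable
   finally show "(\<integral>\<^sup>+x. ennreal (norm (?F (x, s))) \<partial>lborel) = (\<integral>\<^sup>+x. ennreal (norm (D x)) \<partial>lborel) * indicator {0..1} s"
    using lborel_nn_integral_translation[of "%x. ennreal (norm (D x))" "s *\<^sub>R v"] by simp
  qed
  also have "\<dots> = (\<integral>\<^sup>+x. ennreal (norm (D x)) \<partial>lborel) * emeasure lborel {0..1::real}"
   by (rule nn_integral_cmult_indicator) simp
  also have "\<dots> < \<infinity>" using D by (simp add: integrable_iff_bounded)
  finally show "(\<integral>\<^sup>+p. ennreal (norm (?F p)) \<partial>(lborel \<Otimes>\<^sub>M lborel)) < \<infinity>" .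
 qed
 have "0 = (LINT x|lborel. f (x + v) - f x)"
  using f int_tr by (simp add: lborel_integral_translation)
 also have "\<dots> = (LINT x|lborel. LINT s|lborel. D (x + s *\<^sub>R v) * indicator {0..1} s)"
  by (simp only: FTC)
 also have "\<dots> = (LINT s|lborel. LINT x|lborel. D (x + s *\<^sub>R v) * indicator {0..1} s)"
  by (rule lborel_pair.Fubini_integral[symmetric]) (use int in simp)
 also have "\<dots> = (LINT s|lborel. (LINT x|lborel. D x) * indicator {0..1::real} s)"
  by (intro Bochner_Integration.integral_cong) (auto simp: lborel_integral_translation)
 also have "\<dots> = (LINT x|lborel. D x)" by simp
 finally show ?thesis ..
qed

locale gaussian_form =
 fixes q :: "'a::euclidean_space => 'a => real" and c :: real
 assumes q_bilinear: "bilinear q" and q_sym: "q x y = q y x"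
  and c_pos: "0 < c" and coercive: "c * (x \<bullet> x) \<le> q x x"
begin

definition weight :: "'a => real" where "weight x = exp (- (q x x / 2))"

lemma bounded_bilinear_q: "bounded_bilinear q"
 using q_bilinear by (simp add: bilinear_conv_bounded_bilinear)

lemma continuous_q: "continuous_on UNIV (%x. q (g x) (h x))" if "continuous_on UNIV g" "continuous_on UNIV h" for g h :: "'b::topological_space => 'a"
 by (rule bounded_bilinear.continuous_on[OF bounded_bilinear_q that])

lemma continuous_weight: "continuous_on UNIV weight"
 unfolding weight_def by (intro continuous_intros continuous_q) auto

text \<open>With \<open>s = c / 4 * (x \<bullet> x)\<close> coercivity bounds the weight by
  \<open>exp (- 2 * s)\<close>. One factor \<open>exp (- s)\<close> absorbs the power of the norm,
  at the cost of the constant \<open>?K\<close>; the other one remains as an integrable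
  Gaussian.\<close>

lemma integrable_power_weight: "integrable lborel (%x. norm x ^ n * weight x)"
proof (rule Bochner_Integration.integrable_bound)
 let ?K = "1 + (4 / c) ^ n * real n ^ n"
 show "integrable lborel (%x::'a. ?K * exp (- (c / 4) * (x \<bullet> x)))"
  using integrable_gaussian[of "c / 4", where 'a='a] c_pos by simp
 have "continuous_on UNIV (%x. norm x ^ n * weight x)" by (intro continuous_intros continuous_weight)
 thus "(%x. norm x ^ n * weight x) \<in> borel_measurable lborel" by (simp add: borel_measurable_continuous_onI)
 show "AE x in lborel. norm (norm x ^ n * weight x) \<le> norm (?K * exp (- (c / 4) * (x \<bullet> x)))"
 proof (rule AE_I2)
  fix x :: 'a
  let ?s = "c / 4 * (x \<bullet> x)"
  have s: "0 \<le> ?s" using c_pos by simp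
  \<comment> \<open>An even power of the norm is a power of \<open>x \<bullet> x\<close>, hence a
    multiple of a power of \<open>?s\<close>.\<close>
  have "norm x ^ n \<le> 1 + norm x ^ (2 * n)"
  proof (cases "norm x \<le> 1")
   case True
   hence "norm x ^ n \<le> 1" by (simp add: power_le_one)
   thus ?thesis by (simp add: add_increasing2)
  next
   case False
   hence "norm x ^ n \<le> norm x ^ (2 * n)" by (intro power_increasing) auto
   thus ?thesis by simp
  qed
  also have "norm x ^ (2 * n) = (4 / c) ^ n * ?s ^ n"
   using c_pos by (simp add: power_mult power_mult_distrib[symmetric] dot_square_norm)
  also have "\<dots> \<le> (4 / c) ^ n * (real n ^ n * exp ?s)"
   using c_pos power_le_exp[OF s] by (intro mult_left_mono) auto
  also have "1 + \<dots> \<le> exp ?s + (4 / c) ^ n * (real n ^ n * exp ?s)"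
   using s by simp
  finally have a: "norm x ^ n \<le> ?K * exp ?s" by (simp add: algebra_simps)
  have b: "weight x \<le> exp (- ?s) * exp (- ?s)"
   using coercive[of x] by (simp add: weight_def mult_exp_exp)
  have "norm x ^ n * weight x \<le> (?K * exp ?s) * (exp (- ?s) * exp (- ?s))"
   by (intro mult_mono a b) (use c_pos in \<open>auto simp: weight_def\<close>)
  also have "\<dots> = ?K * exp (- ?s)" by (simp add: exp_minus field_simps)
  finally have "norm x ^ n * weight x \<le> ?K * exp (- ?s)" .
  moreover have "0 \<le> ?K" using c_pos by simp
  ultimately show "norm (norm x ^ n * weight x) \<le> norm (?K * exp (- (c / 4) * (x \<bullet> x)))"
   by (simp add: abs_mult weight_def)
 qed
qed

lemma integrable_monomial:
 assumes "finite S"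
 shows "integrable lborel (%x. (\<Prod>k\<in>S. x \<bullet> u k) * weight x)"
proof (rule Bochner_Integration.integrable_bound)
 show "integrable lborel (%x. (\<Prod>k\<in>S. norm (u k)) * (norm x ^ card S * weight x))"
  by (intro integrable_mult_right integrable_power_weight)
 have "continuous_on UNIV (%x. (\<Prod>k\<in>S. x \<bullet> u k) * weight x)" by (intro continuous_intros continuous_weight)
 thus "(%x. (\<Prod>k\<in>S. x \<bullet> u k) * weight x) \<in> borel_measurable lborel" by (simp add: borel_measurable_continuous_onI)
 show "AE x in lborel. norm ((\<Prod>k\<in>S. x \<bullet> u k) * weight x) \<le> norm ((\<Prod>k\<in>S. norm (u k)) * (norm x ^ card S * weight x))"
 proof (rule AE_I2)
  fix x :: 'a
  have "\<bar>\<Prod>k\<in>S. x \<bullet> u k\<bar> \<le> (\<Prod>k\<in>S. norm x * norm (u k))"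
   unfolding abs_prod by (intro prod_mono) (auto intro: Cauchy_Schwarz_ineq2)
  also have "\<dots> = (\<Prod>k\<in>S. norm (u k)) * norm x ^ card S" by (simp add: prod.distrib mult.commute)
  finally show "norm ((\<Prod>k\<in>S. x \<bullet> u k) * weight x) \<le> norm ((\<Prod>k\<in>S. norm (u k)) * (norm x ^ card S * weight x))"
   by (simp add: abs_mult weight_def prod_nonneg mult_right_mono mult.assoc[symmetric])
 qed
qed

text \<open>The hypothesis on \<open>v\<close> says that the derivative of \<open>weight\<close>
  along \<open>v\<close> is \<open>- (x \<bullet> u0)\<close> times \<open>weight\<close>; the
  derivative of the whole product integrates to 0.\<close>

lemma integration_by_parts:
 assumes S: "finite S" and v: "\<And>x. q x v = x \<bullet> u0"
 shows "(LINT x|lborel. (x \<bullet> u0) * (\<Prod>k\<in>S. x \<bullet> u k) * weight x)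
   = (\<Sum>k\<in>S. (v \<bullet> u k) * (LINT x|lborel. (\<Prod>j\<in>S - {k}. x \<bullet> u j) * weight x))"
proof -
 let ?f = "%x. (\<Prod>k\<in>S. x \<bullet> u k) * weight x"
 let ?A = "%x. (\<Sum>k\<in>S. (v \<bullet> u k) * (\<Prod>j\<in>S - {k}. x \<bullet> u j))"
 let ?D = "%x. ?A x * weight x - (x \<bullet> u0) * (\<Prod>k\<in>S. x \<bullet> u k) * weight x"
 have iA: "integrable lborel (%x. ?A x * weight x)"
  unfolding sum_distrib_right mult.assoc
  by (intro Bochner_Integration.integrable_sum integrable_mult_right integrable_monomial finite_Diff S)
 have iB: "integrable lborel (%x. (x \<bullet> u0) * (\<Prod>k\<in>S. x \<bullet> u k) * weight x)"
 proof -
  \<comment> \<open>The additional factor gets the index \<open>None\<close>, which makes the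
    integrand again a monomial over a finite index set.\<close>
  have "integrable lborel (%x. (\<Prod>k\<in>insert None (Some ` S). x \<bullet> (case k of None => u0 | Some k => u k)) * weight x)"
   using S by (intro integrable_monomial) auto
  thus ?thesis using S by (simp add: prod.reindex)
 qed
 have "(LINT x|lborel. ?D x) = 0"
 proof (rule integral_directional_derivative[where f="?f" and v=v])
  show "integrable lborel ?f" by (rule integrable_monomial[OF S])
  show "integrable lborel ?D" by (rule Bochner_Integration.integrable_diff[OF iA iB])
  show "continuous_on UNIV ?D" by (intro continuous_intros continuous_weight)
  fix x s
  have qq: "q (x + s *\<^sub>R v) (x + s *\<^sub>R v) = q x x + 2 * s * q x v + s * s * q v v" for s
   using q_bilinear q_sym[of v x]
   by (simp add: bilinear_ladd bilinear_radd bilinear_lmul bilinear_rmul algebra_simps)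
  have "((%s. weight (x + s *\<^sub>R v)) has_real_derivative - ((x + s *\<^sub>R v) \<bullet> u0) * weight (x + s *\<^sub>R v)) (at s)"
  proof -
   have "((%s. exp (- ((q x x + 2 * s * q x v + s * s * q v v) / 2))) has_real_derivative
     exp (- ((q x x + 2 * s * q x v + s * s * q v v) / 2)) * (- (q x v + s * q v v))) (at s)"
    by (auto intro!: derivative_eq_intros simp: field_simps)
   moreover have "q x v + s * q v v = (x + s *\<^sub>R v) \<bullet> u0"
    using v[of "x + s *\<^sub>R v"] q_bilinear by (simp add: bilinear_ladd bilinear_lmul)
   ultimately show ?thesis by (simp add: weight_def qq mult.commute)
  qed
  moreover have "((%s. \<Prod>k\<in>S. (x + s *\<^sub>R v) \<bullet> u k) has_real_derivative ?A (x + s *\<^sub>R v)) (at s)"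
  proof -
   have "((%s. \<Prod>k\<in>S. (x + s *\<^sub>R v) \<bullet> u k) has_field_derivative (\<Sum>k\<in>S. (v \<bullet> u k) * (\<Prod>j\<in>S - {k}. (x + s *\<^sub>R v) \<bullet> u j))) (at s)"
   proof (rule has_field_derivative_prod)
    fix k
    have "((%s. x \<bullet> u k + s * (v \<bullet> u k)) has_real_derivative (v \<bullet> u k)) (at s)"
     by (auto intro!: derivative_eq_intros)
    thus "((%s. (x + s *\<^sub>R v) \<bullet> u k) has_real_derivative (v \<bullet> u k)) (at s)"
     by (simp add: inner_add_left)
   qed
   thus ?thesis by simp
  qed
  ultimately show "((%s. ?f (x + s *\<^sub>R v)) has_real_derivative ?D (x + s *\<^sub>R v)) (at s)"
   by (auto intro!: derivative_eq_intros simp: algebra_simps)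
 qed
 hence "(LINT x|lborel. (x \<bullet> u0) * (\<Prod>k\<in>S. x \<bullet> u k) * weight x) = (LINT x|lborel. ?A x * weight x)"
  using iA iB by (simp add: Bochner_Integration.integral_diff)
 also have "\<dots> = (\<Sum>k\<in>S. (v \<bullet> u k) * (LINT x|lborel. (\<Prod>j\<in>S - {k}. x \<bullet> u j) * weight x))"
  unfolding sum_distrib_right mult.assoc
  using integrable_monomial[OF finite_Diff[OF S], where u=u]
  by (subst Bochner_Integration.integral_sum) auto
 finally show ?thesis .
qed

text \<open>Integration by parts pairs the largest index with every other \<open>k\<close>. Taking
  the largest makes \<open>k\<close> the minimum and it the maximum of the new pair, in agreement
  with the ordered covariance \<open>u (Min e) \<bullet> g (Max e)\<close>. Here \<open>g k\<close>
  is the solution for the source \<open>u k\<close>.\<close>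

theorem wick:
 fixes u g :: "nat => 'a"
 assumes "finite S" and g: "\<And>k x. k \<in> S ==> q x (g k) = x \<bullet> u k"
 shows "(LINT x|lborel. (\<Prod>k\<in>S. x \<bullet> u k) * weight x)
   = (LINT x|lborel. weight x) * (\<Sum>p\<in>perfect_matchings S. \<Prod>e\<in>p. u (Min e) \<bullet> g (Max e))"
 using assms
proof (induction "card S" arbitrary: S rule: less_induct)
 case less
 show ?case
 proof (cases "S = {}")
  case True
  thus ?thesis by (simp add: perfect_matchings_empty)
 next
  case False
  let ?m = "Max S" and ?Z = "LINT x|lborel. weight x"
  let ?c = "%e. u (Min e) \<bullet> g (Max e)"
  have m: "?m \<in> S" using less.prems False by (intro Max_in) auto
  have "(LINT x|lborel. (\<Prod>k\<in>S. x \<bullet> u k) * weight x)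
    = (LINT x|lborel. (x \<bullet> u ?m) * (\<Prod>k\<in>S - {?m}. x \<bullet> u k) * weight x)"
   using less.prems m by (simp add: prod.remove)
  also have "\<dots> = (\<Sum>k\<in>S - {?m}. (g ?m \<bullet> u k) * (LINT x|lborel. (\<Prod>j\<in>S - {?m} - {k}. x \<bullet> u j) * weight x))"
   using less.prems m by (intro integration_by_parts) auto
  also have "\<dots> = (\<Sum>k\<in>S - {?m}. ?Z * (\<Sum>p\<in>perfect_matchings (S - {k, ?m}). \<Prod>e\<in>insert {k, ?m} p. ?c e))"
  proof (rule sum.cong[OF refl])
   fix k assume k: "k \<in> S - {?m}"
   have eq: "S - {?m} - {k} = S - {k, ?m}" by auto
   have "card (S - {k, ?m}) < card S"
    using less.prems k by (intro psubset_card_mono) auto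
   hence IH: "(LINT x|lborel. (\<Prod>j\<in>S - {k, ?m}. x \<bullet> u j) * weight x)
     = ?Z * (\<Sum>p\<in>perfect_matchings (S - {k, ?m}). \<Prod>e\<in>p. ?c e)"
    using less.prems by (intro less.hyps) auto
   have "k < ?m" using less.prems k by (simp add: order.not_eq_order_implies_strict)
   hence mm: "Min {k, ?m} = k" "Max {k, ?m} = ?m" by auto
   have "(\<Prod>e\<in>insert {k, ?m} p. ?c e) = (g ?m \<bullet> u k) * (\<Prod>e\<in>p. ?c e)"
    if p: "p \<in> perfect_matchings (S - {k, ?m})" for p
   proof -
    have "finite p" using p less.prems finite_UnionD[of p]
     by (auto simp: perfect_matchings_def partition_on_def)
    moreover have "{k, ?m} \<notin> p" using perfect_matchings_insert(2)[OF p m] k by auto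
    ultimately show ?thesis by (simp add: mm inner_commute)
   qed
   hence "(\<Sum>p\<in>perfect_matchings (S - {k, ?m}). \<Prod>e\<in>insert {k, ?m} p. ?c e)
     = (g ?m \<bullet> u k) * (\<Sum>p\<in>perfect_matchings (S - {k, ?m}). \<Prod>e\<in>p. ?c e)"
    by (simp add: sum_distrib_left)
   thus "(g ?m \<bullet> u k) * (LINT x|lborel. (\<Prod>j\<in>S - {?m} - {k}. x \<bullet> u j) * weight x)
     = ?Z * (\<Sum>p\<in>perfect_matchings (S - {k, ?m}). \<Prod>e\<in>insert {k, ?m} p. ?c e)"
    unfolding eq IH by (simp only: mult_ac)
  qed
  also have "\<dots> = ?Z * (\<Sum>p\<in>perfect_matchings S. \<Prod>e\<in>p. ?c e)"
   using sum_perfect_matchings[OF less.prems(1) m, of "%p. \<Prod>e\<in>p. ?c e"] by (simp add: sum_distrib_left)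
  finally show ?thesis .
 qed
qed

end

section \<open>Laplace transforms determine bounded functionals\<close>

text \<open>Rounding down to multiples of \<open>1 / 2 ^ n\<close> gives finitely many values on a
  bounded function, with uniform error at most \<open>(1/2) ^ n\<close>.\<close>

lemma approximate_bounded_by_simple:
 fixes F :: "'a => real"
 assumes [measurable]: "F \<in> borel_measurable M" and B: "\<And>x. \<bar>F x\<bar> \<le> B"
 shows "\<exists>s. (\<forall>n. simple_function M (s n)) \<and> (\<forall>n x. \<bar>s n x\<bar> \<le> B + 1) \<and> (\<forall>x. (%n. s n x) \<longlonglongrightarrow> F x)"
proof -
 define s where "s n x = real_of_int \<lfloor>F x * 2 ^ n\<rfloor> / 2 ^ n" for n :: nat and x
 have close: "\<bar>s n x - F x\<bar> \<le> (1/2) ^ n" for n x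
 proof -
  have "\<bar>real_of_int \<lfloor>F x * 2 ^ n\<rfloor> - F x * 2 ^ n\<bar> \<le> 1" by linarith
  moreover have "s n x - F x = (real_of_int \<lfloor>F x * 2 ^ n\<rfloor> - F x * 2 ^ n) / 2 ^ n"
   by (simp add: s_def field_simps)
  ultimately show ?thesis by (simp add: abs_divide power_divide divide_right_mono)
 qed
 have "simple_function M (s n)" for n
 proof (rule simple_function_borel_measurable)
  show "s n \<in> borel_measurable M" unfolding s_def by measurable
  have "\<lfloor>F x * 2 ^ n\<rfloor> \<in> {\<lfloor>- B * 2 ^ n\<rfloor>..\<lfloor>B * 2 ^ n\<rfloor>}" for x
  proof -
   have "- B * 2 ^ n \<le> F x * 2 ^ n" "F x * 2 ^ n \<le> B * 2 ^ n"
    using B[of x] by (intro mult_right_mono; simp add: abs_le_iff)+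
   thus ?thesis by (simp add: floor_mono)
  qed
  hence "s n ` space M \<subseteq> (%k. real_of_int k / 2 ^ n) ` {\<lfloor>- B * 2 ^ n\<rfloor>..\<lfloor>B * 2 ^ n\<rfloor>}"
   unfolding s_def by (intro image_subsetI) (rule image_eqI[OF refl], blast)
  thus "finite (s n ` space M)" by (rule finite_subset) simp
 qed
 moreover have "\<bar>s n x\<bar> \<le> B + 1" for n x
 proof -
  have "(1/2 :: real) ^ n \<le> 1" by (simp add: power_le_one)
  thus ?thesis using close[of n x] B[of x] by linarith
 qed
 moreover have "(%n. s n x) \<longlonglongrightarrow> F x" for x
 proof (rule Lim_transform[OF tendsto_const])
  have lim: "(%n. (1/2 :: real) ^ n) \<longlonglongrightarrow> 0" by (rule LIMSEQ_realpow_zero) auto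
  show "(%n. s n x - F x) \<longlonglongrightarrow> 0"
   by (rule Lim_null_comparison[OF _ lim]) (simp add: close)
 qed
 ultimately show ?thesis by blast
qed

text \<open>\<open>P\<close> stands for the identity to be proved. Bounds and convergence refer to
  the non-negative orthant, since exponentials need not be bounded outside it.\<close>

locale laplace_class =
 fixes P :: "(real^'n::finite => real) => bool"
 assumes exponential: "\<And>V. (\<And>i. 0 \<le> V $ i) ==> P (%u. exp (- (V \<bullet> u)))"
  and add: "\<And>F G. [|F \<in> borel_measurable borel; G \<in> borel_measurable borel; bounded (F ` {u. \<forall>i. 0 \<le> u $ i});
    bounded (G ` {u. \<forall>i. 0 \<le> u $ i}); P F; P G|] ==> P (%u. F u + G u)"
  and scale: "\<And>F c. [|F \<in> borel_measurable borel; bounded (F ` {u. \<forall>i. 0 \<le> u $ i}); P F|] ==> P (%u. c * F u)"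
  and limit: "\<And>F G B. [|\<And>n. F n \<in> borel_measurable borel; G \<in> borel_measurable borel;
    \<And>n u. (\<And>i. 0 \<le> u $ i) ==> \<bar>F n u\<bar> \<le> B; \<And>n. P (F n);
    \<And>u. (\<And>i. 0 \<le> u $ i) ==> (%n. F n u) \<longlonglongrightarrow> G u|] ==> P G"
begin

abbreviation orthant :: "(real^'n) set" where "orthant \<equiv> {u. \<forall>i. 0 \<le> u $ i}"

definition good :: "(real^'n => real) => bool" where
 "good F \<longleftrightarrow> F \<in> borel_measurable borel \<and> bounded (F ` orthant) \<and> P F"

lemma good_add: "good F ==> good G ==> good (%u. F u + G u)"
 using add[of F G] bounded_plus_comp[of F orthant G] by (auto simp: good_def)

lemma good_scale: "good F ==> good (%u. c * F u)"
 using scale[of F c] bounded_scaleR_comp[of F orthant c] by (auto simp: good_def)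

lemma good_exponential: "(\<And>i. 0 \<le> V $ i) ==> good (%u. exp (- (V \<bullet> u)))"
proof -
 assume V: "\<And>i. 0 \<le> V $ i"
 have "0 \<le> V \<bullet> u" if "u \<in> orthant" for u
  using that V unfolding inner_vec_def by (intro sum_nonneg) simp
 hence "bounded ((%u. exp (- (V \<bullet> u))) ` orthant)"
  by (intro boundedI[of _ 1]) auto
 thus ?thesis using exponential[OF V] by (simp add: good_def)
qed

lemma good_limit:
 assumes "\<And>n. good (F n)" "G \<in> borel_measurable borel"
  and B: "\<And>n u. u \<in> orthant ==> \<bar>F n u\<bar> \<le> B" and lim: "\<And>u. u \<in> orthant ==> (%n. F n u) \<longlonglongrightarrow> G u"
 shows "good G"
proof -
 have "P G"
  by (rule limit[of F G B]) (use assms in \<open>auto simp: good_def\<close>)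
 moreover have "\<bar>G u\<bar> \<le> B" if "u \<in> orthant" for u
  using LIMSEQ_le_const2[OF tendsto_rabs[OF lim[OF that]]] B[OF that] by auto
 hence "bounded (G ` orthant)" by (intro boundedI[of _ B]) auto
 ultimately show ?thesis using assms(2) by (simp add: good_def)
qed

lemma good_const: "good (%_. c)"
 using good_scale[OF good_exponential[of 0], of c] by simp

text \<open>Exponents add under multiplication, so these functions form an algebra, which contains
  the polynomials in the variables \<open>exp (- (u $ i))\<close>.\<close>

inductive exponential_sum :: "(real^'n => real) => bool" where
 base: "(\<And>i. 0 \<le> V $ i) ==> exponential_sum (%u. c * exp (- (V \<bullet> u)))"
| plus: "exponential_sum F ==> exponential_sum G ==> exponential_sum (%u. F u + G u)"

lemma exponential_sum_good: "exponential_sum F ==> good F"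
proof (induction rule: exponential_sum.induct)
 case (base V c)
 thus ?case by (rule good_scale[OF good_exponential])
next
 case (plus F G)
 thus ?case by (simp add: good_add)
qed

lemma exponential_sum_mult_base:
 assumes "exponential_sum F" "\<And>i. 0 \<le> V $ i"
 shows "exponential_sum (%u. F u * (c * exp (- (V \<bullet> u))))"
 using assms(1)
proof induction
 case (base W d)
 have "exponential_sum (%u. (d * c) * exp (- ((W + V) \<bullet> u)))"
  by (rule exponential_sum.base) (use base assms(2) in simp)
 moreover have "(d * exp (- (W \<bullet> u))) * (c * exp (- (V \<bullet> u))) = (d * c) * exp (- ((W + V) \<bullet> u))" for u
 proof -
  have "exp (- (W \<bullet> u)) * exp (- (V \<bullet> u)) = exp (- ((W + V) \<bullet> u))"
   by (simp add: inner_add_left mult_exp_exp)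
  thus ?thesis by (metis mult.assoc mult.left_commute)
 qed
 ultimately show ?case by presburger
next
 case (plus F G)
 thus ?case using exponential_sum.plus by (simp add: distrib_right)
qed

lemma exponential_sum_mult:
 assumes "exponential_sum F" "exponential_sum G"
 shows "exponential_sum (%u. F u * G u)"
 using assms(2)
proof induction
 case (base V c)
 thus ?case by (rule exponential_sum_mult_base[OF assms(1)])
next
 case (plus G H)
 thus ?case using exponential_sum.plus by (simp add: distrib_left)
qed

abbreviation expvec :: "real^'n => real^'n" where "expvec u \<equiv> \<chi> i. exp (- (u $ i))"

lemma exponential_sum_polynomial:
 assumes "real_polynomial_function p"
 shows "exponential_sum (%u. p (expvec u))"
 using assms
proof induction
 case (linear f)
 have "f (expvec u) = (\<Sum>i\<in>UNIV. f (axis i 1) * exp (- (axis i 1 \<bullet> u)))" for u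
 proof -
  have "expvec u = (\<Sum>i\<in>UNIV. exp (- (u $ i)) *\<^sub>R axis i 1)"
   by (subst basis_expansion[symmetric]) (simp add: scalar_mult_eq_scaleR)
  hence "f (expvec u) = (\<Sum>i\<in>UNIV. f (exp (- (u $ i)) *\<^sub>R axis i 1))"
   using linear bounded_linear.linear linear_sum by metis
  also have "\<dots> = (\<Sum>i\<in>UNIV. f (axis i 1) * exp (- (axis i 1 \<bullet> u)))"
   using linear by (simp add: bounded_linear.linear linear_scale inner_axis' mult.commute)
  finally show ?thesis .
 qed
 moreover have "exponential_sum (%u. \<Sum>i\<in>I. f (axis i 1) * exp (- (axis i 1 \<bullet> u)))" if "finite I" for I
  using that
 proof induction
  case empty
  have "exponential_sum (%u. 0 * exp (- (0 \<bullet> u)))" by (rule exponential_sum.base) simp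
  thus ?case by simp
 next
  case (insert i I)
  have "exponential_sum (%u. f (axis i 1) * exp (- (axis i 1 \<bullet> u)))"
   by (rule exponential_sum.base) (simp add: axis_def)
  thus ?case using insert exponential_sum.plus by simp
 qed
 ultimately show ?case by simp
next
 case (const c)
 have "exponential_sum (%u. c * exp (- (0 \<bullet> u)))" by (rule exponential_sum.base) simp
 thus ?case by simp
next
 case (add f g)
 thus ?case by (auto intro: exponential_sum.plus)
next
 case (mult f g)
 thus ?case by (auto intro: exponential_sum_mult)
qed

lemma expvec_unit_cube: "u \<in> orthant ==> expvec u \<in> {0..1}"
 by (auto simp: less_eq_vec_def)

lemma measurable_expvec [measurable]: "expvec \<in> borel_measurable borel"
 by (intro borel_measurable_continuous_onI continuous_intros)

text \<open>\<open>expvec\<close> maps the orthant into the compact unit cube, where polynomials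
  approximate \<open>f\<close> uniformly; composed with \<open>expvec\<close> they are sums of
  exponentials.\<close>

lemma good_continuous:
 assumes f: "continuous_on UNIV f"
 shows "good (%u. f (expvec u))"
proof -
 have comp: "compact {0..1 :: real^'n}" by simp
 have cont: "continuous_on {0..1} f" using f continuous_on_subset by blast
 have "\<exists>p. real_polynomial_function p \<and> (\<forall>x\<in>{0..1}. \<bar>f x - p x\<bar> < 1 / Suc n)" for n
  by (rule Stone_Weierstrass_real_polynomial_function[OF comp cont, of "1 / real (Suc n)"]) (simp, blast)
 then obtain p where p: "\<And>n. real_polynomial_function (p n)" "\<And>n x. x \<in> {0..1} ==> \<bar>f x - p n x\<bar> < 1 / Suc n"
  by metis
 have "bounded (f ` {0..1})" using compact_imp_bounded[OF compact_continuous_image[OF cont comp]] .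
 then obtain B where "\<forall>y\<in>f ` {0..1}. norm y \<le> B" unfolding bounded_iff ..
 hence B: "\<And>x. x \<in> {0..1} ==> \<bar>f x\<bar> \<le> B" by (simp del: atLeastAtMost_iff)
 show ?thesis
 proof (rule good_limit[where F="%n u. p n (expvec u)" and B="B + 1"])
  show "good (%u. p n (expvec u))" for n by (intro exponential_sum_good exponential_sum_polynomial p)
  show "(%u. f (expvec u)) \<in> borel_measurable borel"
   by (intro borel_measurable_continuous_onI continuous_on_compose2[OF f] continuous_intros) auto
  fix n and u :: "real^'n" assume u: "u \<in> orthant"
  have "\<bar>f (expvec u) - p n (expvec u)\<bar> < 1 / Suc n" using p(2) expvec_unit_cube[OF u] by blast
  moreover have "1 / real (Suc n) \<le> 1" by simp
  ultimately show "\<bar>p n (expvec u)\<bar> \<le> B + 1"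
   using B[OF expvec_unit_cube[OF u]] by (smt (verit))
 next
  fix u :: "real^'n" assume u: "u \<in> orthant"
  show "(%n. p n (expvec u)) \<longlonglongrightarrow> f (expvec u)"
  proof (rule LIMSEQ_I)
   fix r :: real assume "0 < r"
   then obtain N where N: "1 / Suc N < r" using nat_approx_posE by blast
   have "norm (p n (expvec u) - f (expvec u)) < r" if "N \<le> n" for n
   proof -
    have "1 / real (Suc n) \<le> 1 / Suc N" using that by (simp add: field_simps)
    thus ?thesis using p(2)[OF expvec_unit_cube[OF u], of n] N by (simp add: abs_minus_commute)
   qed
   thus "\<exists>no. \<forall>n\<ge>no. norm (p n (expvec u) - f (expvec u)) < r" by blast
  qed
 qed
qed

text \<open>The condition \<open>u \<le> a\<close> says that each \<open>exp (- (u $ i))\<close> is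
  at least \<open>exp (- (a $ i))\<close>. The ramp \<open>?t\<close> is 1 above this threshold and
  falls to 0 below it with slope \<open>n\<close>, continuously in the coordinate of
  \<open>expvec u\<close>.\<close>

lemma good_box: "good (indicator {..a})"
proof -
 let ?t = "%n i s. max 0 (1 - real n * max 0 (exp (- (a $ i)) - s))"
 let ?f = "%n (s::real^'n). \<Prod>i\<in>UNIV. ?t n i (s $ i)"
 show ?thesis
 proof (rule good_limit[where F="%n u. ?f n (expvec u)" and B=1])
  show "good (%u. ?f n (expvec u))" for n
   by (rule good_continuous[where f="?f n"]) (intro continuous_intros)
  show "indicator {..a} \<in> borel_measurable borel" by simp
  have t: "0 \<le> ?t n i s" "?t n i s \<le> 1" for n i s by auto
  show "\<bar>?f n (expvec u)\<bar> \<le> 1" for n u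
   using t by (simp only: abs_prod abs_of_nonneg) (rule prod_le_1, blast)
  fix u :: "real^'n"
  show "(%n. ?f n (expvec u)) \<longlonglongrightarrow> indicator {..a} u"
  proof (cases "u \<le> a")
   case True
   hence "?f n (expvec u) = 1" for n by (auto simp: less_eq_vec_def intro!: prod.neutral)
   thus ?thesis using True by simp
  next
   case False
   then obtain i where i: "a $ i < u $ i" by (auto simp: less_eq_vec_def not_le)
   let ?d = "exp (- (a $ i)) - exp (- (u $ i))"
   have d: "0 < ?d" using i by simp
   obtain N where N: "1 / ?d < real N" using reals_Archimedean2 by blast
   have "?f n (expvec u) = 0" if "N \<le> n" for n
   proof -
    have "1 < real N * ?d" using N d by (simp add: field_simps)
    also have "\<dots> \<le> real n * ?d" using that d by (intro mult_right_mono) auto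
    finally have "?t n i (expvec u $ i) = 0" using d by (simp add: max_def)
    thus ?thesis by (intro prod_zero) auto
   qed
   hence "eventually (%n. ?f n (expvec u) = 0) sequentially" by (auto simp: eventually_sequentially)
   hence "(%n. ?f n (expvec u)) \<longlonglongrightarrow> 0" by (rule tendsto_eventually)
   thus ?thesis using False by simp
  qed
 qed
qed

text \<open>Dynkin's theorem: the lower boxes are stable under intersection and generate the Borel
  sets, and sets with good indicators are closed under complements and countable disjoint
  unions.\<close>

lemma good_indicator:
 assumes "A \<in> sets (borel :: (real^'n) measure)"
 shows "good (indicator A)"
proof -
 have sets: "sets (borel :: (real^'n) measure) = sigma_sets UNIV (range atMost)"
  by (subst borel_eq_atMost, rule sets_measure_of) simp
 have A: "A \<in> sigma_sets UNIV (range (atMost :: real^'n => _))" using assms sets by simp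
 have stable: "Int_stable (range (atMost :: real^'n => _))"
 proof (rule Int_stableI, clarify)
  fix a b :: "real^'n"
  have "{..a} \<inter> {..b} = {..\<chi> i. min (a $ i) (b $ i)}" by (auto simp: less_eq_vec_def)
  thus "{..a} \<inter> {..b} \<in> range atMost" by blast
 qed
 have "range (atMost :: real^'n => _) \<subseteq> Pow UNIV" by simp
 from stable this A show ?thesis
 proof (induction rule: sigma_sets_induct_disjoint)
  case (basic A)
  thus ?case using good_box by auto
 next
  case empty
  thus ?case using good_const[of 0] by (simp add: indicator_def[abs_def])
 next
  case (compl A)
  have "good (%u. 1 + -1 * indicator A u)" by (rule good_add[OF good_const good_scale[OF compl(2)]])
  moreover have "(%u. 1 + -1 * indicator A u :: real) = indicator (UNIV - A)" by (auto simp: indicator_def fun_eq_iff)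
  ultimately show ?case by simp
 next
  case (union A)
  have sum: "good (%u. \<Sum>i<n. indicator (A i) u)" for n
   by (induction n) (auto intro: good_add good_const union(3))
  show ?case
  proof (rule good_limit[where F="%n u. \<Sum>i<n. indicator (A i) u" and B=1])
   show "good (%u. \<Sum>i<n. indicator (A i) u)" for n by (rule sum)
   show "indicator (\<Union>i. A i) \<in> borel_measurable borel"
    using union(2) unfolding sets[symmetric] by (intro borel_measurable_indicator sets.countable_UN)
   fix u
   have eq: "(\<Sum>i<n. indicator (A i) u) = (indicator (\<Union>i<n. A i) u :: real)" for n
    using union(1) by (intro indicator_UN_disjoint[symmetric]) (auto simp: disjoint_family_on_def)
   thus "\<bar>\<Sum>i<n. indicator (A i) u :: real\<bar> \<le> 1" for n by (simp add: indicator_def)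
   show "(%n. \<Sum>i<n. indicator (A i) u :: real) \<longlonglongrightarrow> indicator (\<Union>i. A i) u"
    unfolding eq by (rule LIMSEQ_indicator_UN)
  qed
 qed
qed

lemma good_simple:
 assumes "simple_function borel F"
 shows "good F"
proof -
 have "good (%u. \<Sum>y\<in>I. y * indicator (F -` {y}) u)" if "finite I" for I
  using that
 proof induction
  case empty
  thus ?case using good_const by simp
 next
  case (insert y I)
  have "F -` {y} \<in> sets borel" using simple_functionD(2)[OF assms, of "{y}"] by simp
  hence "good (%u. y * indicator (F -` {y}) u + (\<Sum>y\<in>I. y * indicator (F -` {y}) u))"
   by (intro good_add good_scale good_indicator insert.IH)
  thus ?case using insert by (simp only: sum.insert[OF insert.hyps])
 qed
 hence "good (%u. \<Sum>y\<in>range F. y * indicator (F -` {y}) u)"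
  using simple_functionD(1)[OF assms] by simp
 moreover have "(\<Sum>y\<in>range F. y * indicator (F -` {y}) u) = F u" for u
 proof -
  have "(\<Sum>y\<in>range F. y * indicator (F -` {y}) u) = (\<Sum>y\<in>range F. if y = F u then y else 0)"
   by (intro sum.cong) (auto simp: indicator_def)
  thus ?thesis using simple_functionD(1)[OF assms] by simp
 qed
 ultimately show ?thesis by simp
qed

theorem bounded_measurable:
 assumes F: "F \<in> borel_measurable borel" and "bounded (range F)"
 shows "P F"
proof -
 obtain B where B: "\<And>x. \<bar>F x\<bar> \<le> B" using assms(2) by (auto simp: bounded_iff)
 obtain s where s: "\<And>n. simple_function borel (s n)" "\<And>n x. \<bar>s n x\<bar> \<le> B + 1" "\<And>x. (%n. s n x) \<longlonglongrightarrow> F x"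
  using approximate_bounded_by_simple[OF F B] by auto
 have "good F" by (rule good_limit[OF good_simple[OF s(1)] F s(2) s(3)])
 thus ?thesis by (simp add: good_def)
qed

end

section \<open>Ribbon pairings\<close>

lemma psum_0 [simp]: "psum \<nu> 0 = 0"
 by (simp add: psum_def)

lemma psum_Suc: "l < length \<nu> ==> psum \<nu> (Suc l) = psum \<nu> l + \<nu> ! l"
 by (simp add: psum_def take_Suc_conv_app_nth)

lemma psum_length [simp]: "psum \<nu> (length \<nu>) = sum_list \<nu>"
 by (simp add: psum_def)

locale half_edges =
 fixes \<nu> :: "nat list"
 assumes pos: "\<forall>k\<in>set \<nu>. 0 < k"
begin

lemma psum_less: "l < l' ==> l' \<le> length \<nu> ==> psum \<nu> l < psum \<nu> l'"
proof (induction l')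
 case (Suc m)
 have "0 < \<nu> ! m" using pos Suc.prems by simp
 thus ?case using Suc psum_Suc[of m \<nu>] by (cases "l = m") auto
qed simp

lemma psum_mono: "l \<le> l' ==> l' \<le> length \<nu> ==> psum \<nu> l \<le> psum \<nu> l'"
 using psum_less[of l l'] by (cases "l = l'") auto

lemma psum_inj: "l \<le> length \<nu> ==> l' \<le> length \<nu> ==> psum \<nu> l = psum \<nu> l' ==> l = l'"
 using psum_less[of l l'] psum_less[of l' l] by (cases l l' rule: linorder_cases) auto

lemma label_cases:
 assumes "k \<in> {1..sum_list \<nu>}"
 obtains l i where "l < length \<nu>" "i < \<nu> ! l" "k = psum \<nu> l + 1 + i"
proof -
 define l where "l = (LEAST l. k \<le> psum \<nu> l)"
 have ex: "k \<le> psum \<nu> (length \<nu>)" using assms by simp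
 have 1: "k \<le> psum \<nu> l" "l \<le> length \<nu>"
  unfolding l_def by (rule LeastI[of "%l. k \<le> psum \<nu> l", OF ex], rule Least_le[of "%l. k \<le> psum \<nu> l", OF ex])
 have "l ~= 0" using 1 assms by (auto intro: gr0I)
 then obtain m where m: "l = Suc m" using not0_implies_Suc by blast
 have "\<not> k \<le> psum \<nu> m" using not_less_Least[of m "%l. k \<le> psum \<nu> l"] m unfolding l_def by auto
 thus thesis
  using 1 m psum_Suc[of m \<nu>] by (intro that[of m "k - psum \<nu> m - 1"]) auto
qed

text \<open>The case distinction at the end of a block becomes a cyclic shift of the offset within
  the block; the summand 1 is there because labels start at 1 and offsets at 0.\<close>

lemma next_label_block:
 assumes l: "l < length \<nu>" and i: "i < \<nu> ! l"
 shows "next_label \<nu> (psum \<nu> l + 1 + i) = psum \<nu> l + 1 + Suc i mod (\<nu> ! l)"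
proof (cases "Suc i = \<nu> ! l")
 case True
 let ?k = "psum \<nu> l + 1 + i"
 have k: "?k = psum \<nu> (Suc l)" using True psum_Suc[OF l] by simp
 have "(THE l'. l' \<in> {1..length \<nu>} \<and> ?k = psum \<nu> l') = Suc l"
  using k l psum_inj[of _ "Suc l"] by (intro the_equality) auto
 moreover have "\<exists>l'\<in>{1..length \<nu>}. ?k = psum \<nu> l'" using k l by (intro bexI[of _ "Suc l"]) auto
 ultimately show ?thesis unfolding next_label_def using True by simp
next
 case False
 have "\<not> (\<exists>l'\<in>{1..length \<nu>}. psum \<nu> l + 1 + i = psum \<nu> l')"
 proof
  assume "\<exists>l'\<in>{1..length \<nu>}. psum \<nu> l + 1 + i = psum \<nu> l'"
  then obtain l' where l': "l' \<le> length \<nu>" "psum \<nu> l + 1 + i = psum \<nu> l'" by auto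
  thus False
   using psum_mono[of l' l] psum_mono[of "Suc l" l'] psum_Suc[OF l] l i False
   by (cases "l' \<le> l") auto
 qed
 thus ?thesis unfolding next_label_def using False i by auto
qed

lemma block_range: "l < length \<nu> ==> i < \<nu> ! l ==> psum \<nu> l + 1 + i \<in> {1..sum_list \<nu>}"
 using psum_mono[of "Suc l" "length \<nu>"] psum_Suc[of l \<nu>] by simp

lemma bij_next_label: "bij_betw (next_label \<nu>) {1..sum_list \<nu>} {1..sum_list \<nu>}"
proof -
 have "k \<in> next_label \<nu> ` {1..sum_list \<nu>}" if k': "k \<in> {1..sum_list \<nu>}" for k
 proof -
  obtain l i where k: "l < length \<nu>" "i < \<nu> ! l" "k = psum \<nu> l + 1 + i"
   by (rule label_cases[OF k'])
  \<comment> \<open>Subtraction of 1 modulo the size of the block, written without negative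
    numbers.\<close>
  define j where "j = (i + (\<nu> ! l - 1)) mod (\<nu> ! l)"
  have j: "j < \<nu> ! l" using k by (simp add: j_def)
  have "Suc j mod (\<nu> ! l) = i" unfolding j_def mod_Suc_eq using k by simp
  hence "k = next_label \<nu> (psum \<nu> l + 1 + j)" using next_label_block[OF k(1) j] k(3) by simp
  thus ?thesis using block_range[OF k(1) j] by (rule image_eqI)
 qed
 moreover have "next_label \<nu> ` {1..sum_list \<nu>} \<subseteq> {1..sum_list \<nu>}"
 proof
  fix k' assume "k' \<in> next_label \<nu> ` {1..sum_list \<nu>}"
  then obtain k where k: "k \<in> {1..sum_list \<nu>}" "k' = next_label \<nu> k" by blast
  obtain l i where li: "l < length \<nu>" "i < \<nu> ! l" "k = psum \<nu> l + 1 + i"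
   by (rule label_cases[OF k(1)])
  have "Suc i mod (\<nu> ! l) < \<nu> ! l" using li by simp
  from block_range[OF li(1) this] show "k' \<in> {1..sum_list \<nu>}"
   unfolding k(2) li(3) next_label_block[OF li(1,2)] .
 qed
 ultimately have im: "next_label \<nu> ` {1..sum_list \<nu>} = {1..sum_list \<nu>}" by blast
 hence "inj_on (next_label \<nu>) {1..sum_list \<nu>}" by (intro eq_card_imp_inj_on) simp_all
 thus ?thesis using im by (simp add: bij_betw_def)
qed

definition prev_label :: "nat => nat" where
 "prev_label = inv_into {1..sum_list \<nu>} (next_label \<nu>)"

lemma next_prev:
 assumes "k \<in> {1..sum_list \<nu>}"
 shows "next_label \<nu> k \<in> {1..sum_list \<nu>}" "prev_label k \<in> {1..sum_list \<nu>}"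
  "next_label \<nu> (prev_label k) = k" "prev_label (next_label \<nu> k) = k"
 using assms bij_betwE[OF bij_next_label] bij_betwE[OF bij_betw_inv_into[OF bij_next_label]]
  bij_betw_inv_into_right[OF bij_next_label] bij_betw_inv_into_left[OF bij_next_label]
 unfolding prev_label_def by blast+

definition sides :: "side set" where
 "sides = {1..sum_list \<nu>} \<times> UNIV"

fun join :: "side => side" where
 "join (k, True) = (next_label \<nu> k, False)"
| "join (k, False) = (prev_label k, True)"

lemma mem_sides [simp]: "(k, b) \<in> sides \<longleftrightarrow> k \<in> {1..sum_list \<nu>}"
 by (simp add: sides_def)

lemma finite_sides: "finite sides"
 by (simp add: sides_def)

lemma snd_join [simp]: "snd (join s) \<longleftrightarrow> \<not> snd s"
 by (cases s rule: join.cases) auto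

lemma join_involution: "s \<in> sides ==> join s \<in> sides \<and> join s ~= s \<and> join (join s) = s"
 using next_prev by (cases s rule: join.cases) (auto simp del: atLeastAtMost_iff)

lemma joined_iff: "joined \<nu> s s' \<longleftrightarrow> s \<in> sides \<and> s' = join s"
proof
 assume "joined \<nu> s s'"
 then obtain k where k: "k \<in> {1..sum_list \<nu>}" "{s, s'} = {(k, True), (next_label \<nu> k, False)}"
  unfolding joined_def by blast
 hence "s = (k, True) \<and> s' = (next_label \<nu> k, False) \<or> s' = (k, True) \<and> s = (next_label \<nu> k, False)"
  by (simp add: doubleton_eq_iff) blast
 thus "s \<in> sides \<and> s' = join s" using k(1) next_prev[OF k(1)] by auto
next
 assume s: "s \<in> sides \<and> s' = join s"
 show "joined \<nu> s s'"
 proof (cases s rule: join.cases)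
  case (1 k)
  thus ?thesis using s unfolding joined_def by (intro bexI[of _ k]) auto
 next
  case (2 k)
  thus ?thesis using s next_prev[of k] unfolding joined_def
   by (intro bexI[of _ "prev_label k"]) (auto simp: insert_commute)
 qed
qed

end

section \<open>Boundary cycles and trails of a ribbon pairing\<close>

locale ribbon_pairing = half_edges \<nu> for \<nu> :: "nat list" +
 fixes p tw :: "nat set set"
 assumes ribbon: "(p, tw) \<in> ribbon_pairings \<nu>"
begin

lemma pairs: "partition_on {1..sum_list \<nu>} p" "e \<in> p ==> card e = 2" "tw \<subseteq> p"
 using ribbon by (auto simp: ribbon_pairings_def pair_partitions_def)

definition partner :: "nat => nat" where
 "partner k = (SOME k'. k' ~= k \<and> {k, k'} \<in> p)"

lemma finite_p: "finite p"
 by (rule finite_elements[OF _ pairs(1)]) simp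

lemma partner:
 assumes "k \<in> {1..sum_list \<nu>}"
 shows "partner k ~= k" "{k, partner k} \<in> p" "partner k \<in> {1..sum_list \<nu>}" "partner (partner k) = k"
  and partner_unique: "\<And>k'. k' ~= k ==> {k, k'} \<in> p ==> k' = partner k"
proof -
 have U: "\<Union>p = {1..sum_list \<nu>}" using partition_onD1[OF pairs(1)] by simp
 have dj: "e = e'" if "e \<in> p" "e' \<in> p" "x \<in> e" "x \<in> e'" for e e' x
  using that partition_onD2[OF pairs(1)] unfolding disjoint_def by blast
 have ex: "\<exists>k'. k' ~= k \<and> {k, k'} \<in> p" if k: "k \<in> {1..sum_list \<nu>}" for k
 proof -
  have "k \<in> \<Union>p" using k U by simp
  then obtain e where e: "e \<in> p" "k \<in> e" by (rule UnionE)
  obtain a b where ab: "e = {a, b}" "a ~= b" using pairs(2)[OF e(1)] unfolding card_2_iff by blast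
  show ?thesis
  proof (cases "k = a")
   case True
   thus ?thesis using e ab by (intro exI[of _ b]) simp
  next
   case False
   thus ?thesis using e ab by (intro exI[of _ a]) (simp add: insert_commute)
  qed
 qed
 have 1: "partner k ~= k \<and> {k, partner k} \<in> p" if "k \<in> {1..sum_list \<nu>}" for k
  unfolding partner_def by (rule someI_ex[OF ex[OF that]])
 have uq: "k' = partner k" if "k \<in> {1..sum_list \<nu>}" "k' ~= k" "{k, k'} \<in> p" for k k'
  using dj[OF that(3) conjunct2[OF 1[OF that(1)]], of k] that(2) by (auto simp: doubleton_eq_iff)
 show 2: "partner k ~= k" "{k, partner k} \<in> p" using 1[OF assms] by auto
 show 3: "partner k \<in> {1..sum_list \<nu>}" using 2(2) U by blast
 show "partner (partner k) = k"
  using uq[OF 3, of k] 2 by (simp add: insert_commute)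
 show "\<And>k'. k' ~= k ==> {k, k'} \<in> p ==> k' = partner k" by (rule uq[OF assms])
qed

definition glue :: "side => side" where
 "glue s = (partner (fst s), if {fst s, partner (fst s)} \<in> tw then snd s else \<not> snd s)"

lemma glue_involution: "s \<in> sides ==> glue s \<in> sides \<and> glue s ~= s \<and> glue (glue s) = s"
proof -
 assume s: "s \<in> sides"
 hence k: "fst s \<in> {1..sum_list \<nu>}" by (cases s) simp
 have "{partner (fst s), fst s} = {fst s, partner (fst s)}" by (rule insert_commute)
 thus ?thesis using partner(1,3,4)[OF k] by (cases s) (simp add: glue_def prod_eq_iff)
qed

lemma glued_iff: "s \<in> sides ==> glued (p, tw) s s' \<longleftrightarrow> s' = glue s"
proof -
 assume s: "s \<in> sides"
 have k: "fst s \<in> {1..sum_list \<nu>}" using s by (cases s) auto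
 show ?thesis
 proof
  assume g: "glued (p, tw) s s'"
  hence "fst s' = partner (fst s)" unfolding glued_def by (intro partner_unique[OF k]) auto
  with g show "s' = glue s" unfolding glued_def glue_def by (auto simp: prod_eq_iff split: if_splits)
 next
  assume "s' = glue s"
  with partner(1,2)[OF k] show "glued (p, tw) s s'" unfolding glued_def glue_def by auto
 qed
qed

sublocale two_involutions sides join glue
 by unfold_locales (use finite_sides join_involution glue_involution in auto)

text \<open>On \<open>sides\<close> the relations \<open>joined\<close> and \<open>glued\<close> are
  the graphs of the involutions \<open>join\<close> and \<open>glue\<close>, so only membership in
  \<open>sides\<close> has to be derived from the relational description.\<close>

lemma traversal_iff: "traversal \<nu> (p, tw) ss \<longleftrightarrow> alternating ss"
proof
 assume t: "traversal \<nu> (p, tw) ss"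
 have ne: "ss ~= []" "even (length ss)" "distinct ss" using t by (auto simp: traversal_def)
 have step: "if even i then joined \<nu> (ss ! i) (ss ! (Suc i mod length ss))
  else glued (p, tw) (ss ! i) (ss ! (Suc i mod length ss))" if "i < length ss" for i
  using t that by (simp add: traversal_def Let_def)
 have sub: "ss ! i \<in> sides" if i: "i < length ss" for i
 proof (cases "even i")
  case True
  thus ?thesis using step[OF i] by (simp add: joined_iff)
 next
  case False
  \<comment> \<open>A side at an odd position is the end of the join before it.\<close>
  have "i - 1 < length ss" "even (i - 1)" "Suc (i - 1) mod length ss = i" using i False by (auto elim: oddE)
  thus ?thesis using step[of "i - 1"] join_involution by (simp add: joined_iff)
 qed
 have "ss ! (Suc i mod length ss) = (if even i then join else glue) (ss ! i)" if i: "i < length ss" for i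
  using step[OF i] by (cases "even i") (simp_all add: joined_iff glued_iff[OF sub[OF i]])
 moreover have "set ss \<subseteq> sides" unfolding set_conv_nth using sub by blast
 ultimately show "alternating ss" using ne unfolding alternating_def by blast
next
 assume a: "alternating ss"
 hence "ss ! i \<in> sides" if "i < length ss" for i using that by (auto simp: alternating_def)
 thus "traversal \<nu> (p, tw) ss"
  using a by (auto simp: alternating_def traversal_def Let_def joined_iff glued_iff)
qed

text \<open>One traversal is fixed for each boundary cycle, with arbitrary starting point and
  direction.\<close>

definition cycles :: "side list list" where
 "cycles = (SOME css. (\<forall>ss\<in>set css. alternating ss) \<and> distinct (concat css) \<and> set (concat css) = sides)"

lemma cycles:
 "ss \<in> set cycles ==> alternating ss" "distinct (concat cycles)" "set (concat cycles) = sides"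
proof -
 have "(\<forall>ss\<in>set cycles. alternating ss) \<and> distinct (concat cycles) \<and> set (concat cycles) = sides"
  unfolding cycles_def by (rule someI_ex) (rule alternating_partition, unfold_locales)
 thus "ss \<in> set cycles ==> alternating ss" "distinct (concat cycles)" "set (concat cycles) = sides"
  by auto
qed

lemma cycles_disjoint:
 assumes "ss \<in> set cycles" "ss' \<in> set cycles" "s \<in> set ss" "s \<in> set ss'"
 shows "ss = ss'"
proof (rule ccontr)
 assume ne: "ss ~= ss'"
 obtain i j where ij: "i < length cycles" "cycles ! i = ss" "j < length cycles" "cycles ! j = ss'"
  using assms by (auto simp: in_set_conv_nth)
 thus False
  using cycles(2) ne assms(3,4) by (auto simp: distinct_concat_iff distinct_conv_nth)
   (metis cycles(2) disjoint_iff distinct_concat_iff nth_mem)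
qed

lemma distinct_cycles: "distinct cycles"
proof -
 have "[] \<notin> set cycles" using cycles(1) by (auto simp: alternating_def)
 hence "removeAll [] cycles = cycles" by (simp add: removeAll_id)
 thus ?thesis using cycles(2) by (simp add: distinct_concat_iff)
qed

lemma traversal_cycle:
 assumes "alternating ss'"
 obtains ss k where "ss \<in> set cycles" "even k" "ss' = rotate k ss \<or> ss' = rotate k (rev ss)"
proof -
 have ne: "ss' ~= []" "set ss' \<subseteq> sides" using assms by (auto simp: alternating_def)
 hence "hd ss' \<in> set (concat cycles)" unfolding cycles(3) by auto
 then obtain ss where ss: "ss \<in> set cycles" "hd ss' \<in> set ss" by auto
 thus thesis
  using alternating_same_cycle[OF cycles(1)[OF ss(1)] assms ss(2)] that by blast
qed

lemma card_boundary_cycles: "card (boundary_cycles \<nu> (p, tw)) = length cycles"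
proof -
 have "boundary_cycles \<nu> (p, tw) = set ` set cycles"
 proof
  show "boundary_cycles \<nu> (p, tw) \<subseteq> set ` set cycles"
  proof
   fix x assume "x \<in> boundary_cycles \<nu> (p, tw)"
   then obtain ss' where ss': "alternating ss'" "x = set ss'"
    by (auto simp: boundary_cycles_def traversal_iff)
   obtain ss k where "ss \<in> set cycles" "ss' = rotate k ss \<or> ss' = rotate k (rev ss)"
    using traversal_cycle[OF ss'(1)] by metis
   thus "x \<in> set ` set cycles" using ss'(2) by auto
  qed
  show "set ` set cycles \<subseteq> boundary_cycles \<nu> (p, tw)"
   using cycles(1) by (auto simp: boundary_cycles_def traversal_iff)
 qed
 moreover have "inj_on set (set cycles)"
 proof (rule inj_onI)
  fix ss ss' assume a: "ss \<in> set cycles" "ss' \<in> set cycles" "set ss = set ss'"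
  have "hd ss \<in> set ss" using cycles(1)[OF a(1)] by (simp add: alternating_def)
  thus "ss = ss'" using cycles_disjoint[OF a(1,2)] a(3) by blast
 qed
 ultimately show ?thesis by (simp add: card_image distinct_card[OF distinct_cycles])
qed

lemma flip_even:
 assumes "alternating ss" "i < length ss" "even i"
 shows "snd (ss ! Suc i) ~= snd (ss ! i)"
proof -
 have "Suc i < length ss" using assms by (metis Suc_lessI alternating_def even_Suc)
 thus ?thesis using alternating_next[OF assms(1,2)] assms(3) by simp
qed

lemma trail_class_traversal:
 assumes ss: "alternating ss" and ss': "even k" "ss' = rotate k ss \<or> ss' = rotate k (rev ss)"
 shows "trail_class (trail_word ss') = trail_class (trail_word ss)"
proof -
 have ev: "even (length ss)" using ss by (simp add: alternating_def)
 have "trail_word (rev ss) = rotate 1 (rev (map flip_step (trail_word ss)))"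
  by (rule trail_word_rev[OF ev]) (rule flip_even[OF ss])
 hence "trail_class (trail_word (rev ss)) = trail_class (trail_word ss)"
  by (simp only: trail_class_rotate trail_class_rev)
 thus ?thesis
  using ss' trail_word_rotate[of ss k] trail_word_rotate[of "rev ss" k] ev trail_class_rotate by auto
qed

lemma labels_trail_word:
 assumes "alternating ss"
 shows "\<Union>(step_labels ` set (trail_word ss)) = {k. (k, True) \<in> set ss}"
proof -
 have nx: "ss ! (Suc i mod length ss) = join (ss ! i)" if "i < length ss" "even i" for i
  using alternating_next[OF assms that(1)] that by simp
 have lab: "step_labels (trail_word ss ! i) = (if odd i then {} else if snd (ss ! i) then {fst (ss ! i)} else {fst (join (ss ! i))})"
  if "i < length ss" for i
  using that nx[OF that] by (simp add: nth_trail_word step_labels_def)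
 show ?thesis
 proof
  show "\<Union>(step_labels ` set (trail_word ss)) \<subseteq> {k. (k, True) \<in> set ss}"
  proof
   fix k assume "k \<in> \<Union>(step_labels ` set (trail_word ss))"
   then obtain i where i: "i < length ss" "k \<in> step_labels (trail_word ss ! i)"
    by (auto simp: in_set_conv_nth)
   hence "even i" using lab[OF i(1)] by (auto split: if_splits)
   define s where "s = ss ! i"
   have s: "s \<in> set ss" "join s \<in> set ss"
    using i alternating_closed[OF assms] by (auto simp: s_def)
   show "k \<in> {k. (k, True) \<in> set ss}"
    using i(2) s \<open>even i\<close> unfolding lab[OF i(1)] s_def[symmetric]
    by (cases s rule: join.cases) auto
  qed
  show "{k. (k, True) \<in> set ss} \<subseteq> \<Union>(step_labels ` set (trail_word ss))"
  proof
   fix k assume "k \<in> {k. (k, True) \<in> set ss}"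
   hence k: "(k, True) \<in> set ss" by simp
   then obtain i where i: "i < length ss" "ss ! i = (k, True)" by (auto simp: in_set_conv_nth)
   have "\<exists>j<length ss. k \<in> step_labels (trail_word ss ! j)"
   proof (cases "even i")
    case True
    thus ?thesis using i lab[OF i(1)] by (intro exI[of _ i]) auto
   next
    case False
    hence j: "i - 1 < length ss" "even (i - 1)" "Suc (i - 1) mod length ss = i" using i by (auto elim: oddE)
    have e: "join (ss ! (i - 1)) = (k, True)" using nx[OF j(1,2)] j(3) i by simp
    hence "\<not> snd (ss ! (i - 1))" using snd_join by (metis snd_conv)
    thus ?thesis using lab[OF j(1)] j e by (intro exI[of _ "i - 1"]) auto
   qed
   thus "k \<in> \<Union>(step_labels ` set (trail_word ss))"
    by (metis UN_iff length_trail_word nth_mem)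
  qed
 qed
qed

lemma positive_side: "alternating ss ==> \<exists>k. (k, True) \<in> set ss"
proof -
 assume a: "alternating ss"
 have "hd ss \<in> set ss" using a by (simp add: alternating_def)
 hence "hd ss \<in> set ss \<and> join (hd ss) \<in> set ss" using alternating_closed[OF a] by blast
 thus ?thesis by (cases "hd ss" rule: join.cases) auto
qed

text \<open>Trails form a set, so a product over them is a product over cycles only if distinct
  cycles have distinct trails. A trail determines the half-edges whose positive sides lie on its
  cycle, and every cycle has such a side. \<open>cls\<close> stands for either kind of class,
  oriented or not.\<close>

lemma inj_on_trail_labels:
 assumes f: "\<And>ss. ss \<in> set cycles ==> g ss \<in> trail_class (trail_word ss)"
  and cls: "\<And>w. w \<in> trail_class w \<and> w \<in> cls w \<and> cls w \<subseteq> trail_class w"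
 shows "inj_on (%ss. cls (g ss)) (set cycles)"
proof (rule inj_onI)
 fix ss ss' assume a: "ss \<in> set cycles" "ss' \<in> set cycles" "cls (g ss) = cls (g ss')"
 have "g ss \<in> trail_class (g ss')" using a(3) cls by blast
 hence "\<Union>(step_labels ` set (trail_word ss)) = \<Union>(step_labels ` set (trail_word ss'))"
  using labels_trail_class[OF f[OF a(1)]] labels_trail_class[OF f[OF a(2)]] labels_trail_class[of "g ss" "g ss'"] by simp
 hence e: "{k. (k, True) \<in> set ss} = {k. (k, True) \<in> set ss'}"
  using labels_trail_word cycles(1) a by simp
 obtain k where k: "(k, True) \<in> set ss" using positive_side[OF cycles(1)[OF a(1)]] by blast
 hence "(k, True) \<in> set ss'" using e by blast
 thus "ss = ss'" using cycles_disjoint[OF a(1,2) k] by blast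
qed

lemma prod_trails:
 "(\<Prod>t\<in>trails \<nu> (p, tw). f t) = (\<Prod>ss\<in>set cycles. f (trail_class (trail_word ss)))"
proof -
 have "trails \<nu> (p, tw) = (%ss. trail_class (trail_word ss)) ` set cycles"
 proof
  show "trails \<nu> (p, tw) \<subseteq> (%ss. trail_class (trail_word ss)) ` set cycles"
  proof
   fix t assume "t \<in> trails \<nu> (p, tw)"
   then obtain ss' where ss': "alternating ss'" "t = trail_class (trail_word ss')"
    by (auto simp: trails_def traversal_iff trail_class_def)
   obtain ss k where ss: "ss \<in> set cycles" "even k" "ss' = rotate k ss \<or> ss' = rotate k (rev ss)"
    using traversal_cycle[OF ss'(1)] by metis
   show "t \<in> (%ss. trail_class (trail_word ss)) ` set cycles"
    using trail_class_traversal[OF cycles(1)[OF ss(1)] ss(2,3)] ss(1) ss'(2) by auto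
  qed
  show "(%ss. trail_class (trail_word ss)) ` set cycles \<subseteq> trails \<nu> (p, tw)"
   using cycles(1) by (auto simp: trails_def traversal_iff trail_class_def)
 qed
 moreover have "inj_on (%ss. trail_class (trail_word ss)) (set cycles)"
  by (rule inj_on_trail_labels) auto
 ultimately show ?thesis by (simp add: prod.reindex)
qed

text \<open>Without twists both the joins and the gluings change the sign of a side.\<close>

lemma oriented_signs:
 assumes "tw = {}" "alternating ss" "i < length ss"
 shows "snd (ss ! i) = (if even i then snd (hd ss) else \<not> snd (hd ss))"
 using assms(3)
proof (induction i)
 case 0
 thus ?case by (simp add: hd_conv_nth[symmetric])
next
 case (Suc i)
 have "ss ! Suc i = (if even i then join else glue) (ss ! i)"
  using alternating_next[OF assms(2), of i] Suc.prems by simp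
 moreover have "snd (glue (ss ! i)) \<longleftrightarrow> \<not> snd (ss ! i)" unfolding glue_def using assms(1) by simp
 ultimately have "snd (ss ! Suc i) \<longleftrightarrow> \<not> snd (ss ! i)" by simp
 thus ?case using Suc by simp
qed

definition positive_cycle :: "side list => side list" where
 "positive_cycle ss = (if snd (hd ss) then ss else rev ss)"

text \<open>Signs alternate along the cycle and its length is even, so the first and the last side
  of \<open>ss\<close> have opposite signs; one of the two directions starts at a positive
  side.\<close>

lemma positive_cycle:
 assumes "tw = {}" "alternating ss"
 shows "alternating (positive_cycle ss)" "set (positive_cycle ss) = set ss" "snd (hd (positive_cycle ss))"
proof -
 have n: "ss ~= []" "even (length ss)" using assms(2) by (auto simp: alternating_def)
 define j where "j = length ss - 1"
 have j: "j < length ss" "hd (rev ss) = ss ! j" using n by (auto simp: j_def hd_rev last_conv_nth)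
 have "odd j" using n by (cases "length ss") (simp_all add: j_def)
 with oriented_signs[OF assms j(1)] have "\<not> snd (hd ss) ==> snd (hd (rev ss))" unfolding j(2) by (simp only: if_False simp_thms)
 thus "snd (hd (positive_cycle ss))" by (simp add: positive_cycle_def)
 show "alternating (positive_cycle ss)" "set (positive_cycle ss) = set ss"
  using alternating_rev[OF assms(2)] assms(2) by (simp_all add: positive_cycle_def)
qed

lemma prod_oriented_trails:
 assumes tw: "tw = {}"
 shows "(\<Prod>t\<in>oriented_trails \<nu> (p, tw). f t) = (\<Prod>ss\<in>set cycles. f (cyclic_class (trail_word (positive_cycle ss))))"
proof -
 \<comment> \<open>The joins start at even positions, and the sides there all have the sign of the
   head.\<close>
 have nobwd: "(\<forall>k k'. Bwd k k' \<notin> set (trail_word ss)) \<longleftrightarrow> snd (hd ss)" if "alternating ss" for ss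
 proof -
  have n: "ss ~= []" using that by (simp add: alternating_def)
  have "(\<exists>k k'. Bwd k k' \<in> set (trail_word ss)) \<longleftrightarrow> \<not> snd (hd ss)"
  proof
   assume "\<exists>k k'. Bwd k k' \<in> set (trail_word ss)"
   then obtain k k' i where i: "i < length ss" "trail_word ss ! i = Bwd k k'" by (auto simp: in_set_conv_nth)
   hence "even i" "\<not> snd (ss ! i)" by (auto simp: nth_trail_word split: if_splits)
   thus "\<not> snd (hd ss)" using oriented_signs[OF tw that i(1)] by simp
  next
   assume "\<not> snd (hd ss)"
   hence "trail_word ss ! 0 = Bwd (fst (ss ! 0)) (fst (ss ! (Suc 0 mod length ss)))"
    using n by (simp add: nth_trail_word hd_conv_nth)
   moreover have "trail_word ss ! 0 \<in> set (trail_word ss)" using n by simp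
   ultimately show "\<exists>k k'. Bwd k k' \<in> set (trail_word ss)" by metis
  qed
  thus ?thesis by blast
 qed
 have "oriented_trails \<nu> (p, tw) = (%ss. cyclic_class (trail_word (positive_cycle ss))) ` set cycles"
 proof
  show "oriented_trails \<nu> (p, tw) \<subseteq> (%ss. cyclic_class (trail_word (positive_cycle ss))) ` set cycles"
  proof
   fix t assume "t \<in> oriented_trails \<nu> (p, tw)"
   then obtain ss' where ss': "alternating ss'" "t = cyclic_class (trail_word ss')" "snd (hd ss')"
    using nobwd by (auto simp: oriented_trails_def traversal_iff)
   obtain ss where ss: "ss \<in> set cycles" "hd ss' \<in> set ss"
   proof -
    have "hd ss' \<in> set (concat cycles)" unfolding cycles(3) using ss'(1) by (auto simp: alternating_def)
    thus thesis using that by auto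
   qed
   let ?ss = "positive_cycle ss"
   have a: "alternating ?ss" "set ?ss = set ss" "snd (hd ?ss)"
    using positive_cycle[OF tw cycles(1)[OF ss(1)]] by auto
   obtain i where i: "i < length ?ss" "?ss ! i = hd ss'" using ss(2) a(2) by (metis in_set_conv_nth)
   \<comment> \<open>Sides of equal sign are an even distance apart, so a rotation suffices and the
     orientation is kept.\<close>
   have ev: "even i" using oriented_signs[OF tw a(1) i(1)] i(2) ss'(3) a(3) by (auto split: if_splits)
   have "hd (rotate i ?ss) = hd ss'"
   proof -
    have "hd (rotate i ?ss) = ?ss ! (i mod length ?ss)" using i(1) by (intro hd_rotate_conv_nth) auto
    thus ?thesis using i by (simp only: mod_less)
   qed
   hence e: "rotate i ?ss = ss'" using alternating_unique[OF alternating_rotate[OF a(1) ev] ss'(1)] by simp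
   have l: "even (length ?ss)" using a(1) by (simp add: alternating_def)
   have "t = cyclic_class (trail_word ?ss)"
    unfolding ss'(2) e[symmetric] trail_word_rotate[OF l ev] by (rule cyclic_class_rotate)
   thus "t \<in> (%ss. cyclic_class (trail_word (positive_cycle ss))) ` set cycles" using ss(1) by blast
  qed
  show "(%ss. cyclic_class (trail_word (positive_cycle ss))) ` set cycles \<subseteq> oriented_trails \<nu> (p, tw)"
  proof (rule image_subsetI)
   fix ss assume "ss \<in> set cycles"
   note a = positive_cycle[OF tw cycles(1)[OF this]]
   show "cyclic_class (trail_word (positive_cycle ss)) \<in> oriented_trails \<nu> (p, tw)"
    unfolding oriented_trails_def traversal_iff using nobwd[OF a(1)] a(1,3) by blast
  qed
 qed
 moreover have "inj_on (%ss. cyclic_class (trail_word (positive_cycle ss))) (set cycles)"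
 proof (rule inj_on_trail_labels)
  fix ss assume ss: "ss \<in> set cycles"
  show "trail_word (positive_cycle ss) \<in> trail_class (trail_word ss)"
  proof -
   have "trail_class (trail_word (positive_cycle ss)) = trail_class (trail_word ss)"
   proof (rule trail_class_traversal[OF cycles(1)[OF ss], of 0])
    show "positive_cycle ss = rotate 0 ss \<or> positive_cycle ss = rotate 0 (rev ss)"
     unfolding positive_cycle_def by simp
   qed simp
   thus ?thesis using mem_trail_class[of "trail_word (positive_cycle ss)"] by simp
  qed
 qed (auto simp: trail_class_def)
 ultimately show ?thesis by (simp add: prod.reindex)
qed

end

section \<open>Pairs of a matching in increasing order and in a list\<close>

lemma card_2_Min_Max:
 fixes e :: "'a::linorder set"
 assumes "card e = 2"
 shows "e = {Min e, Max e}" "Min e < Max e"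
proof -
 obtain x y where e: "e = {x, y}" "x ~= y" using assms unfolding card_2_iff by blast
 have "e = {Min e, Max e} \<and> Min e < Max e"
 proof (cases "x < y")
  case True
  hence "min x y = x" "max x y = y" by auto
  thus ?thesis unfolding e(1) using True by simp
 next
  case False
  hence "y < x" using e(2) by simp
  moreover from this have "min x y = y" "max x y = x" by auto
  ultimately show ?thesis unfolding e(1) by (simp add: insert_commute)
 qed
 thus "e = {Min e, Max e}" "Min e < Max e" by blast+
qed

lemma pair_list: "finite p ==> distinct (pair_list p)" "finite p ==> set (pair_list p) = p"
proof -
 assume "finite p"
 hence "\<exists>es. distinct es \<and> set es = p" using finite_distinct_list by blast
 hence "distinct (pair_list p) \<and> set (pair_list p) = p" unfolding pair_list_def by (rule someI_ex)
 thus "distinct (pair_list p)" "set (pair_list p) = p" by auto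
qed

lemma card_perfect_matching:
 assumes "finite S" "p \<in> perfect_matchings S"
 shows "2 * card p = card S"
proof -
 have p: "partition_on S p" "\<And>e. e \<in> p ==> card e = 2" using assms(2) by (auto simp: perfect_matchings_def)
 have "card S = card (\<Union>p)" using partition_onD1[OF p(1)] by simp
 also have "\<dots> = (\<Sum>e\<in>p. card e)"
  using partition_onD2[OF p(1)] p(2) by (intro card_Union_disjoint) (auto intro: card_ge_0_finite)
 also have "\<dots> = 2 * card p" using p(2) by simp
 finally show ?thesis by simp
qed

definition pair_of :: "nat set => nat \<times> nat" where
 "pair_of e = (Min e, Max e)"

lemma rotate_concat_pairs:
 "map \<sigma> (k # L) = L @ [x] ==>
  concat (map (%k. [f k, X (\<sigma> k)]) (k # L)) = f k # concat (map (%k. [X k, f k]) L) @ [X x]"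
 by (induction L arbitrary: k) auto

text \<open>The boundary cycle of a vertex starts with a vertex matrix, its vertex product with a
  field value; around a block that \<open>\<sigma>\<close> permutes cyclically the two words differ
  by one rotation.\<close>

lemma rotate1_concat_pairs:
 assumes "map \<sigma> ks = rotate1 ks"
 shows "concat (map (%k. [f k, X (\<sigma> k)]) ks) = rotate 1 (concat (map (%k. [X k, f k]) ks))"
proof (cases ks)
 case (Cons k L)
 hence "map \<sigma> (k # L) = L @ [k]" using assms by simp
 from rotate_concat_pairs[OF this, of f X] show ?thesis unfolding Cons by simp
qed simp

section \<open>Vertices and ribbons as gluing values\<close>

context gluing begin

text \<open>It makes the choice of a word by \<open>SOME\<close> in \<open>trail_product\<close>
  harmless: \<open>z\<close> sees neither rotations nor reversals, provided that flipping a step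
  applies \<open>st\<close> to its factor.\<close>

lemma z_list_mul_trail_class:
 assumes w': "w' \<in> trail_class w" and w: "w ~= []" and f: "\<And>s. s \<in> set w ==> f (flip_step s) = st (f s)"
 shows "z (list_mul (map f w')) = z (list_mul (map f w))"
proof -
 have rot: "z (list_mul (map f (rotate k v))) = z (list_mul (map f v))" for k v
  unfolding rotate_map[symmetric] by (rule z_list_mul_rotate)
 have "map f (rev (map flip_step w)) = rev (map st (map f w))"
  unfolding rev_map[symmetric] map_map by (intro arg_cong[where f=rev] map_cong refl) (simp add: f)
 hence fl: "z (list_mul (map f (rev (map flip_step w)))) = z (list_mul (map f w))"
  using list_mul_rev[of "map f w"] w by simp
 from w' consider k where "w' = rotate k w" | k where "w' = rotate k (rev (map flip_step w))"
  unfolding trail_class_def cyclic_class_def by blast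
 thus ?thesis
 proof cases
  case 1
  thus ?thesis by (simp only: rot)
 next
  case 2
  thus ?thesis by (simp only: rot fl)
 qed
qed

definition side_value :: "nat list => (nat => nat => 'm) => side => 'm" where
 "side_value \<nu> a s = (if snd s then a (fst s) (next_label \<nu> (fst s))
  else st (a (half_edges.prev_label \<nu> (fst s)) (fst s)))"

lemma joining_sides:
 assumes "half_edges \<nu>"
 shows "joining (half_edges.sides \<nu>) (half_edges.join \<nu>) (side_value \<nu> a)"
proof -
 interpret half_edges \<nu> by fact
 have "side_value \<nu> a (join s) = st (side_value \<nu> a s)" if s: "s \<in> sides" for s
 proof (cases s rule: join.cases)
  case (1 k)
  thus ?thesis using s next_prev(4)[of k] by (simp add: side_value_def)
 next
  case (2 k)
  thus ?thesis using s next_prev(3)[of k] by (simp add: side_value_def)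
 qed
 thus ?thesis unfolding joining_def using join_involution by simp
qed

text \<open>If every half-edge is glued to itself, the boundary cycles are the vertices: a gluing
  changes the sign of a side, and a join moves on to the neighbouring half-edge. The cycle
  \<open>cy l\<close> of each vertex is written down explicitly and read off.\<close>

lemma gluing_value_vertices:
 assumes he: "half_edges \<nu>" and gs: "glues (half_edges.sides \<nu>) (self_glues X ps)"
 shows "gluing_value (self_glues X ps) (half_edges.join \<nu>) (side_value \<nu> a)
  = (\<Prod>l=1..length \<nu>. z (list_mul (concat (map (%k. [X k, a k (next_label \<nu> k)])
    [psum \<nu> (l - 1) + 1..<psum \<nu> l + 1]))))"
proof -
 interpret half_edges \<nu> by fact
 define g where "g = (%s :: side. (fst s, \<not> snd s))"
 define H where "H = (%s :: side. if snd s then st (X (fst s)) else X (fst s))"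
 define ks where "ks = (%l. [psum \<nu> l + 1..<psum \<nu> (Suc l) + 1])"
 define us where "us = (%l. map (%k. (k, True)) (ks l))"
 define cy where "cy = (%l. concat (map (%v. [v, join v]) (us l)))"
 define css where "css = map cy [0..<length \<nu>]"
 have inv: "two_involutions sides join g"
 proof
  show "finite sides" by (rule finite_sides)
  show "join s \<in> sides \<and> join s ~= s \<and> join (join s) = s" if "s \<in> sides" for s by (rule join_involution[OF that])
  show "g s \<in> sides \<and> g s ~= s \<and> g (g s) = s" if "s \<in> sides" for s using that by (cases s) (simp add: g_def)
 qed
 have lk: "length (ks l) = \<nu> ! l" "\<And>i. i < \<nu> ! l ==> ks l ! i = psum \<nu> l + 1 + i" if "l < length \<nu>" for l
  using psum_Suc[OF that] by (simp_all add: ks_def del: upt_Suc)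
 have lc: "length (cy l) = 2 * length (ks l)" for l
 proof -
  have "length (concat (map (%v. [v, join v]) vs)) = 2 * length vs" for vs by (induction vs) auto
  from this[of "us l"] show ?thesis unfolding cy_def by (simp only: us_def length_map)
 qed
 have cn: "cy l ! (2 * i) = (ks l ! i, True)" "cy l ! (Suc (2 * i)) = join (ks l ! i, True)" if "i < length (ks l)" for l i
 proof -
  have "concat (map (%v. [v, join v]) vs) ! (2 * i) = vs ! i \<and> concat (map (%v. [v, join v]) vs) ! (Suc (2 * i)) = join (vs ! i)"
   if "i < length vs" for vs i
   using that by (induction vs arbitrary: i) (auto simp: nth_Cons split: nat.split)
  from this[of i "us l"] show "cy l ! (2 * i) = (ks l ! i, True)" "cy l ! (Suc (2 * i)) = join (ks l ! i, True)"
   using that by (simp_all add: cy_def us_def)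
 qed
 have sub: "set (cy l) \<subseteq> sides" if l: "l < length \<nu>" for l
 proof -
  have "(k, True) \<in> sides" if "k \<in> set (ks l)" for k
  proof -
   obtain i where "i < \<nu> ! l" "k = psum \<nu> l + 1 + i" using \<open>k \<in> set (ks l)\<close> lk[OF l] by (metis in_set_conv_nth)
   thus ?thesis using block_range[OF l] by simp
  qed
  thus ?thesis using join_involution by (auto simp: cy_def us_def simp del: join.simps mem_sides)
 qed
 have cover: "set (concat css) = sides"
 proof
  show "set (concat css) \<subseteq> sides"
  proof
   fix s assume "s \<in> set (concat css)"
   then obtain l where "l < length \<nu>" "s \<in> set (cy l)" unfolding css_def by auto
   thus "s \<in> sides" using sub by blast
  qed
  have kin: "k \<in> \<Union> (set ` (ks ` {..<length \<nu>}))" if kN: "k \<in> {1..sum_list \<nu>}" for k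
  proof -
   obtain l i where li: "l < length \<nu>" "i < \<nu> ! l" "k = psum \<nu> l + 1 + i" by (rule label_cases[OF kN])
   hence "k = ks l ! i" "i < length (ks l)" using lk[OF li(1)] by auto
   thus ?thesis using li(1) nth_mem by blast
  qed
  show "sides \<subseteq> set (concat css)"
  proof
   fix s assume s: "s \<in> sides"
   define k where "k = (if snd s then fst s else prev_label (fst s))"
   have k: "k \<in> {1..sum_list \<nu>}" "s = (k, True) \<or> s = join (k, True)"
    using s next_prev[of "fst s"] unfolding k_def by (cases s; cases "snd s"; auto)+
   obtain l where "l < length \<nu>" "k \<in> set (ks l)" using kin[OF k(1)] by blast
   thus "s \<in> set (concat css)" using k(2) unfolding css_def cy_def us_def by fastforce
  qed
 qed
 \<comment> \<open>The lists cover all sides, so the right total length forces distinctness.\<close>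
 have "length (concat css) = card sides"
 proof -
  have "length (concat css) = sum_list (map (%l. 2 * \<nu> ! l) [0..<length \<nu>])"
   unfolding css_def length_concat map_map by (intro arg_cong[where f=sum_list] map_cong refl) (simp add: lc lk)
  also have "\<dots> = 2 * sum_list (map ((!) \<nu>) [0..<length \<nu>])" by (simp add: sum_list_const_mult)
  also have "\<dots> = card sides" unfolding map_nth by (simp add: sides_def card_cartesian_product)
  finally show ?thesis .
 qed
 hence dist: "distinct (concat css)" using cover by (intro card_distinct) simp
 have alt: "two_involutions.alternating sides join g ss" if ssc: "ss \<in> set css" for ss
 proof -
  obtain l where l: "l < length \<nu>" "ss = cy l" using ssc by (auto simp: css_def)
  have n: "0 < \<nu> ! l" using l pos by simp
  have "distinct ss" using dist ssc by (metis distinct_concat_iff)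
  moreover have "cy l ! (Suc i mod length (cy l)) = (if even i then join else g) (cy l ! i)" if i: "i < length (cy l)" for i
  proof (cases "even i")
   case True
   then obtain j where j: "i = 2 * j" by (elim evenE)
   hence "j < length (ks l)" using i lc by simp
   thus ?thesis using cn[of j l] j lc[of l] by simp
  next
   case False
   then obtain j where j: "i = Suc (2 * j)" by (elim oddE) simp
   hence jl: "j < \<nu> ! l" using i lc lk(1)[OF l(1)] by simp
   define j' where "j' = Suc j mod (\<nu> ! l)"
   have j': "j' < \<nu> ! l" using n by (simp add: j'_def)
   have "Suc i mod length (cy l) = 2 * j'"
    unfolding j lc lk(1)[OF l(1)] j'_def by (simp add: mult_mod_right)
   hence "cy l ! (Suc i mod length (cy l)) = (psum \<nu> l + 1 + j', True)"
    using cn(1)[of j' l] lk[OF l(1)] j' by simp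
   moreover have "cy l ! i = (psum \<nu> l + 1 + j', False)"
    using cn(2)[of j l] lk[OF l(1)] jl next_label_block[OF l(1) jl] j unfolding j'_def by simp
   ultimately show ?thesis using False by (simp add: g_def)
  qed
  moreover have "ss ~= []" "even (length ss)" using lc[of l] lk(1)[OF l(1)] n l(2) by auto
  ultimately show ?thesis unfolding two_involutions.alternating_def[OF inv] using sub[OF l(1)] l(2) by blast
 qed
 have "gluing_value (self_glues X ps) join (side_value \<nu> a) = (\<Prod>ss\<in>set css. z (cycle_word (side_value \<nu> a) H ss))"
 proof (rule gluing_value_cycles[OF inv joining_sides[OF he] _ gs _ alt dist cover])
  show "H (g s) = st (H s)" for s by (simp add: H_def g_def)
  show "compatible g H (self_glues X ps)" by (auto simp: compatible_def self_glues_def g_def H_def)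
 qed
 also have "\<dots> = (\<Prod>l<length \<nu>. z (cycle_word (side_value \<nu> a) H (cy l)))"
 proof -
  have "[] \<notin> set css" using alt two_involutions.alternating_def[OF inv] by blast
  hence "removeAll [] css = css" by (simp add: removeAll_id)
  hence "distinct css" using dist by (simp add: distinct_concat_iff)
  hence "(\<Prod>ss\<in>set css. z (cycle_word (side_value \<nu> a) H ss)) = prod_list (map (%l. z (cycle_word (side_value \<nu> a) H (cy l))) [0..<length \<nu>])"
   by (subst prod.distinct_set_conv_list) (simp_all add: css_def comp_def)
  also have "\<dots> = (\<Prod>l\<in>set [0..<length \<nu>]. z (cycle_word (side_value \<nu> a) H (cy l)))"
   by (rule prod.distinct_set_conv_list[symmetric]) simp
  finally show ?thesis by (simp add: atLeast0LessThan)
 qed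
 also have "\<dots> = (\<Prod>l<length \<nu>. z (list_mul (concat (map (%k. [X k, a k (next_label \<nu> k)]) (ks l)))))"
 proof (rule prod.cong[OF refl])
  fix l assume "l \<in> {..<length \<nu>}"
  hence l: "l < length \<nu>" by simp
  have m: "map (next_label \<nu>) (ks l) = rotate1 (ks l)"
  proof (rule nth_equalityI)
   fix i assume "i < length (map (next_label \<nu>) (ks l))"
   hence i: "i < \<nu> ! l" using lk[OF l] by simp
   hence "Suc i mod (\<nu> ! l) < \<nu> ! l" by simp
   thus "map (next_label \<nu>) (ks l) ! i = rotate1 (ks l) ! i"
    using lk[OF l] i next_label_block[OF l i] by (simp add: nth_rotate1)
  qed simp
  have "cycle_word (side_value \<nu> a) H (cy l) = list_mul (concat (map (%k. [a k (next_label \<nu> k), X (next_label \<nu> k)]) (ks l)))"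
   unfolding cy_def cycle_word_pairs by (simp add: us_def comp_def side_value_def H_def)
  also have "\<dots> = list_mul (rotate 1 (concat (map (%k. [X k, a k (next_label \<nu> k)]) (ks l))))"
   unfolding rotate1_concat_pairs[OF m, of "%k. a k (next_label \<nu> k)" X] ..
  finally show "z (cycle_word (side_value \<nu> a) H (cy l)) = z (list_mul (concat (map (%k. [X k, a k (next_label \<nu> k)]) (ks l))))"
   by (simp only: z_list_mul_rotate)
 qed
 finally show ?thesis by (simp add: prod.atLeast1_atMost_eq ks_def del: upt_Suc)
qed

text \<open>The word read when the ribbon is crossed from side \<open>s\<close>. For a straight
  pair, \<open>h\<close> and \<open>h'\<close> start at the negative side of the smaller and of the
  larger half-edge; for a twisted pair, \<open>t\<close> and \<open>t'\<close> start at the negative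
  and at the positive side of the smaller one. The opposite crossings carry
  \<open>st\<close>.\<close>

definition side_glue :: "nat set set => nat set set => (nat set => 'm) => (nat set => 'm) =>
  (nat set => 'm) => (nat set => 'm) => side => 'm" where
 "side_glue p tw h h' t t' s = (let k = fst s; k' = ribbon_pairing.partner p k; e = {k, k'} in
  if e \<in> tw then (if k < k' then (if snd s then t' e else t e) else st (if snd s then t' e else t e))
  else if k < k' then (if snd s then st (h' e) else h e) else (if snd s then st (h e) else h' e))"

abbreviation matching_glues where
 "matching_glues p tw h h' t t' \<equiv>
  ribbon_glues (%q. (h {fst q, snd q}, h' {fst q, snd q})) (%q. (t {fst q, snd q}, t' {fst q, snd q}))
   (pair_of ` tw) (map pair_of (pair_list p))"

text \<open>Each pair lists four sides; they cover \<open>sides\<close>, and their total number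
  equals its cardinality, so no side is listed twice.\<close>

lemma glues_matching:
 assumes "half_edges \<nu>" "p \<in> perfect_matchings {1..sum_list \<nu>}"
 shows "glues (half_edges.sides \<nu>) (self_glues X (map pair_of (pair_list p)))"
proof -
 interpret half_edges \<nu> by fact
 have p: "partition_on {1..sum_list \<nu>} p" "\<And>e. e \<in> p ==> card e = 2" using assms(2) by (auto simp: perfect_matchings_def)
 have fin: "finite p" using finite_elements[OF _ p(1)] by simp
 define gl where "gl = (%es. glue_sides (self_glues X (map pair_of es)))"
 have s: "set (gl es) = (\<Union>e\<in>set es. {Min e, Max e} \<times> UNIV)" "length (gl es) = 4 * length es" for es
 proof -
  have U: "{(k, False), (k, True), (k', False), (k', True)} = {k, k'} \<times> UNIV" for k k' :: nat by (auto simp: UNIV_bool)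
  have c: "gl (e # es) = [(Min e, False), (Min e, True), (Max e, False), (Max e, True)] @ gl es" for e es
   by (simp add: gl_def self_glues_def pair_of_def)
  have n: "gl [] = []" by (simp add: gl_def self_glues_def)
  show "set (gl es) = (\<Union>e\<in>set es. {Min e, Max e} \<times> UNIV)"
   by (induction es) (simp_all add: n c U[symmetric])
  show "length (gl es) = 4 * length es" by (induction es) (simp_all add: n c)
 qed
 have "set (gl (pair_list p)) = (\<Union>e\<in>p. e \<times> UNIV)"
  unfolding s(1) pair_list(2)[OF fin] using card_2_Min_Max(1)[OF p(2)] by (intro SUP_cong refl) simp
 also have "\<dots> = \<Union>p \<times> UNIV" by blast
 finally have st: "set (gl (pair_list p)) = sides" unfolding sides_def using partition_onD1[OF p(1)] by simp
 have "length (pair_list p) = card p" using pair_list[OF fin] distinct_card by metis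
 hence "length (gl (pair_list p)) = card sides"
  using card_perfect_matching[OF _ assms(2)] s(2)[of "pair_list p"] by (simp add: sides_def card_cartesian_product)
 hence "distinct (gl (pair_list p))" unfolding st[symmetric] by (intro card_distinct) simp
 thus ?thesis unfolding glues_def using st by (simp add: gl_def)
qed

text \<open>The list contains each gluing in one orientation; \<open>side_glue\<close> extends its
  labels to all sides, which makes the list compatible with the involution
  \<open>glue\<close>.\<close>

lemma ribbon_value:
 assumes rb: "ribbon_pairing \<nu> p tw"
  and css: "\<And>ss. ss \<in> set css ==> two_involutions.alternating (half_edges.sides \<nu>) (half_edges.join \<nu>) (ribbon_pairing.glue p tw) ss"
   "distinct (concat css)" "set (concat css) = half_edges.sides \<nu>"
 shows "gluing_value (matching_glues p tw h h' t t') (half_edges.join \<nu>) (side_value \<nu> a)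
  = (\<Prod>ss\<in>set css. z (cycle_word (side_value \<nu> a) (side_glue p tw h h' t t') ss))"
proof -
 interpret R: ribbon_pairing \<nu> p tw by fact
 have pm: "p \<in> perfect_matchings {1..sum_list \<nu>}" using R.ribbon by (auto simp: ribbon_pairings_def pair_partitions_def perfect_matchings_def)
 have he: "half_edges \<nu>" by unfold_locales
 have inv: "two_involutions R.sides R.join R.glue" by unfold_locales
 show ?thesis
 proof (rule gluing_value_cycles[OF inv joining_sides[OF he] _ _ _ css])
  fix s assume s: "s \<in> R.sides"
  obtain k b where kb: "s = (k, b)" by (cases s)
  have k: "k \<in> {1..sum_list \<nu>}" using s kb by simp
  define k' where "k' = R.partner k"
  have k': "R.partner k = k'" "R.partner k' = k" "k' ~= k" unfolding k'_def by (rule refl, rule R.partner(4)[OF k], rule R.partner(1)[OF k])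
  have c: "{k', k} = {k, k'}" by (rule insert_commute)
  show "side_glue p tw h h' t t' (R.glue s) = st (side_glue p tw h h' t t' s)"
  proof (cases "k < k'")
   case True
   hence "\<not> k' < k" by simp
   with True show ?thesis unfolding kb R.glue_def side_glue_def Let_def fst_conv snd_conv k' c by simp
  next
   case False
   hence "k' < k" using k'(3) by simp
   with False show ?thesis unfolding kb R.glue_def side_glue_def Let_def fst_conv snd_conv k' c by simp
  qed
 next
  show "glues R.sides (matching_glues p tw h h' t t')"
  proof -
   have "glues R.sides ([] @ matching_glues p tw h h' t t' @ [])"
    unfolding glues_ribbon_iff[where X=undefined] using glues_matching[OF he pm] by simp
   thus ?thesis by simp
  qed
  have "b = R.glue a \<and> Y = side_glue p tw h h' t t' a \<and> R.glue b = a \<and> side_glue p tw h h' t t' b = st Y"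
   if abY: "(a, b, Y) \<in> set (matching_glues p tw h h' t t')" for a b Y
  proof -
   obtain e where e: "e \<in> p" and Y: "(a, b, Y) \<in> set (if pair_of e \<in> pair_of ` tw
    then [((Min e, False), (Max e, False), t {Min e, Max e}), ((Min e, True), (Max e, True), t' {Min e, Max e})]
    else [((Min e, False), (Max e, True), h {Min e, Max e}), ((Max e, False), (Min e, True), h' {Min e, Max e})])"
    using abY pair_list(2)[OF R.finite_p] unfolding ribbon_glues_def pair_of_def[abs_def] by auto
   define k k' where "k = Min e" and "k' = Max e"
   have ee: "e = {k, k'}" "k < k'" unfolding k_def k'_def by (rule card_2_Min_Max[OF R.pairs(2)[OF e]])+
   have c: "{k', k} = e" unfolding ee(1) by (rule insert_commute)
   have tw: "pair_of e \<in> pair_of ` tw \<longleftrightarrow> e \<in> tw"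
   proof
    assume "pair_of e \<in> pair_of ` tw"
    then obtain e' where e': "e' \<in> tw" "pair_of e = pair_of e'" by blast
    hence "e' = e" using card_2_Min_Max(1)[OF R.pairs(2)[OF e]] card_2_Min_Max(1)[OF R.pairs(2), of e'] R.pairs(3)
     by (auto simp: pair_of_def)
    thus "e \<in> tw" using e'(1) by simp
   qed simp
   have kin: "k \<in> {1..sum_list \<nu>}" using e ee(1) partition_onD1[OF R.pairs(1)] by blast
   have pk: "R.partner k = k'" using R.partner_unique[OF kin, of k'] e ee by simp
   hence pk': "R.partner k' = k" using R.partner(4)[OF kin] by simp
   have nk: "\<not> k' < k" using ee(2) by simp
   have kk: "{k, k'} = e" by (rule ee(1)[symmetric])
   have G: "R.glue (k, i) = (k', if e \<in> tw then i else \<not> i)" "R.glue (k', i) = (k, if e \<in> tw then i else \<not> i)" for i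
    unfolding R.glue_def fst_conv snd_conv pk pk' kk c by (rule refl)+
   have H: "side_glue p tw h h' t t' (k, i) = (if e \<in> tw then (if i then t' e else t e) else if i then st (h' e) else h e)"
    "side_glue p tw h h' t t' (k', i) = (if e \<in> tw then st (if i then t' e else t e) else if i then st (h e) else h' e)" for i
    unfolding side_glue_def Let_def fst_conv snd_conv pk pk' kk c using ee(2) nk by simp_all
   show ?thesis
    using Y unfolding tw k_def[symmetric] k'_def[symmetric] kk
    by (cases "e \<in> tw") (auto simp: G H)
  qed
  thus "compatible R.glue (side_glue p tw h h' t t') (matching_glues p tw h h' t t')"
   unfolding compatible_def by blast
 qed
qed

text \<open>The vertex products are read as the value of the pattern in which every half-edge is
  glued to itself, contracted pair by pair, and the ordered pairs are translated back into
  two-element sets.\<close>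

theorem matching_contraction:
 assumes he: "half_edges \<nu>" and pm: "p \<in> perfect_matchings {1..sum_list \<nu>}"
  and cr: "\<And>e. e \<in> p ==> contraction_rule I X w (\<kappa> e) (h e) (h' e) (t e) (t' e)"
 shows "(\<Sum>b\<in>PiE {1..sum_list \<nu>} (%_. I). (\<Prod>e\<in>p. \<kappa> e (b (Min e)) (b (Max e))) *
   (\<Prod>l=1..length \<nu>. z (list_mul (concat (map (%k. [X (b k), a k (next_label \<nu> k)])
    [psum \<nu> (l - 1) + 1..<psum \<nu> l + 1])))))
  = w ^ card p * (\<Sum>tw\<in>Pow p. gluing_value (matching_glues p tw h h' t t') (half_edges.join \<nu>) (side_value \<nu> a))"
proof -
 interpret half_edges \<nu> by fact
 have p: "partition_on {1..sum_list \<nu>} p" "\<And>e. e \<in> p ==> card e = 2" using pm by (auto simp: perfect_matchings_def)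
 have fin: "finite p" using finite_elements[OF _ p(1)] by simp
 define ps where "ps = map pair_of (pair_list p)"
 have ps: "set ps = pair_of ` p" by (simp add: ps_def pair_list(2)[OF fin])
 have len: "length ps = card p" using pair_list[OF fin] distinct_card unfolding ps_def by (metis length_map)
 have e2: "{fst (pair_of e), snd (pair_of e)} = e" if "e \<in> p" for e
  using card_2_Min_Max(1)[OF p(2)[OF that]] by (simp add: pair_of_def)
 have inj: "inj_on pair_of p" by (rule inj_onI) (metis e2)
 have "fst ` set ps \<union> snd ` set ps = (\<Union>e\<in>p. {fst (pair_of e), snd (pair_of e)})" unfolding ps by blast
 also have "\<dots> = \<Union>p" using e2 by simp
 finally have lab: "fst ` set ps \<union> snd ` set ps = {1..sum_list \<nu>}" using partition_onD1[OF p(1)] by simp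
 note gm = glues_matching[OF he pm, folded ps_def]
 have "(\<Sum>b\<in>PiE (fst ` set ps \<union> snd ` set ps) (%_. I).
   (\<Prod>q\<in>set ps. \<kappa> {fst q, snd q} (b (fst q)) (b (snd q))) * gluing_value ([] @ self_glues (%k. X (b k)) ps) join (side_value \<nu> a))
  = w ^ length ps * (\<Sum>tw\<in>Pow (set ps). gluing_value ([] @ ribbon_glues (%q. (h {fst q, snd q}, h' {fst q, snd q})) (%q. (t {fst q, snd q}, t' {fst q, snd q})) tw ps) join (side_value \<nu> a))"
 proof (rule gluing_contraction[OF joining_sides[OF he]])
  show "glues sides ([] @ self_glues (%_. undefined) ps)" using gm by simp
  fix q assume "q \<in> set ps"
  then obtain e where e: "e \<in> p" "q = pair_of e" using ps by blast
  hence ee: "{fst q, snd q} = e" using e2 by simp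
  show "contraction_rule I X w (\<kappa> {fst q, snd q}) (fst (h {fst q, snd q}, h' {fst q, snd q})) (snd (h {fst q, snd q}, h' {fst q, snd q}))
    (fst (t {fst q, snd q}, t' {fst q, snd q})) (snd (t {fst q, snd q}, t' {fst q, snd q}))"
   unfolding ee fst_conv snd_conv by (rule cr[OF e(1)])
 qed
 moreover have "(\<Prod>q\<in>set ps. \<kappa> {fst q, snd q} (b (fst q)) (b (snd q))) = (\<Prod>e\<in>p. \<kappa> e (b (Min e)) (b (Max e)))" for b
  unfolding ps prod.reindex[OF inj] comp_def
  by (rule prod.cong[OF refl]) (simp add: e2, simp add: pair_of_def)
 moreover have "(\<Sum>tw\<in>Pow (set ps). f tw) = (\<Sum>tw\<in>Pow p. f (pair_of ` tw))" for f :: "_ => 'c"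
 proof -
  have "Pow (set ps) = (`) pair_of ` Pow p" unfolding ps by (rule image_Pow_surj[OF refl, symmetric])
  thus ?thesis by (simp add: sum.reindex[OF inj_on_image_Pow[OF inj]])
 qed
 moreover have "gluing_value (self_glues (%k. X (b k)) ps) join (side_value \<nu> a)
  = (\<Prod>l=1..length \<nu>. z (list_mul (concat (map (%k. [X (b k), a k (next_label \<nu> k)]) [psum \<nu> (l - 1) + 1..<psum \<nu> l + 1]))))" for b
  by (rule gluing_value_vertices[OF he gm])
 ultimately show ?thesis unfolding lab len append_Nil by (simp only: ps_def)
qed

text \<open>For \<open>h' = st h\<close> and \<open>t = t' = h\<close> the word across a ribbon,
  straight or twisted, depends only on whether it is crossed from the smaller or from the larger
  label. This is the rule for \<open>Glue\<close> steps.\<close>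

lemma trail_value:
 assumes rb: "ribbon_pairing \<nu> p tw"
  and ss: "two_involutions.alternating (half_edges.sides \<nu>) (half_edges.join \<nu>) (ribbon_pairing.glue p tw) ss"
  and w': "w' \<in> trail_class (trail_word ss)"
  and f: "\<And>k k'. f (Fwd k k') = a k k'" "\<And>k k'. f (Bwd k k') = st (a k' k)"
   "\<And>k k'. f (Glue k k') = (if k < k' then h {k, k'} else st (h {k, k'}))"
 shows "z (list_mul (map f w')) = z (cycle_word (side_value \<nu> a) (side_glue p tw h (%e. st (h e)) h h) ss)"
proof -
 interpret R: ribbon_pairing \<nu> p tw by fact
 have n: "ss ~= []" "set ss \<subseteq> R.sides" using ss by (auto simp: R.alternating_def)
 have step: "trail_word ss ! i = (if odd i then Glue (fst (ss ! i)) (R.partner (fst (ss ! i)))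
   else if snd (ss ! i) then Fwd (fst (ss ! i)) (next_label \<nu> (fst (ss ! i))) else Bwd (fst (ss ! i)) (R.prev_label (fst (ss ! i))))"
  if "i < length ss" for i
 proof -
  have "fst (R.join s) = (if snd s then next_label \<nu> (fst s) else R.prev_label (fst s))" for s by (cases s rule: R.join.cases) auto
  moreover have "fst (R.glue s) = R.partner (fst s)" for s by (simp add: R.glue_def)
  ultimately show ?thesis using R.alternating_next[OF ss that] that by (simp add: nth_trail_word)
 qed
 have k: "fst (ss ! i) \<in> {1..sum_list \<nu>}" if "i < length ss" for i
  using n(2) nth_mem[OF that] by (cases "ss ! i") auto
 have "z (list_mul (map f w')) = z (list_mul (map f (trail_word ss)))"
 proof (rule z_list_mul_trail_class[OF w'])
  show "trail_word ss ~= []" using n(1) by (metis length_0_conv length_trail_word)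
  fix s assume "s \<in> set (trail_word ss)"
  then obtain i where i: "i < length ss" "s = trail_word ss ! i" by (metis in_set_conv_nth length_trail_word)
  show "f (flip_step s) = st (f s)"
  proof (cases s)
   case (Glue x y)
   hence "x \<in> {1..sum_list \<nu>}" "y = R.partner x" using step[OF i(1)] i(2) k[OF i(1)] by (auto split: if_splits)
   hence "x ~= y" using R.partner(1)[of x] by simp
   moreover have "{y, x} = {x, y}" by (rule insert_commute)
   ultimately show ?thesis using Glue by (cases "x < y") (simp_all add: f)
  qed (simp_all add: f)
 qed
 also have "map f (trail_word ss) = map (%i. if even i then side_value \<nu> a (ss ! i) else side_glue p tw h (%e. st (h e)) h h (ss ! i)) [0..<length ss]"
 proof (rule nth_equalityI)
  fix i assume "i < length (map f (trail_word ss))"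
  hence i: "i < length ss" by simp
  have "map f (trail_word ss) ! i = f (trail_word ss ! i)" using i by simp
  thus "map f (trail_word ss) ! i = map (%i. if even i then side_value \<nu> a (ss ! i) else side_glue p tw h (%e. st (h e)) h h (ss ! i)) [0..<length ss] ! i"
   using i unfolding step[OF i] by (simp add: f side_value_def side_glue_def Let_def)
 qed simp
 finally show ?thesis unfolding cycle_word_def .
qed

end

section \<open>Ribbon expansions for fixed paths\<close>

lemma mat_prod_Cons [simp]: "mat_prod (M # Ms) = M ** mat_prod Ms"
 by (simp add: mat_prod_def)

lemma mat_prod_Nil [simp]: "mat_prod [] = mat 1"
 by (simp add: mat_prod_def)

lemma mat_prod_concat_pairs:
 "mat_prod (concat (map (%k. [X k, a k]) ks)) = mat_prod (map (%k. X k ** a k) ks)"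
 by (induction ks) (simp_all add: matrix_mul_assoc)

lemma real_list_mul: "Ms ~= [] ==> RG.list_mul Ms = mat_prod Ms"
proof (induction Ms)
 case (Cons M Ms)
 thus ?case
  using RG.list_mul_append[of "[M]" Ms] by (cases "Ms = []") (simp_all add: RG.list_mul_def)
qed simp

lemma quat_list_mul: "Ms ~= [] ==> QG.list_mul Ms = mat_prod Ms"
proof (induction Ms)
 case (Cons M Ms)
 thus ?case
  using QG.list_mul_append[of "[M]" Ms] by (cases "Ms = []") (simp_all add: QG.list_mul_def)
qed simp

lemma complex_list_mul: "Ms ~= [] ==> CG.list_mul (map Along Ms) = Along (mat_prod Ms)"
proof (induction Ms)
 case (Cons M Ms)
 thus ?case
  using CG.list_mul_append[of "[Along M]" "map Along Ms"]
  by (cases "Ms = []") (simp_all add: CG.list_mul_def)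
qed simp

lemma complex_list_mul_Clash:
 assumes "Clash \<in> set Ms"
 shows "CG.list_mul Ms = Clash"
proof -
 have C: "oriented_mult Clash x = Clash" "oriented_mult x Clash = Clash" for x :: "(complex^'n^'n) oriented" by (cases x; simp)+
 show ?thesis using assms
 proof (induction Ms)
  case (Cons M Ms)
  thus ?case
   using CG.list_mul_append[of "[M]" Ms] C
   by (cases "Ms = []") (auto simp: CG.list_mul_def)
 qed simp
qed

lemma block_not_Nil:
 assumes "half_edges \<nu>" "l \<in> {1..length \<nu>}"
 shows "[psum \<nu> (l - 1) + 1..<psum \<nu> l + 1] ~= []"
 using half_edges.psum_less[OF assms(1), of "l - 1" l] assms(2) by simp

lemma ribbon_pairingI:
 assumes "half_edges \<nu>" "p \<in> perfect_matchings {1..sum_list \<nu>}" "tw \<subseteq> p"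
 shows "ribbon_pairing \<nu> p tw"
 using assms unfolding ribbon_pairing_def ribbon_pairing_axioms_def
 by (simp add: ribbon_pairings_def pair_partitions_def perfect_matchings_def)

lemma someI_class: "(SOME w. w \<in> trail_class v) \<in> trail_class v" "(SOME w. w \<in> cyclic_class v) \<in> cyclic_class v"
 by (rule someI[of "%w. w \<in> trail_class v" v], simp) (rule someI[of "%w. w \<in> cyclic_class v" v], simp)

lemma trail_class_not_Nil: "w \<in> trail_class v ==> v ~= [] ==> w ~= []"
proof -
 assume "w \<in> trail_class v" "v ~= []"
 moreover from this have "length w = length v" by (auto simp: trail_class_def cyclic_class_def)
 ultimately show "w ~= []" by auto
qed

lemma adj_cmat: "adj (cmat M) = transpose (cmat M)"
 by (simp add: adj_def cmat_def transpose_def star_complex_def vec_eq_iff)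

text \<open>Each contraction of real symmetric matrices carries a factor 1/2, and the
  \<open>card p\<close> factors make up \<open>weight1\<close>.\<close>

theorem real_ribbon_expansion:
 fixes hf :: "'v path => real^'n::finite^'n" and A :: "nat => nat => complex^'n^'n"
 assumes he: "half_edges \<nu>" and pm: "p \<in> perfect_matchings {1..sum_list \<nu>}"
 shows "(\<Sum>b\<in>PiE {1..sum_list \<nu>} (%_. Basis).
   (\<Prod>e\<in>p. complex_of_real (b (Min e) \<bullet> conjugate (hf (\<gamma> (pair_index p e))) (b (Max e)))) *
   (\<Prod>l=1..length \<nu>. trace (vertex_product \<nu> id (%k. cmat (mat_of (b k))) A l)))
  = (\<Sum>tw\<in>Pow p. complex_of_real (weight1 \<nu> (p, tw)) *
    (\<Prod>t\<in>trails \<nu> (p, tw). trace (trail_product transpose (%g. cmat (hf g)) A p \<gamma> t)))"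
proof -
 define H where "H = (%e. cmat (hf (\<gamma> (pair_index p e))))"
 have vp: "RG.list_mul (concat (map (%k. [cmat (mat_of (b k)), A k (next_label \<nu> k)]) [psum \<nu> (l - 1) + 1..<psum \<nu> l + 1]))
   = vertex_product \<nu> id (%k. cmat (mat_of (b k))) A l" if "l \<in> {1..length \<nu>}" for l and b :: "nat => (real, 'n) herm"
 proof -
  have "concat (map (%k. [cmat (mat_of (b k)), A k (next_label \<nu> k)]) [psum \<nu> (l - 1) + 1..<psum \<nu> l + 1]) ~= []"
   using block_not_Nil[OF he that] by (cases "[psum \<nu> (l - 1) + 1..<psum \<nu> l + 1]") auto
  thus ?thesis unfolding vertex_product_def id_apply mat_prod_concat_pairs[symmetric] by (rule real_list_mul)
 qed
 have cr: "RG.contraction_rule Basis (%e. cmat (mat_of e)) (1/2) (%b b'. complex_of_real (b \<bullet> conjugate (hf (\<gamma> (pair_index p e))) b')) (H e) (transpose (H e)) (H e) (H e)" for e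
  unfolding H_def by (rule real_contraction_rule)
 have "(\<Sum>b\<in>PiE {1..sum_list \<nu>} (%_. Basis).
   (\<Prod>e\<in>p. complex_of_real (b (Min e) \<bullet> conjugate (hf (\<gamma> (pair_index p e))) (b (Max e)))) *
   (\<Prod>l=1..length \<nu>. trace (vertex_product \<nu> id (%k. cmat (mat_of (b k))) A l)))
  = (1/2) ^ card p * (\<Sum>tw\<in>Pow p. RG.gluing_value (RG.matching_glues p tw H (%e. transpose (H e)) H H) (half_edges.join \<nu>) (RG.side_value \<nu> A))"
  by (rule trans[OF _ RG.matching_contraction[OF he pm cr]])
   (intro sum.cong refl arg_cong2[where f="(*)"] prod.cong arg_cong[where f=trace] vp[symmetric])
 also have "\<dots> = (\<Sum>tw\<in>Pow p. complex_of_real (weight1 \<nu> (p, tw)) *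
    (\<Prod>t\<in>trails \<nu> (p, tw). trace (trail_product transpose (%g. cmat (hf g)) A p \<gamma> t)))"
  unfolding sum_distrib_left
 proof (rule sum.cong[OF refl])
  fix tw assume "tw \<in> Pow p"
  hence rb: "ribbon_pairing \<nu> p tw" using ribbon_pairingI[OF he pm] by simp
  interpret R: ribbon_pairing \<nu> p tw by (rule rb)
  have c: "card p = sum_list \<nu> div 2" using card_perfect_matching[OF _ pm] by simp
  have "RG.gluing_value (RG.matching_glues p tw H (%e. transpose (H e)) H H) R.join (RG.side_value \<nu> A)
   = (\<Prod>ss\<in>set R.cycles. trace (RG.cycle_word (RG.side_value \<nu> A) (RG.side_glue p tw H (%e. transpose (H e)) H H) ss))"
   by (rule RG.ribbon_value[OF rb R.cycles])
  also have "\<dots> = (\<Prod>ss\<in>set R.cycles. trace (trail_product transpose (%g. cmat (hf g)) A p \<gamma> (trail_class (trail_word ss))))"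
  proof (rule prod.cong[OF refl])
   fix ss assume "ss \<in> set R.cycles"
   hence a: "R.alternating ss" by (rule R.cycles(1))
   let ?w = "SOME w. w \<in> trail_class (trail_word ss)"
   have "ss ~= []" using a unfolding R.alternating_def by (elim conjE)
   hence "trail_word ss ~= []" by (metis length_0_conv length_trail_word)
   hence ne: "?w ~= []" by (rule trail_class_not_Nil[OF someI_class(1)])
   show "trace (RG.cycle_word (RG.side_value \<nu> A) (RG.side_glue p tw H (%e. transpose (H e)) H H) ss)
     = trace (trail_product transpose (%g. cmat (hf g)) A p \<gamma> (trail_class (trail_word ss)))"
    unfolding trail_product_def
    by (subst real_list_mul[symmetric], use ne in simp, rule RG.trail_value[OF rb a someI_class(1), symmetric])
     (simp_all add: H_def Let_def adj_cmat)
  qed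
  also have "\<dots> = (\<Prod>t\<in>trails \<nu> (p, tw). trace (trail_product transpose (%g. cmat (hf g)) A p \<gamma> t))"
   by (rule R.prod_trails[symmetric])
  finally show "(1/2) ^ card p * RG.gluing_value (RG.matching_glues p tw H (%e. transpose (H e)) H H) R.join (RG.side_value \<nu> A)
   = complex_of_real (weight1 \<nu> (p, tw)) * (\<Prod>t\<in>trails \<nu> (p, tw). trace (trail_product transpose (%g. cmat (hf g)) A p \<gamma> t))"
   by (simp add: weight1_def c power_one_over)
 qed
 finally show ?thesis .
qed

text \<open>The contraction uses \<open>-2 * qre (trace M)\<close> at vertices and trails alike.
  This puts \<open>(-2) ^ m\<close> on the left for \<open>m\<close> vertices, and
  \<open>(-1) ^ r\<close> times \<open>(-2) ^ f\<close> on the right for \<open>r\<close> pairs and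
  \<open>f\<close> boundary cycles; \<open>weight4\<close> is the quotient.\<close>

theorem quat_ribbon_expansion:
 fixes hf :: "'v path => quat^'n::finite^'n" and A :: "nat => nat => quat^'n^'n"
 assumes he: "half_edges \<nu>" and pm: "p \<in> perfect_matchings {1..sum_list \<nu>}"
 shows "(\<Sum>b\<in>PiE {1..sum_list \<nu>} (%_. Basis).
   (\<Prod>e\<in>p. b (Min e) \<bullet> conjugate (hf (\<gamma> (pair_index p e))) (b (Max e))) *
   (\<Prod>l=1..length \<nu>. qre (trace (vertex_product \<nu> id (%k. mat_of (b k)) A l))))
  = (\<Sum>tw\<in>Pow p. weight4 \<nu> (p, tw) *
    (\<Prod>t\<in>trails \<nu> (p, tw). qre (trace (trail_product adj hf A p \<gamma> t))))"
proof -
 let ?T = "%tw. \<Prod>t\<in>trails \<nu> (p, tw). qre (trace (trail_product adj hf A p \<gamma> t))"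
 define H where "H = (%e. hf (\<gamma> (pair_index p e)))"
 have vp: "QG.list_mul (concat (map (%k. [mat_of (b k), A k (next_label \<nu> k)]) [psum \<nu> (l - 1) + 1..<psum \<nu> l + 1]))
   = vertex_product \<nu> id (%k. mat_of (b k)) A l" if "l \<in> {1..length \<nu>}" for l and b :: "nat => (quat, 'n) herm"
 proof -
  have "concat (map (%k. [mat_of (b k), A k (next_label \<nu> k)]) [psum \<nu> (l - 1) + 1..<psum \<nu> l + 1]) ~= []"
   using block_not_Nil[OF he that] by (cases "[psum \<nu> (l - 1) + 1..<psum \<nu> l + 1]") auto
  thus ?thesis unfolding vertex_product_def id_apply mat_prod_concat_pairs[symmetric] by (rule quat_list_mul)
 qed
 have c: "card p = sum_list \<nu> div 2" using card_perfect_matching[OF _ pm] by simp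
 have cr: "QG.contraction_rule Basis (mat_of) (-1) (%b b'. b \<bullet> conjugate (hf (\<gamma> (pair_index p e))) b') (H e) (adj (H e)) (H e) (H e)" for e
  unfolding H_def by (rule quat_contraction_rule)
 have "(\<Sum>b\<in>PiE {1..sum_list \<nu>} (%_. Basis).
   (\<Prod>e\<in>p. b (Min e) \<bullet> conjugate (hf (\<gamma> (pair_index p e))) (b (Max e))) *
   (\<Prod>l=1..length \<nu>. - 2 * qre (trace (vertex_product \<nu> id (%k. mat_of (b k)) A l))))
  = (- 1) ^ card p * (\<Sum>tw\<in>Pow p. QG.gluing_value (QG.matching_glues p tw H (%e. adj (H e)) H H) (half_edges.join \<nu>) (QG.side_value \<nu> A))"
  by (rule trans[OF _ QG.matching_contraction[OF he pm cr]])
   (intro sum.cong refl arg_cong2[where f="(*)"] prod.cong arg_cong[where f=trace] arg_cong[where f=qre] vp[symmetric])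
 also have "\<dots> = (- 1) ^ card p * (\<Sum>tw\<in>Pow p. ?T tw * (- 2) ^ card (boundary_cycles \<nu> (p, tw)))"
 proof (intro arg_cong2[where f="(*)"] refl sum.cong)
  fix tw assume "tw \<in> Pow p"
  hence rb: "ribbon_pairing \<nu> p tw" using ribbon_pairingI[OF he pm] by simp
  interpret R: ribbon_pairing \<nu> p tw by (rule rb)
  have "QG.gluing_value (QG.matching_glues p tw H (%e. adj (H e)) H H) R.join (QG.side_value \<nu> A)
   = (\<Prod>ss\<in>set R.cycles. - 2 * qre (trace (QG.cycle_word (QG.side_value \<nu> A) (QG.side_glue p tw H (%e. adj (H e)) H H) ss)))"
   by (rule QG.ribbon_value[OF rb R.cycles])
  also have "\<dots> = (\<Prod>ss\<in>set R.cycles. - 2 * qre (trace (trail_product adj hf A p \<gamma> (trail_class (trail_word ss)))))"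
  proof (rule prod.cong[OF refl])
   fix ss assume "ss \<in> set R.cycles"
   hence a: "R.alternating ss" by (rule R.cycles(1))
   let ?w = "SOME w. w \<in> trail_class (trail_word ss)"
   have "ss ~= []" using a unfolding R.alternating_def by (elim conjE)
   hence "trail_word ss ~= []" by (metis length_0_conv length_trail_word)
   hence ne: "?w ~= []" by (rule trail_class_not_Nil[OF someI_class(1)])
   show "- 2 * qre (trace (QG.cycle_word (QG.side_value \<nu> A) (QG.side_glue p tw H (%e. adj (H e)) H H) ss))
     = - 2 * qre (trace (trail_product adj hf A p \<gamma> (trail_class (trail_word ss))))"
    unfolding trail_product_def
    by (subst quat_list_mul[symmetric], use ne in simp, rule QG.trail_value[OF rb a someI_class(1), symmetric])
     (simp_all add: H_def Let_def)
  qed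
  also have "\<dots> = ?T tw * (- 2) ^ card (boundary_cycles \<nu> (p, tw))"
   unfolding R.prod_trails R.card_boundary_cycles prod.distrib prod_constant distinct_card[OF R.distinct_cycles]
   by (rule mult.commute)
  finally show "QG.gluing_value (QG.matching_glues p tw H (%e. adj (H e)) H H) R.join (QG.side_value \<nu> A)
   = ?T tw * (- 2) ^ card (boundary_cycles \<nu> (p, tw))" .
 qed
 also have "\<dots> = (- 2) ^ length \<nu> * (\<Sum>tw\<in>Pow p. weight4 \<nu> (p, tw) * ?T tw)"
  unfolding sum_distrib_left
 proof (rule sum.cong[OF refl])
  fix tw
  define f m r where "f = card (boundary_cycles \<nu> (p, tw))" and "m = length \<nu>" and "r = card p"
  have "weight4 \<nu> (p, tw) = (- 2) powi (int m - int r + int f) * 2 powi (- 2 * int m + int r)"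
   by (simp add: weight4_def euler_char_def f_def m_def r_def c)
  also have "\<dots> = ((- 2) ^ m / (- 2) ^ r * (- 2) ^ f) * (2 ^ r / (2 ^ m * 2 ^ m))"
   by (simp add: power_int_add power_int_diff power_int_minus power_int_mult mult_2 field_simps power2_eq_square)
  finally have w: "weight4 \<nu> (p, tw) = ((- 2) ^ m / (- 2) ^ r * (- 2) ^ f) * (2 ^ r / (2 ^ m * 2 ^ m))" .
  have "(- 2) ^ k = (- 1) ^ k * (2 :: real) ^ k" for k by (simp add: power_mult_distrib[symmetric])
  hence "(- 2) ^ m * weight4 \<nu> (p, tw) = (- 1) ^ r * (- 2) ^ f"
   unfolding w by (simp add: field_simps power_mult_distrib[symmetric])
  thus "(- 1) ^ card p * (?T tw * (- 2) ^ card (boundary_cycles \<nu> (p, tw)))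
   = (- 2) ^ length \<nu> * (weight4 \<nu> (p, tw) * ?T tw)"
   unfolding f_def m_def r_def by (simp add: mult_ac)
 qed
 finally have "(- 2) ^ length \<nu> * (\<Sum>b\<in>PiE {1..sum_list \<nu>} (%_. Basis).
   (\<Prod>e\<in>p. b (Min e) \<bullet> conjugate (hf (\<gamma> (pair_index p e))) (b (Max e))) *
   (\<Prod>l=1..length \<nu>. qre (trace (vertex_product \<nu> id (%k. mat_of (b k)) A l))))
  = (- 2) ^ length \<nu> * (\<Sum>tw\<in>Pow p. weight4 \<nu> (p, tw) * ?T tw)"
  unfolding sum_distrib_left prod.distrib prod_constant by (simp add: mult_ac)
 thus ?thesis by simp
qed

text \<open>A twisted pair puts \<open>Clash\<close> into the word of some boundary cycle, whose
  trace is then 0. Without twists each cycle can be read from a positive side; there all labels are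
  \<open>Along\<close>, and their product is the matrix product of the oriented trail.\<close>

theorem complex_ribbon_expansion:
 fixes hf :: "'v path => complex^'n::finite^'n" and A :: "nat => nat => complex^'n^'n"
 assumes he: "half_edges \<nu>" and pm: "p \<in> perfect_matchings {1..sum_list \<nu>}"
 shows "(\<Sum>b\<in>PiE {1..sum_list \<nu>} (%_. Basis).
   (\<Prod>e\<in>p. complex_of_real (b (Min e) \<bullet> conjugate (hf (\<gamma> (pair_index p e))) (b (Max e)))) *
   (\<Prod>l=1..length \<nu>. trace (vertex_product \<nu> id (%k. mat_of (b k)) A l)))
  = (\<Sum>tw\<in>Pow p. complex_of_real (weight2 \<nu> (p, tw)) *
    (\<Prod>t\<in>oriented_trails \<nu> (p, tw). trace (trail_product transpose hf A p \<gamma> t)))"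
proof -
 define H where "H = (%e. hf (\<gamma> (pair_index p e)))"
 let ?B = "CG.side_value \<nu> (%k k'. Along (A k k'))"
 let ?G = "%tw. CG.side_glue p tw (%e. Along (H e)) (%e. Along (adj (H e))) (%e. Clash) (%e. Clash)"
 let ?M = "%tw. CG.matching_glues p tw (%e. Along (H e)) (%e. Along (adj (H e))) (%e. Clash) (%e. Clash)"
 have vp: "oriented_trace (CG.list_mul (concat (map (%k. [Along (mat_of (b k)), Along (A k (next_label \<nu> k))]) [psum \<nu> (l - 1) + 1..<psum \<nu> l + 1])))
   = trace (vertex_product \<nu> id (%k. mat_of (b k)) A l)" if "l \<in> {1..length \<nu>}" for l and b :: "nat => (complex, 'n) herm"
 proof -
  let ?L = "concat (map (%k. [mat_of (b k), A k (next_label \<nu> k)]) [psum \<nu> (l - 1) + 1..<psum \<nu> l + 1])"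
  have ne: "?L ~= []"
   using block_not_Nil[OF he that] by (cases "[psum \<nu> (l - 1) + 1..<psum \<nu> l + 1]") auto
  have "concat (map (%k. [Along (mat_of (b k)), Along (A k (next_label \<nu> k))]) [psum \<nu> (l - 1) + 1..<psum \<nu> l + 1]) = map Along ?L"
   by (simp add: map_concat comp_def)
  thus ?thesis unfolding vertex_product_def id_apply mat_prod_concat_pairs[symmetric] by (simp only: complex_list_mul[OF ne] oriented_trace.simps)
 qed
 have cr: "CG.contraction_rule Basis (%e. Along (mat_of e)) (1) (%b b'. complex_of_real (b \<bullet> conjugate (hf (\<gamma> (pair_index p e))) b')) (Along (H e)) (Along (adj (H e))) Clash Clash" for e
  unfolding H_def by (rule complex_contraction_rule)
 have "(\<Sum>b\<in>PiE {1..sum_list \<nu>} (%_. Basis).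
   (\<Prod>e\<in>p. complex_of_real (b (Min e) \<bullet> conjugate (hf (\<gamma> (pair_index p e))) (b (Max e)))) *
   (\<Prod>l=1..length \<nu>. trace (vertex_product \<nu> id (%k. mat_of (b k)) A l)))
  = 1 ^ card p * (\<Sum>tw\<in>Pow p. CG.gluing_value (?M tw) (half_edges.join \<nu>) ?B)"
  by (rule trans[OF _ CG.matching_contraction[OF he pm cr]])
   (intro sum.cong refl arg_cong2[where f="(*)"] prod.cong vp[symmetric])
 also have "\<dots> = (\<Sum>tw\<in>Pow p. complex_of_real (weight2 \<nu> (p, tw)) *
    (\<Prod>t\<in>oriented_trails \<nu> (p, tw). trace (trail_product transpose hf A p \<gamma> t)))"
  unfolding power_one mult_1
 proof (rule sum.cong[OF refl])
  fix tw assume tw: "tw \<in> Pow p"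
  hence rb: "ribbon_pairing \<nu> p tw" using ribbon_pairingI[OF he pm] by simp
  interpret R: ribbon_pairing \<nu> p tw by (rule rb)
  show "CG.gluing_value (?M tw) R.join ?B = complex_of_real (weight2 \<nu> (p, tw)) *
    (\<Prod>t\<in>oriented_trails \<nu> (p, tw). trace (trail_product transpose hf A p \<gamma> t))"
  proof (cases "tw = {}")
   case False
   then obtain e where e: "e \<in> tw" "e \<in> p" using tw by blast
   define k where "k = Min e"
   have ee: "e = {k, Max e}" "k < Max e" unfolding k_def by (rule card_2_Min_Max[OF R.pairs(2)[OF e(2)]])+
   have kin: "k \<in> {1..sum_list \<nu>}" using e(2) ee(1) partition_onD1[OF R.pairs(1)] by blast
   have pk: "R.partner k = Max e" using R.partner_unique[OF kin, of "Max e"] e(2) ee by simp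
   define s where "s = (k, False)"
   have tws: "{fst s, R.partner (fst s)} \<in> tw" using e(1) ee(1) by (simp add: s_def pk)
   have "s \<in> set (concat R.cycles)" unfolding R.cycles(3) using kin by (simp add: s_def)
   then obtain ss where ss: "ss \<in> set R.cycles" "s \<in> set ss" by auto
   have a: "R.alternating ss" by (rule R.cycles(1)[OF ss(1)])
   have "\<exists>j<length ss. odd j \<and> {fst (ss ! j), R.partner (fst (ss ! j))} \<in> tw"
   proof -
    obtain i where i: "i < length ss" "ss ! i = s" using ss(2) by (auto simp: in_set_conv_nth)
    show ?thesis
    proof (cases "odd i")
     case True
     thus ?thesis using i tws by blast
    next
     case False
     \<comment> \<open>At an even position \<open>s\<close> is reached by a gluing, so the ribbon is
       crossed one position earlier, cyclically.\<close>
     define j where "j = (if i = 0 then length ss - 1 else i - 1)"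
     have ev: "even (length ss)" using a by (simp add: R.alternating_def)
     have j: "j < length ss" "odd j" "Suc j mod length ss = i"
      using i False ev by (auto simp: j_def)
     have "R.glue (ss ! j) = s" using R.alternating_next[OF a j(1)] j i by simp
     moreover have "ss ! j \<in> R.sides" using a j(1) by (auto simp: R.alternating_def)
     ultimately have "ss ! j = R.glue s" using R.glue_involution by metis
     hence "fst (ss ! j) = R.partner k" by (simp add: R.glue_def s_def)
     hence "{fst (ss ! j), R.partner (fst (ss ! j))} = {fst s, R.partner (fst s)}"
      using R.partner(4)[OF kin] by (simp add: s_def insert_commute)
     thus ?thesis using j tws by auto
    qed
   qed
   then obtain j where j: "j < length ss" "odd j" "{fst (ss ! j), R.partner (fst (ss ! j))} \<in> tw" by blast
   have "?G tw (ss ! j) = Clash" using j(3) by (simp add: CG.side_glue_def Let_def)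
   hence "Clash \<in> set (map (%i. if even i then ?B (ss ! i) else ?G tw (ss ! i)) [0..<length ss])"
    using j(1,2) by (auto intro!: image_eqI[of _ _ j])
   hence "oriented_trace (CG.cycle_word ?B (?G tw) ss) = 0"
    unfolding CG.cycle_word_def by (simp add: complex_list_mul_Clash)
   hence "(\<Prod>ss\<in>set R.cycles. oriented_trace (CG.cycle_word ?B (?G tw) ss)) = 0"
    using ss(1) by (intro prod_zero) auto
   moreover have "CG.gluing_value (?M tw) R.join ?B = (\<Prod>ss\<in>set R.cycles. oriented_trace (CG.cycle_word ?B (?G tw) ss))"
    by (rule CG.ribbon_value[OF rb R.cycles])
   ultimately have "CG.gluing_value (?M tw) R.join ?B = 0" by (simp only:)
   thus ?thesis using False by (simp add: weight2_def)
  next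
   case True
   have pc: "R.alternating (R.positive_cycle ss)" "set (R.positive_cycle ss) = set ss" "snd (hd (R.positive_cycle ss))"
    if "ss \<in> set R.cycles" for ss
    using R.positive_cycle[OF True R.cycles(1)[OF that]] .
   define css where "css = map R.positive_cycle R.cycles"
   have mc: "mset (concat css) = mset (concat R.cycles)"
   proof -
    have "mset (concat (map R.positive_cycle cs)) = mset (concat cs)" for cs
     by (induction cs) (simp_all add: R.positive_cycle_def)
    thus ?thesis by (simp add: css_def)
   qed
   have css: "R.alternating ss" if "ss \<in> set css" for ss using that pc(1) by (auto simp: css_def)
   have d: "distinct (concat css)" "set (concat css) = R.sides"
    using mset_eq_imp_distinct_iff[OF mc] mset_eq_setD[OF mc] R.cycles(2,3) by simp_all
   have inj: "inj_on R.positive_cycle (set R.cycles)"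
   proof (rule inj_onI)
    fix ss ss' assume a: "ss \<in> set R.cycles" "ss' \<in> set R.cycles" "R.positive_cycle ss = R.positive_cycle ss'"
    have "hd ss \<in> set ss" using R.cycles(1)[OF a(1)] by (simp add: R.alternating_def)
    moreover have "set ss = set ss'" using pc(2)[OF a(1)] pc(2)[OF a(2)] a(3) by simp
    ultimately show "ss = ss'" using R.cycles_disjoint[OF a(1,2)] by blast
   qed
   have "CG.gluing_value (?M tw) R.join ?B = (\<Prod>ss\<in>set css. oriented_trace (CG.cycle_word ?B (?G tw) ss))"
    by (rule CG.ribbon_value[OF rb css d])
   also have "\<dots> = (\<Prod>ss\<in>set R.cycles. oriented_trace (CG.cycle_word ?B (?G tw) (R.positive_cycle ss)))"
    by (simp add: css_def prod.reindex[OF inj])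
   also have "\<dots> = (\<Prod>ss\<in>set R.cycles. trace (trail_product transpose hf A p \<gamma> (cyclic_class (trail_word (R.positive_cycle ss)))))"
   proof (rule prod.cong[OF refl])
    fix ss0 assume "ss0 \<in> set R.cycles"
    hence a: "R.alternating (R.positive_cycle ss0)" "snd (hd (R.positive_cycle ss0))" by (rule pc(1), intro pc(3))
    define ss where "ss = R.positive_cycle ss0"
    let ?f = "step_factor transpose hf A p \<gamma>"
    have n: "ss ~= []" using a by (simp add: ss_def R.alternating_def)
    have tn: "trail_word ss ~= []" using n by (metis length_0_conv length_trail_word)
    have "map (%i. if even i then ?B (ss ! i) else ?G tw (ss ! i)) [0..<length ss] = map Along (map ?f (trail_word ss))"
    proof (rule nth_equalityI)
     fix i assume "i < length (map (%i. if even i then ?B (ss ! i) else ?G tw (ss ! i)) [0..<length ss])"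
     hence i: "i < length ss" by simp
     have sg: "snd (ss ! i) \<longleftrightarrow> even i" using R.oriented_signs[OF True a(1), of i] a(2) i by (simp add: ss_def)
     have nx: "ss ! (Suc i mod length ss) = (if even i then R.join else R.glue) (ss ! i)"
      using R.alternating_next[OF a(1), of i] i by (simp add: ss_def)
     have r: "map Along (map ?f (trail_word ss)) ! i = Along (?f (trail_word ss ! i))" using i by simp
     have l: "map (%i. if even i then ?B (ss ! i) else ?G tw (ss ! i)) [0..<length ss] ! i = (if even i then ?B (ss ! i) else ?G tw (ss ! i))"
      using i by simp
     obtain k b where kb: "ss ! i = (k, b)" by (cases "ss ! i")
     show "map (%i. if even i then ?B (ss ! i) else ?G tw (ss ! i)) [0..<length ss] ! i = map Along (map ?f (trail_word ss)) ! i"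
     proof (cases "even i")
      case True
      hence "b" using sg kb by simp
      thus ?thesis unfolding l r nth_trail_word[OF i] nx kb using True by (simp add: CG.side_value_def)
     next
      case False
      hence "\<not> b" using sg kb by simp
      moreover have "{k, R.partner k} \<notin> tw" using \<open>tw = {}\<close> by blast
      moreover have "fst (R.glue (k, b)) = R.partner k" by (simp add: R.glue_def)
      ultimately show ?thesis unfolding l r nth_trail_word[OF i] nx kb using False
       by (simp add: CG.side_glue_def Let_def H_def)
     qed
    qed simp
    hence "oriented_trace (CG.cycle_word ?B (?G tw) ss) = trace (mat_prod (map ?f (trail_word ss)))"
     unfolding CG.cycle_word_def using tn by (simp only: complex_list_mul map_is_Nil_conv not_False_eq_True oriented_trace.simps)
    also have "\<dots> = trace (mat_prod (map ?f (SOME w. w \<in> cyclic_class (trail_word ss))))"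
    proof -
     obtain i where i: "(SOME w. w \<in> cyclic_class (trail_word ss)) = rotate i (trail_word ss)"
      using someI_class(2)[of "trail_word ss"] unfolding cyclic_class_def by blast
     have "map ?f (trail_word ss) ~= []" "rotate i (map ?f (trail_word ss)) ~= []" using tn by auto
     thus ?thesis unfolding i rotate_map[symmetric]
      using RG.z_list_mul_rotate[of i "map ?f (trail_word ss)"] real_list_mul by metis
    qed
    finally show "oriented_trace (CG.cycle_word ?B (?G tw) (R.positive_cycle ss0))
      = trace (trail_product transpose hf A p \<gamma> (cyclic_class (trail_word (R.positive_cycle ss0))))"
     unfolding trail_product_def ss_def .
   qed
   also have "\<dots> = (\<Prod>t\<in>oriented_trails \<nu> (p, tw). trace (trail_product transpose hf A p \<gamma> t))"
    by (rule R.prod_oriented_trails[OF True, symmetric])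
   finally show ?thesis using True by (simp add: weight2_def)
  qed
 qed
 finally show ?thesis .
qed

section \<open>The twisted Gaussian free field\<close>

lemma inner_mult_left_star:
 fixes a b h :: "'a::tracial_star_scalar"
 shows "inner (h * a) b = inner a (star h * b)"
proof -
 have tr: "inner (x * y) 1 = inner (y * x) (1::'a)" for x y :: 'a
 proof -
  have "inner (x * y) 1 = inner x (star y)" using inner_star[of x "star y"] by simp
  also have "\<dots> = inner (star y) x" by (rule inner_commute)
  also have "\<dots> = inner y (star x)" using inner_star_star[of "star y" x] by simp
  also have "\<dots> = inner (y * x) 1" using inner_star[of y "star x"] by simp
  finally show ?thesis .
 qed
 have "inner (h * a) b = inner (h * (a * star b)) 1" using inner_star[of "h * a" b] by (simp add: mult.assoc)
 also have "\<dots> = inner ((a * star b) * h) 1" by (rule tr)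
 also have "\<dots> = inner a (star h * b)" using inner_star[of a "star h * b"] by (simp add: star_mult mult.assoc)
 finally show ?thesis .
qed

lemma inner_matrix_mult_left:
 fixes A B h :: "'a::tracial_star_scalar^'n::finite^'n"
 shows "inner (h ** A) B = inner A (adj h ** B)"
proof -
 have "inner (h ** A) B = (\<Sum>i\<in>UNIV. \<Sum>j\<in>UNIV. \<Sum>k\<in>UNIV. inner (A $ k $ j) (star (h $ i $ k) * B $ i $ j))"
  by (simp add: inner_vec_def matrix_matrix_mult_def inner_sum_left inner_mult_left_star)
 also have "\<dots> = (\<Sum>i\<in>UNIV. \<Sum>k\<in>UNIV. \<Sum>j\<in>UNIV. inner (A $ k $ j) (star (h $ i $ k) * B $ i $ j))"
  by (intro sum.cong refl sum.swap)
 also have "\<dots> = (\<Sum>k\<in>UNIV. \<Sum>i\<in>UNIV. \<Sum>j\<in>UNIV. inner (A $ k $ j) (star (h $ i $ k) * B $ i $ j))"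
  by (rule sum.swap)
 also have "\<dots> = (\<Sum>k\<in>UNIV. \<Sum>j\<in>UNIV. \<Sum>i\<in>UNIV. inner (A $ k $ j) (star (h $ i $ k) * B $ i $ j))"
  by (intro sum.cong refl sum.swap)
 also have "\<dots> = inner A (adj h ** B)"
  by (simp add: inner_vec_def matrix_matrix_mult_def adj_def inner_sum_right)
 finally show ?thesis .
qed

lemma inner_matrix_mult_right:
 fixes A B h :: "'a::tracial_star_scalar^'n::finite^'n"
 shows "inner (A ** h) B = inner A (B ** adj h)"
proof -
 have "inner (A ** h) B = inner (adj h ** adj A) (adj B)"
  using inner_adj_left[of "A ** h" B] by (simp add: adj_mult)
 also have "\<dots> = inner (adj A) (adj (B ** adj h))" by (simp add: inner_matrix_mult_left adj_mult)
 also have "\<dots> = inner A (B ** adj h)" by (rule inner_adj_left)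
 finally show ?thesis .
qed

lemma inner_conjugate:
 fixes a b :: "('a::tracial_star_scalar, 'n::finite) herm"
 shows "inner (conjugate h a) b = inner a (conjugate (adj h) b)"
proof -
 have "inner (conjugate h a) b = inner (h ** (mat_of a ** adj h)) (mat_of b)"
  by (simp add: inner_herm_eq mat_of_conjugate matrix_mul_assoc)
 also have "\<dots> = inner (mat_of a ** adj h) (adj h ** mat_of b)" by (rule inner_matrix_mult_left)
 also have "\<dots> = inner (mat_of a) ((adj h ** mat_of b) ** adj (adj h))" by (rule inner_matrix_mult_right)
 also have "\<dots> = inner a (conjugate (adj h) b)" by (simp only: inner_herm_eq mat_of_conjugate)
 finally show ?thesis .
qed

lemma adj_one [simp]: "adj (mat 1) = mat (1 :: 'a::star_scalar)"
 by (auto simp: adj_def mat_def vec_eq_iff)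

lemma conjugate_conjugate: "conjugate h (conjugate h' a) = conjugate (h ** h') a"
 by (simp add: mat_of_inject[symmetric] mat_of_conjugate adj_mult matrix_mul_assoc)

lemma conjugate_one [simp]: "conjugate (mat 1) a = a"
 by (simp add: mat_of_inject[symmetric] mat_of_conjugate)

lemma inner_conjugate_unitary:
 fixes a b :: "('a::tracial_star_scalar, 'n::finite) herm"
 shows "adj h ** h = mat 1 ==> inner (conjugate h a) (conjugate h b) = inner a b"
 by (simp add: inner_conjugate conjugate_conjugate)

lemma hol_Cons: "hol U ((v, s) # (w, r) # \<gamma>) = U v w ** hol U ((w, r) # \<gamma>)"
proof -
 have "[0..<Suc (length \<gamma>)] = 0 # map Suc [0..<length \<gamma>]"
  by (simp add: map_Suc_upt upt_conv_Cons del: upt_Suc)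
 thus ?thesis unfolding hol_def Let_def mat_prod_def by (simp add: comp_def del: upt_Suc)
qed

lemma hol_single: "hol U [] = mat 1" "hol U [x] = mat 1"
 by (simp_all add: hol_def mat_prod_def)

lemma transport_conjugate: "transport (%v w. conjugate (U v w)) b (map fst \<gamma>) = conjugate (hol U \<gamma>) b"
proof (induction \<gamma> rule: induct_list012)
 case (3 x y zs)
 obtain v s w r where xy: "x = (v, s)" "y = (w, r)" by (cases x; cases y)
 thus ?case using 3 by (simp add: hol_Cons conjugate_conjugate[symmetric])
qed (simp_all add: hol_single)

lemma hol_unitary:
 assumes "connection E U" "nearest_neighbour E (map fst \<gamma>)"
 shows "hol U \<gamma> ** adj (hol U \<gamma>) = mat 1"
 using assms(2)
proof (induction \<gamma> rule: induct_list012)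
 case (3 x y zs)
 obtain v s w r where xy: "x = (v, s)" "y = (w, r)" by (cases x; cases y)
 let ?H = "hol U ((w, r) # zs)"
 have e: "{v, w} \<in> E" "?H ** adj ?H = mat 1" using 3 xy by simp_all
 have "hol U (x # y # zs) ** adj (hol U (x # y # zs)) = U v w ** (?H ** adj ?H) ** adj (U v w)"
  unfolding xy hol_Cons by (simp only: adj_mult matrix_mul_assoc)
 also have "\<dots> = mat 1" using e assms(1) by (simp add: connection_def)
 finally show ?case .
qed (simp_all add: hol_single)

section \<open>The quadratic form of the twisted field\<close>

locale twisted_field =
 fixes E :: "'v::finite set set" and C :: "'v => 'v => real" and \<kappa> :: "'v => real"
  and U :: "'v => 'v => 'a::tracial_star_scalar^'n::finite^'n"
 assumes N: "network E C \<kappa>" and conn: "connection E U"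
begin

lemma edge: "{x, y} \<in> E ==> U y x = adj (U x y)" "{x, y} \<in> E ==> adj (U x y) ** U x y = mat 1"
 using conn by (auto simp: connection_def)

lemma jump_rate_sym: "jump_rate E C x y = jump_rate E C y x"
proof -
 have "{y, x} = {x, y}" by (rule insert_commute)
 thus ?thesis using network_conductance(1)[OF N, of x y] by (simp add: jump_rate_def)
qed

abbreviation "law \<equiv> gff E C \<kappa> U"
abbreviation "path_law \<equiv> path_measure E C \<kappa>"
abbreviation "pairing_law \<equiv> pairing_measure E C \<kappa>"

text \<open>The twisted Laplacian of the network with killing \<open>\<kappa> + V\<close>, where
  parallel transport acts on Hermitian matrices by conjugation.\<close>

definition operator :: "real^'v => ('a, 'n) herm^'v => ('a, 'n) herm^'v" where
 "operator V \<Phi> = (\<chi> x. (exit_rate E C \<kappa> x + V $ x) *\<^sub>R \<Phi> $ x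
  - (\<Sum>z\<in>UNIV. jump_rate E C x z *\<^sub>R conjugate (U x z) (\<Phi> $ z)))"

lemma linear_operator: "linear (operator V)"
proof (rule linearI)
 show "operator V (\<Phi> + \<Psi>) = operator V \<Phi> + operator V \<Psi>" for \<Phi> \<Psi>
  by (simp add: operator_def vec_eq_iff linear_add[OF linear_conjugate] scaleR_add_right sum.distrib)
 show "operator V (r *\<^sub>R \<Phi>) = r *\<^sub>R operator V \<Phi>" for r \<Phi>
  by (simp add: operator_def vec_eq_iff linear_scale[OF linear_conjugate] scaleR_sum_right scaleR_diff_right mult.commute)
qed

definition form :: "real^'v => ('a, 'n) herm^'v => ('a, 'n) herm^'v => real" where
 "form V \<Phi> \<Psi> = \<Phi> \<bullet> operator V \<Psi>"

lemma bilinear_form: "bilinear (form V)"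
 unfolding bilinear_def form_def
 by (intro conjI allI linearI)
  (simp_all add: inner_add_left inner_add_right linear_add[OF linear_operator] linear_scale[OF linear_operator])

lemma form_expand:
 "form V \<Phi> \<Psi> = (\<Sum>x\<in>UNIV. (exit_rate E C \<kappa> x + V $ x) * (\<Phi> $ x \<bullet> \<Psi> $ x))
  - (\<Sum>x\<in>UNIV. \<Sum>z\<in>UNIV. jump_rate E C x z * (\<Phi> $ x \<bullet> conjugate (U x z) (\<Psi> $ z)))"
 by (simp add: form_def operator_def inner_vec_def inner_diff_right inner_sum_right sum_subtractf)

lemma form_sym: "form V \<Phi> \<Psi> = form V \<Psi> \<Phi>"
proof -
 have e: "jump_rate E C x z * (\<Phi> $ x \<bullet> conjugate (U x z) (\<Psi> $ z)) = jump_rate E C z x * (\<Psi> $ z \<bullet> conjugate (U z x) (\<Phi> $ x))" for x z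
 proof (cases "{x, z} \<in> E")
  case True
  have "\<Phi> $ x \<bullet> conjugate (U x z) (\<Psi> $ z) = \<Psi> $ z \<bullet> conjugate (U z x) (\<Phi> $ x)"
   unfolding inner_commute[of "\<Phi> $ x"] inner_conjugate edge(1)[OF True] ..
  thus ?thesis using jump_rate_sym[of x z] by simp
 next
  case False
  thus ?thesis using jump_rate_sym[of x z] by (simp add: jump_rate_def)
 qed
 have "(\<Sum>x\<in>UNIV. \<Sum>z\<in>UNIV. jump_rate E C x z * (\<Phi> $ x \<bullet> conjugate (U x z) (\<Psi> $ z)))
  = (\<Sum>x\<in>UNIV. \<Sum>z\<in>UNIV. jump_rate E C x z * (\<Psi> $ x \<bullet> conjugate (U x z) (\<Phi> $ z)))"
  unfolding e by (rule sum.swap)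
 thus ?thesis unfolding form_expand by (simp add: inner_commute)
qed

definition discrepancy :: "('a, 'n) herm^'v => 'v => 'v => ('a, 'n) herm" where
 "discrepancy \<Phi> x y = \<Phi> $ y - conjugate (U y x) (\<Phi> $ x)"

text \<open>Expanding the squared discrepancies uses that transport along an edge is an isometry.
  The factor 1/2 compensates for meeting every edge in both directions.\<close>

lemma form_zero_expand:
 "form 0 \<Phi> \<Phi> = (\<Sum>x\<in>UNIV. \<kappa> x * (\<Phi> $ x \<bullet> \<Phi> $ x))
  + 1/2 * (\<Sum>x\<in>UNIV. \<Sum>y\<in>UNIV. jump_rate E C x y * (discrepancy \<Phi> x y \<bullet> discrepancy \<Phi> x y))"
proof -
 let ?c = "jump_rate E C"
 have d: "?c x y * (discrepancy \<Phi> x y \<bullet> discrepancy \<Phi> x y)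
   = ?c x y * (\<Phi> $ y \<bullet> \<Phi> $ y) + ?c x y * (\<Phi> $ x \<bullet> \<Phi> $ x) - 2 * (?c y x * (\<Phi> $ y \<bullet> conjugate (U y x) (\<Phi> $ x)))" for x y
 proof (cases "{x, y} \<in> E")
  case True
  hence "{y, x} \<in> E" by (simp add: insert_commute)
  hence "conjugate (U y x) (\<Phi> $ x) \<bullet> conjugate (U y x) (\<Phi> $ x) = \<Phi> $ x \<bullet> \<Phi> $ x"
   by (intro inner_conjugate_unitary edge(2))
  hence eq: "discrepancy \<Phi> x y \<bullet> discrepancy \<Phi> x y
   = \<Phi> $ y \<bullet> \<Phi> $ y + \<Phi> $ x \<bullet> \<Phi> $ x - 2 * (\<Phi> $ y \<bullet> conjugate (U y x) (\<Phi> $ x))"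
   by (simp add: discrepancy_def inner_diff_left inner_diff_right inner_commute)
  show ?thesis unfolding eq jump_rate_sym[of y x] by (simp add: algebra_simps)
 next
  case False
  thus ?thesis using jump_rate_sym[of x y] by (simp add: jump_rate_def)
 qed
 have 1: "(\<Sum>x\<in>UNIV. \<Sum>y\<in>UNIV. ?c x y * (\<Phi> $ y \<bullet> \<Phi> $ y)) = (\<Sum>x\<in>UNIV. \<Sum>y\<in>UNIV. ?c x y * (\<Phi> $ x \<bullet> \<Phi> $ x))"
  by (subst sum.swap) (simp add: jump_rate_sym)
 have 2: "(\<Sum>x\<in>UNIV. \<Sum>y\<in>UNIV. ?c y x * (\<Phi> $ y \<bullet> conjugate (U y x) (\<Phi> $ x)))
   = (\<Sum>x\<in>UNIV. \<Sum>z\<in>UNIV. ?c x z * (\<Phi> $ x \<bullet> conjugate (U x z) (\<Phi> $ z)))"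
  by (rule sum.swap)
 have "(\<Sum>x\<in>UNIV. \<Sum>y\<in>UNIV. ?c x y * (discrepancy \<Phi> x y \<bullet> discrepancy \<Phi> x y))
  = 2 * (\<Sum>x\<in>UNIV. \<Sum>y\<in>UNIV. ?c x y * (\<Phi> $ x \<bullet> \<Phi> $ x))
   - 2 * (\<Sum>x\<in>UNIV. \<Sum>z\<in>UNIV. ?c x z * (\<Phi> $ x \<bullet> conjugate (U x z) (\<Phi> $ z)))"
  unfolding d sum_subtractf sum.distrib sum_distrib_left[symmetric] 1 2 by simp
 moreover have "(\<Sum>x\<in>UNIV. (exit_rate E C \<kappa> x + 0 $ x) * (\<Phi> $ x \<bullet> \<Phi> $ x))
  = (\<Sum>x\<in>UNIV. \<kappa> x * (\<Phi> $ x \<bullet> \<Phi> $ x)) + (\<Sum>x\<in>UNIV. \<Sum>y\<in>UNIV. ?c x y * (\<Phi> $ x \<bullet> \<Phi> $ x))"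
  by (simp add: exit_rate_def distrib_right sum.distrib sum_distrib_right)
 ultimately show ?thesis unfolding form_expand by simp
qed

lemma action_form: "gff_action E C \<kappa> U \<Phi> = form 0 \<Phi> \<Phi> / 2"
proof -
 have "(\<Sum>(x, y) | {x, y} \<in> E. let D = mat_of (\<Phi> $ y) - U y x ** mat_of (\<Phi> $ x) ** U x y in C x y * re (trace (D ** D)))
  = (\<Sum>(x, y) | {x, y} \<in> E. jump_rate E C x y * (discrepancy \<Phi> x y \<bullet> discrepancy \<Phi> x y))"
 proof (rule sum.cong[OF refl], clarify)
  fix x y assume e: "{x, y} \<in> E"
  hence "{y, x} \<in> E" by (simp add: insert_commute)
  from edge(1)[OF this] have "mat_of (\<Phi> $ y) - U y x ** mat_of (\<Phi> $ x) ** U x y = mat_of (discrepancy \<Phi> x y)"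
   by (simp add: discrepancy_def minus_herm.rep_eq mat_of_conjugate)
  thus "(let D = mat_of (\<Phi> $ y) - U y x ** mat_of (\<Phi> $ x) ** U x y in C x y * re (trace (D ** D)))
    = jump_rate E C x y * (discrepancy \<Phi> x y \<bullet> discrepancy \<Phi> x y)"
   using e by (simp add: Let_def jump_rate_def inner_herm_def)
 qed
 also have "\<dots> = (\<Sum>(x, y)\<in>UNIV. jump_rate E C x y * (discrepancy \<Phi> x y \<bullet> discrepancy \<Phi> x y))"
  by (intro sum.mono_neutral_left) (auto simp: jump_rate_def split: if_splits)
 also have "\<dots> = (\<Sum>x\<in>UNIV. \<Sum>y\<in>UNIV. jump_rate E C x y * (discrepancy \<Phi> x y \<bullet> discrepancy \<Phi> x y))"
  unfolding UNIV_Times_UNIV[symmetric] by (rule sum.cartesian_product[symmetric])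
 finally show ?thesis unfolding gff_action_def form_zero_expand by (simp add: inner_herm_def)
qed

lemma form_potential: "form V \<Phi> \<Phi> = form 0 \<Phi> \<Phi> + (\<Sum>x\<in>UNIV. V $ x * (\<Phi> $ x \<bullet> \<Phi> $ x))"
 unfolding form_expand by (simp add: distrib_right sum.distrib)

lemma potential: "V \<bullet> half_tr_sq \<Phi> = (\<Sum>x\<in>UNIV. V $ x * (\<Phi> $ x \<bullet> \<Phi> $ x)) / 2"
 by (simp add: inner_vec_def half_tr_sq_def inner_herm_def sum_divide_distrib)

text \<open>The factor 1/2 in \<open>half_tr_sq\<close> matches the one in the action, so the weight
  raises the killing by exactly \<open>V\<close>.\<close>

lemma action_potential: "exp (- gff_action E C \<kappa> U \<Phi>) * exp (- (V \<bullet> half_tr_sq \<Phi>)) = exp (- (form V \<Phi> \<Phi> / 2))"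
 unfolding exp_add[symmetric] action_form potential form_potential[of V] by (simp add: add_divide_distrib)

text \<open>A zero of the form has no discrepancy along edges, so its norm is constant on the
  connected graph; it vanishes where the killing is positive, hence everywhere.\<close>

lemma form_definite:
 assumes z: "form 0 \<Phi> \<Phi> = 0"
 shows "\<Phi> = 0"
proof -
 let ?c = "jump_rate E C"
 have n1: "0 \<le> \<kappa> x * (\<Phi> $ x \<bullet> \<Phi> $ x)" for x using network_killing_nonneg[OF N] by simp
 have n2: "0 \<le> ?c x y * (discrepancy \<Phi> x y \<bullet> discrepancy \<Phi> x y)" for x y using jump_rate_nonneg[OF N] by simp
 have n3: "0 \<le> (\<Sum>x\<in>UNIV. \<kappa> x * (\<Phi> $ x \<bullet> \<Phi> $ x))" "0 \<le> (\<Sum>x\<in>UNIV. \<Sum>y\<in>UNIV. ?c x y * (discrepancy \<Phi> x y \<bullet> discrepancy \<Phi> x y))"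
  by (intro sum_nonneg n1 n2)+
 hence s: "(\<Sum>x\<in>UNIV. \<kappa> x * (\<Phi> $ x \<bullet> \<Phi> $ x)) = 0" "(\<Sum>x\<in>UNIV. \<Sum>y\<in>UNIV. ?c x y * (discrepancy \<Phi> x y \<bullet> discrepancy \<Phi> x y)) = 0"
  using z unfolding form_zero_expand by linarith+
 have k: "\<kappa> x * (\<Phi> $ x \<bullet> \<Phi> $ x) = 0" for x
  using s(1) n1 by (subst (asm) sum_nonneg_eq_0_iff) auto
 have "(\<Sum>y\<in>UNIV. ?c x y * (discrepancy \<Phi> x y \<bullet> discrepancy \<Phi> x y)) = 0" for x
  using s(2) n2 by (subst (asm) sum_nonneg_eq_0_iff) (auto intro: sum_nonneg)
 hence c: "?c x y * (discrepancy \<Phi> x y \<bullet> discrepancy \<Phi> x y) = 0" for x y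
  using n2 by (subst (asm) sum_nonneg_eq_0_iff) auto
 have step: "\<Phi> $ y \<bullet> \<Phi> $ y = \<Phi> $ x \<bullet> \<Phi> $ x" if e: "{x, y} \<in> E" for x y
 proof -
  have "?c x y > 0" using network_conductance(2)[OF N e] e by (simp add: jump_rate_def)
  hence "\<Phi> $ y = conjugate (U y x) (\<Phi> $ x)" using c[of x y] by (simp add: discrepancy_def)
  moreover have "{y, x} \<in> E" using e by (simp add: insert_commute)
  ultimately show ?thesis using inner_conjugate_unitary[OF edge(2)] by metis
 qed
 have all: "\<Phi> $ y \<bullet> \<Phi> $ y = \<Phi> $ x \<bullet> \<Phi> $ x" for x y
  using network_connected[OF N, of x y]
  by (induction rule: rtrancl_induct) (use step in \<open>auto\<close>)
 obtain x where "\<kappa> x ~= 0" using network_killing_nonzero[OF N] by blast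
 hence "\<Phi> $ x \<bullet> \<Phi> $ x = 0" using k[of x] by simp
 hence "\<Phi> $ y = 0" for y using all[of y x] by simp
 thus ?thesis by (simp add: vec_eq_iff)
qed

lemma form_zero_nonneg: "0 \<le> form 0 \<Phi> \<Phi>"
 unfolding form_zero_expand
 using network_killing_nonneg[OF N] jump_rate_nonneg[OF N] by (intro add_nonneg_nonneg mult_nonneg_nonneg sum_nonneg) auto

text \<open>The minimum of the form on the compact unit sphere is positive, and homogeneity extends
  the bound.\<close>

lemma coercive: "\<exists>c>0. \<forall>\<Phi>. c * (\<Phi> \<bullet> \<Phi>) \<le> form 0 \<Phi> \<Phi>"
proof -
 let ?S = "sphere (0 :: ('a, 'n) herm^'v) 1"
 obtain \<Phi>\<^sub>0 :: "('a, 'n) herm^'v" where "norm \<Phi>\<^sub>0 = 1" using vector_choose_size[of 1] by auto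
 hence ne: "?S ~= {}" by auto
 have cont: "continuous_on ?S (%\<Phi>. form 0 \<Phi> \<Phi>)"
  using bounded_bilinear.continuous_on[OF bilinear_form[unfolded bilinear_conv_bounded_bilinear] continuous_on_id continuous_on_id] by simp
 obtain \<Psi> where \<Psi>: "\<Psi> \<in> ?S" "\<And>\<Phi>. \<Phi> \<in> ?S ==> form 0 \<Psi> \<Psi> \<le> form 0 \<Phi> \<Phi>"
  using continuous_attains_inf[OF compact_sphere ne cont] by blast
 have "form 0 \<Psi> \<Psi> ~= 0" using form_definite[of \<Psi>] \<Psi>(1) by auto
 hence p: "0 < form 0 \<Psi> \<Psi>" using form_zero_nonneg[of \<Psi>] by simp
 have "form 0 \<Psi> \<Psi> * (\<Phi> \<bullet> \<Phi>) \<le> form 0 \<Phi> \<Phi>" for \<Phi>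
 proof (cases "\<Phi> = 0")
  case False
  have f: "form 0 (r *\<^sub>R \<Phi>) (r *\<^sub>R \<Phi>) = r\<^sup>2 * form 0 \<Phi> \<Phi>" for r
   using bilinear_lmul[OF bilinear_form[of 0]] bilinear_rmul[OF bilinear_form[of 0]] by (simp add: power2_eq_square)
  have "(1 / norm \<Phi>) *\<^sub>R \<Phi> \<in> ?S" using False by simp
  from \<Psi>(2)[OF this] have "form 0 \<Psi> \<Psi> \<le> form 0 \<Phi> \<Phi> / (norm \<Phi>)\<^sup>2" unfolding f by (simp add: power_one_over)
  thus ?thesis using False by (simp add: dot_square_norm field_simps)
 qed (simp add: form_zero_nonneg)
 thus ?thesis using p by blast
qed

lemma gaussian_form:
 assumes V: "\<And>x. 0 \<le> V $ x"
 shows "\<exists>c. gaussian_form (form V) c"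
proof -
 obtain c where c: "0 < c" "\<And>\<Phi>. c * (\<Phi> \<bullet> \<Phi>) \<le> form 0 \<Phi> \<Phi>" using coercive by blast
 have "c * (\<Phi> \<bullet> \<Phi>) \<le> form V \<Phi> \<Phi>" for \<Phi>
 proof -
  have "0 \<le> (\<Sum>x\<in>UNIV. V $ x * (\<Phi> $ x \<bullet> \<Phi> $ x))" using V by (intro sum_nonneg) simp
  thus ?thesis using c(2)[of \<Phi>] form_potential[of V \<Phi>] by linarith
 qed
 thus ?thesis using c(1) bilinear_form form_sym by (intro exI[of _ c] gaussian_form.intro) auto
qed

section \<open>Integrals against the field and their Wick expansion\<close>

definition partition_function :: real where
 "partition_function = (LINT \<Psi>|lborel. exp (- gff_action E C \<kappa> U \<Psi>))"

lemma action_measurable [measurable]: "gff_action E C \<kappa> U \<in> borel_measurable borel"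
proof -
 have "continuous_on UNIV (%\<Phi>. form 0 \<Phi> \<Phi> / 2)"
  using bounded_bilinear.continuous_on[OF bilinear_form[unfolded bilinear_conv_bounded_bilinear] continuous_on_id continuous_on_id]
  by (intro continuous_intros) simp_all
 thus ?thesis unfolding action_form[abs_def] by (rule borel_measurable_continuous_onI)
qed

lemma partition_function_nonneg: "0 \<le> partition_function"
 unfolding partition_function_def by (rule integral_nonneg_AE) simp

lemma gff_sets [simp, measurable_cong]: "sets (law) = sets borel"
 by (simp add: gff_def)

lemma gff_space [simp]: "space (law) = UNIV"
 by (simp add: gff_def)

lemma gff_integral:
 fixes f :: "('a, 'n) herm^'v => real"
 assumes [measurable]: "f \<in> borel_measurable borel"
 shows "(LINT \<Phi>|law. f \<Phi>) = (LINT \<Phi>|lborel. f \<Phi> * exp (- gff_action E C \<kappa> U \<Phi>)) / partition_function"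
  "integrable lborel (%\<Phi>. f \<Phi> * exp (- gff_action E C \<kappa> U \<Phi>)) ==> integrable (law) f"
proof -
 have nn: "AE \<Phi> in lborel. 0 \<le> exp (- gff_action E C \<kappa> U \<Phi>) / partition_function"
  using partition_function_nonneg by simp
 show "(LINT \<Phi>|law. f \<Phi>) = (LINT \<Phi>|lborel. f \<Phi> * exp (- gff_action E C \<kappa> U \<Phi>)) / partition_function"
  unfolding gff_def partition_function_def[symmetric]
  by (subst integral_density) (use nn in \<open>simp_all add: mult.commute\<close>)
 assume "integrable lborel (%\<Phi>. f \<Phi> * exp (- gff_action E C \<kappa> U \<Phi>))"
 hence "integrable lborel (%\<Phi>. (f \<Phi> * exp (- gff_action E C \<kappa> U \<Phi>)) / partition_function)" by simp
 thus "integrable (law) f"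
  unfolding gff_def partition_function_def[symmetric]
  by (subst integrable_density) (use nn in \<open>simp_all add: mult.commute\<close>)
qed

lemma half_tr_sq_nonneg: "0 \<le> half_tr_sq \<Phi> $ x" for \<Phi> :: "('a, 'n) herm^'v"
 using inner_ge_zero[of "\<Phi> $ x"] by (simp add: half_tr_sq_def inner_herm_def)

lemma measurable_half_tr_sq [measurable]: "(half_tr_sq :: ('a, 'n) herm^'v => _) \<in> borel_measurable borel"
proof -
 have "continuous_on UNIV (%\<Phi> :: ('a, 'n) herm^'v. \<chi> x. (\<Phi> $ x \<bullet> \<Phi> $ x) / 2)" by (intro continuous_intros) simp
 thus ?thesis unfolding half_tr_sq_def[abs_def] inner_herm_def by (rule borel_measurable_continuous_onI)
qed

lemma integrable_gff_monomial:
 assumes "finite S"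
 shows "integrable (law) (%\<Phi>. \<Prod>k\<in>S. \<Phi> $ xs k \<bullet> b k)"
proof (rule gff_integral(2))
 obtain c where "gaussian_form (form 0) c" using gaussian_form[of 0] by auto
 then interpret gaussian_form "form 0" c .
 have w: "weight \<Phi> = exp (- gff_action E C \<kappa> U \<Phi>)" for \<Phi> by (simp add: weight_def action_form)
 have "integrable lborel (%\<Phi>. (\<Prod>k\<in>S. \<Phi> \<bullet> axis (xs k) (b k)) * weight \<Phi>)" by (rule integrable_monomial[OF assms])
 thus "integrable lborel (%\<Phi>. (\<Prod>k\<in>S. \<Phi> $ xs k \<bullet> b k) * exp (- gff_action E C \<kappa> U \<Phi>))"
  by (simp add: w inner_axis)
 show "(%\<Phi>. \<Prod>k\<in>S. \<Phi> $ xs k \<bullet> b k) \<in> borel_measurable borel"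
  by (intro borel_measurable_continuous_onI continuous_intros)
qed

lemma finite_gff: "finite_measure (law)"
proof
 have "integrable (law) (%\<Phi>. 1 :: real)" using integrable_gff_monomial[of "{}"] by simp
 hence "(\<integral>\<^sup>+\<Phi>. ennreal (norm (1::real)) \<partial>law) < \<infinity>" unfolding integrable_iff_bounded by simp
 thus "emeasure (law) (space (law)) ~= \<infinity>" by (simp add: less_top)
qed

lemma linear_conjugates: "linear (conjugate (U v w))"
 by (rule linear_conjugate)

lemma conjugate_contraction: "{v, w} \<in> E ==> norm (conjugate (U v w) c) \<le> norm c"
 using inner_conjugate_unitary[OF edge(2), of v w c c] by (simp add: norm_eq_sqrt_inner)

lemma path_integral_transported:
 assumes V: "\<And>x. 0 \<le> V $ x"
 shows "integrable (path_law x y) (%\<gamma>. exp (- (V \<bullet> occupation \<gamma>)) *\<^sub>R conjugate (hol U \<gamma>) b)"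
  "(LINT \<gamma>|path_law x y. exp (- (V \<bullet> occupation \<gamma>)) *\<^sub>R conjugate (hol U \<gamma>) b)
   = green E C \<kappa> V (%v w. conjugate (U v w)) x y b"
 unfolding transport_conjugate[symmetric]
 by (rule path_integral_transport[OF N V linear_conjugates], rule conjugate_contraction, assumption)+

lemma path_integral_conjugate:
 assumes V: "\<And>x. 0 \<le> V $ x"
 shows "(LINT \<gamma>|path_law x y. exp (- (V \<bullet> occupation \<gamma>)) * (b \<bullet> conjugate (hol U \<gamma>) b'))
  = b \<bullet> green E C \<kappa> V (%v w. conjugate (U v w)) x y b'"
proof -
 note P = path_integral_transported[OF V, of x y b']
 have "(LINT \<gamma>|path_law x y. b \<bullet> (exp (- (V \<bullet> occupation \<gamma>)) *\<^sub>R conjugate (hol U \<gamma>) b'))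
  = b \<bullet> green E C \<kappa> V (%v w. conjugate (U v w)) x y b'"
  unfolding P(2)[symmetric] by (rule integral_inner_right) (rule P(1))
 thus ?thesis by (simp add: inner_scaleR_right)
qed

text \<open>The coordinate of the field at \<open>xs k\<close> along \<open>b k\<close> is the inner
  product with the point source \<open>u k\<close>. By the Green equation \<open>g k\<close> solves
  \<open>operator V (g k) = u k\<close>, as Wick's formula requires, and its values are integrals
  against the path measures.\<close>

theorem gff_wick:
 fixes S :: "nat set" and b :: "nat => ('a, 'n) herm"
 assumes V: "\<And>x. 0 \<le> V $ x" and S: "finite S"
 shows "(LINT \<Phi>|law. (\<Prod>k\<in>S. \<Phi> $ xs k \<bullet> b k) * exp (- (V \<bullet> half_tr_sq \<Phi>)))
  = (LINT \<Phi>|law. exp (- (V \<bullet> half_tr_sq \<Phi>))) * (\<Sum>p\<in>perfect_matchings S. \<Prod>e\<in>p.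
    LINT \<gamma>|path_law (xs (Min e)) (xs (Max e)).
     exp (- (V \<bullet> occupation \<gamma>)) * (b (Min e) \<bullet> conjugate (hol U \<gamma>) (b (Max e))))"
proof -
 obtain c where "gaussian_form (form V) c" using gaussian_form[OF V] by blast
 then interpret gaussian_form "form V" c .
 define u where "u = (%k. axis (xs k) (b k))"
 define g where "g = (%k. \<chi> y. green E C \<kappa> V (%v w. conjugate (U v w)) y (xs k) (b k))"
 have w: "exp (- (V \<bullet> half_tr_sq \<Phi>)) * exp (- gff_action E C \<kappa> U \<Phi>) = weight \<Phi>" for \<Phi>
  using action_potential[of \<Phi> V] by (simp add: weight_def mult.commute)
 have K: "operator V (g k) = u k" for k
 proof -
  have "operator V (g k) $ x = u k $ x" for x
   using green_equation[where T="%v w. conjugate (U v w)" and x=x and y="xs k" and b="b k", OF N V linear_conjugates conjugate_contraction]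
   by (simp add: operator_def g_def u_def axis_def)
  thus ?thesis by (simp add: vec_eq_iff)
 qed
 have g: "form V \<Phi> (g k) = \<Phi> \<bullet> u k" for \<Phi> k by (simp add: form_def K)
 have "(LINT \<Phi>|law. (\<Prod>k\<in>S. \<Phi> $ xs k \<bullet> b k) * exp (- (V \<bullet> half_tr_sq \<Phi>)))
  = (LINT \<Phi>|lborel. (\<Prod>k\<in>S. \<Phi> \<bullet> u k) * weight \<Phi>) / partition_function"
 proof -
  have [measurable]: "(%\<Phi>. \<Prod>k\<in>S. \<Phi> $ xs k \<bullet> b k) \<in> borel_measurable borel"
   by (intro borel_measurable_continuous_onI continuous_intros)
  have m: "(%\<Phi>. (\<Prod>k\<in>S. \<Phi> $ xs k \<bullet> b k) * exp (- (V \<bullet> half_tr_sq \<Phi>))) \<in> borel_measurable borel"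
   by measurable
  show ?thesis unfolding gff_integral(1)[OF m] by (simp add: w[symmetric] u_def inner_axis mult.assoc)
 qed
 also have "(LINT \<Phi>|lborel. (\<Prod>k\<in>S. \<Phi> \<bullet> u k) * weight \<Phi>)
  = (LINT \<Phi>|lborel. weight \<Phi>) * (\<Sum>p\<in>perfect_matchings S. \<Prod>e\<in>p. u (Min e) \<bullet> g (Max e))"
  by (rule wick[OF S g])
 also have "(LINT \<Phi>|lborel. weight \<Phi>) * (\<Sum>p\<in>perfect_matchings S. \<Prod>e\<in>p. u (Min e) \<bullet> g (Max e)) / partition_function
  = (LINT \<Phi>|law. exp (- (V \<bullet> half_tr_sq \<Phi>))) * (\<Sum>p\<in>perfect_matchings S. \<Prod>e\<in>p. u (Min e) \<bullet> g (Max e))"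
  by (subst gff_integral(1)) (simp_all add: w)
 also have "\<dots> = (LINT \<Phi>|law. exp (- (V \<bullet> half_tr_sq \<Phi>))) * (\<Sum>p\<in>perfect_matchings S. \<Prod>e\<in>p.
    LINT \<gamma>|path_law (xs (Min e)) (xs (Max e)).
     exp (- (V \<bullet> occupation \<gamma>)) * (b (Min e) \<bullet> conjugate (hol U \<gamma>) (b (Max e))))"
 proof -
  have "u (Min e) \<bullet> g (Max e) = (LINT \<gamma>|path_law (xs (Min e)) (xs (Max e)).
     exp (- (V \<bullet> occupation \<gamma>)) * (b (Min e) \<bullet> conjugate (hol U \<gamma>) (b (Max e))))" for e :: "nat set"
   unfolding path_integral_conjugate[OF V] by (simp add: u_def g_def inner_axis')
  thus ?thesis by (simp only:)
 qed
 finally show ?thesis .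
qed

end

section \<open>The isomorphism theorem\<close>

text \<open>Holonomies are unitary along nearest-neighbour paths, that is, almost everywhere; bounds
  are therefore essential ones, and they have to survive sums, products and traces of
  matrices.\<close>

definition ess_bounded :: "'x measure => ('x => 'b::{real_normed_vector, second_countable_topology}) => bool" where
 "ess_bounded M f \<longleftrightarrow> f \<in> borel_measurable M \<and> (\<exists>B. AE x in M. norm (f x) \<le> B)"

lemma ess_bounded_const: "ess_bounded M (%_. c)"
 unfolding ess_bounded_def by (auto intro!: exI[of _ "norm c"])

lemma ess_bounded_linear:
 assumes l: "bounded_linear l" and f: "ess_bounded M f"
 shows "ess_bounded M (%x. l (f x))"
proof -
 obtain B where B: "f \<in> borel_measurable M" "AE x in M. norm (f x) \<le> B" using f by (auto simp: ess_bounded_def)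
 obtain K where K: "0 \<le> K" "\<And>x. norm (l x) \<le> norm x * K" using bounded_linear.nonneg_bounded[OF l] by blast
 have "(%x. l (f x)) \<in> borel_measurable M"
  by (rule measurable_compose[OF B(1)])
   (intro borel_measurable_continuous_onI bounded_linear.continuous_on[OF l] continuous_on_id)
 moreover have "AE x in M. norm (l (f x)) \<le> B * K"
  using B(2) by eventually_elim (rule order_trans[OF K(2) mult_right_mono[OF _ K(1)]])
 ultimately show ?thesis by (auto simp: ess_bounded_def)
qed

lemma ess_bounded_bilinear:
 assumes l: "bounded_bilinear l" and f: "ess_bounded M f" and g: "ess_bounded M g"
 shows "ess_bounded M (%x. l (f x) (g x))"
proof -
 obtain B where B: "f \<in> borel_measurable M" "AE x in M. norm (f x) \<le> B" using f by (auto simp: ess_bounded_def)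
 obtain B' where B': "g \<in> borel_measurable M" "AE x in M. norm (g x) \<le> B'" using g by (auto simp: ess_bounded_def)
 obtain K where K: "0 \<le> K" "\<And>x y. norm (l x y) \<le> norm x * norm y * K" using bounded_bilinear.nonneg_bounded[OF l] by blast
 have "(%x. l (f x) (g x)) \<in> borel_measurable M"
  by (rule borel_measurable_continuous_Pair[OF B(1) B'(1)])
   (intro bounded_bilinear.continuous_on[OF l] continuous_intros)
 moreover have "AE x in M. norm (l (f x) (g x)) \<le> B * B' * K"
  using B(2) B'(2)
 proof eventually_elim
  case (elim x)
  have "0 \<le> B" using elim(1) norm_ge_zero order_trans by blast
  hence "norm (f x) * norm (g x) \<le> B * B'" using elim by (intro mult_mono) auto
  thus ?case using K(2)[of "f x" "g x"] mult_right_mono[OF _ K(1)] order_trans by blast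
 qed
 ultimately show ?thesis by (auto simp: ess_bounded_def)
qed

lemma ess_bounded_prod:
 fixes f :: "'i => 'x => 'c::{real_normed_field, second_countable_topology}"
 assumes "\<And>i. i \<in> I ==> ess_bounded M (f i)"
 shows "ess_bounded M (%x. \<Prod>i\<in>I. f i x)"
 using assms
proof (induction I rule: infinite_finite_induct)
 case (insert i I)
 thus ?case using ess_bounded_bilinear[OF bounded_bilinear_mult, of M "f i" "%x. \<Prod>i\<in>I. f i x"] by simp
qed (simp_all add: ess_bounded_const)

lemma ess_bounded_integrable:
 fixes f :: "'x => 'b::{banach, second_countable_topology}"
 assumes "finite_measure M" "ess_bounded M f"
 shows "integrable M f"
 using assms finite_measure.integrable_const_bound[OF assms(1)] by (auto simp: ess_bounded_def)

lemma bounded_bilinear_matrix_mult: "bounded_bilinear ((**) :: 'b::star_scalar^'n::finite^'n => 'b^'n^'n => 'b^'n^'n)"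
 unfolding bilinear_conv_bounded_bilinear[symmetric] bilinear_def
 by (intro conjI allI linearI)
  (simp_all add: matrix_add_left matrix_add_right matrix_scaleR_left matrix_scaleR_right)

lemma ess_bounded_mat_prod:
 fixes fs :: "('x => 'b::star_scalar^'n::finite^'n) list"
 assumes "\<And>f. f \<in> set fs ==> ess_bounded M f"
 shows "ess_bounded M (%x. mat_prod (map (%f. f x) fs))"
 using assms
proof (induction fs)
 case (Cons f fs)
 thus ?case
  using ess_bounded_bilinear[OF bounded_bilinear_matrix_mult, of M f "%x. mat_prod (map (%f. f x) fs)"] by simp
qed (simp add: ess_bounded_const)

lemma bounded_linear_adj: "bounded_linear (adj :: 'b::star_scalar^'n::finite^'n => _)"
 unfolding linear_conv_bounded_linear[symmetric] by (rule linearI) (simp_all add: adj_add adj_scaleR)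

lemma bounded_linear_trace: "bounded_linear (trace :: 'b::star_scalar^'n::finite^'n => _)"
 unfolding linear_conv_bounded_linear[symmetric] by (rule linearI) (simp_all add: trace_plus trace_scaleR)

lemma bounded_linear_qre: "bounded_linear qre"
 unfolding linear_conv_bounded_linear[symmetric] by (rule linearI) simp_all

lemma bounded_linear_cmat: "bounded_linear (cmat :: real^'n::finite^'n => _)"
 unfolding linear_conv_bounded_linear[symmetric] by (rule linearI) (simp_all add: cmat_add cmat_scaleR)

lemma bounded_linear_mat_of: "bounded_linear (mat_of :: ('a::star_scalar, 'n::finite) herm => _)"
 unfolding linear_conv_bounded_linear[symmetric] by (rule linearI) (simp_all add: plus_herm.rep_eq scaleR_herm.rep_eq)

lemma ess_bounded_trail_product:
 fixes h :: "'v path => 'b::star_scalar^'n::finite^'n"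
 assumes "\<And>i. ess_bounded M (%\<gamma>. h (\<gamma> i))"
 shows "ess_bounded M (%\<gamma>. trail_product tr h A p \<gamma> t)"
proof -
 have "ess_bounded M (%\<gamma>. step_factor tr h A p \<gamma> s)" for s
 proof (cases s)
  case (Glue k k')
  thus ?thesis
   using assms ess_bounded_linear[OF bounded_linear_adj assms] by (cases "k < k'") (simp_all add: Let_def)
 qed (simp_all add: ess_bounded_const)
 hence "ess_bounded M (%\<gamma>. mat_prod (map (%f. f \<gamma>) (map (%s \<gamma>. step_factor tr h A p \<gamma> s) (SOME w. w \<in> t))))"
  by (intro ess_bounded_mat_prod) auto
 thus ?thesis by (simp add: trail_product_def comp_def)
qed

section \<open>Multilinear expansion of vertex products\<close>

lemma multilinear_expansion:
 fixes Q :: "(nat => 'e::euclidean_space) => 'c::real_vector"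
 assumes S: "finite S" and lin: "\<And>k Y. k \<in> S ==> linear (%m. Q (Y(k := m)))"
 shows "Q Y = (\<Sum>b\<in>PiE S (%_. Basis). (\<Prod>k\<in>S. Y k \<bullet> b k) *\<^sub>R Q (%k. if k \<in> S then b k else Y k))"
 using S lin
proof (induction S rule: finite_induct)
 case (insert k S)
 let ?Z = "%b j. if j \<in> S then b j else Y j"
 have step: "Q (?Z b) = (\<Sum>e\<in>Basis. (Y k \<bullet> e) *\<^sub>R Q (%j. if j \<in> insert k S then (b(k := e)) j else Y j))" for b
 proof -
  have l: "linear (%m. Q ((?Z b)(k := m)))" by (rule insert.prems) simp
  have "?Z b = (?Z b)(k := \<Sum>e\<in>Basis. (Y k \<bullet> e) *\<^sub>R e)" using insert.hyps by (auto simp: euclidean_representation)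
  hence "Q (?Z b) = Q ((?Z b)(k := \<Sum>e\<in>Basis. (Y k \<bullet> e) *\<^sub>R e))" by (rule arg_cong)
  also have "\<dots> = (\<Sum>e\<in>Basis. (Y k \<bullet> e) *\<^sub>R Q ((?Z b)(k := e)))"
   by (simp only: linear_sum[OF l] linear_scale[OF l])
  also have "\<dots> = (\<Sum>e\<in>Basis. (Y k \<bullet> e) *\<^sub>R Q (%j. if j \<in> insert k S then (b(k := e)) j else Y j))"
   by (intro sum.cong refl arg_cong2[where f=scaleR] arg_cong[where f=Q]) auto
  finally show ?thesis .
 qed
 have pr: "(\<Prod>j\<in>insert k S. Y j \<bullet> (b(k := e)) j) = (\<Prod>j\<in>S. Y j \<bullet> b j) * (Y k \<bullet> e)" for b e
 proof -
  have "(\<Prod>j\<in>S. Y j \<bullet> (b(k := e)) j) = (\<Prod>j\<in>S. Y j \<bullet> b j)" using insert.hyps by (intro prod.cong) auto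
  thus ?thesis using insert.hyps by (simp add: mult.commute)
 qed
 have "Q Y = (\<Sum>b\<in>PiE S (%_. Basis). (\<Prod>j\<in>S. Y j \<bullet> b j) *\<^sub>R Q (?Z b))"
 proof (rule insert.IH)
  show "linear (%m. Q (Z(j := m)))" if "j \<in> S" for j Z using that by (intro insert.prems) simp
 qed
 also have "\<dots> = (\<Sum>b\<in>PiE S (%_. Basis). \<Sum>e\<in>Basis. (\<Prod>j\<in>insert k S. Y j \<bullet> (b(k := e)) j) *\<^sub>R Q (%j. if j \<in> insert k S then (b(k := e)) j else Y j))"
  unfolding pr scaleR_scaleR[symmetric] scaleR_sum_right[symmetric] step ..
 also have "\<dots> = (\<Sum>b\<in>PiE (insert k S) (%_. Basis). (\<Prod>j\<in>insert k S. Y j \<bullet> b j) *\<^sub>R Q (%j. if j \<in> insert k S then b j else Y j))"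
  unfolding sum_PiE_insert[OF insert.hyps(2)] by (rule sum.swap)
 finally show ?case .
qed simp

lemma linear_mat_prod:
 fixes emb :: "'e::real_vector => 'b::real_algebra_1^'n::finite^'n"
 assumes emb: "linear emb" and "distinct ks" "k \<in> set ks"
 shows "linear (%m. mat_prod (map (%j. emb ((Y(k := m)) j) ** a j) ks))"
 using assms(2,3)
proof (induction ks)
 case (Cons j ks)
 show ?case
 proof (cases "j = k")
  case True
  hence e: "map (%j. emb ((Y(k := m)) j) ** a j) ks = map (%j. emb (Y j) ** a j) ks" for m
   using Cons.prems by (intro map_cong) auto
  show ?thesis unfolding list.map mat_prod_Cons e True fun_upd_same
   by (rule linearI) (simp_all add: linear_add[OF emb] linear_scale[OF emb] matrix_add_left matrix_scaleR_left)
 next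
  case False
  hence l: "linear (%m. mat_prod (map (%j. emb ((Y(k := m)) j) ** a j) ks))" using Cons by simp
  have e: "(Y(k := m)) j = Y j" for m using False by simp
  show ?thesis unfolding list.map mat_prod_Cons e
   by (rule linearI) (simp_all only: linear_add[OF l] linear_scale[OF l] matrix_add_right matrix_scaleR_right)
 qed
qed simp

text \<open>The label \<open>k\<close> belongs to exactly one block, so all factors but one are
  constant in it.\<close>

lemma linear_vertex_products:
 fixes emb :: "'e::real_vector => 'b::real_algebra_1^'n::finite^'n" and \<tau> :: "'b^'n^'n => 'c::{real_algebra_1, comm_ring_1}"
 assumes he: "half_edges \<nu>" and emb: "linear emb" and \<tau>: "linear \<tau>" and k: "k \<in> {1..sum_list \<nu>}"
 shows "linear (%m. \<Prod>l=1..length \<nu>. \<tau> (vertex_product \<nu> id (%j. emb ((Y(k := m)) j)) A l))"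
proof -
 interpret half_edges \<nu> by fact
 obtain l i where li: "l < length \<nu>" "i < \<nu> ! l" "k = psum \<nu> l + 1 + i" by (rule label_cases[OF k])
 have kb: "psum \<nu> l < k" "k \<le> psum \<nu> (Suc l)" using li psum_Suc[OF li(1)] by auto
 have other: "vertex_product \<nu> id (%j. emb ((Y(k := m)) j)) A l' = vertex_product \<nu> id (%j. emb (Y j)) A l'"
  if "l' \<in> {1..length \<nu>} - {Suc l}" for l' m
 proof -
  have "k \<notin> set [psum \<nu> (l' - 1) + 1..<psum \<nu> l' + 1]"
  proof (cases "l' \<le> l")
   case True
   hence "psum \<nu> l' \<le> psum \<nu> l" using psum_mono li(1) by simp
   thus ?thesis using kb by simp
  next
   case False
   hence "Suc l \<le> l' - 1" "l' - 1 \<le> length \<nu>" using that by auto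
   hence "psum \<nu> (Suc l) \<le> psum \<nu> (l' - 1)" by (rule psum_mono)
   thus ?thesis using kb by simp
  qed
  thus ?thesis unfolding vertex_product_def by (intro arg_cong[where f=mat_prod] map_cong) auto
 qed
 have l: "linear (%m. vertex_product \<nu> id (%j. emb ((Y(k := m)) j)) A (Suc l))"
  unfolding vertex_product_def id_apply using kb by (intro linear_mat_prod[OF emb]) auto
 have e: "(\<Prod>l=1..length \<nu>. \<tau> (vertex_product \<nu> id (%j. emb ((Y(k := m)) j)) A l))
  = \<tau> (vertex_product \<nu> id (%j. emb ((Y(k := m)) j)) A (Suc l)) * (\<Prod>l'\<in>{1..length \<nu>} - {Suc l}. \<tau> (vertex_product \<nu> id (%j. emb (Y j)) A l'))" for m
 proof -
  have "Suc l \<in> {1..length \<nu>}" using li(1) by simp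
  hence "(\<Prod>l=1..length \<nu>. \<tau> (vertex_product \<nu> id (%j. emb ((Y(k := m)) j)) A l))
  = \<tau> (vertex_product \<nu> id (%j. emb ((Y(k := m)) j)) A (Suc l)) * (\<Prod>l'\<in>{1..length \<nu>} - {Suc l}. \<tau> (vertex_product \<nu> id (%j. emb ((Y(k := m)) j)) A l'))"
   by (intro prod.remove) auto
  also have "(\<Prod>l'\<in>{1..length \<nu>} - {Suc l}. \<tau> (vertex_product \<nu> id (%j. emb ((Y(k := m)) j)) A l'))
   = (\<Prod>l'\<in>{1..length \<nu>} - {Suc l}. \<tau> (vertex_product \<nu> id (%j. emb (Y j)) A l'))"
   by (intro prod.cong refl arg_cong[where f=\<tau>] other)
  finally show ?thesis .
 qed
 show ?thesis unfolding e
  by (rule linearI) (simp_all only: linear_add[OF l] linear_scale[OF l] linear_add[OF \<tau>] linear_scale[OF \<tau>] distrib_right mult_scaleR_left)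
qed

lemma vertex_products_expansion:
 fixes emb :: "'e::euclidean_space => 'b::real_algebra_1^'n::finite^'n" and \<tau> :: "'b^'n^'n => 'c::{real_algebra_1, comm_ring_1}"
 assumes he: "half_edges \<nu>" and emb: "linear emb" and \<tau>: "linear \<tau>"
 shows "(\<Prod>l=1..length \<nu>. \<tau> (vertex_product \<nu> id (%j. emb (Y j)) A l))
  = (\<Sum>b\<in>PiE {1..sum_list \<nu>} (%_. Basis). (\<Prod>k\<in>{1..sum_list \<nu>}. Y k \<bullet> b k) *\<^sub>R
    (\<Prod>l=1..length \<nu>. \<tau> (vertex_product \<nu> id (%j. emb (b j)) A l)))"
proof -
 interpret half_edges \<nu> by fact
 let ?Q = "%Y. \<Prod>l=1..length \<nu>. \<tau> (vertex_product \<nu> id (%j. emb (Y j)) A l)"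
 have loc: "?Q (%k. if k \<in> {1..sum_list \<nu>} then b k else Y k) = ?Q b" for b
 proof (intro prod.cong refl arg_cong[where f=\<tau>])
  fix l assume l: "l \<in> {1..length \<nu>}"
  have "psum \<nu> l \<le> sum_list \<nu>" using psum_mono[of l "length \<nu>"] l by simp
  thus "vertex_product \<nu> id (%j. emb (if j \<in> {1..sum_list \<nu>} then b j else Y j)) A l = vertex_product \<nu> id (%j. emb (b j)) A l"
   unfolding vertex_product_def by (intro arg_cong[where f=mat_prod] map_cong) auto
 qed
 show ?thesis
  using multilinear_expansion[of "{1..sum_list \<nu>}" ?Q Y, OF _ linear_vertex_products[OF he emb \<tau>]] unfolding loc by simp
qed

lemma pair_index:
 assumes "finite p" "i < card p"
 shows "pair_index p (pair_list p ! i) = i"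
proof -
 have l: "length (pair_list p) = card p" using pair_list[OF assms(1)] distinct_card by metis
 show ?thesis unfolding pair_index_def
  using l assms(2) pair_list(1)[OF assms(1)] by (intro the_equality) (auto simp: nth_eq_iff_index_eq)
qed

lemma prod_pairs:
 assumes "finite p"
 shows "(\<Prod>e\<in>p. f e (pair_index p e)) = (\<Prod>i<card p. f (pair_list p ! i) i)"
proof -
 have l: "length (pair_list p) = card p" using pair_list[OF assms(1)] distinct_card by metis
 have "bij_betw ((!) (pair_list p)) {..<card p} p"
  using bij_betw_nth[OF pair_list(1)[OF assms], of "{..<card p}" p] l pair_list(2)[OF assms] by simp
 hence "(\<Prod>e\<in>p. f e (pair_index p e)) = (\<Prod>i<card p. f (pair_list p ! i) (pair_index p (pair_list p ! i)))"
  by (rule prod.reindex_bij_betw[symmetric])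
 also have "\<dots> = (\<Prod>i<card p. f (pair_list p ! i) i)" using pair_index[OF assms] by (intro prod.cong) auto
 finally show ?thesis .
qed

section \<open>Products of path measures\<close>

context twisted_field begin

abbreviation edge_measure where
 "edge_measure xs p i \<equiv> path_law (xs (Min (pair_list p ! i))) (xs (Max (pair_list p ! i)))"

lemma product_sigma_finite_edges: "product_sigma_finite (edge_measure xs p)"
 by (rule product_sigma_finite.intro)
  (rule finite_measure.axioms(1)[OF finite_path_measure[OF N]])

lemma pairing_measure_box:
 assumes "\<And>i. i < card p ==> A i \<in> sets path_space"
 shows "emeasure (pairing_law xs p) (PiE {..<card p} A) = (\<Prod>i<card p. emeasure (edge_measure xs p i) (A i))"
 unfolding pairing_measure_def
 by (rule product_sigma_finite.emeasure_PiM[OF product_sigma_finite_edges]) (use assms in auto)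

lemma space_pairing_measure: "space (pairing_law xs p) = PiE {..<card p} (%_. UNIV)"
 by (simp add: pairing_measure_def space_PiM)

lemma component_undefined:
 assumes "\<gamma> \<in> space (pairing_law xs p)" "\<not> i < card p"
 shows "\<gamma> i = undefined"
 by (rule PiE_arb[OF assms(1)[unfolded space_pairing_measure]]) (simp add: assms(2))

lemma finite_pairing_measure: "finite_measure (pairing_law xs p)"
proof
 have f: "emeasure (edge_measure xs p i) UNIV ~= top" for i
  using finite_measure.emeasure_finite[OF finite_path_measure[OF N]] by (simp add: top_unique)
 have "UNIV \<in> sets (path_space :: 'v path measure)" using sets.top[of "edge_measure xs p 0"] by simp
 hence "emeasure (pairing_law xs p) (space (pairing_law xs p)) = (\<Prod>i<card p. emeasure (edge_measure xs p i) UNIV)"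
  unfolding space_pairing_measure by (intro pairing_measure_box)
 thus "emeasure (pairing_law xs p) (space (pairing_law xs p)) ~= \<infinity>"
  using f by (simp add: ennreal_prod_eq_top)
qed

lemma measurable_path_component:
 "(%\<gamma>. \<gamma> i) \<in> measurable (pairing_law xs p) (path_space :: 'v path measure)"
proof (cases "i < card p")
 case True
 have "(%\<gamma>. \<gamma> i) \<in> measurable (pairing_law xs p) (edge_measure xs p i)"
  unfolding pairing_measure_def using True by (intro measurable_component_singleton) simp
 thus ?thesis using measurable_cong_sets[OF refl sets_path_measure] by blast
next
 case False
 have "(%\<gamma>. undefined) \<in> measurable (pairing_law xs p) (path_space :: 'v path measure)"
  by (rule measurable_const) (use sets_eq_imp_space_eq[OF sets_path_measure[of E C \<kappa>]] in auto)
 thus ?thesis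
  using measurable_cong[of "pairing_law xs p" "%\<gamma>. \<gamma> i" "%_. undefined" path_space] component_undefined[OF _ False]
  by blast
qed

text \<open>The exceptional set is contained in a box with one side of measure 0.\<close>

lemma AE_component:
 assumes AE: "AE \<gamma> in edge_measure xs p i. P \<gamma>" and P: "{\<gamma>. \<not> P \<gamma>} \<in> sets path_space" and i: "i < card p"
 shows "AE \<gamma> in pairing_law xs p. P (\<gamma> i)"
proof (rule AE_I')
 define B where "B = (%j. if j = i then {\<gamma>. \<not> P \<gamma>} else (UNIV :: 'v path set))"
 have U: "UNIV \<in> sets (path_space :: 'v path measure)" using sets.top[of "edge_measure xs p 0"] by simp
 have z: "emeasure (edge_measure xs p i) {\<gamma>. \<not> P \<gamma>} = 0"
  using AE P by (subst (asm) AE_iff_measurable[of "{\<gamma>. \<not> P \<gamma>}"]) auto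
 have "emeasure (pairing_law xs p) (PiE {..<card p} B) = (\<Prod>j<card p. emeasure (edge_measure xs p j) (B j))"
  by (rule pairing_measure_box) (simp add: B_def P U)
 also have "\<dots> = 0" using i z by (intro prod_zero) (auto simp: B_def)
 finally have e: "emeasure (pairing_law xs p) (PiE {..<card p} B) = 0" .
 have "PiE {..<card p} B \<in> sets (pairing_law xs p)"
  unfolding pairing_measure_def by (intro sets_PiM_I_finite) (auto simp: B_def P U)
 thus "PiE {..<card p} B \<in> null_sets (pairing_law xs p)" using e by blast
 show "{\<gamma> \<in> space (pairing_law xs p). \<not> P (\<gamma> i)} \<subseteq> PiE {..<card p} B"
  unfolding space_pairing_measure by (auto simp: B_def PiE_iff extensional_def)
qed

text \<open>Almost every path is a nearest-neighbour path, and its holonomy has the norm of the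
  identity matrix. Components outside the index range are constantly \<open>undefined\<close>, which
  gives a bound for every index that \<open>pair_index\<close> may return.\<close>

lemma ess_bounded_hol: "ess_bounded (pairing_law xs p) (%\<gamma>. hol U (\<gamma> i))"
proof -
 define G where "G = (%ys. mat_prod (map (%i. U (ys ! i) (ys ! Suc i)) [0..<length ys - 1]))"
 have h: "hol U \<gamma> = G (map fst \<gamma>)" for \<gamma> by (simp add: hol_def Let_def G_def)
 have "(%\<gamma>. map fst (\<gamma> i)) \<in> measurable (pairing_law xs p) (count_space UNIV)"
  by (rule measurable_compose[OF measurable_path_component measurable_vertices])
 hence m: "(%\<gamma>. hol U (\<gamma> i)) \<in> borel_measurable (pairing_law xs p)"
  unfolding h by (rule measurable_compose) simp
 have "\<exists>B. AE \<gamma> in pairing_law xs p. norm (hol U (\<gamma> i)) \<le> B"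
 proof (cases "i < card p")
  case True
  have "{\<gamma> :: 'v path. \<not> nearest_neighbour E (map fst \<gamma>)} \<in> sets path_space"
   by (rule sets_vertices)
  with AE_nearest_neighbour[OF N] have "AE \<gamma> in pairing_law xs p. nearest_neighbour E (map fst (\<gamma> i))"
   using True by (rule AE_component)
  hence "AE \<gamma> in pairing_law xs p. norm (hol U (\<gamma> i)) \<le> norm (mat 1 :: 'a^'n^'n)"
  proof eventually_elim
   case (elim \<gamma>)
   have "inner (hol U (\<gamma> i)) (hol U (\<gamma> i)) = inner (mat 1 ** hol U (\<gamma> i)) (hol U (\<gamma> i))" by simp
   also have "\<dots> = inner (mat 1) (mat 1 :: 'a^'n^'n)"
    unfolding inner_matrix_mult_right hol_unitary[OF conn elim] ..
   finally show ?case by (simp add: norm_eq_sqrt_inner)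
  qed
  thus ?thesis ..
 next
  case False
  show ?thesis
  proof (intro exI AE_I2)
   fix \<gamma> assume "\<gamma> \<in> space (pairing_law xs p)"
   hence "\<gamma> i = undefined" by (rule component_undefined[OF _ False])
   thus "norm (hol U (\<gamma> i)) \<le> norm (hol U undefined)" by simp
  qed
 qed
 thus ?thesis using m by (simp add: ess_bounded_def)
qed

section \<open>The isomorphism for monomials and for vertex products\<close>

definition transported :: "(nat => ('a, 'n) herm) => nat set set => (nat => 'v path) => real" where
 "transported b p \<gamma> = (\<Prod>e\<in>p. b (Min e) \<bullet> conjugate (hol U (\<gamma> (pair_index p e))) (b (Max e)))"

lemma ess_bounded_transported: "ess_bounded (pairing_law xs p) (transported b q)"
 unfolding transported_def[abs_def]
proof (rule ess_bounded_prod)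
 fix e
 let ?h = "%\<gamma>. hol U (\<gamma> (pair_index q e))"
 have "ess_bounded (pairing_law xs p) (%\<gamma>. inner (mat_of (b (Min e))) (?h \<gamma> ** mat_of (b (Max e)) ** adj (?h \<gamma>)))"
  by (intro ess_bounded_linear[OF bounded_linear_inner_right] ess_bounded_bilinear[OF bounded_bilinear_matrix_mult]
   ess_bounded_linear[OF bounded_linear_adj] ess_bounded_hol ess_bounded_const)
 thus "ess_bounded (pairing_law xs p) (%\<gamma>. b (Min e) \<bullet> conjugate (?h \<gamma>) (b (Max e)))"
  by (simp add: inner_herm_eq mat_of_conjugate)
qed

definition shifted :: "nat => (real^'v => real) => (nat => 'v path) => real" where
 "shifted r F \<gamma> = (LINT \<Phi>|law. F (half_tr_sq \<Phi> + (\<Sum>i<r. occupation (\<gamma> i))))"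

lemma shift_nonneg: "0 \<le> (half_tr_sq \<Phi> + (\<Sum>i<r. occupation (\<gamma> i))) $ x" for \<Phi> :: "('a, 'n) herm^'v"
 using half_tr_sq_nonneg[of \<Phi> x] occupation_nonneg by (auto intro!: add_nonneg_nonneg sum_nonneg)

context
 fixes F :: "real^'v => real" and B :: real
 assumes F [measurable]: "F \<in> borel_measurable borel"
  and B: "\<And>u. (\<And>x. 0 \<le> u $ x) ==> \<bar>F u\<bar> \<le> B"
begin

lemma integrable_shift: "integrable (law) (%\<Phi>. F (half_tr_sq \<Phi> + (\<Sum>i<r. occupation (\<gamma> i))))"
 by (rule finite_measure.integrable_const_bound[OF finite_gff, of _ B])
  (use B[OF shift_nonneg] in \<open>auto intro!: AE_I2\<close>)

lemma shifted_bound: "\<bar>shifted r F \<gamma>\<bar> \<le> B * measure (law) UNIV"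
proof -
 have "\<bar>shifted r F \<gamma>\<bar> \<le> (LINT \<Phi>|law. \<bar>F (half_tr_sq \<Phi> + (\<Sum>i<r. occupation (\<gamma> i)))\<bar>)"
  unfolding shifted_def by (rule integral_abs_bound)
 also have "\<dots> \<le> (LINT \<Phi>|law. B)"
  by (intro integral_mono integrable_abs integrable_shift B shift_nonneg finite_measure.integrable_const[OF finite_gff])
 also have "\<dots> = B * measure (law) UNIV" by simp
 finally show ?thesis .
qed

lemma measurable_shifted: "shifted r F \<in> borel_measurable (pairing_law xs p)"
proof -
 interpret G: finite_measure "law" by (rule finite_gff)
 note [measurable] = measurable_path_component
 have [measurable]: "(%\<gamma>. \<Sum>i<r. occupation (\<gamma> i)) \<in> borel_measurable (pairing_law xs p)"
  by (intro borel_measurable_sum measurable_compose[OF measurable_path_component measurable_occupation])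
 show ?thesis unfolding shifted_def[abs_def]
  by (intro G.borel_measurable_lebesgue_integral) measurable
qed

lemma ess_bounded_shifted: "ess_bounded (pairing_law xs p) (shifted r F)"
 unfolding ess_bounded_def real_norm_def
 by (intro conjI measurable_shifted exI[of _ "B * measure (law) UNIV"] AE_I2 shifted_bound)

lemma integrable_monomial_functional:
 assumes "finite S"
 shows "integrable (law) (%\<Phi>. (\<Prod>k\<in>S. \<Phi> $ xs k \<bullet> b k) * F (half_tr_sq \<Phi>))"
proof (rule Bochner_Integration.integrable_bound)
 show "integrable (law) (%\<Phi>. B * (\<Prod>k\<in>S. \<Phi> $ xs k \<bullet> b k))"
  by (intro integrable_mult_right integrable_gff_monomial assms)
 have "(%\<Phi>. \<Prod>k\<in>S. \<Phi> $ xs k \<bullet> b k) \<in> borel_measurable (law)"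
  using integrable_gff_monomial[OF assms] by (rule borel_measurable_integrable)
 thus "(%\<Phi>. (\<Prod>k\<in>S. \<Phi> $ xs k \<bullet> b k) * F (half_tr_sq \<Phi>)) \<in> borel_measurable (law)" by measurable
 have "\<bar>F (half_tr_sq \<Phi>)\<bar> \<le> B" for \<Phi> :: "('a, 'n) herm^'v" by (rule B[OF half_tr_sq_nonneg])
 hence BB: "\<bar>F (half_tr_sq \<Phi>)\<bar> \<le> \<bar>B\<bar>" for \<Phi> :: "('a, 'n) herm^'v" using order_trans abs_ge_self by blast
 show "AE \<Phi> in law. norm ((\<Prod>k\<in>S. \<Phi> $ xs k \<bullet> b k) * F (half_tr_sq \<Phi>)) \<le> norm (B * (\<Prod>k\<in>S. \<Phi> $ xs k \<bullet> b k))"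
  unfolding real_norm_def abs_mult mult.commute[of "\<bar>B\<bar>"] by (intro AE_I2 mult_left_mono BB abs_ge_zero)
qed

lemma integrable_shifted_transported:
 "integrable (pairing_law xs p) (%\<gamma>. shifted r F \<gamma> * transported b q \<gamma>)"
 by (intro ess_bounded_integrable finite_pairing_measure ess_bounded_bilinear[OF bounded_bilinear_mult]
  ess_bounded_shifted ess_bounded_transported)

end

text \<open>For an exponential the shifted expectation has one factor per path, so the integral over
  the product measure splits into the path integrals of Wick's formula. The closure properties of
  \<open>laplace_class\<close> are linearity and dominated convergence, available because field and
  occupation stay in the orthant.\<close>

theorem isomorphism:
 fixes S :: "nat set" and b :: "nat => ('a, 'n) herm"
 assumes S: "finite S" and F: "F \<in> borel_measurable borel" "bounded (range F)"
 shows "(LINT \<Phi>|law. (\<Prod>k\<in>S. \<Phi> $ xs k \<bullet> b k) * F (half_tr_sq \<Phi>))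
  = (\<Sum>p\<in>perfect_matchings S. LINT \<gamma>|pairing_law xs p. shifted (card S div 2) F \<gamma> * transported b p \<gamma>)"
proof -
 let ?G = "law" and ?r = "card S div 2"
 let ?m = "%\<Phi>. \<Prod>k\<in>S. \<Phi> $ xs k \<bullet> b k"
 let ?P = "%F. (LINT \<Phi>|?G. ?m \<Phi> * F (half_tr_sq \<Phi>))
  = (\<Sum>p\<in>perfect_matchings S. LINT \<gamma>|pairing_law xs p. shifted ?r F \<gamma> * transported b p \<gamma>)"
 have bd: "\<exists>B. \<forall>u. (\<forall>i. 0 \<le> u $ i) \<longrightarrow> \<bar>F u\<bar> \<le> B" if "bounded (F ` {u. \<forall>i. 0 \<le> u $ i})" for F :: "real^'v => real"
  using that unfolding bounded_iff by auto
 have "laplace_class ?P"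
 proof
  fix V :: "real^'v" assume V: "\<And>i. 0 \<le> V $ i"
  define M where "M = (LINT \<Phi>|?G. exp (- (V \<bullet> half_tr_sq \<Phi>)))"
  have sh: "shifted r (%u. exp (- (V \<bullet> u))) \<gamma> = M * (\<Prod>i<r. exp (- (V \<bullet> occupation (\<gamma> i))))" for r \<gamma>
  proof -
   have "exp (- (V \<bullet> (half_tr_sq \<Phi> + (\<Sum>i<r. occupation (\<gamma> i))))) = exp (- (V \<bullet> half_tr_sq \<Phi>)) * (\<Prod>i<r. exp (- (V \<bullet> occupation (\<gamma> i))))"
    for \<Phi> :: "('a, 'n) herm^'v"
    by (simp add: inner_add_right inner_sum_right exp_sum[symmetric] exp_add[symmetric] sum_negf)
   thus ?thesis unfolding shifted_def M_def by simp
  qed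
  have "(LINT \<gamma>|pairing_law xs p. shifted ?r (%u. exp (- (V \<bullet> u))) \<gamma> * transported b p \<gamma>)
   = M * (\<Prod>e\<in>p. LINT \<gamma>|path_law (xs (Min e)) (xs (Max e)).
     exp (- (V \<bullet> occupation \<gamma>)) * (b (Min e) \<bullet> conjugate (hol U \<gamma>) (b (Max e))))"
   if p: "p \<in> perfect_matchings S" for p
  proof -
   have fp: "finite p" using p S finite_elements by (auto simp: perfect_matchings_def)
   have r: "?r = card p" using card_perfect_matching[OF S p] by simp
   let ?f = "%e \<gamma>. exp (- (V \<bullet> occupation \<gamma>)) * (b (Min e) \<bullet> conjugate (hol U \<gamma>) (b (Max e)))"
   have "shifted ?r (%u. exp (- (V \<bullet> u))) \<gamma> * transported b p \<gamma> = M * (\<Prod>i<card p. ?f (pair_list p ! i) (\<gamma> i))" for \<gamma>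
    unfolding sh r transported_def prod_pairs[OF fp, of "%e i. b (Min e) \<bullet> conjugate (hol U (\<gamma> i)) (b (Max e))"]
    by (simp add: prod.distrib)
   hence "(LINT \<gamma>|pairing_law xs p. shifted ?r (%u. exp (- (V \<bullet> u))) \<gamma> * transported b p \<gamma>)
    = M * (LINT \<gamma>|pairing_law xs p. (\<Prod>i<card p. ?f (pair_list p ! i) (\<gamma> i)))" by simp
   also have "(LINT \<gamma>|pairing_law xs p. (\<Prod>i<card p. ?f (pair_list p ! i) (\<gamma> i)))
    = (\<Prod>i<card p. LINT \<gamma>|edge_measure xs p i. ?f (pair_list p ! i) \<gamma>)"
    unfolding pairing_measure_def
   proof (rule product_sigma_finite.product_integral_prod[OF product_sigma_finite_edges])
    fix i
    note P = path_integral_transported(1)[OF V, of "xs (Min (pair_list p ! i))" "xs (Max (pair_list p ! i))" "b (Max (pair_list p ! i))"]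
    from integrable_inner_right[OF P, of "b (Min (pair_list p ! i))"]
    show "integrable (edge_measure xs p i) (?f (pair_list p ! i))" by (simp add: inner_scaleR_right)
   qed simp
   also have "\<dots> = (\<Prod>e\<in>p. LINT \<gamma>|path_law (xs (Min e)) (xs (Max e)). ?f e \<gamma>)"
    using prod_pairs[OF fp, of "%e _. LINT \<gamma>|path_law (xs (Min e)) (xs (Max e)). ?f e \<gamma>"] by simp
   finally show ?thesis .
  qed
  thus "?P (%u. exp (- (V \<bullet> u)))"
   unfolding gff_wick[OF V S] M_def sum_distrib_left by (intro sum.cong refl) simp
 next
  fix F H :: "real^'v => real"
  assume m: "F \<in> borel_measurable borel" "H \<in> borel_measurable borel"
   and "bounded (F ` {u. \<forall>i. 0 \<le> u $ i})" "bounded (H ` {u. \<forall>i. 0 \<le> u $ i})" and PF: "?P F" and PH: "?P H"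
  then obtain B B' where B: "\<And>u. (\<And>i. 0 \<le> u $ i) ==> \<bar>F u\<bar> \<le> B" and B': "\<And>u. (\<And>i. 0 \<le> u $ i) ==> \<bar>H u\<bar> \<le> B'"
   using bd by meson
  have sh: "shifted r (%u. F u + H u) \<gamma> = shifted r F \<gamma> + shifted r H \<gamma>" for r \<gamma>
   unfolding shifted_def by (rule Bochner_Integration.integral_add[OF integrable_shift[OF m(1) B] integrable_shift[OF m(2) B']])
  have "(LINT \<Phi>|?G. ?m \<Phi> * (F (half_tr_sq \<Phi>) + H (half_tr_sq \<Phi>))) = (LINT \<Phi>|?G. ?m \<Phi> * F (half_tr_sq \<Phi>)) + (LINT \<Phi>|?G. ?m \<Phi> * H (half_tr_sq \<Phi>))"
   unfolding distrib_left
   by (rule Bochner_Integration.integral_add[OF integrable_monomial_functional[OF m(1) B S] integrable_monomial_functional[OF m(2) B' S]])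
  moreover have "(LINT \<gamma>|pairing_law xs p. shifted ?r (%u. F u + H u) \<gamma> * transported b p \<gamma>)
   = (LINT \<gamma>|pairing_law xs p. shifted ?r F \<gamma> * transported b p \<gamma>) + (LINT \<gamma>|pairing_law xs p. shifted ?r H \<gamma> * transported b p \<gamma>)" for p
   unfolding sh distrib_right
   by (rule Bochner_Integration.integral_add[OF integrable_shifted_transported[OF m(1) B] integrable_shifted_transported[OF m(2) B']])
  ultimately show "?P (%u. F u + H u)" unfolding PF PH by (simp add: sum.distrib)
 next
  fix F :: "real^'v => real" and c :: real
  assume PF: "?P F"
  have sh: "shifted r (%u. c * F u) \<gamma> = c * shifted r F \<gamma>" for r \<gamma> by (simp add: shifted_def)
  have m: "?m \<Phi> * (c * F (half_tr_sq \<Phi>)) = c * (?m \<Phi> * F (half_tr_sq \<Phi>))" for \<Phi> by simp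
  show "?P (%u. c * F u)"
   by (simp only: sh m mult.assoc integral_mult_right_zero sum_distrib_left[symmetric] PF)
 next
  fix F :: "nat => real^'v => real" and H :: "real^'v => real" and B :: real
  assume m: "\<And>n. F n \<in> borel_measurable borel" "H \<in> borel_measurable borel"
   and B: "\<And>n u. (\<And>i. 0 \<le> u $ i) ==> \<bar>F n u\<bar> \<le> B" and PF: "\<And>n. ?P (F n)"
   and lim: "\<And>u. (\<And>i. 0 \<le> u $ i) ==> (%n. F n u) \<longlonglongrightarrow> H u"
  have BH: "\<bar>H u\<bar> \<le> B" if "\<And>i. 0 \<le> u $ i" for u
   \<comment> \<open>The limit inherits the bound on the orthant.\<close>
   by (rule LIMSEQ_le_const2[OF tendsto_rabs[OF lim[OF that]]]) (use B[OF that] in blast)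
  note [measurable] = m
  have B0: "0 \<le> B" using B[of 0 0] by simp
  have mm: "?m \<in> borel_measurable ?G" using integrable_gff_monomial[OF S] by (rule borel_measurable_integrable)
  have L: "(%n. LINT \<Phi>|?G. ?m \<Phi> * F n (half_tr_sq \<Phi>)) \<longlonglongrightarrow> (LINT \<Phi>|?G. ?m \<Phi> * H (half_tr_sq \<Phi>))"
  proof (rule integral_dominated_convergence[where w="%\<Phi>. \<bar>?m \<Phi>\<bar> * B"])
   show "integrable ?G (%\<Phi>. \<bar>?m \<Phi>\<bar> * B)" by (intro integrable_mult_left integrable_abs integrable_gff_monomial S)
   show "AE \<Phi> in ?G. (%n. ?m \<Phi> * F n (half_tr_sq \<Phi>)) \<longlonglongrightarrow> ?m \<Phi> * H (half_tr_sq \<Phi>)"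
    by (intro AE_I2 tendsto_mult tendsto_const lim half_tr_sq_nonneg)
   show "AE \<Phi> in ?G. norm (?m \<Phi> * F n (half_tr_sq \<Phi>)) \<le> \<bar>?m \<Phi>\<bar> * B" for n
    unfolding real_norm_def abs_mult by (intro AE_I2 mult_left_mono B half_tr_sq_nonneg abs_ge_zero)
   show "(%\<Phi>. ?m \<Phi> * H (half_tr_sq \<Phi>)) \<in> borel_measurable ?G" "(%\<Phi>. ?m \<Phi> * F n (half_tr_sq \<Phi>)) \<in> borel_measurable ?G" for n
    using mm by measurable
  qed
  have sl: "(%n. shifted r (F n) \<gamma>) \<longlonglongrightarrow> shifted r H \<gamma>" for r \<gamma>
   unfolding shifted_def
  proof (rule integral_dominated_convergence[where w="%_. B"])
   show "integrable ?G (%_. B)" by (rule finite_measure.integrable_const[OF finite_gff])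
   show "AE \<Phi> in ?G. (%n. F n (half_tr_sq \<Phi> + (\<Sum>i<r. occupation (\<gamma> i)))) \<longlonglongrightarrow> H (half_tr_sq \<Phi> + (\<Sum>i<r. occupation (\<gamma> i)))"
    by (intro AE_I2 lim shift_nonneg)
   show "AE \<Phi> in ?G. norm (F n (half_tr_sq \<Phi> + (\<Sum>i<r. occupation (\<gamma> i)))) \<le> B" for n
    unfolding real_norm_def by (intro AE_I2 B shift_nonneg)
  qed measurable
  let ?c = "B * measure ?G UNIV"
  have "(%n. LINT \<gamma>|pairing_law xs p. shifted ?r (F n) \<gamma> * transported b p \<gamma>)
   \<longlonglongrightarrow> (LINT \<gamma>|pairing_law xs p. shifted ?r H \<gamma> * transported b p \<gamma>)" for p
  proof (rule integral_dominated_convergence[where w="%\<gamma>. ?c * \<bar>transported b p \<gamma>\<bar>"])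
   let ?M = "pairing_law xs p"
   show "integrable ?M (%\<gamma>. ?c * \<bar>transported b p \<gamma>\<bar>)"
    by (intro integrable_mult_right integrable_abs ess_bounded_integrable finite_pairing_measure ess_bounded_transported)
   show "AE \<gamma> in ?M. (%n. shifted ?r (F n) \<gamma> * transported b p \<gamma>) \<longlonglongrightarrow> shifted ?r H \<gamma> * transported b p \<gamma>"
    by (intro AE_I2 tendsto_mult tendsto_const sl)
   show "AE \<gamma> in ?M. norm (shifted ?r (F n) \<gamma> * transported b p \<gamma>) \<le> ?c * \<bar>transported b p \<gamma>\<bar>" for n
    unfolding real_norm_def abs_mult by (intro AE_I2 mult_right_mono shifted_bound[OF m(1) B] abs_ge_zero)
   show "(%\<gamma>. shifted ?r H \<gamma> * transported b p \<gamma>) \<in> borel_measurable ?M"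
    by (rule borel_measurable_integrable[OF integrable_shifted_transported[OF m(2) BH]])
   show "(%\<gamma>. shifted ?r (F n) \<gamma> * transported b p \<gamma>) \<in> borel_measurable ?M" for n
    by (rule borel_measurable_integrable[OF integrable_shifted_transported[OF m(1) B]])
  qed
  hence "(%n. \<Sum>p\<in>perfect_matchings S. LINT \<gamma>|pairing_law xs p. shifted ?r (F n) \<gamma> * transported b p \<gamma>)
   \<longlonglongrightarrow> (\<Sum>p\<in>perfect_matchings S. LINT \<gamma>|pairing_law xs p. shifted ?r H \<gamma> * transported b p \<gamma>)"
   by (intro tendsto_sum)
  with L show "?P H" unfolding PF by (rule LIMSEQ_unique)
 qed
 thus ?thesis by (rule laplace_class.bounded_measurable[OF _ F])
qed

text \<open>\<open>Q\<close> is the product over vertices as a multilinear function of the field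
  values, \<open>TP\<close> the product over trails and \<open>wt\<close> the weight. Expanding
  \<open>Q\<close> in a basis reduces the left-hand side to monomials; the sum over the basis is
  carried out inside the path integral, where \<open>ex\<close> applies at fixed paths.\<close>

lemma ribbon_isomorphism:
 fixes Q :: "(nat => ('a, 'n) herm) => 'c::{real_normed_field, banach, second_countable_topology}"
  and TP :: "ribbon => (nat => 'v path) => 'c"
 assumes F: "F \<in> borel_measurable borel" "bounded (range F)"
  and Q: "\<And>Y. Q Y = (\<Sum>b\<in>PiE {1..sum_list \<nu>} (%_. Basis). (\<Prod>k\<in>{1..sum_list \<nu>}. Y k \<bullet> b k) *\<^sub>R Q b)"
  and ex: "\<And>p \<gamma>. p \<in> perfect_matchings {1..sum_list \<nu>} ==>
   (\<Sum>b\<in>PiE {1..sum_list \<nu>} (%_. Basis). (\<Prod>e\<in>p. of_real (b (Min e) \<bullet> conjugate (hol U (\<gamma> (pair_index p e))) (b (Max e)))) * Q b)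
   = (\<Sum>tw\<in>Pow p. wt (p, tw) * TP (p, tw) \<gamma>)"
  and eb: "\<And>p tw. ess_bounded (pairing_law xs p) (TP (p, tw))"
 shows "(LINT \<Phi>|law. Q (%k. \<Phi> $ xs k) * of_real (F (half_tr_sq \<Phi>)))
  = (\<Sum>\<rho>\<in>ribbon_pairings \<nu>. wt \<rho> * (LINT \<gamma>|pairing_law xs (fst \<rho>).
    of_real (LINT \<Phi>|law. F (half_tr_sq \<Phi> + (\<Sum>i<sum_list \<nu> div 2. occupation (\<gamma> i)))) * TP \<rho> \<gamma>))"
proof -
 let ?S = "{1..sum_list \<nu>}" and ?G = "law" and ?M = "pairing_law xs"
 let ?D = "PiE ?S (%_. Basis :: ('a, 'n) herm set)"
 let ?sh = "shifted (sum_list \<nu> div 2) F"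
 obtain B where B: "\<And>u. \<bar>F u\<bar> \<le> B" using F(2) by (auto simp: bounded_iff)
 have sw: "(LINT \<Phi>|?G. F (half_tr_sq \<Phi> + (\<Sum>i<sum_list \<nu> div 2. occupation (\<gamma> i)))) = ?sh \<gamma>" for \<gamma> by (simp add: shifted_def)
 have iL: "integrable ?G (%\<Phi>. (\<Prod>k\<in>?S. \<Phi> $ xs k \<bullet> b k) * F (half_tr_sq \<Phi>))" for b
  by (rule integrable_monomial_functional[OF F(1) B]) simp
 have iR: "integrable (?M p) (%\<gamma>. ?sh \<gamma> * transported b p \<gamma>)" for b p
  by (rule integrable_shifted_transported[OF F(1) B])
 have esh: "ess_bounded (?M p) (%\<gamma>. of_real (?sh \<gamma>) :: 'c)" for p
  by (intro ess_bounded_linear[OF bounded_linear_of_real] ess_bounded_shifted[OF F(1) B])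
 have iT: "integrable (?M p) (%\<gamma>. of_real (?sh \<gamma>) * TP (p, tw) \<gamma>)" for p tw
  by (intro ess_bounded_integrable finite_pairing_measure ess_bounded_bilinear[OF bounded_bilinear_mult] esh eb)
 have "(LINT \<Phi>|?G. Q (%k. \<Phi> $ xs k) * of_real (F (half_tr_sq \<Phi>)))
  = (LINT \<Phi>|?G. (\<Sum>b\<in>?D. of_real ((\<Prod>k\<in>?S. \<Phi> $ xs k \<bullet> b k) * F (half_tr_sq \<Phi>)) * Q b))"
  by (subst Q) (simp add: sum_distrib_left sum_distrib_right scaleR_conv_of_real mult_ac)
 also have "\<dots> = (\<Sum>b\<in>?D. of_real (LINT \<Phi>|?G. (\<Prod>k\<in>?S. \<Phi> $ xs k \<bullet> b k) * F (half_tr_sq \<Phi>)) * Q b)"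
  by (subst Bochner_Integration.integral_sum)
   (use iL in \<open>auto simp del: of_real_mult of_real_prod intro!: integrable_mult_left integrable_of_real sum.cong
    simp: integral_bounded_linear[OF bounded_linear_of_real iL]\<close>)
 also have "\<dots> = (\<Sum>b\<in>?D. \<Sum>p\<in>perfect_matchings ?S. of_real (LINT \<gamma>|?M p. ?sh \<gamma> * transported b p \<gamma>) * Q b)"
  using isomorphism[of ?S F xs, OF _ F] by (simp add: sum_distrib_right)
 also have "\<dots> = (\<Sum>p\<in>perfect_matchings ?S. \<Sum>b\<in>?D. of_real (LINT \<gamma>|?M p. ?sh \<gamma> * transported b p \<gamma>) * Q b)"
  by (rule sum.swap)
 also have "\<dots> = (\<Sum>p\<in>perfect_matchings ?S. \<Sum>tw\<in>Pow p. wt (p, tw) * (LINT \<gamma>|?M p. of_real (?sh \<gamma>) * TP (p, tw) \<gamma>))"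
 proof (rule sum.cong[OF refl])
  fix p assume p: "p \<in> perfect_matchings ?S"
  have "(\<Sum>b\<in>?D. of_real (LINT \<gamma>|?M p. ?sh \<gamma> * transported b p \<gamma>) * Q b)
   = (\<Sum>b\<in>?D. LINT \<gamma>|?M p. of_real (?sh \<gamma> * transported b p \<gamma>) * Q b)"
   by (simp del: of_real_mult add: integral_bounded_linear[OF bounded_linear_of_real iR])
  also have "\<dots> = (LINT \<gamma>|?M p. (\<Sum>b\<in>?D. of_real (?sh \<gamma> * transported b p \<gamma>) * Q b))"
   by (intro Bochner_Integration.integral_sum[symmetric] integrable_mult_left integrable_of_real iR)
  also have "\<dots> = (LINT \<gamma>|?M p. (\<Sum>tw\<in>Pow p. wt (p, tw) * (of_real (?sh \<gamma>) * TP (p, tw) \<gamma>)))"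
  proof (rule Bochner_Integration.integral_cong[OF refl])
   fix \<gamma>
   have "(\<Sum>b\<in>?D. of_real (?sh \<gamma> * transported b p \<gamma>) * Q b)
    = of_real (?sh \<gamma>) * (\<Sum>b\<in>?D. (\<Prod>e\<in>p. of_real (b (Min e) \<bullet> conjugate (hol U (\<gamma> (pair_index p e))) (b (Max e)))) * Q b)"
    by (simp add: transported_def sum_distrib_left mult.assoc)
   thus "(\<Sum>b\<in>?D. of_real (?sh \<gamma> * transported b p \<gamma>) * Q b) = (\<Sum>tw\<in>Pow p. wt (p, tw) * (of_real (?sh \<gamma>) * TP (p, tw) \<gamma>))"
    unfolding ex[OF p] sum_distrib_left by (simp add: mult_ac)
  qed
  also have "\<dots> = (\<Sum>tw\<in>Pow p. wt (p, tw) * (LINT \<gamma>|?M p. of_real (?sh \<gamma>) * TP (p, tw) \<gamma>))"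
   by (subst Bochner_Integration.integral_sum) (auto intro!: integrable_mult_right iT)
  finally show "(\<Sum>b\<in>?D. of_real (LINT \<gamma>|?M p. ?sh \<gamma> * transported b p \<gamma>) * Q b)
   = (\<Sum>tw\<in>Pow p. wt (p, tw) * (LINT \<gamma>|?M p. of_real (?sh \<gamma>) * TP (p, tw) \<gamma>))" .
 qed
 also have "\<dots> = (\<Sum>\<rho>\<in>Sigma (perfect_matchings ?S) Pow. wt \<rho> * (LINT \<gamma>|?M (fst \<rho>). of_real (?sh \<gamma>) * TP \<rho> \<gamma>))"
  by (subst sum.Sigma) (auto simp: perfect_matchings_def intro!: finite_elements[of ?S] finite_perfect_matchings[unfolded perfect_matchings_def] sum.cong)
 also have "Sigma (perfect_matchings ?S) Pow = ribbon_pairings \<nu>"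
  by (auto simp: ribbon_pairings_def pair_partitions_def perfect_matchings_def)
 finally show ?thesis unfolding sw .
qed

end

theorem theorem3p4:
  fixes E :: "'v::finite set set" and C :: "'v \<Rightarrow> 'v \<Rightarrow> real" and \<kappa> :: "'v \<Rightarrow> real"
    and \<nu> :: "nat list" and xs :: "nat \<Rightarrow> 'v" and F :: "real^'v \<Rightarrow> real"
  assumes "network E C \<kappa>"
    and "CARD('n::finite) \<ge> 2"
    and "\<forall>k\<in>set \<nu>. 0 < k"
    and "even (sum_list \<nu>)"
    and "F \<in> borel_measurable borel"
    and "bounded (range F)"
  shows
    "(\<forall>(U :: 'v \<Rightarrow> 'v \<Rightarrow> real^'n^'n) (A :: nat \<Rightarrow> nat \<Rightarrow> complex^'n^'n).
        connection E U \<longrightarrow>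
        (LINT \<Phi>|gff E C \<kappa> U.
           (\<Prod>l=1..length \<nu>. trace (vertex_product \<nu> xs (\<lambda>y. cmat (mat_of (\<Phi> $ y))) A l))
           * complex_of_real (F (half_tr_sq \<Phi>)))
        = ribbon_integral1 E C \<kappa> \<nu> xs A U
            (\<lambda>\<gamma>. LINT \<Phi>|gff E C \<kappa> U. F (half_tr_sq \<Phi> + (\<Sum>i<sum_list \<nu> div 2. occupation (\<gamma> i)))))
     \<and>
     (\<forall>(U :: 'v \<Rightarrow> 'v \<Rightarrow> complex^'n^'n) (A :: nat \<Rightarrow> nat \<Rightarrow> complex^'n^'n).
        connection E U \<longrightarrow>
        (LINT \<Phi>|gff E C \<kappa> U.
           (\<Prod>l=1..length \<nu>. trace (vertex_product \<nu> xs (\<lambda>y. mat_of (\<Phi> $ y)) A l))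
           * complex_of_real (F (half_tr_sq \<Phi>)))
        = ribbon_integral2 E C \<kappa> \<nu> xs A U
            (\<lambda>\<gamma>. LINT \<Phi>|gff E C \<kappa> U. F (half_tr_sq \<Phi> + (\<Sum>i<sum_list \<nu> div 2. occupation (\<gamma> i)))))
     \<and>
     (\<forall>(U :: 'v \<Rightarrow> 'v \<Rightarrow> quat^'n^'n) (A :: nat \<Rightarrow> nat \<Rightarrow> quat^'n^'n).
        connection E U \<longrightarrow>
        (LINT \<Phi>|gff E C \<kappa> U.
           (\<Prod>l=1..length \<nu>. qre (trace (vertex_product \<nu> xs (\<lambda>y. mat_of (\<Phi> $ y)) A l)))
           * F (half_tr_sq \<Phi>))
        = ribbon_integral4 E C \<kappa> \<nu> xs A U
            (\<lambda>\<gamma>. LINT \<Phi>|gff E C \<kappa> U. F (half_tr_sq \<Phi> + (\<Sum>i<sum_list \<nu> div 2. occupation (\<gamma> i)))))"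
proof -
 note N = assms(1) and F = assms(5,6)
 have he: "half_edges \<nu>" by unfold_locales (rule assms(3))
 have vp: "vertex_product \<nu> xs X A l = vertex_product \<nu> id (%k. X (xs k)) A l" for X :: "'v => 'b::semiring_1^'n^'n" and A l
  by (simp add: vertex_product_def)
 show ?thesis
 proof (intro conjI allI impI)
  fix U :: "'v => 'v => real^'n^'n" and A :: "nat => nat => complex^'n^'n"
  assume "connection E U"
  then interpret twisted_field E C \<kappa> U by unfold_locales (use N in auto)
  have lin: "linear (%e :: (real, 'n) herm. cmat (mat_of e))"
   using bounded_linear_compose[OF bounded_linear_cmat bounded_linear_mat_of] by (rule bounded_linear.linear)
  show "(LINT \<Phi>|gff E C \<kappa> U. (\<Prod>l=1..length \<nu>. trace (vertex_product \<nu> xs (%y. cmat (mat_of (\<Phi> $ y))) A l)) * complex_of_real (F (half_tr_sq \<Phi>)))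
   = ribbon_integral1 E C \<kappa> \<nu> xs A U (%\<gamma>. LINT \<Phi>|gff E C \<kappa> U. F (half_tr_sq \<Phi> + (\<Sum>i<sum_list \<nu> div 2. occupation (\<gamma> i))))"
   unfolding ribbon_integral1_def vp
  proof (rule ribbon_isomorphism[where Q="%Y. \<Prod>l=1..length \<nu>. trace (vertex_product \<nu> id (%k. cmat (mat_of (Y k))) A l)" and wt="%\<rho>. complex_of_real (weight1 \<nu> \<rho>)" and TP="%\<rho> \<gamma>. \<Prod>t\<in>trails \<nu> \<rho>. trace (trail_product transpose (%g. cmat (hol U g)) A (fst \<rho>) \<gamma> t)", OF F])
   show "(%Y. \<Prod>l=1..length \<nu>. trace (vertex_product \<nu> id (%k. cmat (mat_of (Y k))) A l)) Y = (\<Sum>b\<in>PiE {1..sum_list \<nu>} (%_. Basis). (\<Prod>k\<in>{1..sum_list \<nu>}. Y k \<bullet> b k) *\<^sub>R (%Y. \<Prod>l=1..length \<nu>. trace (vertex_product \<nu> id (%k. cmat (mat_of (Y k))) A l)) b)" for Y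
    by (rule vertex_products_expansion[OF he lin bounded_linear.linear[OF bounded_linear_trace]])
  next
   fix p and \<gamma> :: "nat => 'v path" assume "p \<in> perfect_matchings {1..sum_list \<nu>}"
   from real_ribbon_expansion[OF he this, of "hol U" \<gamma> A]
   show "(\<Sum>b\<in>PiE {1..sum_list \<nu>} (%_. Basis). (\<Prod>e\<in>p. complex_of_real (b (Min e) \<bullet> conjugate (hol U (\<gamma> (pair_index p e))) (b (Max e)))) * (%Y. \<Prod>l=1..length \<nu>. trace (vertex_product \<nu> id (%k. cmat (mat_of (Y k))) A l)) b)
    = (\<Sum>tw\<in>Pow p. (%\<rho>. complex_of_real (weight1 \<nu> \<rho>)) (p, tw) * (%\<rho> \<gamma>. \<Prod>t\<in>trails \<nu> \<rho>. trace (trail_product transpose (%g. cmat (hol U g)) A (fst \<rho>) \<gamma> t)) (p, tw) \<gamma>)" unfolding fst_conv .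
  next
   show "ess_bounded (pairing_measure E C \<kappa> xs p)
     (%\<gamma>. \<Prod>t\<in>trails \<nu> (p, tw). trace (trail_product transpose (%g. cmat (hol U g)) A (fst (p, tw)) \<gamma> t))" for p tw
    by (intro ess_bounded_prod ess_bounded_linear[OF bounded_linear_trace] ess_bounded_trail_product
     ess_bounded_linear[OF bounded_linear_cmat] ess_bounded_hol)
  qed
 next
  fix U :: "'v => 'v => complex^'n^'n" and A :: "nat => nat => complex^'n^'n"
  assume "connection E U"
  then interpret twisted_field E C \<kappa> U by unfold_locales (use N in auto)
  show "(LINT \<Phi>|gff E C \<kappa> U. (\<Prod>l=1..length \<nu>. trace (vertex_product \<nu> xs (%y. mat_of (\<Phi> $ y)) A l)) * complex_of_real (F (half_tr_sq \<Phi>)))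
   = ribbon_integral2 E C \<kappa> \<nu> xs A U (%\<gamma>. LINT \<Phi>|gff E C \<kappa> U. F (half_tr_sq \<Phi> + (\<Sum>i<sum_list \<nu> div 2. occupation (\<gamma> i))))"
   unfolding ribbon_integral2_def vp
  proof (rule ribbon_isomorphism[where Q="%Y. \<Prod>l=1..length \<nu>. trace (vertex_product \<nu> id (%k. mat_of (Y k)) A l)" and wt="%\<rho>. complex_of_real (weight2 \<nu> \<rho>)" and TP="%\<rho> \<gamma>. \<Prod>t\<in>oriented_trails \<nu> \<rho>. trace (trail_product transpose (hol U) A (fst \<rho>) \<gamma> t)", OF F])
   show "(%Y. \<Prod>l=1..length \<nu>. trace (vertex_product \<nu> id (%k. mat_of (Y k)) A l)) Y = (\<Sum>b\<in>PiE {1..sum_list \<nu>} (%_. Basis). (\<Prod>k\<in>{1..sum_list \<nu>}. Y k \<bullet> b k) *\<^sub>R (%Y. \<Prod>l=1..length \<nu>. trace (vertex_product \<nu> id (%k. mat_of (Y k)) A l)) b)" for Y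
    by (rule vertex_products_expansion[OF he bounded_linear.linear[OF bounded_linear_mat_of] bounded_linear.linear[OF bounded_linear_trace]])
  next
   fix p and \<gamma> :: "nat => 'v path" assume "p \<in> perfect_matchings {1..sum_list \<nu>}"
   from complex_ribbon_expansion[OF he this, of "hol U" \<gamma> A]
   show "(\<Sum>b\<in>PiE {1..sum_list \<nu>} (%_. Basis). (\<Prod>e\<in>p. complex_of_real (b (Min e) \<bullet> conjugate (hol U (\<gamma> (pair_index p e))) (b (Max e)))) * (%Y. \<Prod>l=1..length \<nu>. trace (vertex_product \<nu> id (%k. mat_of (Y k)) A l)) b)
    = (\<Sum>tw\<in>Pow p. (%\<rho>. complex_of_real (weight2 \<nu> \<rho>)) (p, tw) * (%\<rho> \<gamma>. \<Prod>t\<in>oriented_trails \<nu> \<rho>. trace (trail_product transpose (hol U) A (fst \<rho>) \<gamma> t)) (p, tw) \<gamma>)" unfolding fst_conv .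
  next
   show "ess_bounded (pairing_measure E C \<kappa> xs p)
     (%\<gamma>. \<Prod>t\<in>oriented_trails \<nu> (p, tw). trace (trail_product transpose (hol U) A (fst (p, tw)) \<gamma> t))" for p tw
    by (intro ess_bounded_prod ess_bounded_linear[OF bounded_linear_trace] ess_bounded_trail_product
     ess_bounded_hol)
  qed
 next
  fix U :: "'v => 'v => quat^'n^'n" and A :: "nat => nat => quat^'n^'n"
  assume "connection E U"
  then interpret twisted_field E C \<kappa> U by unfold_locales (use N in auto)
  have lin: "linear (%M :: quat^'n^'n. qre (trace M))"
   using bounded_linear_compose[OF bounded_linear_qre bounded_linear_trace] by (rule bounded_linear.linear)
  \<comment> \<open>The general statement lives over a normed field; at type \<open>real\<close> its
    \<open>of_real\<close> is the identity and is removed afterwards.\<close>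
  have eq: "(LINT \<Phi>|gff E C \<kappa> U. (\<Prod>l=1..length \<nu>. qre (trace (vertex_product \<nu> id (%k. mat_of (\<Phi> $ xs k)) A l))) * of_real (F (half_tr_sq \<Phi>)))
   = (\<Sum>\<rho>\<in>ribbon_pairings \<nu>. weight4 \<nu> \<rho> * (LINT \<gamma>|pairing_measure E C \<kappa> xs (fst \<rho>).
     of_real (LINT \<Phi>|gff E C \<kappa> U. F (half_tr_sq \<Phi> + (\<Sum>i<sum_list \<nu> div 2. occupation (\<gamma> i)))) *
     (\<Prod>t\<in>trails \<nu> \<rho>. qre (trace (trail_product adj (hol U) A (fst \<rho>) \<gamma> t)))))"
  proof (rule ribbon_isomorphism[where Q="%Y. \<Prod>l=1..length \<nu>. qre (trace (vertex_product \<nu> id (%k. mat_of (Y k)) A l))" and wt="%\<rho>. weight4 \<nu> \<rho>" and TP="%\<rho> \<gamma>. \<Prod>t\<in>trails \<nu> \<rho>. qre (trace (trail_product adj (hol U) A (fst \<rho>) \<gamma> t))", OF F])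
   show "(%Y. \<Prod>l=1..length \<nu>. qre (trace (vertex_product \<nu> id (%k. mat_of (Y k)) A l))) Y = (\<Sum>b\<in>PiE {1..sum_list \<nu>} (%_. Basis). (\<Prod>k\<in>{1..sum_list \<nu>}. Y k \<bullet> b k) *\<^sub>R (%Y. \<Prod>l=1..length \<nu>. qre (trace (vertex_product \<nu> id (%k. mat_of (Y k)) A l))) b)" for Y
    by (rule vertex_products_expansion[OF he bounded_linear.linear[OF bounded_linear_mat_of] lin])
  next
   fix p and \<gamma> :: "nat => 'v path" assume "p \<in> perfect_matchings {1..sum_list \<nu>}"
   from quat_ribbon_expansion[OF he this, of "hol U" \<gamma> A]
   show "(\<Sum>b\<in>PiE {1..sum_list \<nu>} (%_. Basis). (\<Prod>e\<in>p. of_real (b (Min e) \<bullet> conjugate (hol U (\<gamma> (pair_index p e))) (b (Max e)))) * (%Y. \<Prod>l=1..length \<nu>. qre (trace (vertex_product \<nu> id (%k. mat_of (Y k)) A l))) b)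
    = (\<Sum>tw\<in>Pow p. (%\<rho>. weight4 \<nu> \<rho>) (p, tw) * (%\<rho> \<gamma>. \<Prod>t\<in>trails \<nu> \<rho>. qre (trace (trail_product adj (hol U) A (fst \<rho>) \<gamma> t))) (p, tw) \<gamma>)" unfolding fst_conv of_real_eq_id id_apply .
  next
   show "ess_bounded (pairing_measure E C \<kappa> xs p)
     (%\<gamma>. \<Prod>t\<in>trails \<nu> (p, tw). qre (trace (trail_product adj (hol U) A (fst (p, tw)) \<gamma> t)))" for p tw
    by (intro ess_bounded_prod ess_bounded_linear[OF bounded_linear_qre] ess_bounded_linear[OF bounded_linear_trace]
     ess_bounded_trail_product ess_bounded_hol)
  qed
  show "(LINT \<Phi>|gff E C \<kappa> U. (\<Prod>l=1..length \<nu>. qre (trace (vertex_product \<nu> xs (%y. mat_of (\<Phi> $ y)) A l))) * F (half_tr_sq \<Phi>))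
   = ribbon_integral4 E C \<kappa> \<nu> xs A U (%\<gamma>. LINT \<Phi>|gff E C \<kappa> U. F (half_tr_sq \<Phi> + (\<Sum>i<sum_list \<nu> div 2. occupation (\<gamma> i))))"
   unfolding ribbon_integral4_def vp using eq by (simp only: of_real_eq_id id_apply)
 qed
qed

end
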